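(* Let $p_1=2<p_2=3<p_3<\dots$ be the sequence of all primes. For every integer $k\ge 1$, the next number picked by the Euler product sieve at $s_0=1/2$ after $p_1,\dots,p_k$ is $p_{k+1}$. That is, the least natural number $q$ such that $q>p_k$, $q$ is not a power of any of $p_1,\dots,p_k$, and $$\left|\xi^{\approx}_{\{p_1,\dots,p_k,q\}}(1/2)-\xi(1/2)\right|<\left|\xi^{\approx}_{\{p_1,\dots,p_k\}}(1/2)-\xi(1/2)\right|$$ exists and equals $p_{k+1}$. Equivalently, the Euler product sieve at $s_0=1/2$ always picks the primes after only the first prime $2$ has been announced.
   Context: Let $g(s)=\tfrac{s(s-1)}{2}\pi^{-s/2}\Gamma(s/2)$ (with the removable singularity at $s=0$ filled in) and $\xi(s)=g(s)\zeta(s)$, where $\zeta$ is the Riemann zeta function. Then $\xi$ is entire and $\xi(s)=\xi(1-s)$. Let $\mathfrak B$ be a finite set of $m=|\mathfrak B|$ integers $\ge 2$ such that no two distinct elements $b,b'$ satisfy $b^r=b'^t$ with positive integers $r,t$ (for example a finite set of primes, or $\{p_1,\dots,p_k,q\}$ with $q>p_k$ not a power of any of $p_1,\dots,p_k$). Define the meromorphic functions $$\zeta_{\mathfrak B}(s)=\prod_{b\in\mathfrak B}\frac1{1-b^{-s}},\quad \xi_{\mathfrak B}(s)=g(s)\zeta_{\mathfrak B}(s),\quad \zeta^{:}_{\mathfrak B}(s)=s^m(1-s)^m\zeta_{\mathfrak B}(s),\quad \xi^{:}_{\mathfrak B}(s)=s^m(1-s)^m\xi_{\mathfrak B}(s)$$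 (empty product $=1$, removable singularities filled in; for a set of a different cardinality, $m$ is replaced by that cardinality). The poles of $\xi^{:}_{\mathfrak B}$ are simple, located at $2\pi i n/\log b$ ($b\in\mathfrak B$, $n\in\mathbb Z\setminus\{0\}$) and possibly at $-2n$ ($n\ge1$). The sum of its principal parts is $$\xi^{:\mathrm{pp}}_{\mathfrak B}(s)=\sum_{b\in\mathfrak B}\ \sum_{n=-\infty}^{\infty}\frac{\frac{2n\pi i}{\log b}\left(1-\frac{2n\pi i}{\log b}\right)\xi^{:}_{\mathfrak B\setminus\{b\}}\left(\frac{2n\pi i}{\log b}\right)}{\log b\,\left(s-\frac{2n\pi i}{\log b}\right)}+\sum_{n=1}^{\infty}(-1)^n\frac{2\pi^n(2n+1)\,\zeta^{:}_{\mathfrak B}(-2n)}{\Gamma(n)(s+2n)}$$ (the term $n=0$ of the first sum is $0$). Put $\xi^{:\mathrm{reg}}_{\mathfrak B}(s)=\xi^{:}_{\mathfrak B}(s)-\xi^{:\mathrm{pp}}_{\mathfrak B}(s)$, which extends to an entire function, and, for $s\ne0,1$, $$\xi^{\approx}_{\mathfrak B}(s)=\frac{\xi^{:\mathrm{reg}}_{\mathfrak B}(s)+\xi^{:\mathrm{reg}}_{\mathfrak B}(1-s)}{s^m(1-s)^m}.$$ Euler product sieve at $s_0\in\mathbb C\setminus\{0,1\}$: (1) announce some initial primes $p_1,\dots,p_{k_0}$; (2) when the first $k$ primes $p_1,\dots,p_k$ have been found, compute $\xi^{\approx}_{\{p_1,\dots,p_k\}}(s_0)-\xi(s_0)$; (3)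 the next number picked is the least natural number $q$ that is greater than $p_k$, is not a power of any of $p_1,\dots,p_k$, and satisfies $|\xi^{\approx}_{\{p_1,\dots,p_k,q\}}(s_0)-\xi(s_0)|<|\xi^{\approx}_{\{p_1,\dots,p_k\}}(s_0)-\xi(s_0)|$. *)

theory Defs
  imports
    "HOL-Complex_Analysis.Complex_Analysis"
    "HOL-Computational_Algebra.Primes"
begin

text \<open>
  Removable singularities are filled in with \<^const>\<open>remove_sings\<close> throughout; it sends the poles
  of a meromorphic function to 0.
\<close>

text \<open>
  The Riemann zeta function: the unique holomorphic function on the plane without the point 1 that
  extends the Dirichlet series. Its value at the pole 1 is a convention, needed only to make the
  description unique as a total function.
\<close>
definition zeta :: "complex \<Rightarrow> complex" where
  "zeta = (THE f. f holomorphic_on (- {1}) \<and>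
                  (\<forall>s. Re s > 1 \<longrightarrow> (\<lambda>n. 1 / of_nat (Suc n) powr s) sums f s) \<and>
                  f 1 = 0)"

definition gfac :: "complex \<Rightarrow> complex" where
  "gfac = remove_sings (\<lambda>s. s * (s - 1) / 2 * of_real pi powr (- s / 2) * Gamma (s / 2))"

definition xi :: "complex \<Rightarrow> complex" where
  "xi = remove_sings (\<lambda>s. gfac s * zeta s)"

text \<open>
  In the following, \<open>B\<close> is a finite set of integers that are at least 2, no two of which have a
  common positive power.
\<close>

definition zeta_B :: "nat set \<Rightarrow> complex \<Rightarrow> complex" where
  "zeta_B B s = (\<Prod>b\<in>B. 1 / (1 - of_nat b powr (- s)))"

definition xi_B :: "nat set \<Rightarrow> complex \<Rightarrow> complex" where
  "xi_B B = remove_sings (\<lambda>s. gfac s * zeta_B B s)"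

definition zeta_colon :: "nat set \<Rightarrow> complex \<Rightarrow> complex" where
  "zeta_colon B = remove_sings (\<lambda>s. s ^ card B * (1 - s) ^ card B * zeta_B B s)"

definition xi_colon :: "nat set \<Rightarrow> complex \<Rightarrow> complex" where
  "xi_colon B = remove_sings (\<lambda>s. s ^ card B * (1 - s) ^ card B * xi_B B s)"

definition pole_B :: "nat \<Rightarrow> int \<Rightarrow> complex" where
  "pole_B b n = 2 * of_int n * of_real pi * \<i> / of_real (ln (real b))"

text \<open>
  The sum of the principal parts of \<^term>\<open>xi_colon B\<close>. The term for \<open>n = 0\<close> in the first sum
  is 0, because \<^term>\<open>pole_B b 0 = 0\<close>. Both infinite sums converge absolutely.
\<close>
definition xi_pp :: "nat set \<Rightarrow> complex \<Rightarrow> complex" where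
  "xi_pp B s =
     (\<Sum>b\<in>B. \<Sum>\<^sub>\<infinity>n\<in>(UNIV :: int set).
        pole_B b n * (1 - pole_B b n) * xi_colon (B - {b}) (pole_B b n)
        / (of_real (ln (real b)) * (s - pole_B b n)))
   + (\<Sum>\<^sub>\<infinity>n\<in>{1::nat..}.
        (- 1) ^ n * (2 * of_real pi ^ n * (2 * of_nat n + 1) * zeta_colon B (- 2 * of_nat n)
                     / (Gamma (of_nat n) * (s + 2 * of_nat n))))"

definition xi_reg :: "nat set \<Rightarrow> complex \<Rightarrow> complex" where
  "xi_reg B = remove_sings (\<lambda>s. xi_colon B s - xi_pp B s)"

definition xi_approx :: "nat set \<Rightarrow> complex \<Rightarrow> complex" where
  "xi_approx B s = (xi_reg B s + xi_reg B (1 - s)) / (s ^ card B * (1 - s) ^ card B)"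

text \<open>
  The Euler product sieve at \<open>s0\<close>. Sequences are indexed from 1; the value \<open>p 0\<close> plays no role.
\<close>

definition sieve_admissible :: "complex \<Rightarrow> (nat \<Rightarrow> nat) \<Rightarrow> nat \<Rightarrow> nat \<Rightarrow> bool" where
  "sieve_admissible s0 p k q \<longleftrightarrow>
     q > p k \<and>
     (\<forall>i\<in>{1..k}. \<forall>r. q \<noteq> p i ^ r) \<and>
     cmod (xi_approx (insert q (p ` {1..k})) s0 - xi s0) < cmod (xi_approx (p ` {1..k}) s0 - xi s0)"

definition sieve_picks :: "complex \<Rightarrow> (nat \<Rightarrow> nat) \<Rightarrow> nat \<Rightarrow> nat \<Rightarrow> bool" where
  "sieve_picks s0 p k q \<longleftrightarrow>
     sieve_admissible s0 p k q \<and> (\<forall>q'. sieve_admissible s0 p k q' \<longrightarrow> q \<le> q')"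

text \<open>\<open>p\<close> is the result of running the sieve after announcing the primes \<open>p 1, \<dots>, p k0\<close>.\<close>
definition sieve_run :: "complex \<Rightarrow> nat \<Rightarrow> (nat \<Rightarrow> nat) \<Rightarrow> bool" where
  "sieve_run s0 k0 p \<longleftrightarrow>
     (\<forall>k\<in>{1..k0}. prime (p k)) \<and> (\<forall>k\<ge>k0. sieve_picks s0 p k (p (k + 1)))"

end

theory Submission
  imports
    Defs
    "Jordan_Normal_Form.Determinant"
    "HOL-Real_Asymp.Real_Asymp"
    "HOL-Probability.Characteristic_Functions"
begin

text \<open>
  Let \<open>a(n)\<close> be the Dirichlet coefficients of \<^term>\<open>zeta_B B\<close>, let \<open>E = 2 u d/du\<close>, \<open>m = |B|\<close>, and let
  \<open>f\<close> be \<open>E (E + 1)\<close> applied \<open>m + 1\<close> times to \<open>exp (- u)\<close>. Up to an elementary factor, \<^term>\<open>xi_colon B\<close>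
  is the Mellin transform of \<open>\<Psi>(u) = \<Sum> a(n) f(n\<^sup>2 u)\<close>.
  For all \<open>u > 0\<close> this series has an exact expansion in the powers of \<open>u\<close> that belong to the poles:
  for one base it is Poisson summation, and for several bases the difference of the two sides is
  periodic in \<open>ln u\<close> with two incommensurable periods, hence constant, and has mean value 0.
  The expansion converges absolutely because linear forms in two logarithms of integers are not
  exponentially small (Gelfond). Integrated over \<open>(0, \<pi>)\<close> it yields exactly the principal parts, so
  \<^term>\<open>xi_reg B\<close> is the integral over \<open>(\<pi>, \<infinity>)\<close>; the theta functional equation gives the same
  representation of \<^term>\<open>xi\<close> with all coefficients 1. The error of \<^term>\<open>xi_approx B\<close> at \<open>1/2\<close> is thus
  the integral over \<open>u \<ge> \<pi>\<close> of a series dominated by its term with the least \<open>n\<close> such that \<open>a(n) \<noteq> 1\<close>.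
  Adding the next prime moves this \<open>n\<close> up and makes the error smaller, while adding a composite
  \<open>q\<close> creates the coefficient \<open>a(q) = 2\<close> below the next prime and makes the error larger.
\<close>

section \<open>Linear forms in two logarithms\<close>

lemma vandermonde_scaled_det_nonzero:
  fixes \<alpha> c :: "nat \<Rightarrow> real"
  assumes inj: "inj_on \<alpha> {..<L}" and c: "\<And>j. j < L \<Longrightarrow> c j \<noteq> 0"
  shows "det (mat L L (\<lambda>(i,j). c j * \<alpha> i ^ j)) \<noteq> 0"
proof
  let ?A = "mat L L (\<lambda>(i,j). c j * \<alpha> i ^ j)"
  assume "det ?A = 0"
  then obtain v where v: "v \<in> carrier_vec L" "v \<noteq> 0\<^sub>v L" "?A *\<^sub>v v = 0\<^sub>v L"
    using det_0_iff_vec_prod_zero_field[of ?A L] by auto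
  define P where "P = (\<Sum>j<L. monom (c j * v $ j) j)"
  have coeff: "coeff P j = (if j < L then c j * v $ j else 0)" for j
    unfolding P_def by (auto simp: coeff_sum if_distrib cong: if_cong)
  obtain j where j: "j < L" "v $ j \<noteq> 0"
  proof -
    from v(1,2) have "\<exists>j<L. v $ j \<noteq> 0" by (metis carrier_vecD eq_vecI index_zero_vec)
    then show ?thesis using that by blast
  qed
  have "coeff P j \<noteq> 0" using j c by (simp add: coeff)
  then have P0: "P \<noteq> 0" by auto
  have "degree P \<le> L - 1" by (rule degree_le) (auto simp: coeff)
  then have dP: "degree P < L" using j(1) by simp
  have root: "poly P (\<alpha> i) = 0" if "i < L" for i
  proof -
    have "0 = (?A *\<^sub>v v) $ i" using v(3) that by simp
    also have "\<dots> = (\<Sum>j<L. (c j * \<alpha> i ^ j) * v $ j)"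
      using that v(1) by (simp add: scalar_prod_def lessThan_atLeast0)
    also have "\<dots> = poly P (\<alpha> i)"
      unfolding P_def by (simp add: poly_sum poly_monom mult_ac)
    finally show ?thesis by simp
  qed
  have "L = card (\<alpha> ` {..<L})" using inj by (simp add: card_image)
  also have "\<dots> \<le> card {x. poly P x = 0}"
    by (intro card_mono poly_roots_finite P0) (use root in auto)
  also have "\<dots> \<le> degree P" by (intro card_poly_roots_bound P0)
  finally show False using dP by simp
qed

lemma bivariate_zero_estimate:
  fixes p :: "nat \<Rightarrow> real poly" and \<alpha> x :: "nat \<Rightarrow> real" and Z :: "(real \<times> real) set"
  assumes inj: "inj_on \<alpha> {..<L}" and nz: "\<And>i. i < L \<Longrightarrow> \<alpha> i \<noteq> 0"
    and deg: "\<And>j. j < L \<Longrightarrow> degree (p j) \<le> d"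
    and vanish: "\<And>i y \<beta>. i < L \<Longrightarrow> (y, \<beta>) \<in> Z \<Longrightarrow> (\<Sum>j<L. poly (p j) (y + x i) * (\<beta> * \<alpha> i) ^ j) = 0"
    and Znz: "\<And>y \<beta>. (y, \<beta>) \<in> Z \<Longrightarrow> \<beta> \<noteq> 0"
    and card: "finite (fst ` Z)" "card (fst ` Z) > L * d"
    and j: "j < L"
  shows "p j = 0"
proof (rule ccontr)
  assume pj: "p j \<noteq> 0"
  define p' where "p' j = (if p j = 0 then 1 else p j)" for j
  have p'0: "p' j \<noteq> 0" for j by (simp add: p'_def)
  define q where "q i j = Polynomial.smult (\<alpha> i ^ j) (p' j \<circ>\<^sub>p [:x i, 1:])" for i j
  have degq: "degree (q i j) = degree (p' j)" if "i < L" for i j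
    using nz[OF that] by (simp add: q_def degree_pcompose)
  have lcq: "lead_coeff (q i j) = lead_coeff (p' j) * \<alpha> i ^ j" if "i < L" for i j
    by (simp add: q_def lead_coeff_comp)
  have q0: "q i j \<noteq> 0" if "i < L" for i j
    using lcq[OF that, of j] nz[OF that] p'0[of j] by auto
  define A where "A = mat L L (\<lambda>(i,j). q i j)"
  have A: "A \<in> carrier_mat L L" by (simp add: A_def)
  define S where "S = (\<Sum>j<L. degree (p' j))"
  have prod_deg: "degree (\<Prod>i = 0..<L. q i (\<sigma> i)) = S"
    and prod_lc: "lead_coeff (\<Prod>i = 0..<L. q i (\<sigma> i)) = (\<Prod>i = 0..<L. lead_coeff (p' (\<sigma> i)) * \<alpha> i ^ \<sigma> i)"
    if "\<sigma> permutes {0..<L}" for \<sigma>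
  proof -
    have "degree (\<Prod>i = 0..<L. q i (\<sigma> i)) = (\<Sum>i = 0..<L. degree (q i (\<sigma> i)))"
      by (intro degree_prod_eq_sum_degree) (auto simp: q0)
    also have "\<dots> = (\<Sum>i = 0..<L. degree (p' (\<sigma> i)))" by (intro sum.cong) (auto simp: degq)
    also have "\<dots> = (\<Sum>j = 0..<L. degree (p' j))"
      using sum.permute[OF that, of "\<lambda>j. degree (p' j)"] by (simp add: comp_def)
    finally show "degree (\<Prod>i = 0..<L. q i (\<sigma> i)) = S" by (simp add: S_def lessThan_atLeast0)
    show "lead_coeff (\<Prod>i = 0..<L. q i (\<sigma> i)) = (\<Prod>i = 0..<L. lead_coeff (p' (\<sigma> i)) * \<alpha> i ^ \<sigma> i)"
      unfolding lead_coeff_prod by (intro prod.cong) (auto simp: lcq)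
  qed
  have entry: "A $$ (i, \<sigma> i) = q i (\<sigma> i)" if "\<sigma> permutes {0..<L}" "i \<in> {0..<L}" for \<sigma> i
    using that permutes_in_image[OF that(1), of i] by (simp add: A_def)
  have detA: "det A = (\<Sum>\<sigma> | \<sigma> permutes {0..<L}. signof \<sigma> * (\<Prod>i = 0..<L. q i (\<sigma> i)))"
    unfolding det_def'[OF A] by (intro sum.cong refl arg_cong2[of _ _ _ _ "(*)"] prod.cong) (auto simp: entry)
  have sg: "signof \<sigma> * P = Polynomial.smult (signof \<sigma>) P" for \<sigma> and P :: "real poly"
    by (simp add: sign_def)
  have degA: "degree (det A) \<le> S"
    unfolding detA by (intro degree_sum_le finite_permutations) (auto simp: sg prod_deg intro!: order.trans[OF degree_smult_le])
  let ?V = "mat L L (\<lambda>(i,j). lead_coeff (p' j) * \<alpha> i ^ j)"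
  have "coeff (det A) S = (\<Sum>\<sigma> | \<sigma> permutes {0..<L}. signof \<sigma> * (\<Prod>i = 0..<L. lead_coeff (p' (\<sigma> i)) * \<alpha> i ^ \<sigma> i))"
    unfolding detA coeff_sum
  proof (intro sum.cong refl)
    fix \<sigma> assume "\<sigma> \<in> {\<sigma>. \<sigma> permutes {0..<L}}"
    then have s: "\<sigma> permutes {0..<L}" by simp
    show "coeff (signof \<sigma> * (\<Prod>i = 0..<L. q i (\<sigma> i))) S = signof \<sigma> * (\<Prod>i = 0..<L. lead_coeff (p' (\<sigma> i)) * \<alpha> i ^ \<sigma> i)"
      unfolding sg coeff_smult prod_lc[OF s, symmetric] prod_deg[OF s] ..
  qed
  also have "\<dots> = (\<Sum>\<sigma> | \<sigma> permutes {0..<L}. signof \<sigma> * (\<Prod>i = 0..<L. ?V $$ (i, \<sigma> i)))"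
  proof (intro sum.cong refl arg_cong2[of _ _ _ _ "(*)"] prod.cong)
    fix \<sigma> i assume "\<sigma> \<in> {\<sigma>. \<sigma> permutes {0..<L}}" "i \<in> {0..<L}"
    then show "lead_coeff (p' (\<sigma> i)) * \<alpha> i ^ \<sigma> i = ?V $$ (i, \<sigma> i)"
      using permutes_in_image[of \<sigma> "{0..<L}" i] by simp
  qed
  also have "\<dots> = det ?V" by (subst det_def'[of ?V L]) auto
  finally have "coeff (det A) S \<noteq> 0"
    using vandermonde_scaled_det_nonzero[OF inj, of "\<lambda>j. lead_coeff (p' j)"] p'0 by simp
  then have detA0: "det A \<noteq> 0" by auto
  have root: "poly (det A) y = 0" if "y \<in> fst ` Z" for y
  proof -
    from that obtain \<beta> where yb: "(y, \<beta>) \<in> Z" by auto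
    interpret h: comm_ring_hom "\<lambda>P. poly P y" by unfold_locales auto
    define v where "v = vec L (\<lambda>j. if p j = 0 then 0 else \<beta> ^ j)"
    let ?B = "map_mat (\<lambda>P. poly P y) A"
    have "v \<noteq> 0\<^sub>v L"
    proof
      assume "v = 0\<^sub>v L"
      then have "v $ j = 0" using j by simp
      then show False using pj j Znz[OF yb] by (simp add: v_def)
    qed
    moreover have "?B *\<^sub>v v = 0\<^sub>v L"
    proof (rule eq_vecI)
      fix i assume "i < dim_vec (0\<^sub>v L :: real vec)"
      then have i: "i < L" by simp
      have "(?B *\<^sub>v v) $ i = (\<Sum>j<L. poly (q i j) y * (if p j = 0 then 0 else \<beta> ^ j))"
        using i by (simp add: A_def v_def scalar_prod_def lessThan_atLeast0)
      also have "\<dots> = (\<Sum>j<L. poly (p j) (y + x i) * (\<beta> * \<alpha> i) ^ j)"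
        by (intro sum.cong refl) (auto simp: q_def p'_def poly_pcompose power_mult_distrib add.commute)
      also have "\<dots> = 0" by (rule vanish[OF i yb])
      finally show "(?B *\<^sub>v v) $ i = 0\<^sub>v L $ i" using i by simp
    qed (use A in simp)
    moreover have "v \<in> carrier_vec L" by (simp add: v_def)
    moreover have "?B \<in> carrier_mat L L" using A by simp
    ultimately have "det ?B = 0"
      using det_0_iff_vec_prod_zero_field[of ?B L] by blast
    then show ?thesis by simp
  qed
  have "card (fst ` Z) \<le> card {y. poly (det A) y = 0}"
    by (intro card_mono poly_roots_finite detA0) (use root in auto)
  also have "\<dots> \<le> degree (det A)" by (intro card_poly_roots_bound detA0)
  also have "\<dots> \<le> S" by (rule degA)
  also have "\<dots> \<le> (\<Sum>j<L. d)" unfolding S_def by (intro sum_mono) (auto simp: p'_def deg)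
  finally show False using card by simp
qed

lemma pigeonhole_linear_forms:
  fixes g :: "nat \<Rightarrow> 'i \<Rightarrow> real" and Q :: real and H M D :: nat
  assumes I: "finite I" "I \<noteq> {}" and "H > 0" "Q > 0" "M > 0"
    and g: "\<And>d i. d < D \<Longrightarrow> i \<in> I \<Longrightarrow> 0 \<le> g d i \<and> g d i \<le> Q"
    and less: "(M + 1) ^ D < (H + 1) ^ card I"
  obtains c :: "'i \<Rightarrow> int" where "\<And>i. i \<in> I \<Longrightarrow> \<bar>c i\<bar> \<le> int H" "\<exists>i\<in>I. c i \<noteq> 0"
    "\<And>d. d < D \<Longrightarrow> \<bar>\<Sum>i\<in>I. of_int (c i) * g d i\<bar> \<le> card I * H * Q / M"
proof -
  define W where "W = card I * H * Q / M"
  have cI: "card I > 0" using I by (simp add: card_gt_0_iff)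
  have W: "W > 0" using assms cI by (simp add: W_def)
  define V where "V f d = (\<Sum>i\<in>I. real (f i) * g d i)" for f :: "'i \<Rightarrow> nat" and d
  have V: "0 \<le> V f d \<and> V f d \<le> M * W" if "f \<in> I \<rightarrow>\<^sub>E {0..H}" "d < D" for f d
  proof
    show "0 \<le> V f d" unfolding V_def using g that by (intro sum_nonneg) auto
    have "V f d \<le> (\<Sum>i\<in>I. H * Q)" unfolding V_def
      using g that by (intro sum_mono mult_mono) (auto simp: PiE_iff)
    also have "\<dots> = M * W" using assms by (simp add: W_def)
    finally show "V f d \<le> M * W" .
  qed
  define box where "box f = (\<lambda>d\<in>{..<D}. nat \<lfloor>V f d / W\<rfloor>)" for f
  have box: "box f \<in> {..<D} \<rightarrow>\<^sub>E {0..M}" if f: "f \<in> I \<rightarrow>\<^sub>E {0..H}" for f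
  proof
    fix d assume d: "d \<in> {..<D}"
    have "V f d / W \<le> M" using V[OF f, of d] d W by (simp add: field_simps)
    then have "\<lfloor>V f d / W\<rfloor> \<le> int M" by linarith
    then show "box f d \<in> {0..M}" using d by (simp add: box_def)
  qed (simp add: box_def)
  have "card (box ` (I \<rightarrow>\<^sub>E {0..H})) \<le> card ({..<D} \<rightarrow>\<^sub>E {0..M})"
    by (intro card_mono finite_PiE) (use box in auto)
  also have "\<dots> = (M + 1) ^ D" by (simp add: card_PiE)
  also have "\<dots> < card (I \<rightarrow>\<^sub>E {0..H})" using less I by (simp add: card_PiE)
  finally have "\<not> inj_on box (I \<rightarrow>\<^sub>E {0..H})" by (rule pigeonhole)
  then obtain f1 f2 where f: "f1 \<in> I \<rightarrow>\<^sub>E {0..H}" "f2 \<in> I \<rightarrow>\<^sub>E {0..H}" "f1 \<noteq> f2" "box f1 = box f2"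
    by (auto simp: inj_on_def)
  show thesis
  proof (rule that[of "\<lambda>i. int (f1 i) - int (f2 i)"])
    fix i assume "i \<in> I"
    then have "f1 i \<le> H" "f2 i \<le> H" using f by (auto simp: PiE_iff)
    then show "\<bar>int (f1 i) - int (f2 i)\<bar> \<le> int H" by simp
  next
    show "\<exists>i\<in>I. int (f1 i) - int (f2 i) \<noteq> 0"
      using f(1-3) by (metis PiE_ext eq_iff_diff_eq_0 of_nat_eq_iff)
  next
    fix d assume d: "d < D"
    have eq: "(\<Sum>i\<in>I. of_int (int (f1 i) - int (f2 i)) * g d i) = V f1 d - V f2 d"
      by (simp add: V_def algebra_simps sum_subtractf)
    have "nat \<lfloor>V f1 d / W\<rfloor> = nat \<lfloor>V f2 d / W\<rfloor>"
      using fun_cong[OF f(4), of d] d by (simp add: box_def)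
    moreover have "V f1 d / W \<ge> 0" "V f2 d / W \<ge> 0" using V[OF f(1) d] V[OF f(2) d] W by simp_all
    ultimately have "\<bar>V f1 d / W - V f2 d / W\<bar> \<le> 1" by linarith
    then have "\<bar>(V f1 d - V f2 d) / W\<bar> \<le> 1" by (simp add: diff_divide_distrib)
    then have "\<bar>V f1 d - V f2 d\<bar> \<le> W" using W by (simp add: abs_divide)
    then show "\<bar>\<Sum>i\<in>I. of_int (int (f1 i) - int (f2 i)) * g d i\<bar> \<le> card I * H * Q / M"
      unfolding eq W_def .
  qed
qed

lemma power_times_exp_sums:
  fixes x t :: real
  shows "(\<lambda>d. (if d < k then 0 else t ^ (d - k) / fact (d - k)) * x ^ d) sums (x ^ k * exp (t * x))"
proof -
  have "(\<lambda>m. (t * x) ^ m /\<^sub>R fact m) sums exp (t * x)" by (rule exp_converges)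
  then have "(\<lambda>m. x ^ k * ((t * x) ^ m /\<^sub>R fact m)) sums (x ^ k * exp (t * x))" by (rule sums_mult)
  then have "(\<lambda>m. (if m + k < k then 0 else t ^ (m + k - k) / fact (m + k - k)) * x ^ (m + k)) sums (x ^ k * exp (t * x))"
    by (simp add: power_mult_distrib field_simps power_add)
  then show ?thesis
    by (subst (asm) sums_zero_iff_shift) auto
qed

text \<open>
  Coefficients of a bivariate polynomial are chosen by the pigeonhole principle so that the Taylor
  expansion of its restriction to the curve \<open>(x, exp (\<beta> * x))\<close> starts with tiny coefficients. If
  the linear form is tiny, the values at \<open>(r * l + s * n, a ^ r * b ^ s)\<close> are then integers less
  than 1 in absolute value, hence all zero, against the zero estimate.
\<close>
lemma linear_form_contradiction:
  fixes a b n l K L R D H :: nat and X Q :: real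
  assumes ab: "a \<ge> 2" "b \<ge> 2" and ind: "\<And>i j. i > 0 \<Longrightarrow> j > 0 \<Longrightarrow> a ^ i \<noteq> b ^ j"
    and cop: "coprime n l" and n: "n > 0" and RKL: "R * R = K * L" and D: "2 * D = K * L"
    and pos: "K > 0" "L > 0" "D > 0" and Rn: "R \<le> n"
    and X: "2 * real R * (real l + real n) \<le> X" "X \<ge> 1"
    and Q: "Q = X ^ K * exp (3 * L * (ln b / n) * X)"
    and C1: "real D * (real K * real L * Q) \<le> real H / 4"
    and C2: "real K * real L * real H * exp (real K - real D) * Q \<le> 1 / 4"
    and C3: "real K * real L * real H * Q * (4 * real L * real R * \<bar>n * ln a - l * ln b\<bar>) \<le> 1 / 4"
            "2 * real L * real R * \<bar>n * ln a - l * ln b\<bar> \<le> 1"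
  shows False
proof -
  define \<beta> where "\<beta> = ln b / n"
  define \<Lambda> where "\<Lambda> = n * ln a - l * ln b"
  define T where "T = K * L"
  have \<beta>: "\<beta> > 0" using ab n by (simp add: \<beta>_def)
  have expQ: "1 \<le> exp (3 * L * \<beta> * X)" using \<beta> X(2) by simp
  have Q1: "Q \<ge> 1" unfolding Q \<beta>_def[symmetric]
    using mult_mono[OF one_le_power[OF X(2), of K] expQ] X(2) by simp
  have H: "H > 0"
  proof (rule ccontr)
    assume "\<not> H > 0"
    then have "real D * (real K * real L * Q) \<le> 0" using C1 by simp
    moreover have "real D * (real K * real L * Q) > 0" using pos Q1 by simp
    ultimately show False by simp
  qed
  define I where "I = {..<K} \<times> {..<L}"
  have I: "finite I" "I \<noteq> {}" "card I = T" using pos by (auto simp: I_def T_def)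
  define \<gamma> where "\<gamma> kj d = (if d < fst kj then 0 else (real (snd kj) * \<beta>) ^ (d - fst kj) / fact (d - fst kj))" for kj :: "nat \<times> nat" and d
  have \<gamma>0: "\<gamma> kj d \<ge> 0" for kj d using \<beta> by (simp add: \<gamma>_def)
  have \<gamma>sums: "(\<lambda>d. \<gamma> kj d * x ^ d) sums (x ^ fst kj * exp (real (snd kj) * \<beta> * x))" for kj x
    unfolding \<gamma>_def by (rule power_times_exp_sums)
  have le_Q: "X ^ fst kj * exp (real (snd kj) * \<beta> * X) \<le> Q" if "kj \<in> I" for kj
    unfolding Q \<beta>_def[symmetric] using that X(2) \<beta>
    by (intro mult_mono power_increasing) (auto simp: I_def intro!: mult_right_mono)
  have g: "0 \<le> \<gamma> kj d * X ^ d \<and> \<gamma> kj d * X ^ d \<le> Q" if "kj \<in> I" for kj d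
  proof
    show "0 \<le> \<gamma> kj d * X ^ d" using \<gamma>0 X(2) by simp
    have "(\<Sum>d\<in>{d}. \<gamma> kj d * X ^ d) \<le> (\<Sum>d. \<gamma> kj d * X ^ d)"
      using \<gamma>sums[of kj X] \<gamma>0 X(2) by (intro sum_le_suminf) (auto simp: sums_iff)
    also have "\<dots> = X ^ fst kj * exp (real (snd kj) * \<beta> * X)" using \<gamma>sums[of kj X] by (simp add: sums_iff)
    also have "\<dots> \<le> Q" by (rule le_Q[OF that])
    finally show "\<gamma> kj d * X ^ d \<le> Q" by simp
  qed
  define M where "M = H ^ 2 + 2 * H - 1"
  have M1: "M + 1 < (H + 1) ^ 2" and M2: "M \<ge> H ^ 2" and M0: "M > 0"
    using H by (auto simp: M_def power2_eq_square)
  have "(M + 1) ^ D < ((H + 1) ^ 2) ^ D" using M1 pos by (intro power_strict_mono) auto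
  also have "\<dots> = (H + 1) ^ card I" by (simp only: power_mult[symmetric] D I T_def)
  finally have less: "(M + 1) ^ D < (H + 1) ^ card I" .
  have "Q > 0" using Q1 by simp
  obtain c :: "nat \<times> nat \<Rightarrow> int" where c: "\<And>i. i \<in> I \<Longrightarrow> \<bar>c i\<bar> \<le> int H" "\<exists>i\<in>I. c i \<noteq> 0"
    and small: "\<And>d. d < D \<Longrightarrow> \<bar>\<Sum>i\<in>I. of_int (c i) * (\<gamma> i d * X ^ d)\<bar> \<le> card I * H * Q / M"
  proof (rule pigeonhole_linear_forms[OF I(1,2) H \<open>Q > 0\<close> M0 _ less, of "\<lambda>d kj. \<gamma> kj d * X ^ d"])
    show "0 \<le> \<gamma> i d * X ^ d \<and> \<gamma> i d * X ^ d \<le> Q" if "i \<in> I" for d i by (rule g[OF that])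
  qed (use that in blast)
  have c': "\<bar>real_of_int (c i)\<bar> \<le> H" if "i \<in> I" for i
    using c(1)[OF that] by linarith
  have HM: "card I * H * Q / M \<le> T * Q / H"
  proof -
    have "real H * H \<le> M" using M2 unfolding power2_eq_square of_nat_mult[symmetric] of_nat_le_iff .
    then have "T * Q * (H * H) \<le> T * Q * M" using Q1 by (intro mult_left_mono) auto
    then show ?thesis using H M0 by (simp add: I field_simps)
  qed
  have G_small: "\<bar>\<Sum>i\<in>I. of_int (c i) * (x ^ fst i * exp (real (snd i) * \<beta> * x))\<bar> \<le> 1 / 2" if x: "0 \<le> x" "x \<le> X" for x
  proof -
    define t where "t i = x ^ fst i * exp (real (snd i) * \<beta> * x) - (\<Sum>d<D. \<gamma> i d * x ^ d)" for i
    have t: "0 \<le> t i \<and> t i \<le> exp (real K - real D) * Q" if i: "i \<in> I" for i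
    proof -
      have sm: "summable (\<lambda>d. \<gamma> i d * x ^ d)" for x using \<gamma>sums by (auto simp: sums_iff)
      have t_eq: "t i = (\<Sum>d. \<gamma> i (d + D) * x ^ (d + D))"
        using suminf_minus_initial_segment[OF sm[of x], of D] \<gamma>sums[of i x] by (simp add: t_def sums_iff)
      have sm': "summable (\<lambda>d. \<gamma> i (d + D) * x ^ (d + D))" for x
        using sm[of x] by (rule summable_ignore_initial_segment)
      have "t i \<le> (\<Sum>d. exp (- real D) * (\<gamma> i (d + D) * (exp 1 * X) ^ (d + D)))"
        unfolding t_eq
      proof (intro suminf_le sm' summable_mult)
        fix d
        have "x ^ (d + D) \<le> X ^ (d + D)" using x by (intro power_mono) auto
        also have "\<dots> = 1 * X ^ (d + D)" by simp
        also have "\<dots> \<le> exp (real d) * X ^ (d + D)" using X(2) by (intro mult_right_mono) auto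
        also have "\<dots> = exp (- real D) * (exp 1 * X) ^ (d + D)"
          by (simp add: power_mult_distrib exp_of_nat_mult[symmetric] mult.assoc[symmetric] exp_add[symmetric])
        finally have "\<gamma> i (d + D) * x ^ (d + D) \<le> \<gamma> i (d + D) * (exp (- real D) * (exp 1 * X) ^ (d + D))"
          by (intro mult_left_mono \<gamma>0)
        then show "\<gamma> i (d + D) * x ^ (d + D) \<le> exp (- real D) * (\<gamma> i (d + D) * (exp 1 * X) ^ (d + D))"
          by (simp only: mult_ac)
      qed
      also have "\<dots> = exp (- real D) * (\<Sum>d. \<gamma> i (d + D) * (exp 1 * X) ^ (d + D))"
        by (intro suminf_mult sm')
      also have "\<dots> \<le> exp (- real D) * (\<Sum>d. \<gamma> i d * (exp 1 * X) ^ d)"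
      proof (intro mult_left_mono)
        have "0 \<le> (\<Sum>d<D. \<gamma> i d * (exp 1 * X) ^ d)" using \<gamma>0 X(2) by (intro sum_nonneg) auto
        then show "(\<Sum>d. \<gamma> i (d + D) * (exp 1 * X) ^ (d + D)) \<le> (\<Sum>d. \<gamma> i d * (exp 1 * X) ^ d)"
          using suminf_minus_initial_segment[OF sm[of "exp 1 * X"], of D] by simp
      qed simp
      also have "\<dots> = exp (- real D) * ((exp 1 * X) ^ fst i * exp (real (snd i) * \<beta> * (exp 1 * X)))"
        using \<gamma>sums[of i "exp 1 * X"] by (simp add: sums_iff)
      also have "\<dots> \<le> exp (- real D) * ((exp 1 * X) ^ K * exp (3 * L * \<beta> * X))"
      proof (intro mult_left_mono mult_mono power_increasing)
        have "1 * 1 \<le> exp 1 * X" using X(2) by (intro mult_mono) auto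
        then show "1 \<le> exp 1 * X" by simp
        show "fst i \<le> K" using i by (auto simp: I_def)
        have "real (snd i) * (\<beta> * X) * exp 1 \<le> L * (\<beta> * X) * 3"
          using i exp_le \<beta> X(2) by (intro mult_mono) (auto simp: I_def)
        then show "exp (real (snd i) * \<beta> * (exp 1 * X)) \<le> exp (3 * L * \<beta> * X)" by (simp add: mult_ac)
      qed (use X(2) in auto)
      also have "\<dots> = exp (real K - real D) * Q"
        by (simp add: Q \<beta>_def power_mult_distrib exp_of_nat_mult[symmetric] exp_diff exp_minus field_simps)
      finally have "t i \<le> exp (real K - real D) * Q" .
      moreover have "0 \<le> t i" unfolding t_eq using \<gamma>0 x by (intro suminf_nonneg sm') auto
      ultimately show ?thesis by simp
    qed
    have "(\<Sum>i\<in>I. of_int (c i) * (x ^ fst i * exp (real (snd i) * \<beta> * x)))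
        = (\<Sum>i\<in>I. of_int (c i) * (\<Sum>d<D. \<gamma> i d * x ^ d)) + (\<Sum>i\<in>I. of_int (c i) * t i)"
      unfolding sum.distrib[symmetric] by (intro sum.cong refl) (simp add: t_def algebra_simps)
    also have "(\<Sum>i\<in>I. of_int (c i) * (\<Sum>d<D. \<gamma> i d * x ^ d))
        = (\<Sum>d<D. (x / X) ^ d * (\<Sum>i\<in>I. of_int (c i) * (\<gamma> i d * X ^ d)))"
    proof -
      have "(\<Sum>i\<in>I. of_int (c i) * (\<Sum>d<D. \<gamma> i d * x ^ d)) = (\<Sum>d<D. \<Sum>i\<in>I. of_int (c i) * (\<gamma> i d * x ^ d))"
        unfolding sum_distrib_left by (rule sum.swap)
      also have "\<dots> = (\<Sum>d<D. (x / X) ^ d * (\<Sum>i\<in>I. of_int (c i) * (\<gamma> i d * X ^ d)))"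
        unfolding sum_distrib_left using X(2) by (intro sum.cong refl) (auto simp: power_divide)
      finally show ?thesis .
    qed
    finally have "\<bar>\<Sum>i\<in>I. of_int (c i) * (x ^ fst i * exp (real (snd i) * \<beta> * x))\<bar>
       \<le> \<bar>\<Sum>d<D. (x / X) ^ d * (\<Sum>i\<in>I. of_int (c i) * (\<gamma> i d * X ^ d))\<bar> + \<bar>\<Sum>i\<in>I. of_int (c i) * t i\<bar>"
      by (simp only: abs_triangle_ineq)
    also have "\<bar>\<Sum>d<D. (x / X) ^ d * (\<Sum>i\<in>I. of_int (c i) * (\<gamma> i d * X ^ d))\<bar> \<le> (\<Sum>d<D. 1 * (T * Q / H))"
    proof (intro order.trans[OF sum_abs] sum_mono)
      fix d assume "d \<in> {..<D}"
      then have "\<bar>\<Sum>i\<in>I. of_int (c i) * (\<gamma> i d * X ^ d)\<bar> \<le> T * Q / H" using small[of d] HM by simp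
      moreover have "\<bar>(x / X) ^ d\<bar> \<le> 1" using x X(2) by (simp add: power_le_one)
      ultimately show "\<bar>(x / X) ^ d * (\<Sum>i\<in>I. of_int (c i) * (\<gamma> i d * X ^ d))\<bar> \<le> 1 * (T * Q / H)"
        unfolding abs_mult by (intro mult_mono) auto
    qed
    also have "(\<Sum>d<D. 1 * (T * Q / H)) \<le> 1 / 4" using C1 H by (simp add: T_def field_simps)
    also have "\<bar>\<Sum>i\<in>I. of_int (c i) * t i\<bar> \<le> (\<Sum>i\<in>I. H * (exp (real K - real D) * Q))"
    proof (intro order.trans[OF sum_abs] sum_mono)
      fix i assume i: "i \<in> I"
      then show "\<bar>of_int (c i) * t i\<bar> \<le> H * (exp (real K - real D) * Q)"
        unfolding abs_mult using t[OF i] c'[OF i] by (intro mult_mono) auto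
    qed
    also have "\<dots> \<le> 1 / 4" using C2 by (simp add: I T_def mult_ac)
    finally show ?thesis by simp
  qed
  define V where "V r s = (\<Sum>i\<in>I. c i * int (r * l + s * n) ^ fst i * int (a ^ r * b ^ s) ^ snd i)" for r s :: nat
  have V0: "V r s = 0" if rs: "r < 2 * R" "s < 2 * R" for r s
  proof -
    define x where "x = real (r * l + s * n)"
    have "x \<le> 2 * real R * (real l + real n)"
    proof -
      have "real r * l + real s * n \<le> (2 * real R) * l + (2 * real R) * n"
        using rs by (intro add_mono mult_right_mono) auto
      then show ?thesis by (simp add: x_def algebra_simps)
    qed
    then have x: "0 \<le> x" "x \<le> X" using X(1) by (auto simp: x_def)
    have ab_eq: "real (a ^ r * b ^ s) = exp (\<beta> * x + r * \<Lambda> / n)"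
    proof -
      have "\<beta> * x + r * \<Lambda> / n = r * ln a + s * ln b"
        using n by (simp add: \<beta>_def x_def \<Lambda>_def field_simps)
      then show ?thesis using ab by (simp add: exp_add exp_of_nat_mult)
    qed
    have diff: "\<bar>x ^ fst i * real (a ^ r * b ^ s) ^ snd i - x ^ fst i * exp (real (snd i) * \<beta> * x)\<bar> \<le> Q * (4 * L * R * \<bar>\<Lambda>\<bar>)"
      if i: "i \<in> I" for i
    proof -
      define \<delta> where "\<delta> = real (snd i) * (real r * \<Lambda> / n)"
      have "real (snd i) * real r \<le> real L * real (2 * R)" using i rs by (intro mult_mono) (auto simp: I_def)
      then have "real (snd i) * real r * \<bar>\<Lambda>\<bar> \<le> real L * real (2 * R) * \<bar>\<Lambda>\<bar>" by (intro mult_right_mono) auto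
      moreover have "\<bar>\<delta>\<bar> \<le> real (snd i) * real r * \<bar>\<Lambda>\<bar>"
      proof -
        have "real (snd i) * real r * \<bar>\<Lambda>\<bar> * 1 \<le> real (snd i) * real r * \<bar>\<Lambda>\<bar> * n"
          using n by (intro mult_left_mono) auto
        then show ?thesis using n by (simp add: \<delta>_def abs_mult field_simps)
      qed
      ultimately have \<delta>: "\<bar>\<delta>\<bar> \<le> 2 * L * R * \<bar>\<Lambda>\<bar>" by simp
      then have \<delta>1: "\<bar>\<delta>\<bar> \<le> 1" using C3(2) by (simp add: \<Lambda>_def)
      have e: "\<bar>exp \<delta> - 1\<bar> \<le> 2 * \<bar>\<delta>\<bar>"
      proof (cases "\<delta> \<ge> 0")
        case True
        then have "exp \<delta> \<le> 1 + \<delta> + \<delta>\<^sup>2" using \<delta>1 by (intro exp_bound) auto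
        moreover have "\<delta>\<^sup>2 \<le> \<delta>" using True \<delta>1 by (simp add: power2_eq_square mult_left_le)
        ultimately show ?thesis using True by simp
      next
        case False
        then have "exp \<delta> \<le> 1" by simp
        then show ?thesis using False exp_ge_add_one_self[of \<delta>] by linarith
      qed
      have e': "real (a ^ r * b ^ s) ^ snd i = exp (real (snd i) * \<beta> * x) * exp \<delta>"
        unfolding ab_eq exp_of_nat_mult[symmetric] exp_add[symmetric] \<delta>_def by (simp add: algebra_simps)
      have "\<bar>x ^ fst i * real (a ^ r * b ^ s) ^ snd i - x ^ fst i * exp (real (snd i) * \<beta> * x)\<bar>
          = x ^ fst i * exp (real (snd i) * \<beta> * x) * \<bar>exp \<delta> - 1\<bar>"
      proof -
        have "x ^ fst i * real (a ^ r * b ^ s) ^ snd i - x ^ fst i * exp (real (snd i) * \<beta> * x)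
            = x ^ fst i * exp (real (snd i) * \<beta> * x) * (exp \<delta> - 1)"
          unfolding e' by (simp add: algebra_simps)
        then show ?thesis using x by (simp add: abs_mult)
      qed
      also have "\<dots> \<le> Q * (2 * \<bar>\<delta>\<bar>)"
      proof (intro mult_mono e)
        have "x ^ fst i * exp (real (snd i) * \<beta> * x) \<le> X ^ fst i * exp (real (snd i) * \<beta> * X)"
          using x \<beta> by (intro mult_mono power_mono) (auto intro!: mult_left_mono)
        then show "x ^ fst i * exp (real (snd i) * \<beta> * x) \<le> Q" using le_Q[OF i] by simp
      qed (use Q1 in auto)
      also have "\<dots> \<le> Q * (4 * L * R * \<bar>\<Lambda>\<bar>)" using \<delta> Q1 by (intro mult_left_mono) (simp_all add: mult_ac)
      finally show ?thesis .
    qed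
    have Veq: "real_of_int (V r s) = (\<Sum>i\<in>I. of_int (c i) * (x ^ fst i * real (a ^ r * b ^ s) ^ snd i))"
      by (simp add: V_def x_def mult_ac)
    have "real_of_int (V r s) = (\<Sum>i\<in>I. of_int (c i) * (x ^ fst i * exp (real (snd i) * \<beta> * x)))
       + (\<Sum>i\<in>I. of_int (c i) * (x ^ fst i * real (a ^ r * b ^ s) ^ snd i - x ^ fst i * exp (real (snd i) * \<beta> * x)))"
      unfolding Veq sum.distrib[symmetric] by (intro sum.cong refl) (simp add: right_diff_distrib)
    then have "\<bar>real_of_int (V r s)\<bar> \<le> \<bar>\<Sum>i\<in>I. of_int (c i) * (x ^ fst i * exp (real (snd i) * \<beta> * x))\<bar>
       + \<bar>\<Sum>i\<in>I. of_int (c i) * (x ^ fst i * real (a ^ r * b ^ s) ^ snd i - x ^ fst i * exp (real (snd i) * \<beta> * x))\<bar>"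
      by (simp only: abs_triangle_ineq)
    also have "\<bar>\<Sum>i\<in>I. of_int (c i) * (x ^ fst i * exp (real (snd i) * \<beta> * x))\<bar> \<le> 1 / 2" by (rule G_small[OF x])
    also have "\<bar>\<Sum>i\<in>I. of_int (c i) * (x ^ fst i * real (a ^ r * b ^ s) ^ snd i - x ^ fst i * exp (real (snd i) * \<beta> * x))\<bar>
        \<le> (\<Sum>i\<in>I. H * (Q * (4 * L * R * \<bar>\<Lambda>\<bar>)))"
    proof (intro order.trans[OF sum_abs] sum_mono)
      fix i assume i: "i \<in> I"
      show "\<bar>of_int (c i) * (x ^ fst i * real (a ^ r * b ^ s) ^ snd i - x ^ fst i * exp (real (snd i) * \<beta> * x))\<bar> \<le> H * (Q * (4 * L * R * \<bar>\<Lambda>\<bar>))"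
        unfolding abs_mult[of "of_int (c i)"] by (intro mult_mono c' diff i) auto
    qed
    also have "\<dots> \<le> 1 / 4" using C3(1) by (simp add: I T_def \<Lambda>_def mult_ac)
    finally have "\<bar>real_of_int (V r s)\<bar> < 1" by simp
    then show ?thesis by linarith
  qed
  have indep0: "i = 0 \<and> j = 0" if "a ^ i = b ^ j" for i j :: nat
  proof -
    have "1 < a ^ i" if "i > 0" using one_less_power[of a i] that ab by simp
    moreover have "1 < b ^ j" if "j > 0" using one_less_power[of b j] that ab by simp
    ultimately show ?thesis using ind[of i j] that by (cases "i = 0"; cases "j = 0") auto
  qed
  have inj_ab: "r = r' \<and> s = s'" if eq: "a ^ r * b ^ s = a ^ r' * b ^ s'" for r r' s s' :: nat
  proof -
    have *: "r = r' \<and> s = s'" if eq: "a ^ r * b ^ s = a ^ r' * b ^ s'" and le: "r \<le> r'" for r r' s s' :: nat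
    proof -
      have "a ^ r * b ^ s = a ^ r * (a ^ (r' - r) * b ^ s')"
        using eq le by (simp add: mult.assoc[symmetric] power_add[symmetric])
      then have e: "b ^ s = a ^ (r' - r) * b ^ s'" using ab by simp
      show ?thesis
      proof (cases "s' \<le> s")
        case True
        then have "b ^ s = b ^ (s - s') * b ^ s'" by (simp add: power_add[symmetric])
        then have "a ^ (r' - r) = b ^ (s - s')" using e ab by simp
        then show ?thesis using indep0[of "r' - r" "s - s'"] le True by auto
      next
        case False
        then have "b ^ s' = b ^ (s' - s) * b ^ s" by (simp add: power_add[symmetric])
        then have "b ^ s = b ^ s * (a ^ (r' - r) * b ^ (s' - s))" using e by (simp only: mult_ac)
        from mult_eq_self_implies_10[OF this] have "a ^ (r' - r) * b ^ (s' - s) = 1" using ab by simp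
        then have "b ^ (s' - s) = 1" by simp
        then show ?thesis using ab False by simp
      qed
    qed
    show ?thesis using *[OF eq] *[OF eq[symmetric]] linear[of r r'] by auto
  qed
  have inj_x: "r = r' \<and> s = s'" if eq: "r * l + s * n = r' * l + s' * n" and lt: "r < R" "r' < R" for r r' s s' :: nat
  proof -
    have "int r * int l + int s * int n = int r' * int l + int s' * int n"
      using eq by (metis of_nat_add of_nat_mult)
    then have e: "(int r - int r') * int l = (int s' - int s) * int n" by (simp add: algebra_simps)
    then have "int n dvd (int r - int r') * int l" by simp
    then have "int n dvd int r - int r'" using cop by (simp add: coprime_dvd_mult_left_iff)
    moreover have "\<bar>int r - int r'\<bar> < int n" using lt Rn by simp
    ultimately have "int r - int r' = 0" using zdvd_imp_le[of "int n" "\<bar>int r - int r'\<bar>"] by fastforce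
    then show ?thesis using e n by simp
  qed
  have LR: "L \<le> R * R" using RKL pos by simp
  have R0: "R > 0" using RKL pos by (cases R) auto
  define \<alpha> where "\<alpha> i = real (a ^ (i div R) * b ^ (i mod R))" for i
  define xx where "xx i = real ((i div R) * l + (i mod R) * n)" for i
  define Z where "Z = (\<lambda>(r,s). (real (r * l + s * n), real (a ^ r * b ^ s))) ` ({..<R} \<times> {..<R})"
  define pp where "pp j = (\<Sum>k<K. monom (real_of_int (c (k, j))) k)" for j
  have coeff_pp: "coeff (pp j) k = (if k < K then real_of_int (c (k, j)) else 0)" for k j
    unfolding pp_def by (auto simp: coeff_sum if_distrib cong: if_cong)
  have zero: "pp j = 0" if "j < L" for j
  proof (rule bivariate_zero_estimate[where \<alpha> = \<alpha> and x = xx and L = L and Z = Z and d = "K - 1"])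
    show "inj_on \<alpha> {..<L}"
    proof (rule inj_onI)
      fix i i' assume "\<alpha> i = \<alpha> i'"
      then have "i div R = i' div R \<and> i mod R = i' mod R"
        unfolding \<alpha>_def of_nat_eq_iff by (rule inj_ab)
      then have "i div R * R + i mod R = i' div R * R + i' mod R" by simp
      then show "i = i'" unfolding div_mult_mod_eq .
    qed
    show "\<alpha> i \<noteq> 0" for i using ab by (simp add: \<alpha>_def)
    show "degree (pp j) \<le> K - 1" for j
    proof (rule degree_le, intro allI impI)
      fix i assume "K - 1 < i"
      then have "\<not> i < K" by linarith
      then show "coeff (pp j) i = 0" unfolding coeff_pp by (rule if_not_P)
    qed
    have fZ: "fst ` Z = (\<lambda>(r,s). real (r * l + s * n)) ` ({..<R} \<times> {..<R})"
      unfolding Z_def image_image case_prod_beta fst_conv ..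
    show "finite (fst ` Z)" unfolding fZ by simp
    have "inj_on (\<lambda>(r,s). real (r * l + s * n)) ({..<R} \<times> {..<R})"
    proof (rule inj_onI)
      fix u v assume "u \<in> {..<R} \<times> {..<R}" "v \<in> {..<R} \<times> {..<R}"
        and eq: "(case u of (r, s) \<Rightarrow> real (r * l + s * n)) = (case v of (r, s) \<Rightarrow> real (r * l + s * n))"
      then have "fst u < R" "fst v < R" by auto
      moreover have "fst u * l + snd u * n = fst v * l + snd v * n"
        using eq unfolding case_prod_beta of_nat_eq_iff .
      ultimately have "fst u = fst v \<and> snd u = snd v" by (intro inj_x)
      then show "u = v" by (simp add: prod_eq_iff)
    qed
    then have cardZ: "card (fst ` Z) = R * R" unfolding fZ by (simp add: card_image)
    have "L * (K - 1) < K * L" using pos by (cases K) auto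
    then show "L * (K - 1) < card (fst ` Z)" unfolding cardZ RKL .
    show "\<beta> \<noteq> 0" if "(y, \<beta>) \<in> Z" for y \<beta> using that ab by (auto simp: Z_def)
    show "(\<Sum>j<L. poly (pp j) (y + xx i) * (\<beta> * \<alpha> i) ^ j) = 0" if i: "i < L" and Z: "(y, \<beta>) \<in> Z" for i y \<beta>
    proof -
      obtain r s where rs: "r < R" "s < R" "y = real (r * l + s * n)" "\<beta> = real (a ^ r * b ^ s)"
        using Z by (auto simp: Z_def)
      define r' s' where "r' = r + i div R" and "s' = s + i mod R"
      have "i div R < R" using i LR by (intro less_mult_imp_div_less) simp
      moreover have "i mod R < R" using R0 by simp
      ultimately have lt: "r' < 2 * R" "s' < 2 * R" 
        unfolding r'_def s'_def using rs(1,2) by linarith+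
      have y: "y + xx i = real (r' * l + s' * n)"
        by (simp add: rs xx_def r'_def s'_def algebra_simps)
      have b: "\<beta> * \<alpha> i = real (a ^ r' * b ^ s')"
        by (simp add: rs \<alpha>_def r'_def s'_def power_add)
      have "(\<Sum>j<L. poly (pp j) (y + xx i) * (\<beta> * \<alpha> i) ^ j)
          = (\<Sum>j<L. \<Sum>k<K. real_of_int (c (k, j)) * real (r' * l + s' * n) ^ k * real (a ^ r' * b ^ s') ^ j)"
        unfolding y b pp_def by (simp add: poly_sum poly_monom sum_distrib_right)
      also have "\<dots> = (\<Sum>k<K. \<Sum>j<L. real_of_int (c (k, j)) * real (r' * l + s' * n) ^ k * real (a ^ r' * b ^ s') ^ j)"
        by (rule sum.swap)
      also have "\<dots> = real_of_int (V r' s')"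
        unfolding V_def I_def by (simp add: sum.cartesian_product case_prod_beta)
      finally show ?thesis using V0[OF lt] by simp
    qed
  qed (fact that)
  from c(2) obtain k j where kj: "k < K" "j < L" "c (k, j) \<noteq> 0" by (auto simp: I_def)
  have "coeff (pp j) k = 0" using zero[OF kj(2)] by simp
  then show False using kj by (simp add: coeff_pp)
qed

lemma gelfond_asymptotics:
  fixes A B C \<epsilon> :: real
  assumes "A > 0" "B > 0" "C > 0" "\<epsilon> > 0"
  shows "eventually (\<lambda>n::nat. A + B * ln n \<le> C * n powr (1/4)) at_top"
    and "eventually (\<lambda>n::nat. A + A * ln n + A * n powr (1/4) * (B + C * ln n) + A * (n powr (1/4))\<^sup>2 \<le> \<epsilon> * n) at_top"
proof -
  define s where "s n = real n powr (1/8)" for n :: nat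
  have "filterlim s at_top at_top" unfolding s_def by real_asymp
  then have s_top: "eventually (\<lambda>n. s n \<ge> K) at_top" for K by (simp add: filterlim_at_top)
  have ln_s: "eventually (\<lambda>n. ln (real n) \<le> s n) at_top"
    unfolding s_def by real_asymp
  have s2: "real n powr (1/4) = (s n)\<^sup>2" and s8: "n > 0 \<Longrightarrow> real n = (s n) ^ 8" for n
    by (auto simp: s_def powr_powr powr_realpow[symmetric] simp flip: powr_numeral)
  show "eventually (\<lambda>n::nat. A + B * ln n \<le> C * n powr (1/4)) at_top"
    using ln_s s_top[of 1] s_top[of "(A + B) / C"]
  proof eventually_elim
    case (elim n)
    have "A + B * ln n \<le> A * s n + B * s n"
      using elim(1,2) assms by (intro add_mono mult_left_mono) auto
    also have "\<dots> = (A + B) * s n" by (simp add: algebra_simps)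
    also have "\<dots> \<le> (C * s n) * s n" using elim(2,3) assms by (intro mult_right_mono) (auto simp: field_simps)
    finally show ?case by (simp add: s2 power2_eq_square)
  qed
  define K where "K = (A + A + A * (B + C) + A) / \<epsilon>"
  show "eventually (\<lambda>n::nat. A + A * ln n + A * n powr (1/4) * (B + C * ln n) + A * (n powr (1/4))\<^sup>2 \<le> \<epsilon> * n) at_top"
    using ln_s s_top[of 1] s_top[of K] eventually_gt_at_top[of 0]
  proof eventually_elim
    case (elim n)
    define t where "t = s n"
    have t: "t \<ge> 1" "t \<ge> K" "ln n \<le> t" using elim by (auto simp: t_def)
    have p: "t ^ i \<le> t ^ 4" if "i \<le> 4" for i using t(1) that by (rule power_increasing[rotated])
    have "A * t\<^sup>2 * (B + C * ln n) \<le> A * t\<^sup>2 * (B * t + C * t)"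
      using t assms by (intro mult_left_mono add_mono) auto
    also have "\<dots> = A * (B + C) * t ^ 3" by (simp add: algebra_simps power2_eq_square power3_eq_cube)
    also have "\<dots> \<le> A * (B + C) * t ^ 4" using p[of 3] assms by (intro mult_left_mono) auto
    finally have 1: "A * t\<^sup>2 * (B + C * ln n) \<le> A * (B + C) * t ^ 4" .
    have "A * ln n \<le> A * t ^ 4" using t(3) p[of 1] assms by (intro mult_left_mono) auto
    moreover have "A \<le> A * t ^ 4" using p[of 0] assms by simp
    moreover have "A * (t\<^sup>2)\<^sup>2 = A * t ^ 4" by (simp flip: power_mult)
    ultimately have "A + A * ln n + A * t\<^sup>2 * (B + C * ln n) + A * (t\<^sup>2)\<^sup>2 \<le> A * t ^ 4 + A * t ^ 4 + A * (B + C) * t ^ 4 + A * t ^ 4"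
      using 1 by linarith
    also have "\<dots> = (A + A + A * (B + C) + A) * t ^ 4" by (simp add: algebra_simps)
    also have "\<dots> = (\<epsilon> * K) * t ^ 4" using assms by (simp add: K_def)
    also have "\<dots> \<le> (\<epsilon> * t ^ 4) * t ^ 4"
    proof -
      have "K \<le> t ^ 4" using t(2) p[of 1] by simp
      then show ?thesis using assms t by (intro mult_right_mono mult_left_mono) auto
    qed
    also have "\<dots> = \<epsilon> * n" using s8[of n] elim(4) by (simp add: t_def power_add[symmetric])
    finally show ?case by (simp add: t_def s2)
  qed
qed

lemma linear_form_lower_bound_coprime:
  fixes a b :: nat and \<epsilon> :: real
  assumes ab: "a \<ge> 2" "b \<ge> 2" and ind: "\<And>i j. i > 0 \<Longrightarrow> j > 0 \<Longrightarrow> a ^ i \<noteq> b ^ j" and \<epsilon>: "\<epsilon> > 0"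
  shows "eventually (\<lambda>n::nat. \<forall>l::nat. l > 0 \<longrightarrow> coprime n l \<longrightarrow> \<bar>n * ln a - l * ln b\<bar> \<ge> exp (- \<epsilon> * n)) at_top"
proof -
  define C0 where "C0 = (ln a + 1) / ln b"
  define C1 where "C1 = 2 * (C0 + 1)"
  have lnb: "ln b > 0" and lna: "ln a > 0" using ab by auto
  have C0: "C0 > 0" using lna lnb by (simp add: C0_def)
  then have C1: "C1 > 2" by (simp add: C1_def)
  obtain \<kappa> :: nat where \<kappa>: "real \<kappa> \<ge> 24 * ln b * C1 + 1" using real_arch_simple by blast
  have "24 * ln b * C1 > 0" using lnb C1 by simp
  then have \<kappa>1: "\<kappa> \<ge> 1"
  proof -
    have "real \<kappa> > 0" using \<kappa> \<open>24 * ln b * C1 > 0\<close> by linarith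
    then show ?thesis by simp
  qed
  define lam where "lam n = real n powr (1/4)" for n :: nat
  define Lf where "Lf n = 2 * nat \<lceil>lam n\<rceil>" for n
  define A1 where "A1 = \<bar>ln (20 * real \<kappa> ^ 6 * 4 ^ 6)\<bar> + \<bar>ln (4 * C1 * \<kappa>)\<bar> + 1"
  have A1: "A1 > 0" by (simp add: A1_def)
  define A2 where "A2 = \<bar>ln (80 * real \<kappa> ^ 7 * 4 ^ 8)\<bar> + 96 * \<kappa> * ln b * C1 + 8 * real \<kappa> ^ 2 + 8"
  have A2: "A2 > 0" using lnb C1 by (auto simp: A2_def intro!: add_nonneg_pos)
  define A3 where "A3 = \<bar>ln (4 * C1 * \<kappa>)\<bar> + 1"
  have A3: "A3 > 0" by (simp add: A3_def)
  have ev1: "eventually (\<lambda>n::nat. 4 * A1 + 24 * ln n \<le> 1 * n powr (1/4)) at_top"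
    using gelfond_asymptotics(1)[of "4 * A1" 24 1] A1 by simp
  have ev2: "eventually (\<lambda>n::nat. A2 + A2 * ln n + A2 * n powr (1/4) * (A3 + 2 * ln n) + A2 * (n powr (1/4))\<^sup>2 \<le> \<epsilon> * n) at_top"
    using gelfond_asymptotics(2)[of A2 A3 2 \<epsilon>] A2 A3 \<epsilon> by simp
  have ev3: "eventually (\<lambda>n::nat. 4 * real \<kappa> * n powr (1/4) \<le> n) at_top"
  proof -
    have "eventually (\<lambda>n::nat. 4 * real \<kappa> + 4 * real \<kappa> * ln n + 4 * real \<kappa> * n powr (1/4) * (1 + 1 * ln n) + 4 * real \<kappa> * (n powr (1/4))\<^sup>2 \<le> 1 * n) at_top"
      by (rule gelfond_asymptotics(2)) (use \<kappa>1 in auto)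
    then show ?thesis using eventually_ge_at_top[of 1]
  proof eventually_elim
    case (elim n)
    have "0 \<le> real \<kappa> * ln n" "0 \<le> real \<kappa> * n powr (1/4) * ln n" "0 \<le> real \<kappa> * (n powr (1/4))\<^sup>2"
      using elim(2) by auto
    moreover have "4 * real \<kappa> * n powr (1/4) * (1 + ln n) = 4 * (real \<kappa> * n powr (1/4)) + 4 * (real \<kappa> * n powr (1/4) * ln n)"
      by (simp add: algebra_simps)
    moreover have "0 \<le> real \<kappa>" by simp
    ultimately show ?case using elim(1) unfolding mult.assoc mult_1 by linarith
  qed
  qed
  show ?thesis
    using ev1 ev2 ev3 eventually_ge_at_top[of 1]
  proof eventually_elim
    case (elim n)
    note n1 = \<open>1 \<le> n\<close>
    have lam1: "lam n \<ge> 1" using n1 by (simp add: lam_def ge_one_powr_ge_zero)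
    have lamn: "lam n \<le> n" using n1 powr_mono[of "1/4" 1 "real n"] by (simp add: lam_def)
    have lnn: "ln n \<ge> 0" using n1 by simp
    show ?case
    proof (intro allI impI, rule ccontr)
      fix l :: nat assume l: "l > 0" "coprime n l"
      define \<Lambda> where "\<Lambda> = n * ln a - l * ln b"
      assume "\<not> exp (- \<epsilon> * n) \<le> \<bar>n * ln a - l * ln b\<bar>"
      then have \<Lambda>: "\<bar>\<Lambda>\<bar> < exp (- \<epsilon> * n)" by (simp add: \<Lambda>_def)
      then have \<Lambda>1: "\<bar>\<Lambda>\<bar> < 1" by (rule order.strict_trans2) (use \<epsilon> in simp)
      define L where "L = Lf n"
      have L: "2 * lam n \<le> L" "L \<le> 4 * lam n" "even L" "L > 0"
        using lam1 unfolding L_def Lf_def by (auto, linarith+)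
      define R where "R = \<kappa> * L"
      define K where "K = \<kappa>\<^sup>2 * L"
      define T where "T = K * L"
      define D where "D = T div 2"
      have D: "2 * D = K * L" using L(3) by (simp add: D_def T_def)
      have Dr: "real D = (real \<kappa>)\<^sup>2 * (real L)\<^sup>2 / 2" using arg_cong[OF D, of real] by (simp add: K_def power2_eq_square)
      have posn: "K > 0" "D > 0" "R > 0" using L(4) \<kappa>1 D by (auto simp: K_def R_def intro!: Nat.gr0I)
      define X where "X = C1 * R * n"
      have "l * ln b \<le> n * (ln a + 1)"
        using \<Lambda>1 n1 by (auto simp: \<Lambda>_def abs_less_iff algebra_simps)
      then have lC0: "l \<le> C0 * n" using lnb by (simp add: C0_def field_simps)
      have X1: "2 * real R * (real l + real n) \<le> X"
      proof -
        have "2 * real R * (real l + real n) \<le> 2 * real R * (C0 * n + n)" using lC0 by (intro mult_left_mono) auto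
        then show ?thesis by (simp add: X_def C1_def algebra_simps)
      qed
      have X2: "X \<ge> 1"
      proof -
        have "1 * 1 * 1 \<le> C1 * R * n" using C1 posn n1 by (intro mult_mono) auto
        then show ?thesis by (simp add: X_def)
      qed
      define Q where "Q = X ^ K * exp (3 * L * (ln b / n) * X)"
      have Qexp: "3 * L * (ln b / n) * X = 3 * real \<kappa> * ln b * C1 * (real L)\<^sup>2"
      proof -
        have "(ln b / n) * X = ln b * C1 * R" using n1 by (simp add: X_def)
        then have "3 * L * ((ln b / n) * X) = 3 * L * (ln b * C1 * R)" by (rule arg_cong)
        also have "\<dots> = 3 * real \<kappa> * ln b * C1 * (real L)\<^sup>2" by (simp add: R_def power2_eq_square)
        finally show ?thesis by (simp only: mult.assoc)
      qed
      have Q0: "Q > 0" using X2 by (simp add: Q_def)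
      have lnX: "ln X \<le> \<bar>ln (4 * C1 * \<kappa>)\<bar> + 2 * ln n"
      proof -
        have "X \<le> (4 * C1 * \<kappa>) * n * n"
        proof -
          have "real L \<le> 4 * real n" using L(2) lamn by simp
          then have "C1 * \<kappa> * n * L \<le> C1 * \<kappa> * n * (4 * n)" using C1 by (intro mult_left_mono) auto
          then show ?thesis by (simp add: X_def R_def mult_ac)
        qed
        then have "ln X \<le> ln ((4 * C1 * \<kappa>) * n * n)" using X2 by (intro ln_mono) auto
        also have "\<dots> = ln (4 * C1 * \<kappa>) + 2 * ln n" using C1 \<kappa>1 n1 by (simp add: ln_mult)
        finally show ?thesis by simp
      qed
      have lnQ: "ln Q = K * ln X + 3 * real \<kappa> * ln b * C1 * (real L)\<^sup>2"
        unfolding Q_def Qexp using X2 by (simp add: ln_mult ln_realpow)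
      have Q1: "ln Q \<ge> 0" using X2 lnb C1 by (simp add: lnQ)
      define H where "H = nat \<lceil>4 * (D * (T * Q))\<rceil>"
      have DTQ: "D * (T * Q) \<ge> 1"
      proof -
        have "Q \<ge> 1" using Q1 Q0 by (simp add: ln_ge_zero_iff)
        moreover have "T \<ge> 1" using posn L by (simp add: T_def)
        moreover have "D \<ge> 1" using posn by simp
        ultimately have "1 * (1 * 1) \<le> D * (T * Q)" by (intro mult_mono) auto
        then show ?thesis by simp
      qed
      have H1: "4 * (D * (T * Q)) \<le> H" unfolding H_def by linarith
      have H2: "H \<le> 5 * (D * (T * Q))" unfolding H_def using DTQ by linarith
      have T1: "T \<ge> 1" using posn L by (simp add: T_def)
      have Tb: "real T \<le> (real \<kappa>)\<^sup>2 * (4 * real n) ^ 2" "real D \<le> (real \<kappa>)\<^sup>2 * (4 * real n) ^ 2"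
      proof -
        have "real L \<le> 4 * real n" using L(2) lamn by simp
        then have "real L ^ 2 \<le> (4 * real n) ^ 2" by (intro power_mono) auto
        then have *: "(real \<kappa>)\<^sup>2 * real L ^ 2 \<le> (real \<kappa>)\<^sup>2 * (4 * real n) ^ 2" by (intro mult_left_mono) auto
        show "real T \<le> (real \<kappa>)\<^sup>2 * (4 * real n) ^ 2" using * by (simp add: T_def K_def power2_eq_square mult_ac)
        have "0 \<le> (real \<kappa>)\<^sup>2 * real L ^ 2" by simp
        then show "real D \<le> (real \<kappa>)\<^sup>2 * (4 * real n) ^ 2" using * unfolding Dr by linarith
      qed
      have DT2: "ln (20 * D * T\<^sup>2) \<le> A1 + 6 * ln n - \<bar>ln (4 * C1 * \<kappa>)\<bar> - 1"
      proof -
        have "D * real T ^ 2 \<le> ((real \<kappa>)\<^sup>2 * (4 * real n) ^ 2) * ((real \<kappa>)\<^sup>2 * (4 * real n) ^ 2) ^ 2"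
          using Tb by (intro mult_mono power_mono) auto
        also have "\<dots> = real \<kappa> ^ 6 * 4 ^ 6 * real n ^ 6"
          unfolding power_mult_distrib power_mult[symmetric] by (simp add: power_add[symmetric] eval_nat_numeral)
        finally have "20 * D * real T ^ 2 \<le> 20 * real \<kappa> ^ 6 * 4 ^ 6 * real n ^ 6" by simp
        then have "ln (20 * D * T\<^sup>2) \<le> ln (20 * real \<kappa> ^ 6 * 4 ^ 6 * real n ^ 6)"
          using posn T1 by (intro ln_mono) auto
        also have "\<dots> = ln (20 * real \<kappa> ^ 6 * 4 ^ 6) + 6 * ln n"
          using \<kappa>1 n1 by (subst ln_mult) (auto simp: ln_realpow)
        finally show ?thesis unfolding A1_def by linarith
      qed
      show False
      proof (rule linear_form_contradiction[OF ab ind l(2) _ _ D posn(1) L(4) posn(2) _ _ X2 Q_def])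
        show "0 < n" using n1 by simp
        show "R * R = K * L" by (simp add: R_def K_def power2_eq_square)
        have "real R \<le> n"
        proof -
          have "real \<kappa> * L \<le> \<kappa> * (4 * lam n)" using L(2) by (intro mult_left_mono) auto
          then show ?thesis using elim(3) by (simp add: R_def lam_def mult_ac)
        qed
        then show "R \<le> n" by simp
        show "2 * real R * (real l + real n) \<le> X" using X1 by simp
        show "real D * (real K * real L * Q) \<le> real H / 4" using H1 by (simp add: T_def)
        have C2: "ln (20 * D * T\<^sup>2) + 2 * ln Q + K \<le> D"
        proof -
          have f1: "2 * (3 * real \<kappa> * ln b * C1 * (real L)\<^sup>2) \<le> (real \<kappa>)\<^sup>2 * (real L)\<^sup>2 / 4"
          proof -
            have "real \<kappa> * (24 * ln b * C1) \<le> real \<kappa> * \<kappa>" by (rule mult_left_mono[OF _ of_nat_0_le_iff]) (use \<kappa> in linarith)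
            then have "(real L)\<^sup>2 * (real \<kappa> * (24 * ln b * C1)) \<le> (real L)\<^sup>2 * (real \<kappa> * \<kappa>)" by (rule mult_left_mono) simp
            moreover have "4 * (2 * (3 * real \<kappa> * ln b * C1 * (real L)\<^sup>2)) = (real L)\<^sup>2 * (real \<kappa> * (24 * ln b * C1))" by simp
            moreover have "(real L)\<^sup>2 * (real \<kappa> * \<kappa>) = (real \<kappa>)\<^sup>2 * (real L)\<^sup>2" by (simp add: power2_eq_square)
            ultimately show ?thesis by linarith
          qed
          have f2: "ln (20 * D * T\<^sup>2) + 2 * (K * ln X) + K \<le> (real \<kappa>)\<^sup>2 * (real L)\<^sup>2 / 4"
          proof -
            define Z where "Z = \<bar>ln (4 * C1 * \<kappa>)\<bar>"
            have K1: "real K \<ge> 1" using posn by simp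
            have "ln (20 * D * T\<^sup>2) + 2 * (K * ln X) + K \<le> (A1 + 6 * ln n - Z - 1) + K * (2 * (Z + 2 * ln n) + 1)"
              using DT2 mult_left_mono[OF lnX, of "real K"] unfolding Z_def[symmetric] by (simp add: algebra_simps)
            also have "\<dots> \<le> K * (A1 + 6 * ln n - Z - 1) + K * (2 * (Z + 2 * ln n) + 1)"
            proof -
              have "A1 + 6 * ln n - Z - 1 \<ge> 0" using lnn by (simp add: A1_def Z_def)
              then show ?thesis using mult_right_mono[OF K1, of "A1 + 6 * ln n - Z - 1"] by simp
            qed
            also have "\<dots> = K * (A1 + Z + 10 * ln n)" by (simp add: algebra_simps)
            also have "\<dots> \<le> K * (lam n / 2)"
            proof (intro mult_left_mono)
              have "Z \<le> A1" by (simp add: A1_def Z_def)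
              then show "A1 + Z + 10 * ln n \<le> lam n / 2" using elim(1) lnn A1 by (simp add: lam_def)
            qed simp
            also have "\<dots> \<le> K * (L / 4)" using L(1) by (intro mult_left_mono) auto
            also have "\<dots> = (real \<kappa>)\<^sup>2 * (real L)\<^sup>2 / 4" by (simp add: K_def power2_eq_square)
            finally show ?thesis .
          qed
          have f3: "2 * r \<le> z / 4 \<Longrightarrow> x + 2 * y + w \<le> z / 4 \<Longrightarrow> x + 2 * (y + r) + w \<le> z / 2" for r x y w z :: real
            by argo
          show ?thesis unfolding lnQ Dr by (rule f3[OF f1 f2])
        qed
        show "real K * real L * real H * exp (real K - real D) * Q \<le> 1 / 4"
        proof -
          have p: "0 < real (20 * D * T\<^sup>2)" using posn T1 by simp
          have "real (20 * D * T\<^sup>2) * Q\<^sup>2 * exp (real K - real D) = exp (ln (20 * D * T\<^sup>2) + 2 * ln Q + (real K - real D))"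
            using p Q0 by (simp only: exp_add exp_ln mult_2 power2_eq_square)
          also have "\<dots> \<le> 1" using C2 by simp
          finally have *: "real (20 * D * T\<^sup>2) * Q\<^sup>2 * exp (real K - real D) \<le> 1" .
          have "real T * real H * exp (real K - real D) * Q \<le> real T * (5 * (D * (T * Q))) * exp (real K - real D) * Q"
            using Q0 by (intro mult_right_mono mult_left_mono H2) simp_all
          also have "\<dots> = (real (20 * D * T\<^sup>2) * Q\<^sup>2 * exp (real K - real D)) / 4" by (simp add: power2_eq_square)
          also have "\<dots> \<le> 1 / 4" using * by (rule divide_right_mono) simp
          finally show ?thesis by (simp add: T_def)
        qed
        have C3: "80 * (D * real T ^ 2 * L * R) * Q\<^sup>2 * \<bar>\<Lambda>\<bar> \<le> 1"
        proof -
          have Lb: "real L \<le> 4 * real n" using L(2) lamn by simp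
          have Rb: "real R \<le> real \<kappa> * (4 * real n)" using mult_left_mono[OF Lb, of "real \<kappa>"] by (simp add: R_def)
          have "D * real T ^ 2 * L * R \<le> ((real \<kappa>)\<^sup>2 * (4 * real n) ^ 2) * ((real \<kappa>)\<^sup>2 * (4 * real n) ^ 2) ^ 2 * (4 * real n) * (real \<kappa> * (4 * real n))"
            using Tb Lb Rb by (intro mult_mono power_mono) auto
          also have "\<dots> = real \<kappa> ^ 7 * 4 ^ 8 * real n ^ 8"
          proof -
            have 1: "x\<^sup>2 * (x\<^sup>2)\<^sup>2 * m * x = x ^ 7 * m" for x m :: real
              by (simp add: eval_nat_numeral)
            show ?thesis using 1[of "real \<kappa> * (4 * real n)" "4 * real n"]
              by (simp add: power_mult_distrib) (simp add: eval_nat_numeral)?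
          qed
          finally have "80 * (D * real T ^ 2 * L * R) \<le> 80 * real \<kappa> ^ 7 * 4 ^ 8 * real n ^ 8" by (simp add: mult_ac)
          moreover have "0 < D * real T ^ 2 * L * R" using posn T1 L(4) by simp
          ultimately have "ln (80 * (D * real T ^ 2 * L * R)) \<le> ln (80 * real \<kappa> ^ 7 * 4 ^ 8 * real n ^ 8)"
            by (intro ln_mono) auto
          also have "\<dots> = ln (80 * real \<kappa> ^ 7 * 4 ^ 8) + 8 * ln n"
            using \<kappa>1 n1 by (subst ln_mult) (auto simp: ln_realpow)
          finally have l1: "ln (80 * (D * real T ^ 2 * L * R)) \<le> A2 + A2 * ln n - 96 * \<kappa> * ln b * C1 - 8 * real \<kappa> ^ 2 - 8 + (8 * ln n - A2 * ln n)"
            unfolding A2_def by linarith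
          have "8 \<le> A2" using lnb C1 unfolding A2_def by (auto intro!: add_nonneg_nonneg)
          then have "8 * ln n \<le> A2 * ln n" using lnn by (rule mult_right_mono)
          then have l2: "ln (80 * (D * real T ^ 2 * L * R)) \<le> A2 + A2 * ln n"
          proof -
            have "0 \<le> 96 * \<kappa> * ln b * C1" "0 \<le> 8 * real \<kappa> ^ 2" using lnb C1 by auto
            then show ?thesis using l1 \<open>8 * ln n \<le> A2 * ln n\<close> by linarith
          qed
          have "2 * ln Q \<le> A2 * lam n * (A3 + 2 * ln n) + A2 * (lam n)\<^sup>2"
          proof -
            have A3n: "A3 + 2 * ln n \<ge> 0" using A3 lnn by simp
            have "real K \<le> (real \<kappa>)\<^sup>2 * (4 * lam n)" unfolding K_def using L(2) by (auto intro!: mult_left_mono)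
            moreover have "ln X \<le> A3 + 2 * ln n" using lnX by (simp add: A3_def)
            moreover have "ln X \<ge> 0" using X2 by simp
            ultimately have "2 * (K * ln X) \<le> 2 * ((real \<kappa>)\<^sup>2 * (4 * lam n) * (A3 + 2 * ln n))"
              using lam1 by (intro mult_left_mono mult_mono) auto
            also have "\<dots> = 8 * (real \<kappa>)\<^sup>2 * (lam n * (A3 + 2 * ln n))" by simp
            also have "\<dots> \<le> A2 * (lam n * (A3 + 2 * ln n))"
              using lnb C1 lam1 A3n by (intro mult_right_mono) (auto simp: A2_def intro!: add_nonneg_nonneg)
            finally have 1: "2 * (K * ln X) \<le> A2 * lam n * (A3 + 2 * ln n)" by simp
            have "real L ^ 2 \<le> (4 * lam n)\<^sup>2" using L(2) by (intro power_mono) auto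
            then have "6 * \<kappa> * ln b * C1 * real L ^ 2 \<le> 6 * \<kappa> * ln b * C1 * (4 * lam n)\<^sup>2"
              using lnb C1 by (intro mult_left_mono) auto
            also have "\<dots> = 96 * \<kappa> * ln b * C1 * (lam n)\<^sup>2" by (simp add: power_mult_distrib)
            also have "\<dots> \<le> A2 * (lam n)\<^sup>2"
              by (intro mult_right_mono) (auto simp: A2_def intro!: add_nonneg_nonneg)
            finally show ?thesis using 1 unfolding lnQ by simp
          qed
          then have l3: "ln (80 * (D * real T ^ 2 * L * R)) + 2 * ln Q \<le> \<epsilon> * n"
            using l2 elim(2) unfolding lam_def by linarith
          have p: "0 < 80 * (D * real T ^ 2 * L * R)" using \<open>0 < D * real T ^ 2 * L * R\<close> by simp
          have "80 * (D * real T ^ 2 * L * R) * Q\<^sup>2 = exp (ln (80 * (D * real T ^ 2 * L * R)) + 2 * ln Q)"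
            using p Q0 by (simp only: exp_add exp_ln mult_2 power2_eq_square)
          also have "\<dots> \<le> exp (\<epsilon> * n)" using l3 by simp
          finally have "80 * (D * real T ^ 2 * L * R) * Q\<^sup>2 * \<bar>\<Lambda>\<bar> \<le> exp (\<epsilon> * n) * exp (- \<epsilon> * n)"
            using \<Lambda> by (intro mult_mono) auto
          also have "\<dots> = 1" by (simp add: exp_add[symmetric])
          finally show ?thesis .
        qed
        show "real K * real L * real H * Q * (4 * real L * real R * \<bar>n * ln a - l * ln b\<bar>) \<le> 1 / 4"
        proof -
          have "real T * real H * Q * (4 * L * R * \<bar>\<Lambda>\<bar>) \<le> T * (5 * (D * (T * Q))) * Q * (4 * L * R * \<bar>\<Lambda>\<bar>)"
            using Q0 by (intro mult_right_mono mult_left_mono H2) simp_all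
          also have "\<dots> = (80 * (D * real T ^ 2 * L * R) * Q\<^sup>2 * \<bar>\<Lambda>\<bar>) / 4" by (simp add: power2_eq_square)
          also have "\<dots> \<le> 1 / 4" using C3 by (rule divide_right_mono) simp
          finally show ?thesis by (simp add: T_def \<Lambda>_def)
        qed
        have "2 * L * R * \<bar>\<Lambda>\<bar> \<le> (40 * (T * (D * (T * Q)) * Q)) * (2 * L * R * \<bar>\<Lambda>\<bar>)"
        proof -
          have "Q \<ge> 1" using Q1 Q0 by (simp add: ln_ge_zero_iff)
          moreover have "1 * 1 \<le> real T * (D * (T * Q))" using DTQ T1 by (intro mult_mono) auto
          ultimately have "1 * 1 \<le> (T * (D * (T * Q))) * Q" by (intro mult_mono) auto
          then have "1 \<le> 40 * (T * (D * (T * Q)) * Q)" by linarith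
          then have "1 * (2 * L * R * \<bar>\<Lambda>\<bar>) \<le> (40 * (T * (D * (T * Q)) * Q)) * (2 * L * R * \<bar>\<Lambda>\<bar>)"
            by (rule mult_right_mono) simp
          then show ?thesis by linarith
        qed
        also have "\<dots> = 80 * (D * real T ^ 2 * L * R) * Q\<^sup>2 * \<bar>\<Lambda>\<bar>" by (simp add: power2_eq_square)
        also have "\<dots> \<le> 1" by (rule C3)
        finally show "2 * real L * real R * \<bar>n * ln a - l * ln b\<bar> \<le> 1" by (simp add: \<Lambda>_def)
      qed
    qed
  qed
qed


lemma linear_form_lower_bound:
  fixes a b :: nat and \<epsilon> :: real
  assumes ab: "a \<ge> 2" "b \<ge> 2" and ind: "\<And>i j. i > 0 \<Longrightarrow> j > 0 \<Longrightarrow> a ^ i \<noteq> b ^ j" and \<epsilon>: "\<epsilon> > 0"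
  obtains c where "c > 0" "\<And>(n::nat) (l::nat). n > 0 \<Longrightarrow> \<bar>n * ln a - l * ln b\<bar> \<ge> c * exp (- \<epsilon> * n)"
proof -
  obtain N where N: "\<And>(n::nat) (l::nat). n \<ge> N \<Longrightarrow> l > 0 \<Longrightarrow> coprime n l \<Longrightarrow> \<bar>n * ln a - l * ln b\<bar> \<ge> exp (- \<epsilon> * n)"
    using linear_form_lower_bound_coprime[OF assms, THEN eventually_at_top_linorder[THEN iffD1]] by auto
  have lnab: "ln a > 0" "ln b > 0" using ab by auto
  have nz: "n * ln a \<noteq> l * ln b" if "n > 0" for n l :: nat
  proof (cases "l = 0")
    case False
    have "ln (real a ^ n) \<noteq> ln (real b ^ l)"
      using ind[OF that, of l] False ab by (subst ln_inj_iff) (auto simp flip: of_nat_power)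
    then show ?thesis using ab by (simp add: ln_realpow)
  next
    case True
    have "n * ln a \<noteq> 0" using that lnab by simp
    then show ?thesis using True by (simp del: mult_eq_0_iff)
  qed
  define M where "M = nat \<lceil>(N * ln a + 1) / ln b\<rceil>"
  define c0 where "c0 = Min (insert 1 ((\<lambda>(n::nat,l::nat). \<bar>n * ln a - l * ln b\<bar>) ` ({1..N} \<times> {0..M})))"
  have c0: "c0 > 0" unfolding c0_def by (subst Min_gr_iff) (auto simp: nz)
  have c01: "c0 \<le> 1" unfolding c0_def by (intro Min_le) auto
  define c where "c = min c0 (ln a)"
  have c: "c > 0" "c \<le> 1" using c0 c01 lnab by (auto simp: c_def)
  have cop: "\<bar>n * ln a - l * ln b\<bar> \<ge> c * exp (- \<epsilon> * n)" if n: "n > 0" and cop: "coprime n l" for n l :: nat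
  proof (cases "n \<ge> N \<and> l > 0")
    case True
    have "c * exp (- \<epsilon> * n) \<le> 1 * exp (- \<epsilon> * n)" using c by (intro mult_right_mono) auto
    moreover have "exp (- \<epsilon> * n) \<le> \<bar>n * ln a - l * ln b\<bar>" by (rule N) (use True cop in auto)
    ultimately show ?thesis by linarith
  next
    case False
    have e1: "c * exp (- \<epsilon> * n) \<le> c * 1" using c \<epsilon> by (intro mult_left_mono) auto
    show ?thesis
    proof (cases "l = 0")
      case True
      have "ln a \<le> n * ln a" using n lnab by simp
      moreover have "c \<le> ln a" by (simp add: c_def)
      moreover have "\<bar>n * ln a - l * ln b\<bar> = n * ln a" using True lnab by simp
      ultimately show ?thesis using e1 by linarith
    next
      case l: False
      then have nN: "n \<in> {1..N}" using False n by auto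
      have "c0 \<le> \<bar>n * ln a - l * ln b\<bar>"
      proof (cases "l \<le> M")
        case True
        then show ?thesis unfolding c0_def using nN by (intro Min_le) (auto intro!: image_eqI[of _ _ "(n, l)"])
      next
        case False
        then have "l > (N * ln a + 1) / ln b" unfolding M_def by linarith
        then have "l * ln b > N * ln a + 1" using lnab by (simp add: field_simps)
        moreover have "n * ln a \<le> N * ln a" using nN lnab by (intro mult_right_mono) auto
        ultimately show ?thesis using c01 by linarith
      qed
      then show ?thesis using e1 by (simp add: c_def)
    qed
  qed
  show thesis
  proof (rule that[OF c(1)])
    fix n l :: nat assume n: "n > 0"
    define g where "g = gcd n l"
    have g: "g > 0" using n by (simp add: g_def)
    obtain n' l' where nl: "n = n' * g" "l = l' * g" "coprime n' l'"
      using gcd_coprime_exists[of n l] n unfolding g_def by auto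
    have n': "n' > 0" using n nl by (cases n') auto
    have g1: "real g \<ge> 1" using g by simp
    have nn: "real n' \<le> n" using mult_left_mono[OF g1, of "real n'"] unfolding nl(1) by simp
    have "c * exp (- \<epsilon> * n) \<le> c * exp (- \<epsilon> * n')" using c \<epsilon> nn by (intro mult_left_mono) auto
    also have "\<dots> \<le> \<bar>n' * ln a - l' * ln b\<bar>" by (rule cop[OF n' nl(3)])
    also have "\<dots> = 1 * \<bar>n' * ln a - l' * ln b\<bar>" by simp
    also have "\<dots> \<le> real g * \<bar>n' * ln a - l' * ln b\<bar>" using g1 by (intro mult_right_mono) auto
    also have "\<dots> = \<bar>real g * (n' * ln a - l' * ln b)\<bar>" by (simp add: abs_mult)
    also have "real g * (n' * ln a - l' * ln b) = n * ln a - l * ln b" by (simp add: nl algebra_simps)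
    finally show "c * exp (- \<epsilon> * n) \<le> \<bar>n * ln a - l * ln b\<bar>" .
  qed
qed

section \<open>Fourier series\<close>

lemma continuous_on_infsum:
  fixes f :: "'i \<Rightarrow> 'a::topological_space \<Rightarrow> 'b::banach"
  assumes "\<And>i. continuous_on S (f i)" and "\<And>i x. x \<in> S \<Longrightarrow> norm (f i x) \<le> B i" and "B summable_on UNIV"
  shows "continuous_on S (\<lambda>x. \<Sum>\<^sub>\<infinity>i. f i x)"
proof (rule uniform_limit_theorem)
  show "uniform_limit S (\<lambda>X x. \<Sum>i\<in>X. f i x) (\<lambda>x. \<Sum>\<^sub>\<infinity>i. f i x) (finite_subsets_at_top UNIV)"
    by (rule Weierstrass_m_test_general[where M = B]) (use assms in auto)
  show "\<forall>\<^sub>F X in finite_subsets_at_top UNIV. continuous_on S (\<lambda>x. \<Sum>i\<in>X. f i x)"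
    by (intro always_eventually allI continuous_on_sum assms)
qed auto

lemma has_sum_integral_interval:
  fixes f :: "'i \<Rightarrow> real \<Rightarrow> 'b::{banach}" and B :: "'i \<Rightarrow> real"
  assumes cont: "\<And>i. continuous_on {a..b} (f i)" and "\<And>i x. x \<in> {a..b} \<Longrightarrow> norm (f i x) \<le> B i" and "B summable_on UNIV"
  shows "((\<lambda>i. integral {a..b} (f i)) has_sum integral {a..b} (\<lambda>x. \<Sum>\<^sub>\<infinity>i. f i x)) UNIV"
proof -
  have u: "uniform_limit (cbox a b) (\<lambda>X x. \<Sum>i\<in>X. f i x) (\<lambda>x. \<Sum>\<^sub>\<infinity>i. f i x) (finite_subsets_at_top UNIV)"
    by (rule Weierstrass_m_test_general[where M = B]) (use assms in auto)
  obtain I J where IJ: "\<And>X. ((\<lambda>x. \<Sum>i\<in>X. f i x) has_integral I X) (cbox a b)"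
      "((\<lambda>x. \<Sum>\<^sub>\<infinity>i. f i x) has_integral J) (cbox a b)" "(I \<longlongrightarrow> J) (finite_subsets_at_top UNIV)"
    by (rule uniform_limit_integral_cbox[OF u]) (auto intro!: continuous_on_sum cont)
  have "I X = (\<Sum>i\<in>X. integral {a..b} (f i))" if "finite X" for X
  proof -
    have "((\<lambda>x. \<Sum>i\<in>X. f i x) has_integral (\<Sum>i\<in>X. integral {a..b} (f i))) (cbox a b)"
      using that cont by (intro has_integral_sum) (auto intro!: integrable_integral integrable_continuous_real)
    then show ?thesis using IJ(1) has_integral_unique by blast
  qed
  then have "eventually (\<lambda>X. I X = (\<Sum>i\<in>X. integral {a..b} (f i))) (finite_subsets_at_top UNIV)"
    by (intro eventually_finite_subsets_at_top_weakI)
  then have "((\<lambda>X. \<Sum>i\<in>X. integral {a..b} (f i)) \<longlongrightarrow> J) (finite_subsets_at_top UNIV)"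
    by (rule Lim_transform_eventually[OF IJ(3)])
  moreover have "integral {a..b} (\<lambda>x. \<Sum>\<^sub>\<infinity>i. f i x) = J"
    using integral_unique[OF IJ(2)] by simp
  ultimately show ?thesis by (simp add: has_sum_def)
qed

lemma set_integral_infsum:
  fixes f :: "'i \<Rightarrow> real \<Rightarrow> complex" and g :: "nat \<Rightarrow> 'i"
  assumes g: "bij g"
    and int: "\<And>i. set_integrable lborel S (f i)"
    and sum: "(\<lambda>i. LINT x:S|lborel. norm (f i x)) summable_on UNIV"
    and pt: "\<And>x. x \<in> S \<Longrightarrow> (\<lambda>i. norm (f i x)) summable_on UNIV"
  shows "set_integrable lborel S (\<lambda>x. \<Sum>\<^sub>\<infinity>i. f i x)"
    and "((\<lambda>i. LINT x:S|lborel. f i x) has_sum (LINT x:S|lborel. \<Sum>\<^sub>\<infinity>i. f i x)) UNIV"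
proof -
  define F where "F n x = indicator S x *\<^sub>R f (g n) x" for n x
  have iF: "integrable lborel (F n)" for n using int[of "g n"] by (simp add: F_def[abs_def] set_integrable_def)
  have eqN: "(LINT x:S|lborel. norm (f i x)) = (\<integral>x. norm (indicator S x *\<^sub>R f i x) \<partial>lborel)" for i
    unfolding set_lebesgue_integral_def by (intro Bochner_Integration.integral_cong) auto
  define G where "G i = (\<integral>x. norm (indicator S x *\<^sub>R f i x) \<partial>lborel)" for i
  have "G summable_on UNIV" using sum unfolding eqN G_def[abs_def] .
  then have "(\<lambda>n. G (g n)) summable_on UNIV" by (rule summable_on_reindex_bij_betw[OF g, THEN iffD2])
  then have sN: "summable (\<lambda>n. \<integral>x. norm (F n x) \<partial>lborel)"
    unfolding F_def G_def by (rule summable_on_imp_summable)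
  have pN: "summable (\<lambda>n. norm (F n x))" for x
  proof (cases "x \<in> S")
    case True
    have "(\<lambda>n. norm (f (g n) x)) summable_on UNIV"
      using pt[OF True] by (simp add: summable_on_reindex_bij_betw[OF g, of "\<lambda>i. norm (f i x)"])
    then show ?thesis using True by (simp add: F_def summable_on_imp_summable)
  qed (simp add: F_def)
  have eq: "(\<Sum>n. F n x) = indicator S x *\<^sub>R (\<Sum>\<^sub>\<infinity>i. f i x)" for x
  proof -
    have "(F n x) = (\<lambda>i. indicator S x *\<^sub>R f i x) (g n)" for n by (simp add: F_def)
    have "(\<Sum>n. F n x) = (\<Sum>\<^sub>\<infinity>n. F n x)"
      using norm_summable_imp_has_sum[OF pN summable_sums[OF summable_norm_cancel[OF pN]]] by (metis infsumI)
    also have "\<dots> = (\<Sum>\<^sub>\<infinity>i. indicator S x *\<^sub>R f i x)"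
      unfolding F_def by (rule infsum_reindex_bij_betw[OF g])
    finally show ?thesis by (cases "x \<in> S") auto
  qed
  have "integrable lborel (\<lambda>x. \<Sum>n. F n x)" by (rule integrable_suminf[OF iF _ sN]) (use pN in auto)
  then show "set_integrable lborel S (\<lambda>x. \<Sum>\<^sub>\<infinity>i. f i x)" by (simp add: eq set_integrable_def)
  have "(\<lambda>n. integral\<^sup>L lborel (F n)) sums (\<integral>x. (\<Sum>n. F n x) \<partial>lborel)"
    by (rule sums_integral[OF iF _ sN]) (use pN in auto)
  moreover have "summable (\<lambda>n. norm (integral\<^sup>L lborel (F n)))"
    by (rule summable_comparison_test'[OF sN, of 0]) (auto intro!: integral_norm_bound)
  ultimately have "((\<lambda>n. integral\<^sup>L lborel (F n)) has_sum (\<integral>x. (\<Sum>n. F n x) \<partial>lborel)) UNIV"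
    by (intro norm_summable_imp_has_sum)
  then have "((\<lambda>n. LINT x:S|lborel. f (g n) x) has_sum (LINT x:S|lborel. \<Sum>\<^sub>\<infinity>i. f i x)) UNIV"
    unfolding eq unfolding set_lebesgue_integral_def F_def[abs_def] .
  then show "((\<lambda>i. LINT x:S|lborel. f i x) has_sum (LINT x:S|lborel. \<Sum>\<^sub>\<infinity>i. f i x)) UNIV"
    using has_sum_reindex_bij_betw[OF g, of "\<lambda>i. LINT x:S|lborel. f i x"] by simp
qed

definition fchar :: "int \<Rightarrow> real \<Rightarrow> complex" where
  "fchar n t = cis (2 * pi * of_int n * t)"

lemma continuous_on_fchar [continuous_intros]: "continuous_on S (fchar n)"
  unfolding fchar_def by (intro continuous_intros)

lemma norm_fchar [simp]: "norm (fchar n t) = 1"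
  by (simp add: fchar_def)

lemma fchar_add: "fchar (m + n) t = fchar m t * fchar n t"
  by (simp add: fchar_def cis_mult algebra_simps)

lemma fchar_plus_int [simp]: "fchar n (t + of_int k) = fchar n t"
proof -
  have "fchar n (t + of_int k) = fchar n t * cis (2 * pi * of_int (n * k))"
    by (simp add: fchar_def cis_mult algebra_simps)
  also have "cis (2 * pi * of_int (n * k)) = 1"
    by (rule cis_multiple_2pi) simp
  finally show ?thesis by simp
qed

lemma fourier_coeff_mult_cos_zero:
  fixes f :: "real \<Rightarrow> complex"
  assumes cont: "continuous_on {0..1} f"
    and zero: "\<And>n. integral {0..1} (\<lambda>t. f t * fchar n t) = 0"
  shows "integral {0..1} (\<lambda>t. f t * fchar n t * of_real ((1 + cos (2 * pi * (t - t0))) ^ N)) = 0"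
proof (induction N arbitrary: n)
  case (Suc N)
  define K where "K t = complex_of_real ((1 + cos (2 * pi * (t - t0))) ^ N)" for t
  have contK: "continuous_on {0..1} K" unfolding K_def by (intro continuous_intros)
  define c where "c = cis (- 2 * pi * t0) / 2"
  define d where "d = cis (2 * pi * t0) / 2"
  have eq: "f t * fchar n t * of_real ((1 + cos (2 * pi * (t - t0))) ^ Suc N)
     = f t * fchar n t * K t + (c * (f t * fchar (n + 1) t * K t) + d * (f t * fchar (n - 1) t * K t))" for t
  proof -
    have "complex_of_real (cos x) = (cis x + cis (- x)) / 2" for x
      by (simp add: complex_eq_iff)
    then have "complex_of_real (cos (2 * pi * (t - t0))) = (cis (2 * pi * (t - t0)) + cis (- (2 * pi * (t - t0)))) / 2" .
    also have "\<dots> = c * fchar 1 t + d * fchar (- 1) t"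
      by (simp add: c_def d_def fchar_def cis_mult algebra_simps add_divide_distrib)
    finally have 1: "of_real ((1 + cos (2 * pi * (t - t0))) ^ Suc N) = (1 + c * fchar 1 t + d * fchar (- 1) t) * K t"
      by (simp add: K_def)
    show ?thesis unfolding 1 using fchar_add[of n 1 t] fchar_add[of n "-1" t] by (simp add: algebra_simps)
  qed
  have ints: "(\<lambda>t. f t * fchar m t * K t) integrable_on {0..1}" for m
    by (intro integrable_continuous_real continuous_intros cont contK)
  have "integral {0..1} (\<lambda>t. f t * fchar n t * of_real ((1 + cos (2 * pi * (t - t0))) ^ Suc N))
      = integral {0..1} (\<lambda>t. f t * fchar n t * K t) + (c * integral {0..1} (\<lambda>t. f t * fchar (n + 1) t * K t)
        + d * integral {0..1} (\<lambda>t. f t * fchar (n - 1) t * K t))"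
    unfolding eq by (simp add: integral_add ints integrable_add integrable_on_mult_right)
  then show ?case using Suc.IH by (simp add: K_def)
qed (use zero in simp)

text \<open>
  The kernels \<open>(1 + cos (2 * pi * (t - t0))) ^ N\<close> are trigonometric polynomials that concentrate at
  \<open>t0\<close>, so they detect a nonzero value of \<open>f\<close> at \<open>t0\<close>.
\<close>
lemma fourier_uniqueness_open:
  fixes f :: "real \<Rightarrow> complex"
  assumes cont: "continuous_on {0..1} f"
    and zero: "\<And>n. integral {0..1} (\<lambda>t. f t * fchar n t) = 0"
    and t0: "0 < t0" "t0 < 1"
  shows "f t0 = 0"
proof (rule ccontr)
  assume f0: "f t0 \<noteq> 0"
  define \<phi> where "\<phi> t = Re (cnj (f t0) * f t)" for t
  define \<delta> where "\<delta> = (norm (f t0))\<^sup>2 / 2"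
  have \<delta>: "\<delta> > 0" using f0 by (simp add: \<delta>_def)
  have cont\<phi>: "continuous_on {0..1} \<phi>" unfolding \<phi>_def by (intro continuous_intros cont)
  have \<phi>0: "\<phi> t0 = 2 * \<delta>"
    unfolding \<phi>_def \<delta>_def cmod_power2 by (simp add: power2_eq_square)
  obtain e where e: "e > 0" "\<And>t. t \<in> {0..1} \<Longrightarrow> dist t t0 < e \<Longrightarrow> dist (\<phi> t) (\<phi> t0) < \<delta>"
    using cont\<phi>[unfolded continuous_on_iff, rule_format, of t0 \<delta>] \<delta> t0 by auto
  define \<eta> where "\<eta> = min (e / 2) (min t0 (1 - t0) / 2)"
  have \<eta>: "\<eta> > 0" "\<eta> < e" "\<eta> < t0" "\<eta> < 1 - t0" "\<eta> < 1 / 2" using e t0 by (auto simp: \<eta>_def min_def)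
  have near: "\<phi> t \<ge> \<delta>" if "\<bar>t - t0\<bar> \<le> \<eta>" for t
  proof -
    have "t \<in> {0..1}" using that \<eta> by auto
    then have "\<bar>\<phi> t - \<phi> t0\<bar> < \<delta>" using e(2)[of t] that \<eta> by (simp add: dist_real_def)
    then show ?thesis using \<phi>0 by linarith
  qed
  have "compact (\<phi> ` {0..1})" by (intro compact_continuous_image cont\<phi>) auto
  then obtain M0 where M0: "\<And>t. t \<in> {0..1} \<Longrightarrow> \<bar>\<phi> t\<bar> \<le> M0"
    using compact_imp_bounded bounded_iff by (metis imageI real_norm_def)
  define M where "M = max M0 1"
  have M: "\<And>t. t \<in> {0..1} \<Longrightarrow> \<bar>\<phi> t\<bar> \<le> M" "M > 0" by (auto simp: M_def intro!: order.trans[OF M0])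
  define q where "q = 1 + cos (2 * pi * \<eta>)"
  define Q where "Q = 1 + cos (pi * \<eta>)"
  have q0: "q \<ge> 0" unfolding q_def using cos_ge_minus_one[of "2 * pi * \<eta>"] by linarith
  have "pi * \<eta> < pi * (1/2)" using \<eta> by (intro mult_strict_left_mono) auto
  then have qQ: "q < Q" unfolding q_def Q_def using \<eta> by (auto intro!: cos_monotone_0_pi)
  define K where "K N t = (1 + cos (2 * pi * (t - t0))) ^ N" for N :: nat and t
  have Kbound: "0 \<le> 1 + cos x" for x :: real using cos_ge_minus_one[of x] by linarith
  have lower: "\<phi> t * K N t \<ge> \<delta> * Q ^ N * indicator {t0 - \<eta> / 2..t0 + \<eta> / 2} t - M * q ^ N"
    if t: "t \<in> {0..1}" for t N
  proof -
    consider "\<bar>t - t0\<bar> \<le> \<eta> / 2" | "\<eta> / 2 < \<bar>t - t0\<bar>" "\<bar>t - t0\<bar> \<le> \<eta>" | "\<bar>t - t0\<bar> > \<eta>" by linarith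
    then show ?thesis
    proof cases
      case 1
      have "cos (pi * \<eta>) \<le> cos \<bar>2 * pi * (t - t0)\<bar>"
      proof (intro cos_monotone_0_pi_le)
        show "\<bar>2 * pi * (t - t0)\<bar> \<le> pi * \<eta>" using mult_left_mono[OF 1, of "2 * pi"] by (simp add: abs_mult)
        show "pi * \<eta> \<le> pi" using \<eta> by simp
      qed simp
      then have "Q ^ N \<le> K N t" unfolding Q_def K_def cos_abs_real using Kbound by (intro power_mono) auto
      then have "\<delta> * Q ^ N \<le> \<phi> t * K N t" using near[of t] 1 \<delta> \<eta> qQ q0 by (intro mult_mono) auto
      moreover have "t \<in> {t0 - \<eta> / 2..t0 + \<eta> / 2}" using 1 unfolding atLeastAtMost_iff by linarith
      moreover have "0 \<le> M * q ^ N" using M(2) q0 by simp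
      ultimately show ?thesis by simp
    next
      case 2
      then have "t \<notin> {t0 - \<eta> / 2..t0 + \<eta> / 2}" unfolding atLeastAtMost_iff by linarith
      moreover have "0 \<le> \<phi> t * K N t" using near[OF 2(2)] \<delta> Kbound by (auto simp: K_def)
      moreover have "0 \<le> M * q ^ N" using M(2) q0 by simp
      ultimately show ?thesis by simp
    next
      case 3
      then have "t \<notin> {t0 - \<eta> / 2..t0 + \<eta> / 2}" using \<eta> by auto
      moreover have "cos (2 * pi * (t - t0)) \<le> cos (2 * pi * \<eta>)"
      proof -
        define x where "x = \<bar>t - t0\<bar>"
        have x: "\<eta> < x" "x < 1 - \<eta> \<or> x \<le> 1 - \<eta>" using 3 t \<eta> t0 by (auto simp: x_def abs_real_def)
        have "cos (2 * pi * x) \<le> cos (2 * pi * \<eta>)"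
        proof (cases "x \<le> 1 / 2")
          case True
          then have "2 * pi * x \<le> pi" by simp
          then show ?thesis using x \<eta> by (intro cos_monotone_0_pi_le) auto
        next
          case False
          have "cos (2 * pi * x) = cos (2 * pi - 2 * pi * x)" by (simp add: cos_diff)
          also have "\<dots> = cos (2 * pi * (1 - x))" by (simp add: algebra_simps)
          also have "\<dots> \<le> cos (2 * pi * \<eta>)"
          proof (intro cos_monotone_0_pi_le)
            have "2 * pi * \<eta> \<le> 2 * pi * (1 - x)" using x by (intro mult_left_mono) auto
            then show "2 * pi * \<eta> \<le> 2 * pi * (1 - x)" .
            have "2 * pi * (1 - x) \<le> 2 * pi * (1 / 2)" using False by (intro mult_left_mono) auto
            then show "2 * pi * (1 - x) \<le> pi" by simp
          qed (use \<eta> in auto)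
          finally show ?thesis .
        qed
        moreover have "cos (2 * pi * x) = cos (2 * pi * (t - t0))"
          unfolding x_def using cos_abs_real[of "2 * pi * (t - t0)"] by (simp add: abs_mult)
        ultimately show ?thesis by simp
      qed
      then have "K N t \<le> q ^ N" unfolding K_def q_def using Kbound by (intro power_mono) auto
      then have "M * K N t \<le> M * q ^ N" using M(2) by (intro mult_left_mono) auto
      moreover have "- M * K N t \<le> \<phi> t * K N t"
        using M(1)[OF t] Kbound by (intro mult_right_mono) (auto simp: K_def)
      ultimately show ?thesis by simp
    qed
  qed
  have int0: "integral {0..1} (\<lambda>t. \<phi> t * K N t) = 0" for N
  proof -
    have "integral {0..1} (\<lambda>t. f t * fchar 0 t * of_real (K N t)) = 0"
      unfolding K_def by (rule fourier_coeff_mult_cos_zero[OF cont zero])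
    then have "0 = Re (cnj (f t0) * integral {0..1} (\<lambda>t. f t * of_real (K N t)))"
      by (simp add: fchar_def)
    also have "\<dots> = Re (integral {0..1} (\<lambda>t. cnj (f t0) * (f t * of_real (K N t))))" by simp
    also have "\<dots> = integral {0..1} (\<lambda>t. Re (cnj (f t0) * (f t * of_real (K N t))))"
      unfolding K_def
      by (rule integral_linear[OF _ bounded_linear_Re, unfolded comp_def, symmetric], rule integrable_continuous_real)
        (intro continuous_intros cont)
    also have "(\<lambda>t. Re (cnj (f t0) * (f t * of_real (K N t)))) = (\<lambda>t. \<phi> t * K N t)"
      by (auto simp: \<phi>_def algebra_simps)
    finally show ?thesis by simp
  qed
  have ineq: "\<delta> * \<eta> * Q ^ N \<le> M * q ^ N" for N
  proof -
    have sub: "{t0 - \<eta> / 2..t0 + \<eta> / 2} \<subseteq> {0..1}" using \<eta> by auto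
    have "((\<lambda>t. 1::real) has_integral (t0 + \<eta> / 2 - (t0 - \<eta> / 2))) {t0 - \<eta> / 2..t0 + \<eta> / 2}"
      using has_integral_const_real[of "1::real" "t0 - \<eta> / 2" "t0 + \<eta> / 2"] \<eta> by simp
    then have "((\<lambda>t. indicator {t0 - \<eta> / 2..t0 + \<eta> / 2} t) has_integral \<eta>) {0..1}"
      using has_integral_restrict[OF sub, of "\<lambda>_. 1::real" \<eta>] unfolding indicator_def of_bool_def by simp
    then have 1: "((\<lambda>t. \<delta> * Q ^ N * indicator {t0 - \<eta> / 2..t0 + \<eta> / 2} t) has_integral (\<delta> * Q ^ N * \<eta>)) {0..1}"
      by (rule has_integral_mult_right)
    have 2: "((\<lambda>t::real. M * q ^ N) has_integral (M * q ^ N)) {0..1}"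
      using has_integral_const_real[of "M * q ^ N" 0 1] by simp
    have "((\<lambda>t. \<delta> * Q ^ N * indicator {t0 - \<eta> / 2..t0 + \<eta> / 2} t - M * q ^ N) has_integral (\<delta> * Q ^ N * \<eta> - M * q ^ N)) {0..1}"
      by (rule has_integral_diff[OF 1 2])
    moreover have "((\<lambda>t. \<phi> t * K N t) has_integral 0) {0..1}"
    proof -
      have "(\<lambda>t. \<phi> t * K N t) integrable_on {0..1}"
        unfolding K_def by (intro integrable_continuous_real continuous_intros cont\<phi>)
      then show ?thesis using int0[of N] by (simp add: has_integral_integrable_integral)
    qed
    ultimately have "\<delta> * Q ^ N * \<eta> - M * q ^ N \<le> 0"
      by (rule has_integral_le) (use lower in auto)
    then show ?thesis by (simp add: mult_ac)
  qed
  have Q0: "Q > 0" using qQ q0 by linarith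
  have "(\<lambda>N. M * (q / Q) ^ N) \<longlonglongrightarrow> M * 0"
    using q0 qQ Q0 by (intro tendsto_mult tendsto_const LIMSEQ_realpow_zero) auto
  then have "eventually (\<lambda>N. M * (q / Q) ^ N < \<delta> * \<eta>) at_top"
    using \<delta> \<eta> by (intro order_tendstoD(2)) auto
  then obtain N where "M * (q / Q) ^ N < \<delta> * \<eta>" by (auto simp: eventually_at_top_linorder)
  then have "M * q ^ N < \<delta> * \<eta> * Q ^ N" using Q0 by (simp add: power_divide field_simps)
  then show False using ineq[of N] by linarith
qed

lemma fourier_uniqueness:
  fixes f :: "real \<Rightarrow> complex"
  assumes cont: "continuous_on {0..1} f"
    and zero: "\<And>n. integral {0..1} (\<lambda>t. f t * fchar n t) = 0"
    and t: "t \<in> {0..1}"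
  shows "f t = 0"
proof (rule continuous_constant_on_closure[where S = "{0<..<1::real}"])
  show "continuous_on (closure {0<..<1}) f" using cont by simp
  show "f x = 0" if "x \<in> {0<..<1}" for x
    using fourier_uniqueness_open[OF cont zero] that by auto
  show "t \<in> closure {0<..<1}" using t by simp
qed

lemma poisson_summation:
  fixes g :: "real \<Rightarrow> complex" and B :: "int \<Rightarrow> real"
  assumes contg: "continuous_on UNIV g"
    and B: "\<And>n t. t \<in> {0..1} \<Longrightarrow> norm (g (t + of_int n)) \<le> B n" "B summable_on UNIV"
    and c: "(\<lambda>k. norm (c k)) summable_on UNIV"
    and coeff: "\<And>k. ((\<lambda>n. integral {0..1} (\<lambda>t. g (t + of_int n) * fchar (- k) (t + of_int n))) has_sum c k) UNIV"
    and t: "t \<in> {0..1}"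
  shows "(\<Sum>\<^sub>\<infinity>n. g (t + of_int n)) = (\<Sum>\<^sub>\<infinity>k. c k * fchar k t)"
proof -
  define F where "F t = (\<Sum>\<^sub>\<infinity>n. g (t + of_int n))" for t
  define G where "G t = (\<Sum>\<^sub>\<infinity>k. c k * fchar k t)" for t
  have contn: "continuous_on {0..1} (\<lambda>t. g (t + of_int n))" for n
    by (rule continuous_on_compose2[OF contg]) (auto intro!: continuous_intros)
  have contF: "continuous_on {0..1} F" unfolding F_def
    by (rule continuous_on_infsum[where B = B]) (use B contn in auto)
  have contG: "continuous_on {0..1} G" unfolding G_def
    by (rule continuous_on_infsum[where B = "\<lambda>k. norm (c k)"]) (use c in \<open>auto intro!: continuous_intros simp: norm_mult\<close>)
  have coeffF: "integral {0..1} (\<lambda>t. F t * fchar (- k) t) = c k" for k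
  proof -
    have "((\<lambda>n. integral {0..1} (\<lambda>t. g (t + of_int n) * fchar (- k) t)) has_sum
        integral {0..1} (\<lambda>t. \<Sum>\<^sub>\<infinity>n. g (t + of_int n) * fchar (- k) t)) UNIV"
      by (rule has_sum_integral_interval[where B = B])
        (use B in \<open>auto intro!: continuous_intros contn simp: norm_mult\<close>)
    also have "(\<lambda>t. \<Sum>\<^sub>\<infinity>n. g (t + of_int n) * fchar (- k) t) = (\<lambda>t. F t * fchar (- k) t)"
      unfolding F_def by (simp add: infsum_cmult_left')
    finally show ?thesis using coeff[of k] by (auto dest: has_sum_unique)
  qed
  have ort: "integral {0..1} (fchar k) = (if k = 0 then 1 else 0)" for k
  proof (cases "k = 0")
    case False
    define w where "w = 2 * pi * \<i> * of_int k"
    have w0: "w \<noteq> 0" using False by (simp add: w_def)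
    have fe: "fchar k = (\<lambda>t. exp (w * of_real t))"
      by (auto simp: fchar_def w_def cis_conv_exp mult_ac)
    have "((\<lambda>t. exp (w * of_real t)) has_integral (exp (w * of_real 1) / w - exp (w * of_real 0) / w)) {0..1}"
      using w0 by (intro fundamental_theorem_of_calculus)
        (auto intro!: derivative_eq_intros has_vector_derivative_real_field)
    also have "exp (w * of_real 1) / w - exp (w * of_real 0) / w = 0"
    proof -
      have "exp w = 1" using fun_cong[OF fe, of 1] cis_multiple_2pi[of "of_int k"] by (simp add: fchar_def)
      then show ?thesis by simp
    qed
    finally show ?thesis using False by (simp add: fe integral_unique)
  qed (simp add: fchar_def[abs_def])
  have coeffG: "integral {0..1} (\<lambda>t. G t * fchar (- k) t) = c k" for k
  proof -
    have "((\<lambda>j. integral {0..1} (\<lambda>t. c j * fchar j t * fchar (- k) t)) has_sum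
        integral {0..1} (\<lambda>t. \<Sum>\<^sub>\<infinity>j. c j * fchar j t * fchar (- k) t)) UNIV"
      by (rule has_sum_integral_interval[where B = "\<lambda>j. norm (c j)"])
        (use c in \<open>auto intro!: continuous_intros simp: norm_mult\<close>)
    also have "(\<lambda>t. \<Sum>\<^sub>\<infinity>j. c j * fchar j t * fchar (- k) t) = (\<lambda>t. G t * fchar (- k) t)"
      unfolding G_def by (simp add: infsum_cmult_left')
    also have "(\<lambda>j. integral {0..1} (\<lambda>t. c j * fchar j t * fchar (- k) t)) = (\<lambda>j. if j = k then c k else 0)"
    proof
      fix j
      have "integral {0..1} (\<lambda>t. c j * fchar j t * fchar (- k) t) = integral {0..1} (\<lambda>t. c j * fchar (j - k) t)"
        using fchar_add[of j "- k"] by (intro integral_cong) (simp add: mult.assoc)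
      also have "\<dots> = c j * integral {0..1} (fchar (j - k))" by simp
      finally show "integral {0..1} (\<lambda>t. c j * fchar j t * fchar (- k) t) = (if j = k then c k else 0)"
        by (simp add: ort)
    qed
    finally have "((\<lambda>j. if j = k then c k else 0) has_sum integral {0..1} (\<lambda>t. G t * fchar (- k) t)) UNIV" .
    moreover have "((\<lambda>j. if j = k then c k else 0) has_sum c k) UNIV"
      using has_sum_finite_neutralI[of "{k}" UNIV "\<lambda>j. if j = k then c k else 0"] by auto
    ultimately show ?thesis by (rule has_sum_unique)
  qed
  have "F t - G t = 0"
  proof (rule fourier_uniqueness[OF _ _ t])
    show "continuous_on {0..1} (\<lambda>t. F t - G t)" by (intro continuous_intros contF contG)
    fix n
    have "integral {0..1} (\<lambda>t. F t * fchar n t - G t * fchar n t) = 0"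
      using coeffF[of "- n"] coeffG[of "- n"]
      by (subst integral_diff) (auto intro!: integrable_continuous_real continuous_intros contF contG)
    then show "integral {0..1} (\<lambda>t. (F t - G t) * fchar n t) = 0" by (simp add: algebra_simps)
  qed
  then show ?thesis by (simp add: F_def G_def)
qed

section \<open>Polynomials times the exponential function\<close>

definition pe :: "real poly \<Rightarrow> real \<Rightarrow> real" where
  "pe p u = poly p u * exp (- u)"

definition dop :: "real poly \<Rightarrow> real poly" where
  "dop p = [:0, 1:] * (pderiv p - p)"

lemma coeff_dop: "coeff (dop p) i = real i * coeff p i - (if i = 0 then 0 else coeff p (i - 1))"
  by (cases i) (auto simp: dop_def coeff_pderiv)

lemma dop_add: "dop (p + q) = dop p + dop q"
  by (rule poly_eqI) (auto simp: coeff_dop algebra_simps)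

lemma dop_smult: "dop (Polynomial.smult c p) = Polynomial.smult c (dop p)"
  by (rule poly_eqI) (auto simp: coeff_dop algebra_simps)

lemma pe_has_derivative:
  assumes "u \<noteq> 0"
  shows "(pe p has_real_derivative pe (dop p) u / u) (at u)"
proof -
  have "(pe p has_real_derivative (poly (pderiv p) u * exp (- u) - poly p u * exp (- u))) (at u)"
    unfolding pe_def by (auto intro!: derivative_eq_intros poly_DERIV)
  also have "poly (pderiv p) u * exp (- u) - poly p u * exp (- u) = pe (dop p) u / u"
  proof -
    have "poly (dop p) u = u * (poly (pderiv p) u - poly p u)" by (simp add: dop_def)
    then have "pe (dop p) u / u = (poly (pderiv p) u - poly p u) * exp (- u)" using assms by (simp add: pe_def)
    then show ?thesis by (simp add: left_diff_distrib)
  qed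
  finally show ?thesis .
qed

lemma continuous_on_pe [continuous_intros]: "continuous_on S (pe p)"
  unfolding pe_def by (intro continuous_intros)

lemma poly_le_exp_half:
  fixes p :: "real poly"
  obtains C where "C \<ge> 0" "\<And>u. u \<ge> 0 \<Longrightarrow> \<bar>poly p u\<bar> \<le> C * exp (u / 2)"
proof -
  have pw: "u ^ k \<le> (2 * real k) ^ k * exp (u / 2)" if "u \<ge> 0" for u :: real and k :: nat
  proof (cases "k = 0")
    case False
    have "(u / (2 * k)) ^ k \<le> (1 + (u / 2) / k) ^ k" using that by (intro power_mono) auto
    also have "\<dots> \<le> exp (u / 2)" using that False by (intro exp_ge_one_plus_x_over_n_power_n) auto
    finally show ?thesis using False by (simp add: power_divide field_simps)
  qed (use that in simp)
  define C where "C = (\<Sum>i\<le>degree p. \<bar>coeff p i\<bar> * (2 * real i) ^ i)"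
  show thesis
  proof (rule that[of C])
    show "C \<ge> 0" by (auto simp: C_def intro!: sum_nonneg)
    fix u :: real assume u: "u \<ge> 0"
    have "\<bar>poly p u\<bar> \<le> (\<Sum>i\<le>degree p. \<bar>coeff p i\<bar> * u ^ i)"
      unfolding poly_altdef using u by (intro order.trans[OF sum_abs]) (auto simp: abs_mult intro!: sum_mono)
    also have "\<dots> \<le> (\<Sum>i\<le>degree p. \<bar>coeff p i\<bar> * ((2 * real i) ^ i * exp (u / 2)))"
      using pw[OF u] by (intro sum_mono mult_left_mono) auto
    finally show "\<bar>poly p u\<bar> \<le> C * exp (u / 2)" by (simp add: C_def sum_distrib_right mult.assoc)
  qed
qed

lemma pe_bounds:
  obtains C where "C \<ge> 0" "\<And>u. u \<ge> 0 \<Longrightarrow> \<bar>pe p u\<bar> \<le> C * exp (- u / 2)"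
    "\<And>u. u \<ge> 0 \<Longrightarrow> u * \<bar>pe p u\<bar> \<le> C * exp (- u / 2)"
proof -
  obtain C1 where C1: "C1 \<ge> 0" "\<And>u. u \<ge> 0 \<Longrightarrow> \<bar>poly p u\<bar> \<le> C1 * exp (u / 2)"
    using poly_le_exp_half[of p] by blast
  obtain C2 where C2: "C2 \<ge> 0" "\<And>u. u \<ge> 0 \<Longrightarrow> \<bar>poly ([:0, 1:] * p) u\<bar> \<le> C2 * exp (u / 2)"
    using poly_le_exp_half[of "[:0, 1:] * p"] by blast
  have e: "exp (u / 2) * exp (- u) = exp (- u / 2)" for u :: real by (simp add: exp_add[symmetric])
  show thesis
  proof (rule that[of "max C1 C2"])
    fix u :: real assume u: "u \<ge> 0"
    have "\<bar>poly p u\<bar> * exp (- u) \<le> C1 * exp (u / 2) * exp (- u)" using C1(2)[OF u] by (rule mult_right_mono) simp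
    also have "\<dots> = C1 * exp (- u / 2)" by (simp only: mult.assoc e)
    also have "\<dots> \<le> max C1 C2 * exp (- u / 2)" by (intro mult_right_mono) auto
    finally show "\<bar>pe p u\<bar> \<le> max C1 C2 * exp (- u / 2)" by (simp add: pe_def abs_mult)
    have "\<bar>poly ([:0, 1:] * p) u\<bar> * exp (- u) \<le> C2 * exp (u / 2) * exp (- u)" using C2(2)[OF u] by (rule mult_right_mono) simp
    also have "\<dots> = C2 * exp (- u / 2)" by (simp only: mult.assoc e)
    also have "\<dots> \<le> max C1 C2 * exp (- u / 2)" by (intro mult_right_mono) auto
    finally show "u * \<bar>pe p u\<bar> \<le> max C1 C2 * exp (- u / 2)" using u by (simp add: pe_def abs_mult mult_ac)
  qed (use C1 in auto)
qed

definition tay :: "real poly \<Rightarrow> nat \<Rightarrow> real" where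
  "tay p k = (\<Sum>i\<le>k. coeff p i * (- 1) ^ (k - i) / fact (k - i))"

lemma tay_sums: "(\<lambda>k. tay p k * u ^ k) sums pe p u"
proof -
  have "(\<lambda>k. \<Sum>i\<le>degree p. coeff p i * ((if k < i then 0 else (- 1) ^ (k - i) / fact (k - i)) * u ^ k)) sums
      (\<Sum>i\<le>degree p. coeff p i * (u ^ i * exp ((- 1) * u)))"
    by (intro sums_sum sums_mult power_times_exp_sums)
  also have "(\<Sum>i\<le>degree p. coeff p i * (u ^ i * exp ((- 1) * u))) = pe p u"
    by (simp add: pe_def poly_altdef sum_distrib_right mult.assoc)
  also have "(\<lambda>k. \<Sum>i\<le>degree p. coeff p i * ((if k < i then 0 else (- 1) ^ (k - i) / fact (k - i)) * u ^ k)) = (\<lambda>k. tay p k * u ^ k)"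
  proof
    fix k
    have "(\<Sum>i\<le>degree p. coeff p i * ((if k < i then 0 else (- 1) ^ (k - i) / fact (k - i)) * u ^ k))
        = (\<Sum>i\<in>{..degree p} \<union> {..k}. coeff p i * ((if k < i then 0 else (- 1) ^ (k - i) / fact (k - i)) * u ^ k))"
      by (intro sum.mono_neutral_left) (auto simp: coeff_eq_0)
    also have "\<dots> = (\<Sum>i\<le>k. coeff p i * ((if k < i then 0 else (- 1) ^ (k - i) / fact (k - i)) * u ^ k))"
      by (intro sum.mono_neutral_right) auto
    also have "\<dots> = tay p k * u ^ k"
      unfolding tay_def sum_distrib_right by (intro sum.cong) auto
    finally show "(\<Sum>i\<le>degree p. coeff p i * ((if k < i then 0 else (- 1) ^ (k - i) / fact (k - i)) * u ^ k)) = tay p k * u ^ k" .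
  qed
  finally show ?thesis .
qed

lemma tay_dop: "tay (dop p) k = real k * tay p k"
proof -
  define t where "t i = (- 1) ^ (k - i) / (fact (k - i) :: real)" for i
  have "tay (dop p) k = (\<Sum>i\<le>k. real i * coeff p i * t i) - (\<Sum>i\<le>k. (if i = 0 then 0 else coeff p (i - 1)) * t i)"
    by (simp add: tay_def coeff_dop t_def sum_subtractf algebra_simps diff_divide_distrib)
  also have "(\<Sum>i\<le>k. (if i = 0 then 0 else coeff p (i - 1)) * t i) = (\<Sum>i<k. coeff p i * t (Suc i))"
    by (cases k) (auto simp: sum.atMost_Suc_shift lessThan_Suc_atMost simp del: sum.atMost_Suc)
  also have "\<dots> = (\<Sum>i<k. - (real (k - i) * coeff p i * t i))"
  proof (intro sum.cong refl)
    fix i assume "i \<in> {..<k}"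
    then obtain d where d: "k - i = Suc d" "k - Suc i = d" by (metis Suc_diff_Suc lessThan_iff)
    have f: "(fact (Suc d) :: real) = real (Suc d) * fact d" by simp
    have "real (Suc d) \<noteq> 0" by simp
    then have "t i = - t (Suc i) / real (Suc d)" unfolding t_def d f by (simp del: of_nat_Suc)
    then show "coeff p i * t (Suc i) = - (real (k - i) * coeff p i * t i)"
      unfolding d by (simp del: of_nat_Suc)
  qed
  also have "\<dots> = (\<Sum>i\<le>k. - (real (k - i) * coeff p i * t i))"
    by (intro sum.mono_neutral_left) auto
  also have "(\<Sum>i\<le>k. real i * coeff p i * t i) - (\<Sum>i\<le>k. - (real (k - i) * coeff p i * t i)) = (\<Sum>i\<le>k. real k * (coeff p i * t i))"
    unfolding sum_subtractf[symmetric] by (intro sum.cong refl) (auto simp: of_nat_diff algebra_simps)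
  also have "\<dots> = real k * tay p k" by (simp add: tay_def t_def sum_distrib_left)
  finally show ?thesis .
qed

lemma tay_abs_summable: "summable (\<lambda>k. norm (tay p k * u ^ k))"
proof -
  have "summable (\<lambda>k. tay p k * (\<bar>u\<bar> + 1) ^ k)" using tay_sums by (auto simp: sums_iff)
  then show ?thesis by (rule powser_insidea) simp
qed

text \<open>The Mellin transform of \<open>pe p\<close>, continued meromorphically.\<close>
definition NN :: "real poly \<Rightarrow> complex \<Rightarrow> complex" where
  "NN p w = (\<Sum>i\<le>degree p. of_real (coeff p i) * Gamma (w + of_nat i))"

lemma NN_extend: "degree p \<le> m \<Longrightarrow> NN p w = (\<Sum>i\<le>m. of_real (coeff p i) * Gamma (w + of_nat i))"
  unfolding NN_def by (intro sum.mono_neutral_left) (auto simp: coeff_eq_0)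

lemma NN_dop:
  assumes w: "w \<notin> \<int>\<^sub>\<le>\<^sub>0"
  shows "NN (dop p) w = - w * NN p w"
proof -
  define D where "D = degree p"
  define g where "g i = Gamma (w + of_nat i)" for i
  have nz: "w + of_nat i \<notin> \<int>\<^sub>\<le>\<^sub>0" for i
  proof
    assume "w + of_nat i \<in> \<int>\<^sub>\<le>\<^sub>0"
    then obtain n where "w + of_nat i = - of_nat n" by (elim nonpos_Ints_cases')
    then have "w = - of_nat (n + i)" by (simp add: eq_diff_eq[symmetric])
    then show False using w by (metis minus_of_nat_in_nonpos_Ints)
  qed
  have rec: "g (Suc i) = (w + of_nat i) * g i" for i
    using Gamma_plus1[of "w + of_nat i"] nz[of i] by (simp add: g_def add_ac)
  have "degree (dop p) \<le> Suc D"
  proof (rule degree_le, intro allI impI)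
    fix i assume "Suc D < i"
    then show "coeff (dop p) i = 0" by (simp add: coeff_dop coeff_eq_0 D_def)
  qed
  then have "NN (dop p) w = (\<Sum>i\<le>Suc D. of_real (coeff (dop p) i) * g i)"
    unfolding g_def by (rule NN_extend)
  also have "\<dots> = (\<Sum>i\<le>Suc D. of_nat i * of_real (coeff p i) * g i) - (\<Sum>i\<le>Suc D. (if i = 0 then 0 else of_real (coeff p (i - 1))) * g i)"
    unfolding sum_subtractf[symmetric] by (intro sum.cong refl) (auto simp: coeff_dop algebra_simps)
  also have "(\<Sum>i\<le>Suc D. of_nat i * of_real (coeff p i) * g i) = (\<Sum>i\<le>D. of_nat i * of_real (coeff p i) * g i)"
    by (simp add: coeff_eq_0 D_def)
  also have "(\<Sum>i\<le>Suc D. (if i = 0 then 0 else of_real (coeff p (i - 1))) * g i) = (\<Sum>i\<le>D. of_real (coeff p i) * g (Suc i))"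
    by (simp add: sum.atMost_Suc_shift del: sum.atMost_Suc)
  also have "(\<Sum>i\<le>D. of_nat i * of_real (coeff p i) * g i) - (\<Sum>i\<le>D. of_real (coeff p i) * g (Suc i))
      = (\<Sum>i\<le>D. - w * (of_real (coeff p i) * g i))"
    unfolding sum_subtractf[symmetric] by (intro sum.cong refl) (simp add: rec algebra_simps)
  also have "\<dots> = - w * NN p w" by (simp add: NN_def g_def D_def sum_distrib_left)
  finally show ?thesis .
qed

lemma NN_conv_pochhammer:
  assumes "w \<notin> \<int>\<^sub>\<le>\<^sub>0"
  shows "NN p w = Gamma w * (\<Sum>i\<le>degree p. of_real (coeff p i) * pochhammer w i)"
  unfolding NN_def sum_distrib_left
  using assms by (intro sum.cong refl) (simp add: pochhammer_Gamma Gamma_eq_zero_iff)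

lemma norm_Gamma_imaginary:
  assumes "\<eta> > 0"
  shows "(norm (Gamma (\<i> * of_real \<eta>)))\<^sup>2 = pi / (\<eta> * sinh (pi * \<eta>))"
proof -
  define z where "z = \<i> * complex_of_real \<eta>"
  have ii: "\<i> * (a * (\<i> * b)) = - (a * b)" "\<i> * a * (\<i> * b) = - (a * b)" for a b
  proof -
    have "\<i> * (a * (\<i> * b)) = a * (\<i> * (\<i> * b))" by (rule mult.left_commute)
    then show 1: "\<i> * (a * (\<i> * b)) = - (a * b)" by simp
    show "\<i> * a * (\<i> * b) = - (a * b)" unfolding mult.assoc by (rule 1)
  qed
  have cz: "cnj z = - z" by (simp add: z_def)
  have "complex_of_real ((norm (Gamma z))\<^sup>2) = Gamma z * cnj (Gamma z)"
    by (rule complex_norm_square)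
  also have "\<dots> = Gamma z * Gamma (- z)" by (simp add: cnj_Gamma cz)
  also have "\<dots> = - of_real pi / (z * sin (of_real pi * z))" by (rule Gamma_reflection_complex')
  also have "sin (of_real pi * z) = \<i> * of_real (sinh (pi * \<eta>))"
  proof -
    have "\<i> * (of_real pi * z) = of_real (- (pi * \<eta>))" unfolding z_def ii by simp
    then have "sin (of_real pi * z) = (of_real (exp (- (pi * \<eta>))) - of_real (exp (pi * \<eta>))) / (2 * \<i>)"
      unfolding sin_exp_eq exp_of_real[symmetric] by simp
    also have "\<dots> = of_real ((exp (- (pi * \<eta>)) - exp (pi * \<eta>)) / 2) / \<i>" by simp
    also have "(exp (- (pi * \<eta>)) - exp (pi * \<eta>)) / 2 = - sinh (pi * \<eta>)"
      unfolding sinh_field_def by argo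
    finally show ?thesis by (simp add: divide_i)
  qed
  also have "- of_real pi / (z * (\<i> * of_real (sinh (pi * \<eta>)))) = of_real (pi / (\<eta> * sinh (pi * \<eta>)))"
    unfolding z_def ii by simp
  finally show ?thesis unfolding z_def of_real_eq_iff .
qed

lemma norm_Gamma_imaginary_le:
  assumes "\<delta> > 0"
  obtains C where "C > 0" "\<And>\<eta>. \<eta> \<ge> \<delta> \<Longrightarrow> norm (Gamma (\<i> * of_real \<eta>)) \<le> C * exp (- \<eta>)"
proof -
  define a where "a = exp (- (2 * (pi * \<delta>)))"
  define D where "D = \<delta> * ((1 - a) / 2)"
  have "a < 1" using assms by (simp add: a_def)
  then have D: "D > 0" using assms by (simp add: D_def)
  show thesis
  proof (rule that)
    show "sqrt (pi / D) > 0" using D by simp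
    fix \<eta> assume \<eta>: "\<eta> \<ge> \<delta>"
    define E where "E = exp (pi * \<eta>)"
    define F where "F = exp (- (pi * \<eta>))"
    define G where "G = exp (- \<eta>)"
    have E0: "E > 0" by (simp add: E_def)
    have G0: "G > 0" by (simp add: G_def)
    have "pi * \<delta> \<le> pi * \<eta>" using \<eta> by (rule mult_left_mono) simp
    then have "- (pi * \<eta>) \<le> pi * \<eta> + - (2 * (pi * \<delta>))" by linarith
    then have "F \<le> E * a" unfolding F_def E_def a_def exp_add[symmetric] exp_le_cancel_iff .
    then have "E * ((1 - a) / 2) \<le> (E - F) / 2" by argo
    then have s1: "E * ((1 - a) / 2) \<le> sinh (pi * \<eta>)" unfolding sinh_field_def E_def F_def .
    have s2: "D * E \<le> \<eta> * sinh (pi * \<eta>)"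
    proof -
      have "\<delta> * (E * ((1 - a) / 2)) \<le> \<eta> * sinh (pi * \<eta>)"
        using \<open>a < 1\<close> E0 assms \<eta> by (intro mult_mono[OF \<eta> s1]) auto
      then show ?thesis by (simp only: D_def mult_ac)
    qed
    have s3: "1 \<le> E * G\<^sup>2"
    proof -
      have "2 * \<eta> \<le> pi * \<eta>" using assms \<eta> pi_ge_two by (intro mult_right_mono) auto
      then have "0 \<le> pi * \<eta> + (- \<eta> + - \<eta>)" by linarith
      then have "1 \<le> exp (pi * \<eta> + (- \<eta> + - \<eta>))" unfolding one_le_exp_iff .
      then show ?thesis unfolding exp_add E_def G_def power2_eq_square .
    qed
    have "(norm (Gamma (\<i> * of_real \<eta>)))\<^sup>2 = pi / (\<eta> * sinh (pi * \<eta>))"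
      using norm_Gamma_imaginary[of \<eta>] assms \<eta> by simp
    also have "\<dots> \<le> pi / (D * E)"
    proof (rule divide_left_mono[OF s2 pi_ge_zero])
      have 0: "0 < D * E" using D E0 by (rule mult_pos_pos)
      show "0 < \<eta> * sinh (pi * \<eta>) * (D * E)" by (rule mult_pos_pos[OF less_le_trans[OF 0 s2] 0])
    qed
    also have "\<dots> \<le> pi / D * G\<^sup>2"
    proof -
      have "pi / (D * E) * 1 \<le> pi / (D * E) * (E * G\<^sup>2)" using s3 D E0 by (intro mult_left_mono) auto
      moreover have "pi / (D * E) * (E * G\<^sup>2) = pi / D * G\<^sup>2" using E0 by simp
      ultimately show ?thesis by (simp only: mult_1_right)
    qed
    also have "\<dots> = (sqrt (pi / D) * G)\<^sup>2"
      unfolding power_mult_distrib using D by (subst real_sqrt_pow2) simp_all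
    finally show "norm (Gamma (\<i> * of_real \<eta>)) \<le> sqrt (pi / D) * exp (- \<eta>)"
      unfolding G_def[symmetric] by (rule power2_le_imp_le) (use D G0 in simp)
  qed
qed

lemma set_integrable_lborel_iff_continuous:
  fixes f :: "real \<Rightarrow> complex"
  assumes "continuous_on S f" "S \<in> sets borel" "f absolutely_integrable_on S"
  shows "set_integrable lborel S f"
proof -
  have "(\<lambda>x. indicator S x *\<^sub>R f x) \<in> borel_measurable lborel"
    using borel_measurable_continuous_on_indicator[OF assms(2,1)] by simp
  then show ?thesis using assms(3) unfolding set_integrable_def by (simp add: integrable_completion)
qed

lemma set_integral_scale:
  fixes f :: "real \<Rightarrow> complex" and c :: real
  assumes c: "c > 0" and int: "set_integrable lborel {0<..} f"
  shows "set_integrable lborel {0<..} (\<lambda>x. f (c * x))"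
    and "(LINT x:{0<..}|lborel. f (c * x)) = (LINT x:{0<..}|lborel. f x) / of_real c"
proof -
  have eq: "indicator {0<..} (c * x) *\<^sub>R f (c * x) = indicator {0<..} x *\<^sub>R f (c * x)" for x
    using c by (auto simp: indicator_def zero_less_mult_iff)
  show "set_integrable lborel {0<..} (\<lambda>x. f (c * x))"
    using lborel_integrable_real_affine[of "\<lambda>x. indicator {0<..} x *\<^sub>R f x" c 0] int c
    by (simp add: set_integrable_def eq)
  show "(LINT x:{0<..}|lborel. f (c * x)) = (LINT x:{0<..}|lborel. f x) / of_real c"
  proof -
    have "(\<integral>x. indicator {0<..} x *\<^sub>R f x \<partial>lborel) = \<bar>c\<bar> *\<^sub>R (\<integral>x. indicator {0<..} (c * x) *\<^sub>R f (c * x) \<partial>lborel)"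
      using lborel_integral_real_affine[of c "\<lambda>x. indicator {0<..} x *\<^sub>R f x" 0] c unfolding add_0_left by blast
    then have "(LINT x:{0<..}|lborel. f x) = \<bar>c\<bar> *\<^sub>R (LINT x:{0<..}|lborel. f (c * x))"
      unfolding eq set_lebesgue_integral_def .
    then show ?thesis using c by (simp add: scaleR_conv_of_real)
  qed
qed

lemma pe_mellin:
  assumes w: "\<And>i. coeff p i \<noteq> 0 \<Longrightarrow> Re w + real i > 0" and \<nu>: "\<nu> > 0"
  shows "set_integrable lborel {0<..} (\<lambda>u. of_real (pe p (\<nu> * u)) * of_real u powr (w - 1))"
    and "(LINT u:{0<..}|lborel. of_real (pe p (\<nu> * u)) * of_real u powr (w - 1)) = of_real \<nu> powr (- w) * NN p w"
proof -
  define f where "f u = of_real (pe p u) * complex_of_real u powr (w - 1)" for u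
  define g where "g i t = complex_of_real t powr (w + of_nat i - 1) / of_real (exp t)" for i :: nat and t :: real
  have contg: "continuous_on {0<..} (g i)" for i
    unfolding g_def by (intro continuous_intros) (auto simp: complex_nonpos_Reals_iff)
  have intg: "set_integrable lborel {0<..} (\<lambda>t. of_real (coeff p i) * g i t)"
    and valg: "(LINT t:{0<..}|lborel. of_real (coeff p i) * g i t) = of_real (coeff p i) * Gamma (w + of_nat i)" for i
  proof -
    have *: "set_integrable lborel {0<..} (g i) \<and> (LINT t:{0<..}|lborel. g i t) = Gamma (w + of_nat i)" if "coeff p i \<noteq> 0"
    proof -
      have re: "Re (w + of_nat i) > 0" using w[OF that] by simp
      have 1: "set_integrable lborel {0<..} (g i)"
        using absolutely_integrable_Gamma_integral'[OF re] contg[of i]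
        by (intro set_integrable_lborel_iff_continuous) (auto simp: g_def[abs_def])
      moreover have "(LINT t:{0<..}|lborel. g i t) = Gamma (w + of_nat i)"
        using set_borel_integral_eq_integral(2)[OF 1] Gamma_integral_complex'[OF re]
        by (simp add: g_def[abs_def] integral_unique)
      ultimately show ?thesis by simp
    qed
    show "set_integrable lborel {0<..} (\<lambda>t. of_real (coeff p i) * g i t)"
    proof (cases "coeff p i = 0")
      case False
      then show ?thesis using * by (intro set_integrable_mult_right) auto
    qed (simp add: set_integrable_def)
    show "(LINT t:{0<..}|lborel. of_real (coeff p i) * g i t) = of_real (coeff p i) * Gamma (w + of_nat i)"
      using * by (cases "coeff p i = 0") auto
  qed
  have fg: "f t = (\<Sum>i\<le>degree p. of_real (coeff p i) * g i t)" if "t > 0" for t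
  proof -
    have "g i t = complex_of_real t powr (w - 1) * of_real t ^ i * of_real (exp (- t))" for i
    proof -
      have "w + of_nat i - 1 = (w - 1) + of_nat i" by simp
      then have "complex_of_real t powr (w + of_nat i - 1) = complex_of_real t powr (w - 1) * of_real t ^ i"
        using that by (simp only: powr_add) (simp add: powr_nat')
      then show ?thesis by (simp add: g_def exp_minus divide_inverse)
    qed
    then show ?thesis
      by (simp add: f_def pe_def poly_altdef sum_distrib_right sum_distrib_left mult_ac)
  qed
  have intf: "set_integrable lborel {0<..} f"
  proof -
    have "set_integrable lborel {0<..} (\<lambda>t. \<Sum>i\<le>degree p. of_real (coeff p i) * g i t)"
      using intg unfolding set_integrable_def scaleR_sum_right by (intro Bochner_Integration.integrable_sum)
    then show ?thesis by (subst set_integrable_cong[OF refl refl fg]) auto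
  qed
  have valf: "(LINT t:{0<..}|lborel. f t) = NN p w"
  proof -
    have "(LINT t:{0<..}|lborel. f t) = (LINT t:{0<..}|lborel. \<Sum>i\<le>degree p. of_real (coeff p i) * g i t)"
      by (intro set_lebesgue_integral_cong) (auto simp: fg)
    also have "\<dots> = (\<Sum>i\<le>degree p. (LINT t:{0<..}|lborel. of_real (coeff p i) * g i t))"
      using intg unfolding set_integrable_def set_lebesgue_integral_def scaleR_sum_right
      by (intro Bochner_Integration.integral_sum)
    finally show ?thesis unfolding valg NN_def .
  qed
  have fs: "of_real (pe p (\<nu> * u)) * of_real u powr (w - 1) = of_real \<nu> powr (1 - w) * f (\<nu> * u)" if "u > 0" for u
  proof -
    have 1: "complex_of_real (\<nu> * u) powr (w - 1) = of_real \<nu> powr (w - 1) * of_real u powr (w - 1)"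
      using that \<nu> by (simp add: powr_times_real)
    have 2: "complex_of_real \<nu> powr (1 - w) * of_real \<nu> powr (w - 1) = 1"
      using \<nu> by (simp add: powr_add[symmetric])
    have "of_real \<nu> powr (1 - w) * f (\<nu> * u) = (of_real \<nu> powr (1 - w) * of_real \<nu> powr (w - 1)) * (of_real (pe p (\<nu> * u)) * of_real u powr (w - 1))"
      unfolding f_def 1 by (simp only: mult_ac)
    then show ?thesis unfolding 2 by simp
  qed
  have i2: "set_integrable lborel {0<..} (\<lambda>u. of_real \<nu> powr (1 - w) * f (\<nu> * u))"
    using set_integral_scale(1)[OF \<nu> intf] by (rule set_integrable_mult_right)
  then show "set_integrable lborel {0<..} (\<lambda>u. of_real (pe p (\<nu> * u)) * of_real u powr (w - 1))"
    by (subst set_integrable_cong[OF refl refl fs]) auto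
  have "(LINT u:{0<..}|lborel. of_real (pe p (\<nu> * u)) * of_real u powr (w - 1)) = (LINT u:{0<..}|lborel. of_real \<nu> powr (1 - w) * f (\<nu> * u))"
    by (intro set_lebesgue_integral_cong) (auto simp: fs)
  also have "\<dots> = of_real \<nu> powr (1 - w) * (NN p w / of_real \<nu>)"
    using set_integral_scale(2)[OF \<nu> intf] valf by simp
  also have "\<dots> = of_real \<nu> powr (- w) * NN p w"
  proof -
    have "of_real \<nu> powr (1 - w) = of_real \<nu> * complex_of_real \<nu> powr (- w)"
      using \<nu> powr_add[of "complex_of_real \<nu>" 1 "- w"] by simp
    then show ?thesis using \<nu> by simp
  qed
  finally show "(LINT u:{0<..}|lborel. of_real (pe p (\<nu> * u)) * of_real u powr (w - 1)) = of_real \<nu> powr (- w) * NN p w" .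
qed

section \<open>Series with nonnegative weights\<close>

definition adm :: "real \<Rightarrow> (nat \<Rightarrow> real) \<Rightarrow> bool" where
  "adm \<sigma>0 a \<longleftrightarrow> \<sigma>0 < 1 \<and> \<sigma>0 \<ge> 0 \<and> a 0 = 0 \<and> (\<forall>n. a n \<ge> 0) \<and>
     (\<forall>\<sigma>>\<sigma>0. summable (\<lambda>n. a n * real n powr (- 2 * \<sigma>)))"

lemma admD:
  assumes "adm \<sigma>0 a"
  shows "\<sigma>0 < 1" "\<sigma>0 \<ge> 0" "a 0 = 0" "a n \<ge> 0"
proof -
  note * = assms[unfolded adm_def]
  show "\<sigma>0 < 1" by (rule *[THEN conjunct1])
  show "\<sigma>0 \<ge> 0" by (rule *[THEN conjunct2, THEN conjunct1])
  show "a 0 = 0" by (rule *[THEN conjunct2, THEN conjunct2, THEN conjunct1])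
  show "a n \<ge> 0" by (rule *[THEN conjunct2, THEN conjunct2, THEN conjunct2, THEN conjunct1, THEN spec])
qed

lemma adm_summable:
  assumes "adm \<sigma>0 a" "\<sigma> > \<sigma>0"
  shows "summable (\<lambda>n. a n * real n powr (- 2 * \<sigma>))"
  by (rule assms(1)[unfolded adm_def, THEN conjunct2, THEN conjunct2, THEN conjunct2, THEN conjunct2,
        THEN spec[of _ \<sigma>], THEN mp, OF assms(2)])

definition Psi :: "(nat \<Rightarrow> real) \<Rightarrow> real poly \<Rightarrow> real \<Rightarrow> real" where
  "Psi a p u = (\<Sum>n. a n * pe p ((real n)\<^sup>2 * u))"

lemma Psi_term_bound:
  assumes "adm \<sigma>0 a"
  shows "\<exists>C. C \<ge> 0 \<and> (\<forall>u>0. \<forall>n. \<bar>a n * pe p ((real n)\<^sup>2 * u)\<bar> \<le> a n * real n powr - 2 * (C * exp (- u / 2) / u))"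
proof -
  have "\<exists>C. C \<ge> 0 \<and> (\<forall>u\<ge>0. u * \<bar>pe p u\<bar> \<le> C * exp (- u / 2))"
  proof (rule pe_bounds[of p])
    fix C assume "C \<ge> 0" "\<And>u. u \<ge> 0 \<Longrightarrow> u * \<bar>pe p u\<bar> \<le> C * exp (- u / 2)"
    then show ?thesis by (intro exI[of _ C] conjI allI impI)
  qed
  then obtain C where C': "C \<ge> 0 \<and> (\<forall>u\<ge>0. u * \<bar>pe p u\<bar> \<le> C * exp (- u / 2))" by (rule exE)
  note C = C'[THEN conjunct1] C'[THEN conjunct2, rule_format]
  show ?thesis
  proof (intro exI[of _ C] conjI C(1) allI impI)
    fix u :: real and n :: nat assume u: "u > 0"
    show "\<bar>a n * pe p ((real n)\<^sup>2 * u)\<bar> \<le> a n * real n powr - 2 * (C * exp (- u / 2) / u)"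
    proof (cases "n = 0")
      case False
      define m where "m = (real n)\<^sup>2"
      have m: "m \<ge> 1" using False by (simp add: m_def)
      have mp: "real n powr - 2 = 1 / m" using False by (simp add: m_def powr_minus_divide)
      have mu: "1 * u \<le> m * u" using m u by (intro mult_right_mono) auto
      have "(m * u) * \<bar>pe p (m * u)\<bar> \<le> C * exp (- (m * u) / 2)" using C(2)[of "m * u"] m u by simp
      also have "\<dots> \<le> C * exp (- u / 2)" using C(1) mu by (intro mult_left_mono) auto
      finally have "\<bar>pe p (m * u)\<bar> \<le> C * exp (- u / 2) / (m * u)"
        using m u by (simp add: pos_le_divide_eq mult_ac)
      then have "a n * \<bar>pe p (m * u)\<bar> \<le> a n * (C * exp (- u / 2) / (m * u))"
        using admD(4)[OF assms] by (intro mult_left_mono) auto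
      then show ?thesis using admD(4)[OF assms, of n] by (simp add: m_def[symmetric] mp abs_mult)
    qed (use admD(3)[OF assms] in simp)
  qed
qed

lemma adm_summable2:
  assumes "adm \<sigma>0 a"
  shows "summable (\<lambda>n. a n * real n powr - 2)"
  using adm_summable[OF assms admD(1)[OF assms]] by simp

lemma Psi_abs_summable:
  assumes "adm \<sigma>0 a" "u > 0"
  shows "summable (\<lambda>n. \<bar>a n * pe p ((real n)\<^sup>2 * u)\<bar>)"
proof -
  obtain C where C': "C \<ge> 0 \<and> (\<forall>u>0. \<forall>n. \<bar>a n * pe p ((real n)\<^sup>2 * u)\<bar> \<le> a n * real n powr - 2 * (C * exp (- u / 2) / u))"
    using Psi_term_bound[OF assms(1), of p] by (rule exE)
  note C = C'[THEN conjunct2, rule_format]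
  show ?thesis
    by (rule summable_comparison_test'[OF summable_mult2[OF adm_summable2[OF assms(1)], of "C * exp (- u / 2) / u"], of 0])
      (simp only: real_norm_def abs_idempotent C[OF assms(2)])
qed

lemma Psi_sums:
  assumes "adm \<sigma>0 a" "u > 0"
  shows "(\<lambda>n. a n * pe p ((real n)\<^sup>2 * u)) sums Psi a p u"
  unfolding Psi_def by (rule summable_sums[OF summable_rabs_cancel[OF Psi_abs_summable[OF assms]]])

lemma Psi_bound:
  assumes "adm \<sigma>0 a"
  shows "\<exists>C. C \<ge> 0 \<and> (\<forall>u>0. \<bar>Psi a p u\<bar> \<le> C * exp (- u / 2) / u)"
proof -
  obtain C where C': "C \<ge> 0 \<and> (\<forall>u>0. \<forall>n. \<bar>a n * pe p ((real n)\<^sup>2 * u)\<bar> \<le> a n * real n powr - 2 * (C * exp (- u / 2) / u))"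
    using Psi_term_bound[OF assms(1), of p] by (rule exE)
  note C = C'[THEN conjunct1] C'[THEN conjunct2, rule_format]
  define A where "A = (\<Sum>n. a n * real n powr - 2)"
  have A: "A \<ge> 0" unfolding A_def using admD(4)[OF assms] by (intro suminf_nonneg adm_summable2[OF assms]) auto
  have *: "(\<Sum>n. \<bar>a n * pe p ((real n)\<^sup>2 * u)\<bar>) \<le> A * C * exp (- u / 2) / u" if u: "u > 0" for u
  proof -
    have "(\<Sum>n. \<bar>a n * pe p ((real n)\<^sup>2 * u)\<bar>) \<le> (\<Sum>n. a n * real n powr - 2 * (C * exp (- u / 2) / u))"
      by (intro suminf_le Psi_abs_summable[OF assms u] summable_mult2 adm_summable2[OF assms] C(2)[OF u])
    also have "\<dots> = A * (C * exp (- u / 2) / u)"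
      unfolding A_def by (intro suminf_mult2[symmetric] adm_summable2[OF assms])
    finally show ?thesis by simp
  qed
  show ?thesis
  proof (intro exI[of _ "A * C"] conjI allI impI)
    show "A * C \<ge> 0" using A C(1) by simp
    fix u :: real assume u: "u > 0"
    have "\<bar>Psi a p u\<bar> \<le> (\<Sum>n. \<bar>a n * pe p ((real n)\<^sup>2 * u)\<bar>)"
      unfolding Psi_def by (rule summable_rabs[OF Psi_abs_summable[OF assms u]])
    also note *[OF u]
    finally show "\<bar>Psi a p u\<bar> \<le> A * C * exp (- u / 2) / u" .
  qed
qed

lemma Psi_has_derivative:
  assumes "adm \<sigma>0 a" "u > 0"
  shows "(Psi a p has_real_derivative Psi a (dop p) u / u) (at u)"
proof -
  define S where "S = {u / 2<..}"
  obtain C where C': "C \<ge> 0 \<and> (\<forall>u>0. \<forall>n. \<bar>a n * pe (dop p) ((real n)\<^sup>2 * u)\<bar> \<le> a n * real n powr - 2 * (C * exp (- u / 2) / u))"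
    using Psi_term_bound[OF assms(1), of "dop p"] by (rule exE)
  note C = C'[THEN conjunct1] C'[THEN conjunct2, rule_format]
  have "((\<lambda>x. \<Sum>n. a n * pe p ((real n)\<^sup>2 * x)) has_real_derivative (\<Sum>n. a n * pe (dop p) ((real n)\<^sup>2 * u) / u)) (at u)"
  proof (rule has_field_derivative_series'(2)[where S = S and x0 = u])
    show "convex S" by (simp add: S_def)
    show "u \<in> S" "u \<in> interior S" using assms(2) by (auto simp: S_def interior_open)
    show "summable (\<lambda>n. a n * pe p ((real n)\<^sup>2 * u))" using Psi_sums[OF assms] by (simp add: sums_iff)
    show "((\<lambda>x. a n * pe p ((real n)\<^sup>2 * x)) has_real_derivative a n * pe (dop p) ((real n)\<^sup>2 * x) / x) (at x within S)"
      if "x \<in> S" for n x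
    proof (cases "n = 0")
      case False
      have x: "x > 0" using that assms(2) by (auto simp: S_def)
      have "(pe p has_real_derivative pe (dop p) ((real n)\<^sup>2 * x) / ((real n)\<^sup>2 * x)) (at ((real n)\<^sup>2 * x))"
        using x False by (intro pe_has_derivative) auto
      moreover have "((\<lambda>x. (real n)\<^sup>2 * x) has_real_derivative (real n)\<^sup>2) (at x within S)"
        by (auto intro!: derivative_eq_intros)
      ultimately have "((\<lambda>x. pe p ((real n)\<^sup>2 * x)) has_real_derivative pe (dop p) ((real n)\<^sup>2 * x) / ((real n)\<^sup>2 * x) * (real n)\<^sup>2) (at x within S)"
        by (rule DERIV_chain2)
      then have "((\<lambda>x. a n * pe p ((real n)\<^sup>2 * x)) has_real_derivative a n * (pe (dop p) ((real n)\<^sup>2 * x) / ((real n)\<^sup>2 * x) * (real n)\<^sup>2)) (at x within S)"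
        by (rule DERIV_cmult)
      moreover have "a n * (pe (dop p) ((real n)\<^sup>2 * x) / ((real n)\<^sup>2 * x) * (real n)\<^sup>2) = a n * pe (dop p) ((real n)\<^sup>2 * x) / x"
        using False by simp
      ultimately show ?thesis by (simp only:)
    qed (simp add: admD(3)[OF assms(1)])
    show "uniformly_convergent_on S (\<lambda>n x. \<Sum>i<n. a i * pe (dop p) ((real i)\<^sup>2 * x) / x)"
    proof (rule uniformly_convergentI, rule Weierstrass_m_test)
      show "summable (\<lambda>n. a n * real n powr - 2 * (C / (u / 2) / (u / 2)))"
        by (rule summable_mult2[OF adm_summable2[OF assms(1)]])
      show "norm (a n * pe (dop p) ((real n)\<^sup>2 * x) / x) \<le> a n * real n powr - 2 * (C / (u / 2) / (u / 2))"
        if "x \<in> S" for n x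
      proof -
        note \<open>x \<in> S\<close>
        then have x: "x > u / 2" "x > 0" using assms(2) by (auto simp: S_def)
        have e1: "exp (- x / 2) \<le> 1" using x by simp
        have l1: "C * exp (- x / 2) / x \<le> C * 1 / (u / 2)"
          using C(1) x assms(2) e1 by (intro frac_le mult_left_mono) auto
        have le: "C * exp (- x / 2) / x / x \<le> C * 1 / (u / 2) / (u / 2)"
          by (rule frac_le[OF _ l1]) (use C(1) x assms(2) in auto)
        have "norm (a n * pe (dop p) ((real n)\<^sup>2 * x) / x) = \<bar>a n * pe (dop p) ((real n)\<^sup>2 * x)\<bar> / x"
          using x by (simp add: abs_mult abs_divide)
        also have "\<dots> \<le> a n * real n powr - 2 * (C * exp (- x / 2) / x) / x"
          using C(2)[OF x(2), of n] x by (intro divide_right_mono) auto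
        also have "\<dots> = a n * real n powr - 2 * (C * exp (- x / 2) / x / x)" by simp
        also have "\<dots> \<le> a n * real n powr - 2 * (C * 1 / (u / 2) / (u / 2))"
          using le admD(4)[OF assms(1)] by (intro mult_left_mono) auto
        finally show "norm (a n * pe (dop p) ((real n)\<^sup>2 * x) / x) \<le> a n * real n powr - 2 * (C / (u / 2) / (u / 2))"
          by simp
      qed
    qed
  qed
  moreover have "(\<Sum>n. a n * pe (dop p) ((real n)\<^sup>2 * u) / u) = Psi a (dop p) u / u"
    using Psi_sums[OF assms, of "dop p"] by (simp add: suminf_divide sums_iff)
  ultimately show ?thesis by (simp add: Psi_def[abs_def])
qed

lemma continuous_on_Psi:
  assumes "adm \<sigma>0 a"
  shows "continuous_on {0<..} (Psi a p)"
  using Psi_has_derivative[OF assms] by (intro continuous_at_imp_continuous_on) (auto intro: DERIV_isCont)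

lemma Psi_add:
  assumes "adm \<sigma>0 a" "u > 0"
  shows "Psi a (p + q) u = Psi a p u + Psi a q u"
proof -
  have "(\<lambda>n. a n * pe p ((real n)\<^sup>2 * u) + a n * pe q ((real n)\<^sup>2 * u)) sums (Psi a p u + Psi a q u)"
    by (intro sums_add Psi_sums[OF assms])
  then show ?thesis by (simp add: Psi_def pe_def algebra_simps sums_iff)
qed

lemma Psi_smult:
  assumes "adm \<sigma>0 a" "u > 0"
  shows "Psi a (Polynomial.smult c p) u = c * Psi a p u"
proof -
  have "(\<lambda>n. c * (a n * pe p ((real n)\<^sup>2 * u))) sums (c * Psi a p u)"
    by (intro sums_mult Psi_sums[OF assms])
  then show ?thesis by (simp add: Psi_def pe_def algebra_simps sums_iff)
qed

lemma Psi_mellin: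
  assumes a: "adm \<sigma>0 a" and w: "Re w > \<sigma>0"
  shows "set_integrable lborel {0<..} (\<lambda>u. of_real (Psi a p u) * of_real u powr (w - 1))"
    and "(\<lambda>n. of_real (a n) * of_nat n powr (- 2 * w)) sums s \<Longrightarrow>
      (LINT u:{0<..}|lborel. of_real (Psi a p u) * of_real u powr (w - 1)) = NN p w * s"
    and "summable (\<lambda>n. of_real (a n) * (of_nat n :: complex) powr (- 2 * w))"
proof -
  have Rw: "Re w > 0" using w admD(2)[OF a] by simp
  have i1: "set_integrable lborel {0<..} (\<lambda>u. of_real (pe p (\<nu> * u)) * complex_of_real u powr (w - 1))"
    and v1: "(LINT u:{0<..}|lborel. of_real (pe p (\<nu> * u)) * complex_of_real u powr (w - 1)) = of_real \<nu> powr (- w) * NN p w"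
    if "\<nu> > 0" for \<nu>
    using pe_mellin[of p w \<nu>] Rw that by auto
  define f where "f n u = of_real (a n) * (of_real (pe p ((real n)\<^sup>2 * u)) * complex_of_real u powr (w - 1))" for n u
  have fint: "set_integrable lborel {0<..} (f n)" for n
  proof (cases "n = 0")
    case False
    then have "set_integrable lborel {0<..} (\<lambda>u. of_real (pe p ((real n)\<^sup>2 * u)) * complex_of_real u powr (w - 1))"
      by (intro i1) simp
    then show ?thesis unfolding f_def[abs_def] by (rule set_integrable_mult_right)
  qed (simp add: f_def[abs_def] set_integrable_def admD(3)[OF a])
  define K where "K = (LINT u:{0<..}|lborel. norm (of_real (pe p u) * complex_of_real u powr (w - 1)))"
  have npw: "((real n)\<^sup>2) powr x = real n powr (2 * x)" for n x
    by (cases "n = 0") (auto simp: powr_powr simp flip: powr_numeral)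
  have scale: "(LINT u:{0<..}|lborel. norm (of_real (pe p (\<nu> * u)) * complex_of_real u powr (w - 1))) = \<nu> powr (- Re w) * K"
    if \<nu>: "\<nu> > 0" for \<nu>
  proof -
    define F where "F u = complex_of_real (norm (of_real (pe p u) * complex_of_real u powr (w - 1)))" for u
    have iF: "set_integrable lborel {0<..} F"
      using set_integrable_norm[OF i1[of 1]] unfolding F_def[abs_def] set_integrable_def
      by (simp add: scaleR_conv_of_real flip: of_real_mult)
    have eq: "complex_of_real (norm (of_real (pe p (\<nu> * u)) * complex_of_real u powr (w - 1))) = of_real (\<nu> powr (1 - Re w)) * F (\<nu> * u)"
      if "u > 0" for u
    proof -
      have "\<nu> powr (1 - Re w) * \<nu> powr (Re w - 1) = 1" using \<nu> by (simp add: powr_add[symmetric])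
      moreover have "norm (complex_of_real (\<nu> * u) powr (w - 1)) = \<nu> powr (Re w - 1) * u powr (Re w - 1)"
        using that \<nu> by (simp add: norm_powr_real_powr powr_mult)
      moreover have "norm (complex_of_real u powr (w - 1)) = u powr (Re w - 1)"
        using that by (simp add: norm_powr_real_powr)
      moreover have "x * (c * (y * d)) = (x * y) * (c * d)" for c d x y :: real by (simp only: mult_ac)
      ultimately show ?thesis
        unfolding F_def of_real_mult[symmetric] of_real_eq_iff norm_mult by (simp only: mult_1)
    qed
    have "complex_of_real (LINT u:{0<..}|lborel. norm (of_real (pe p (\<nu> * u)) * complex_of_real u powr (w - 1)))
        = (LINT u:{0<..}|lborel. complex_of_real (norm (of_real (pe p (\<nu> * u)) * complex_of_real u powr (w - 1))))"
      by (rule set_integral_complex_of_real[symmetric])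
    also have "\<dots> = (LINT u:{0<..}|lborel. of_real (\<nu> powr (1 - Re w)) * F (\<nu> * u))"
      by (intro set_lebesgue_integral_cong) (auto simp: eq)
    also have "\<dots> = of_real (\<nu> powr (1 - Re w)) * ((LINT u:{0<..}|lborel. F u) / of_real \<nu>)"
      using set_integral_scale(2)[OF \<nu> iF] by simp
    also have "(LINT u:{0<..}|lborel. F u) = of_real K"
      unfolding F_def K_def by (rule set_integral_complex_of_real)
    also have "of_real (\<nu> powr (1 - Re w)) * (complex_of_real K / of_real \<nu>) = of_real (\<nu> powr (- Re w) * K)"
    proof -
      have "\<nu> powr (1 - Re w) = \<nu> * \<nu> powr (- Re w)" using \<nu> powr_add[of \<nu> 1 "- Re w"] by simp
      then show ?thesis using \<nu> by simp
    qed
    finally show ?thesis unfolding of_real_eq_iff .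
  qed
  have normf: "(LINT u:{0<..}|lborel. norm (f n u)) = a n * real n powr (- 2 * Re w) * K" for n
  proof (cases "n = 0")
    case False
    have "(LINT u:{0<..}|lborel. norm (f n u)) = (LINT u:{0<..}|lborel. a n * norm (of_real (pe p ((real n)\<^sup>2 * u)) * complex_of_real u powr (w - 1)))"
      unfolding f_def norm_mult[of "of_real (a n)"] using admD(4)[OF a, of n] by simp
    also have "\<dots> = a n * (((real n)\<^sup>2) powr (- Re w) * K)" using scale[of "(real n)\<^sup>2"] False by simp
    finally show ?thesis by (simp add: npw)
  qed (simp add: f_def admD(3)[OF a] set_lebesgue_integral_def)
  have sN: "(\<lambda>n. LINT u:{0<..}|lborel. norm (f n u)) summable_on UNIV"
  proof -
    have K: "K \<ge> 0" unfolding K_def set_lebesgue_integral_def by (intro Bochner_Integration.integral_nonneg) auto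
    show ?thesis unfolding normf
      by (rule summable_nonneg_imp_summable_on) (use admD(4)[OF a] adm_summable[OF a w] K in \<open>auto intro!: summable_mult2\<close>)
  qed
  have pt: "(\<lambda>n. norm (f n u)) summable_on UNIV" if "u \<in> {0<..}" for u
  proof (rule summable_nonneg_imp_summable_on)
    have "summable (\<lambda>n. \<bar>a n * pe p ((real n)\<^sup>2 * u)\<bar> * norm (complex_of_real u powr (w - 1)))"
      using that by (intro summable_mult2 Psi_abs_summable[OF a]) auto
    then show "summable (\<lambda>n. norm (f n u))" by (simp add: f_def norm_mult abs_mult mult.assoc)
  qed auto
  have inf: "(\<Sum>\<^sub>\<infinity>n. f n u) = of_real (Psi a p u) * of_real u powr (w - 1)" if u: "u \<in> {0<..}" for u
  proof -
    have "(\<lambda>n. of_real (a n * pe p ((real n)\<^sup>2 * u)) * complex_of_real u powr (w - 1)) sums (of_real (Psi a p u) * of_real u powr (w - 1))"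
      using u by (intro sums_mult2 sums_of_real Psi_sums[OF a]) auto
    then have "(\<lambda>n. f n u) sums (of_real (Psi a p u) * of_real u powr (w - 1))" by (simp add: f_def mult.assoc)
    from norm_summable_imp_has_sum[OF summable_on_imp_summable[OF pt[OF u]] this] show ?thesis by (rule infsumI)
  qed
  note main = set_integral_infsum[where g = "\<lambda>n::nat. n" and f = f and S = "{0<..}", OF _ fint sN pt]
  have m1: "set_integrable lborel {0<..} (\<lambda>u. \<Sum>\<^sub>\<infinity>n. f n u)" by (rule main(1)) (simp_all add: bij_def)
  have m2: "((\<lambda>n. LINT u:{0<..}|lborel. f n u) has_sum (LINT u:{0<..}|lborel. \<Sum>\<^sub>\<infinity>n. f n u)) UNIV"
    by (rule main(2)) (simp_all add: bij_def)
  show "set_integrable lborel {0<..} (\<lambda>u. of_real (Psi a p u) * of_real u powr (w - 1))"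
    using m1 by (subst (asm) set_integrable_cong[OF refl refl inf]) auto
  have v: "(LINT u:{0<..}|lborel. f n u) = NN p w * (of_real (a n) * of_nat n powr (- 2 * w))" for n
  proof (cases "n = 0")
    case False
    have "(complex_of_real ((real n)\<^sup>2)) powr (- w) = of_nat n powr (- 2 * w)"
    proof -
      have "(of_nat n * of_nat n :: complex) powr (- w) = of_nat n powr (- w) * of_nat n powr (- w)"
        by (rule powr_times_real) simp_all
      also have "\<dots> = of_nat n powr (- w + - w)" by (rule powr_add[symmetric])
      finally show ?thesis by (simp add: power2_eq_square)
    qed
    then show ?thesis using v1[of "(real n)\<^sup>2"] False by (simp add: f_def)
  qed (simp add: f_def admD(3)[OF a])
  show "summable (\<lambda>n. of_real (a n) * (of_nat n :: complex) powr (- 2 * w))"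
  proof (rule summable_norm_cancel)
    have "norm (of_real (a n) * (of_nat n :: complex) powr (- 2 * w)) = a n * real n powr (- 2 * Re w)" for n
      using norm_powr_real_powr[of "of_nat n" "- 2 * w"] admD(4)[OF a, of n] by (simp add: norm_mult)
    then show "summable (\<lambda>n. norm (of_real (a n) * (of_nat n :: complex) powr (- 2 * w)))"
      using adm_summable[OF a w] by simp
  qed
  assume s: "(\<lambda>n. of_real (a n) * of_nat n powr (- 2 * w)) sums s"
  have "(\<lambda>n. LINT u:{0<..}|lborel. f n u) sums (LINT u:{0<..}|lborel. \<Sum>\<^sub>\<infinity>n. f n u)"
    using m2 by (rule has_sum_imp_sums)
  moreover have "(\<lambda>n. LINT u:{0<..}|lborel. f n u) sums (NN p w * s)"
    unfolding v by (rule sums_mult[OF s])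
  ultimately have "(LINT u:{0<..}|lborel. \<Sum>\<^sub>\<infinity>n. f n u) = NN p w * s" by (rule sums_unique2)
  moreover have "(LINT u:{0<..}|lborel. \<Sum>\<^sub>\<infinity>n. f n u) = (LINT u:{0<..}|lborel. of_real (Psi a p u) * of_real u powr (w - 1))"
    by (intro set_lebesgue_integral_cong) (auto simp: inf)
  ultimately show "(LINT u:{0<..}|lborel. of_real (Psi a p u) * of_real u powr (w - 1)) = NN p w * s" by simp
qed

section \<open>Coefficients of finite Euler products\<close>

text \<open>Multisets rather than sets: an element of \<open>B\<close> may be a product of others, so factorizations need not be unique.\<close>
definition aB :: "nat set \<Rightarrow> nat \<Rightarrow> real" where
  "aB B n = real (card {M. set_mset M \<subseteq> B \<and> prod_mset M = n})"

definition base_ok :: "nat set \<Rightarrow> bool" where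
  "base_ok B \<longleftrightarrow> finite B \<and> (\<forall>b\<in>B. b \<ge> 2)"

lemma base_ok_insert [simp]: "base_ok (insert b B) \<longleftrightarrow> base_ok B \<and> b \<ge> 2"
  by (auto simp: base_ok_def)

lemma base_ok_subset: "base_ok B \<Longrightarrow> A \<subseteq> B \<Longrightarrow> base_ok A"
  by (auto simp: base_ok_def intro: finite_subset)

lemma size_le_prod_mset:
  fixes M :: "nat multiset"
  assumes "\<forall>b\<in>#M. b \<ge> 2"
  shows "size M < prod_mset M"
  using assms
proof (induction M)
  case (add x M)
  then have IH: "size M < prod_mset M" and x: "x \<ge> 2" by auto
  have "2 * prod_mset M \<le> x * prod_mset M" using x by (rule mult_right_mono) simp
  then show ?case using IH unfolding size_add_mset prod_mset.add_mset by linarith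
qed simp

lemma finite_factorizations:
  assumes "base_ok B"
  shows "finite {M. set_mset M \<subseteq> B \<and> prod_mset M = n}"
proof (rule finite_subset)
  show "{M. set_mset M \<subseteq> B \<and> prod_mset M = n} \<subseteq> mset ` {xs. set xs \<subseteq> B \<and> length xs \<le> n}"
  proof
    fix M assume "M \<in> {M. set_mset M \<subseteq> B \<and> prod_mset M = n}"
    then have M: "set_mset M \<subseteq> B" "prod_mset M = n" by auto
    have "size M < prod_mset M"
      by (rule size_le_prod_mset) (use M(1) assms in \<open>auto simp: base_ok_def\<close>)
    then have "size M \<le> n" using M(2) by simp
    moreover obtain xs where "mset xs = M" using ex_mset by blast
    ultimately show "M \<in> mset ` {xs. set xs \<subseteq> B \<and> length xs \<le> n}" using M by (auto intro!: image_eqI[of _ _ xs])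
  qed
  show "finite (mset ` {xs. set xs \<subseteq> B \<and> length xs \<le> n})"
    using assms by (intro finite_imageI finite_lists_length_le) (simp add: base_ok_def)
qed

lemma aB_nonneg: "aB B n \<ge> 0"
  by (simp add: aB_def)

lemma aB_zero: "base_ok B \<Longrightarrow> aB B 0 = 0"
proof -
  assume "base_ok B"
  then have "0 \<notin> B" by (auto simp: base_ok_def)
  then have "{M. set_mset M \<subseteq> B \<and> prod_mset M = 0} = {}" by (auto simp: prod_mset_zero_iff)
  then show ?thesis unfolding aB_def by (simp only: card.empty of_nat_0)
qed

lemma aB_empty: "aB {} n = (if n = 1 then 1 else 0)"
proof -
  have "{M. set_mset M \<subseteq> {} \<and> prod_mset M = n} = (if n = 1 then {{#}} else {})" by auto
  then show ?thesis unfolding aB_def by simp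
qed

lemma aB_rec:
  assumes B: "base_ok B" and b: "b \<in> B"
  shows "aB B n = aB (B - {b}) n + (if b dvd n then aB B (n div b) else 0)"
proof -
  have b2: "b \<ge> 2" using B b by (auto simp: base_ok_def)
  let ?S = "{M. set_mset M \<subseteq> B \<and> prod_mset M = n}"
  let ?S1 = "{M. set_mset M \<subseteq> B - {b} \<and> prod_mset M = n}"
  let ?S2 = "{M. b \<in># M \<and> set_mset M \<subseteq> B \<and> prod_mset M = n}"
  have fin: "finite ?S" by (rule finite_factorizations[OF B])
  have S: "?S = ?S1 \<union> ?S2" by blast
  have fin12: "finite ?S1" "finite ?S2" using fin unfolding S by simp_all
  have "?S1 \<inter> ?S2 = {}" by blast
  then have card: "card ?S = card ?S1 + card ?S2" unfolding S by (rule card_Un_disjoint[OF fin12])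
  have "card ?S2 = (if b dvd n then card {M. set_mset M \<subseteq> B \<and> prod_mset M = n div b} else 0)"
  proof (cases "b dvd n")
    case True
    have "?S2 = add_mset b ` {M. set_mset M \<subseteq> B \<and> prod_mset M = n div b}"
    proof (intro equalityI subsetI)
      fix M assume M: "M \<in> ?S2"
      then have "b \<in># M" by blast
      from multi_member_split[OF this] obtain M' where M': "M = add_mset b M'" by (rule exE)
      have "b * prod_mset M' = n" using M unfolding M' mem_Collect_eq prod_mset.add_mset by blast
      then have "prod_mset M' = n div b" using b2 by auto
      then show "M \<in> add_mset b ` {M. set_mset M \<subseteq> B \<and> prod_mset M = n div b}" 
        using M unfolding M' by (intro imageI) simp
    next
      fix M assume "M \<in> add_mset b ` {M. set_mset M \<subseteq> B \<and> prod_mset M = n div b}"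
      then show "M \<in> ?S2" using b True by auto
    qed
    then show ?thesis using True by (simp add: card_image inj_on_def)
  next
    case False
    then have e: "?S2 = {}" using dvd_prod_mset by fastforce
    show ?thesis unfolding e using False by simp
  qed
  then show ?thesis using card by (simp add: aB_def)
qed

lemma aB_insert:
  assumes "base_ok (insert b B)" "b \<notin> B"
  shows "aB (insert b B) n = aB B n + (if b dvd n then aB (insert b B) (n div b) else 0)"
  using aB_rec[OF assms(1), of b n] assms(2) by simp

lemma sums_multiples:
  fixes f g :: "nat \<Rightarrow> 'a::real_normed_vector" and b :: nat
  assumes "b > 0" and "\<And>n. f (b * n) = g n" and "\<And>n. \<not> b dvd n \<Longrightarrow> f n = 0" and "g sums s"
  shows "f sums s"
proof -
  have "(\<lambda>n. f (b * n)) sums s" using assms(2,4) by simp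
  moreover have "strict_mono ((*) b)" using assms(1) by (simp add: strict_mono_def)
  moreover have "f n = 0" if "n \<notin> range ((*) b)" for n using that assms(3)[of n] by (auto simp: dvd_def)
  ultimately show ?thesis using sums_mono_reindex[of "(*) b" f s] by simp
qed

lemma adm_aB:
  assumes "base_ok B"
  shows "adm 0 (aB B)"
proof -
  have "finite B" using assms by (simp add: base_ok_def)
  then have "base_ok B \<Longrightarrow> \<forall>\<sigma>>0. summable (\<lambda>n. aB B n * real n powr (- 2 * \<sigma>))"
  proof (induction B rule: finite_induct)
    case empty
    show ?case
    proof (intro allI impI)
      fix \<sigma> :: real assume "\<sigma> > 0"
      have "(\<lambda>n. aB {} n * real n powr (- 2 * \<sigma>)) = (\<lambda>n. if n = 1 then 1 else 0)" by (auto simp: aB_empty)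
      then show "summable (\<lambda>n. aB {} n * real n powr (- 2 * \<sigma>))" by simp
    qed
  next
    case (insert b B)
    have b2: "b \<ge> 2" and okB: "base_ok B" using insert.prems by auto
    show ?case
    proof (intro allI impI)
      fix \<sigma> :: real assume \<sigma>: "\<sigma> > 0"
      define x where "x n = aB (insert b B) n * real n powr (- 2 * \<sigma>)" for n
      define y where "y n = aB B n * real n powr (- 2 * \<sigma>)" for n
      define c where "c = real b powr (- 2 * \<sigma>)"
      have c: "c < 1" "c > 0" using b2 \<sigma> by (auto simp: c_def powr_less_one)
      have x0: "x n \<ge> 0" and y0: "y n \<ge> 0" for n by (auto simp: x_def y_def aB_nonneg)
      have sy: "summable y" using insert.IH[OF okB] \<sigma> by (simp add: y_def[abs_def])
      define A where "A = suminf y"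
      have A: "sum y {..<N} \<le> A" for N unfolding A_def using y0 by (intro sum_le_suminf sy) auto
      have xb: "x (b * m) = y (b * m) + c * x m" for m
        using aB_insert[OF insert.prems insert.hyps(2), of "b * m"] b2
        by (simp add: x_def y_def c_def powr_mult algebra_simps)
      have xn: "x n = y n" if "\<not> b dvd n" for n
        using aB_insert[OF insert.prems insert.hyps(2), of n] that by (simp add: x_def y_def)
      have "sum x {..<N} \<le> A / (1 - c)" for N
      proof -
        have "sum x {..<N} \<le> sum y {..<N} + (\<Sum>n\<in>{n. n < N \<and> b dvd n}. c * x (n div b))"
        proof -
          have "x n \<le> y n + (if b dvd n then c * x (n div b) else 0)" for n
            using xb[of "n div b"] xn[of n] by auto
          then have "sum x {..<N} \<le> (\<Sum>n<N. y n + (if b dvd n then c * x (n div b) else 0))" by (rule sum_mono)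
          also have "\<dots> = sum y {..<N} + (\<Sum>n\<in>{n. n < N \<and> b dvd n}. c * x (n div b))"
            by (simp add: sum.distrib sum.If_cases lessThan_def Collect_conj_eq)
          finally show ?thesis .
        qed
        also have "(\<Sum>n\<in>{n. n < N \<and> b dvd n}. c * x (n div b)) = (\<Sum>m\<in>(\<lambda>n. n div b) ` {n. n < N \<and> b dvd n}. c * x m)"
        proof (subst sum.reindex)
          show "inj_on (\<lambda>n. n div b) {n. n < N \<and> b dvd n}"
          proof (rule inj_onI)
            fix i i' assume i: "i \<in> {n. n < N \<and> b dvd n}" and i': "i' \<in> {n. n < N \<and> b dvd n}" and eq: "i div b = i' div b"
            have 1: "b * (i div b) = i" using i by simp
            have 2: "b * (i' div b) = i'" using i' by simp
            show "i = i'" using 1 unfolding eq 2 by (rule sym)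
          qed
        qed simp
        also have "\<dots> \<le> (\<Sum>m<N. c * x m)"
          using c x0 b2 by (intro sum_mono2) (auto intro: le_less_trans[OF div_le_dividend])
        also have "\<dots> = c * sum x {..<N}" by (simp add: sum_distrib_left)
        finally have "(1 - c) * sum x {..<N} \<le> A" using A[of N] by (simp add: algebra_simps)
        then show ?thesis using c by (simp add: pos_le_divide_eq mult.commute)
      qed
      then have "summable x" using x0 by (intro summableI_nonneg_bounded) auto
      then show "summable (\<lambda>n. aB (insert b B) n * real n powr (- 2 * \<sigma>))" by (simp add: x_def[abs_def])
    qed
  qed
  then show ?thesis using assms aB_zero[OF assms] aB_nonneg unfolding adm_def by simp
qed

lemma euler_factor_nonzero:
  assumes "b \<ge> 2" "Re s > 0"
  shows "1 - of_nat b powr (- s) \<noteq> (0::complex)"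
proof
  assume "1 - of_nat b powr (- s) = (0::complex)"
  then have "norm ((of_nat b :: complex) powr (- s)) = 1" by simp
  then have "real b powr (- Re s) = 1" using assms norm_powr_real_powr[of "of_nat b" "- s"] by simp
  moreover have "real b powr (- Re s) < 1" using assms by (simp add: powr_less_one)
  ultimately show False by simp
qed

lemma aB_dirichlet_sums:
  assumes "base_ok B" "Re w > 0"
  shows "(\<lambda>n. of_real (aB B n) * of_nat n powr (- 2 * w)) sums zeta_B B (2 * w)"
proof -
  have "finite B" using assms by (simp add: base_ok_def)
  then show ?thesis using assms(1)
  proof (induction B rule: finite_induct)
    case empty
    have "(\<lambda>n. of_real (aB {} n) * (of_nat n :: complex) powr (- 2 * w)) = (\<lambda>n. if n = 1 then 1 else 0)"
      by (auto simp: aB_empty)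
    then show ?case using sums_single[of 1 "\<lambda>_. 1::complex"] by (simp add: zeta_B_def)
  next
    case (insert b B)
    have b2: "b \<ge> 2" and okB: "base_ok B" using insert.prems by auto
    define X where "X n = of_real (aB (insert b B) n) * (of_nat n :: complex) powr (- 2 * w)" for n
    define c where "c = (of_nat b :: complex) powr (- 2 * w)"
    have "summable X" unfolding X_def
      by (rule Psi_mellin(3)[OF adm_aB[OF insert.prems]]) (use assms in simp)
    then obtain s where s: "X sums s" by (auto simp: summable_def)
    have "(\<lambda>n. if b dvd n then c * X (n div b) else 0) sums (c * s)"
      by (rule sums_multiples[where b = b and g = "\<lambda>n. c * X n", OF _ _ _ sums_mult[OF s]]) (use b2 in simp_all)
    with insert.IH[OF okB] have "(\<lambda>n. of_real (aB B n) * of_nat n powr (- 2 * w) + (if b dvd n then c * X (n div b) else 0)) sums (zeta_B B (2 * w) + c * s)"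
      by (rule sums_add)
    also have "(\<lambda>n. of_real (aB B n) * of_nat n powr (- 2 * w) + (if b dvd n then c * X (n div b) else 0)) = X"
    proof
      fix n
      have m: "(of_nat (b * m) :: complex) powr (- 2 * w) = c * of_nat m powr (- 2 * w)" for m
        unfolding c_def of_nat_mult by (rule powr_times_real) simp_all
      show "of_real (aB B n) * of_nat n powr (- 2 * w) + (if b dvd n then c * X (n div b) else 0) = X n"
      proof (cases "b dvd n")
        case True
        then obtain m where n: "n = b * m" by (elim dvdE)
        have A: "aB (insert b B) (b * m) = aB B (b * m) + aB (insert b B) m"
          using aB_insert[OF insert.prems insert.hyps(2), of "b * m"] b2 by simp
        have d: "b * m div b = m" using b2 by simp
        have t: "x * (c * z) + c * (y * z) = (x + y) * (c * z)" for x y z :: complex by (simp add: algebra_simps)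
        show ?thesis unfolding n X_def m A d of_real_add using t by (simp only: dvd_triv_left if_True)
      next
        case False
        then show ?thesis using aB_insert[OF insert.prems insert.hyps(2), of n] by (simp add: X_def)
      qed
    qed
    finally have "s = zeta_B B (2 * w) + c * s" using s by (rule sums_unique2[rotated])
    then have "(1 - c) * s = zeta_B B (2 * w)" by (simp add: algebra_simps)
    moreover have "1 - c \<noteq> 0" using euler_factor_nonzero[OF b2, of "2 * w"] assms(2) by (simp add: c_def)
    ultimately have "s = zeta_B (insert b B) (2 * w)"
      using insert.hyps by (simp add: zeta_B_def c_def field_simps)
    then show ?case using s by (simp add: X_def[abs_def])
  qed
qed

lemma Psi_aB_rec:
  assumes ok: "base_ok (insert b B)" and b: "b \<notin> B" and u: "u > 0"
  shows "Psi (aB (insert b B)) p u = Psi (aB B) p u + Psi (aB (insert b B)) p ((real b)\<^sup>2 * u)"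
proof -
  have b2: "b \<ge> 2" and okB: "base_ok B" using ok by auto
  define Y where "Y n = aB (insert b B) n * pe p ((real n)\<^sup>2 * ((real b)\<^sup>2 * u))" for n
  have Ys: "Y sums Psi (aB (insert b B)) p ((real b)\<^sup>2 * u)"
    unfolding Y_def by (rule Psi_sums[OF adm_aB[OF ok]]) (use b2 u in simp)
  have "(\<lambda>n. if b dvd n then Y (n div b) else 0) sums Psi (aB (insert b B)) p ((real b)\<^sup>2 * u)"
    by (rule sums_multiples[where b = b and g = Y, OF _ _ _ Ys]) (use b2 in simp_all)
  with Psi_sums[OF adm_aB[OF okB] u, of p]
  have "(\<lambda>n. aB B n * pe p ((real n)\<^sup>2 * u) + (if b dvd n then Y (n div b) else 0)) sums
      (Psi (aB B) p u + Psi (aB (insert b B)) p ((real b)\<^sup>2 * u))"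
    by (rule sums_add)
  also have "(\<lambda>n. aB B n * pe p ((real n)\<^sup>2 * u) + (if b dvd n then Y (n div b) else 0)) = (\<lambda>n. aB (insert b B) n * pe p ((real n)\<^sup>2 * u))"
  proof
    fix n
    show "aB B n * pe p ((real n)\<^sup>2 * u) + (if b dvd n then Y (n div b) else 0) = aB (insert b B) n * pe p ((real n)\<^sup>2 * u)"
    proof (cases "b dvd n")
      case True
      then obtain m where n: "n = b * m" by (elim dvdE)
      have "(real (b * m))\<^sup>2 * u = (real m)\<^sup>2 * ((real b)\<^sup>2 * u)" by (simp add: power_mult_distrib)
      moreover have "aB (insert b B) (b * m) = aB B (b * m) + aB (insert b B) m"
        using aB_insert[OF ok b, of "b * m"] b2 by simp
      moreover have "b * m div b = m" using b2 by simp
      ultimately show ?thesis unfolding n Y_def by (simp only: dvd_triv_left if_True distrib_right)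
    next
      case False
      then show ?thesis using aB_insert[OF ok b, of n] by simp
    qed
  qed
  finally show ?thesis using Psi_sums[OF adm_aB[OF ok] u, of p] by (rule sums_unique2[rotated])
qed

lemma aB_primes:
  assumes "\<forall>b\<in>B. prime b" "n > 0"
  shows "aB B n = (if prime_factors n \<subseteq> B then 1 else 0)"
proof -
  have "{M. set_mset M \<subseteq> B \<and> prod_mset M = n} = (if prime_factors n \<subseteq> B then {prime_factorization n} else {})"
  proof -
    have "M = prime_factorization n" if "set_mset M \<subseteq> B" "prod_mset M = n" for M
    proof -
      have "prime_factorization (prod_mset M) = M"
        by (rule prime_factorization_prod_mset_primes) (use that(1) assms(1) in blast)
      then show ?thesis unfolding that(2) by (rule sym)
    qed
    note U = this
    have P: "prod_mset (prime_factorization n) = n" using assms(2) by (simp add: prod_mset_prime_factorization_nat)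
    show ?thesis
    proof (cases "prime_factors n \<subseteq> B")
      case True
      have "{M. set_mset M \<subseteq> B \<and> prod_mset M = n} = {prime_factorization n}"
      proof (intro equalityI subsetI)
        fix M assume "M \<in> {M. set_mset M \<subseteq> B \<and> prod_mset M = n}"
        then show "M \<in> {prime_factorization n}" using U[of M] by simp
      next
        fix M assume "M \<in> {prime_factorization n}"
        then have "M = prime_factorization n" by (rule singletonD)
        then show "M \<in> {M. set_mset M \<subseteq> B \<and> prod_mset M = n}" using True P by (simp only: mem_Collect_eq)
      qed
      then show ?thesis by (simp only: True if_True)
    next
      case False
      have "{M. set_mset M \<subseteq> B \<and> prod_mset M = n} = {}"
      proof (rule equals0I)
        fix M assume M: "M \<in> {M. set_mset M \<subseteq> B \<and> prod_mset M = n}"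
        have "M = prime_factorization n" using U[of M] M by simp
        then show False using M False by simp
      qed
      then show ?thesis by (simp only: False if_False)
    qed
  qed
  then show ?thesis by (simp add: aB_def)
qed

lemma aB_insert_le:
  assumes B: "\<forall>b\<in>B. prime b" "finite B" and q: "q \<ge> 2" "q \<notin> B"
  shows "aB (insert q B) n \<le> real n"
proof (induction n rule: less_induct)
  case (less n)
  have okB: "base_ok B" unfolding base_ok_def using B prime_ge_2_nat by blast
  then have ok: "base_ok (insert q B)" using q by simp
  show ?case
  proof (cases "n = 0")
    case False
    have 1: "aB B n \<le> 1" using aB_primes[OF B(1), of n] False by simp
    show ?thesis
    proof (cases "q dvd n")
      case True
      then obtain m where m: "n = q * m" by (elim dvdE)
      have m0: "m > 0" using m False by simp
      have "2 * m \<le> n" using q m by simp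
      have "m < n" using \<open>2 * m \<le> n\<close> m0 by linarith
      have "aB (insert q B) n \<le> 1 + aB (insert q B) m"
      proof -
        have "aB (insert q B) n = aB B n + aB (insert q B) (n div q)" using aB_insert[OF ok q(2), of n] True by simp
        moreover have "n div q = m" using m q by simp
        ultimately show ?thesis using 1 by simp
      qed
      also have "\<dots> \<le> 1 + real m" using less.IH[OF \<open>m < n\<close>] by simp
      also have "\<dots> \<le> real n" using \<open>2 * m \<le> n\<close> m0 by linarith
      finally show ?thesis .
    next
      case False
      then show ?thesis using aB_insert[OF ok q(2), of n] 1 \<open>n \<noteq> 0\<close> by simp
    qed
  qed (simp add: aB_zero[OF ok])
qed

section \<open>Estimates of the terms\<close>

text \<open>With \<open>E = 2 u d/du\<close>, the operator \<open>E (E + 1)\<close> on functions of the form \<open>pe p\<close>.\<close>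
definition LL :: "real poly \<Rightarrow> real poly" where
  "LL p = Polynomial.smult 2 (dop (p + Polynomial.smult 2 (dop p)))"

lemma coeff_LL:
  "coeff (LL p) e = (4 * real e ^ 2 + 2 * real e) * coeff p e
     - (if e \<ge> 1 then (8 * real e - 2) * coeff p (e - 1) else 0) + (if e \<ge> 2 then 4 * coeff p (e - 2) else 0)"
proof -
  consider "e = 0" | "e = 1" | d where "e = Suc (Suc d)" by (metis One_nat_def not0_implies_Suc)
  then show ?thesis
    by cases (simp_all add: LL_def coeff_dop power2_eq_square algebra_simps)
qed

definition LS :: "nat \<Rightarrow> real" where
  "LS j = 2 * real j ^ 2 - real j / 2"

lemma LS_nonneg: "LS j \<ge> 0"
proof (cases j)
  case (Suc i)
  have "real j \<le> real j ^ 2" using Suc by (simp add: power2_eq_square)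
  then show ?thesis unfolding LS_def by linarith
qed (simp add: LS_def)

lemma LS_Suc: "LS (Suc j) = LS j + (4 * real j + 3 / 2)"
  by (simp add: LS_def power2_eq_square field_simps)

definition dpow :: "real \<Rightarrow> nat \<Rightarrow> real" where
  "dpow x i = x ^ i / fact i"

lemma dpow_add: "dpow (x + y) n = (\<Sum>k\<le>n. dpow x (n - k) * dpow y k)"
proof -
  have "dpow (x + y) n = (\<Sum>k\<le>n. real (n choose k) * y ^ k * x ^ (n - k)) / fact n"
    unfolding dpow_def by (subst add.commute, subst binomial_ring) simp
  also have "\<dots> = (\<Sum>k\<le>n. dpow x (n - k) * dpow y k)"
    unfolding sum_divide_distrib
  proof (intro sum.cong refl)
    fix k assume "k \<in> {..n}"
    then have "real (n choose k) = fact n / (fact k * fact (n - k))" by (simp add: binomial_fact)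
    then show "real (n choose k) * y ^ k * x ^ (n - k) / fact n = dpow x (n - k) * dpow y k"
      by (simp add: dpow_def mult_ac)
  qed
  finally show ?thesis .
qed

lemma dpow_add_ge:
  assumes "x \<ge> 0" "y \<ge> 0"
  shows "dpow (x + y) n \<ge> dpow x n + (if n \<ge> 1 then y * dpow x (n - 1) else 0) + (if n \<ge> 2 then y\<^sup>2 / 2 * dpow x (n - 2) else 0)"
proof -
  have nn: "dpow x (n - k) * dpow y k \<ge> 0" for k using assms by (simp add: dpow_def)
  have f2: "(fact 2 :: real) = 2" by (simp add: eval_nat_numeral)
  have "(\<Sum>k\<in>{..min n 2}. dpow x (n - k) * dpow y k) \<le> (\<Sum>k\<le>n. dpow x (n - k) * dpow y k)"
    using nn by (intro sum_mono2) auto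
  moreover have "(\<Sum>k\<in>{..min n 2}. dpow x (n - k) * dpow y k)
     = dpow x n + (if n \<ge> 1 then y * dpow x (n - 1) else 0) + (if n \<ge> 2 then y\<^sup>2 / 2 * dpow x (n - 2) else 0)"
  proof -
    consider "n = 0" | "n = 1" | "n \<ge> 2" by linarith
    then show ?thesis
    proof cases
      case 3
      then have "{..min n 2} = {0, 1, 2}" by auto
      then show ?thesis using 3 f2 by (simp add: dpow_def mult_ac)
    qed (auto simp: dpow_def atMost_Suc)
  qed
  ultimately show ?thesis unfolding dpow_add by linarith
qed

lemma coeff_LL_power:
  shows "e > 2 * j \<Longrightarrow> coeff ((LL ^^ j) 1) e = 0"
    and "coeff ((LL ^^ j) 1) (2 * j) = 4 ^ j"
    and "e \<le> 2 * j \<Longrightarrow> \<bar>coeff ((LL ^^ j) 1) e\<bar> \<le> 4 ^ j * dpow (LS j) (2 * j - e)"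
proof -
  have *: "(\<forall>e>2 * j. coeff ((LL ^^ j) 1) e = 0) \<and> coeff ((LL ^^ j) 1) (2 * j) = 4 ^ j \<and>
      (\<forall>e\<le>2 * j. \<bar>coeff ((LL ^^ j) 1) e\<bar> \<le> 4 ^ j * dpow (LS j) (2 * j - e))"
  proof (induction j)
    case 0
    show ?case by (auto simp: dpow_def coeff_eq_0)
  next
    case (Suc j)
    define P where "P = (LL ^^ j) (1 :: real poly)"
    have P: "(LL ^^ Suc j) 1 = LL P" by (simp add: P_def)
    have P1: "coeff P e = 0" if "e > 2 * j" for e using Suc.IH that by (simp add: P_def)
    have P2: "coeff P (2 * j) = 4 ^ j" using Suc.IH by (simp add: P_def)
    have P3: "\<bar>coeff P e\<bar> \<le> 4 ^ j * dpow (LS j) (2 * j - e)" if "e \<le> 2 * j" for e using Suc.IH that by (simp add: P_def)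
    have dp0: "dpow (LS j) i \<ge> 0" for i using LS_nonneg by (simp add: dpow_def)
    define S where "S = LS j"
    define \<delta> where "\<delta> = 4 * real j + 3 / 2"
    have "\<bar>coeff (LL P) e\<bar> \<le> 4 ^ Suc j * dpow (LS (Suc j)) (2 * Suc j - e)" if e: "e \<le> 2 * Suc j" for e
    proof -
      define i where "i = 2 * Suc j - e"
      have t2: "(if e \<ge> 2 then 4 * \<bar>coeff P (e - 2)\<bar> else 0) \<le> 4 ^ j * (4 * dpow S i)"
      proof (cases "e \<ge> 2")
        case True
        then have "e - 2 \<le> 2 * j" "2 * j - (e - 2) = i" using e by (auto simp: i_def)
        then show ?thesis using P3[of "e - 2"] True by (simp add: S_def)
      qed (use dp0 in \<open>simp add: S_def\<close>)
      have e_le: "8 * real e - 2 \<le> 4 * \<delta>" if "i \<ge> 1"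
      proof -
        have "e \<le> 2 * j + 1" using that by (simp add: i_def)
        then have "real e \<le> 2 * real j + 1" by linarith
        then show ?thesis by (simp add: \<delta>_def)
      qed
      have t1: "(if e \<ge> 1 then (8 * real e - 2) * \<bar>coeff P (e - 1)\<bar> else 0) \<le> 4 ^ j * (4 * (if i \<ge> 1 then \<delta> * dpow S (i - 1) else 0))"
      proof (cases "e \<ge> 1 \<and> i \<ge> 1")
        case True
        then have "e - 1 \<le> 2 * j" "2 * j - (e - 1) = i - 1" using e by (auto simp: i_def)
        then have "\<bar>coeff P (e - 1)\<bar> \<le> 4 ^ j * dpow S (i - 1)" using P3[of "e - 1"] by (simp add: S_def)
        then have "(8 * real e - 2) * \<bar>coeff P (e - 1)\<bar> \<le> (4 * \<delta>) * (4 ^ j * dpow S (i - 1))"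
          using e_le True by (intro mult_mono) (auto simp: \<delta>_def)
        then show ?thesis using True by (simp add: mult_ac)
      next
        case False
        then show ?thesis using e P1[of "e - 1"] dp0[of "i - 1"] by (auto simp: i_def S_def \<delta>_def)
      qed
      have t0: "(4 * real e ^ 2 + 2 * real e) * \<bar>coeff P e\<bar> \<le> 4 ^ j * (4 * (if i \<ge> 2 then \<delta>\<^sup>2 / 2 * dpow S (i - 2) else 0))"
      proof (cases "i \<ge> 2")
        case True
        then have "e \<le> 2 * j" "2 * j - e = i - 2" by (auto simp: i_def)
        then have c: "\<bar>coeff P e\<bar> \<le> 4 ^ j * dpow S (i - 2)" using P3[of e] by (simp add: S_def)
        have er: "real e \<le> 2 * real j" using \<open>e \<le> 2 * j\<close> by linarith
        have "real e ^ 2 \<le> (2 * real j) ^ 2" using er by (intro power_mono) auto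
        then have "4 * real e ^ 2 + 2 * real e \<le> 16 * real j ^ 2 + 4 * real j" using er by (simp add: power_mult_distrib)
        also have "\<dots> \<le> 4 * (\<delta>\<^sup>2 / 2)" by (simp add: \<delta>_def power2_eq_square algebra_simps)
        finally have "(4 * real e ^ 2 + 2 * real e) * \<bar>coeff P e\<bar> \<le> (4 * (\<delta>\<^sup>2 / 2)) * (4 ^ j * dpow S (i - 2))"
          using c by (intro mult_mono) auto
        then show ?thesis using True by (simp add: mult_ac)
      next
        case False
        then have "e > 2 * j" using e by (simp add: i_def)
        then show ?thesis using False P1[of e] by simp
      qed
      have "\<bar>coeff (LL P) e\<bar> \<le> (4 * real e ^ 2 + 2 * real e) * \<bar>coeff P e\<bar> + (if e \<ge> 1 then (8 * real e - 2) * \<bar>coeff P (e - 1)\<bar> else 0)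
          + (if e \<ge> 2 then 4 * \<bar>coeff P (e - 2)\<bar> else 0)"
      proof -
        have tri: "\<bar>x - y + z\<bar> \<le> \<bar>x\<bar> + \<bar>y\<bar> + \<bar>z\<bar>" for x y z :: real by arith
        have a0: "\<bar>(4 * real e ^ 2 + 2 * real e) * coeff P e\<bar> = (4 * real e ^ 2 + 2 * real e) * \<bar>coeff P e\<bar>"
          unfolding abs_mult by simp
        have a1: "\<bar>if e \<ge> 1 then (8 * real e - 2) * coeff P (e - 1) else 0\<bar> = (if e \<ge> 1 then (8 * real e - 2) * \<bar>coeff P (e - 1)\<bar> else 0)"
          by (auto simp: abs_mult)
        have a2: "\<bar>if e \<ge> 2 then 4 * coeff P (e - 2) else 0\<bar> = (if e \<ge> 2 then 4 * \<bar>coeff P (e - 2)\<bar> else 0)"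
          by (simp add: abs_mult)
        show ?thesis unfolding coeff_LL a0[symmetric] a1[symmetric] a2[symmetric] by (rule tri)
      qed
      also have "\<dots> \<le> 4 ^ j * (4 * (if i \<ge> 2 then \<delta>\<^sup>2 / 2 * dpow S (i - 2) else 0)) + 4 ^ j * (4 * (if i \<ge> 1 then \<delta> * dpow S (i - 1) else 0)) + 4 ^ j * (4 * dpow S i)"
        by (intro add_mono t0 t1 t2)
      also have "\<dots> = 4 ^ Suc j * (dpow S i + (if i \<ge> 1 then \<delta> * dpow S (i - 1) else 0) + (if i \<ge> 2 then \<delta>\<^sup>2 / 2 * dpow S (i - 2) else 0))"
        by (simp add: algebra_simps)
      also have "\<dots> \<le> 4 ^ Suc j * dpow (S + \<delta>) i"
        by (intro mult_left_mono dpow_add_ge) (auto simp: S_def \<delta>_def LS_nonneg)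
      also have "S + \<delta> = LS (Suc j)" by (simp add: S_def \<delta>_def LS_Suc)
      finally show ?thesis by (simp add: i_def)
    qed
    moreover have "coeff (LL P) e = 0" if "e > 2 * Suc j" for e
      using that by (simp add: coeff_LL P1)
    moreover have "coeff (LL P) (2 * Suc j) = 4 ^ Suc j"
      using P1[of "2 * Suc j"] P1[of "2 * Suc j - 1"] P2 by (simp add: coeff_LL)
    ultimately show ?case unfolding P by blast
  qed
  show "e > 2 * j \<Longrightarrow> coeff ((LL ^^ j) 1) e = 0" using * by simp
  show "coeff ((LL ^^ j) 1) (2 * j) = 4 ^ j" using * by simp
  show "e \<le> 2 * j \<Longrightarrow> \<bar>coeff ((LL ^^ j) 1) e\<bar> \<le> 4 ^ j * dpow (LS j) (2 * j - e)" using * by simp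
qed

lemma poly_LL_power_approx:
  assumes v: "v > 0"
  shows "\<bar>poly ((LL ^^ j) 1) v - 4 ^ j * v ^ (2 * j)\<bar> \<le> 4 ^ j * v ^ (2 * j) * (exp (LS j / v) - 1)"
proof -
  define P where "P = (LL ^^ j) (1 :: real poly)"
  have "degree P \<le> 2 * j" unfolding P_def by (rule degree_le) (simp add: coeff_LL_power(1))
  then have "poly P v = (\<Sum>e\<le>2 * j. coeff P e * v ^ e)"
    unfolding poly_altdef by (intro sum.mono_neutral_left) (auto simp: coeff_eq_0)
  also have "\<dots> = coeff P (2 * j) * v ^ (2 * j) + (\<Sum>e<2 * j. coeff P e * v ^ e)"
    by (subst lessThan_Suc_atMost[symmetric]) simp
  finally have "\<bar>poly P v - 4 ^ j * v ^ (2 * j)\<bar> = \<bar>\<Sum>e<2 * j. coeff P e * v ^ e\<bar>"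
    using coeff_LL_power(2)[of j] by (simp add: P_def)
  also have "\<dots> \<le> (\<Sum>e<2 * j. 4 ^ j * dpow (LS j) (2 * j - e) * v ^ e)"
  proof (intro order.trans[OF sum_abs] sum_mono)
    fix e assume "e \<in> {..<2 * j}"
    then show "\<bar>coeff P e * v ^ e\<bar> \<le> 4 ^ j * dpow (LS j) (2 * j - e) * v ^ e"
      using coeff_LL_power(3)[of e j] v by (auto simp: abs_mult P_def intro!: mult_right_mono)
  qed
  also have "\<dots> = 4 ^ j * v ^ (2 * j) * (\<Sum>e<2 * j. dpow (LS j / v) (2 * j - e))"
    unfolding sum_distrib_left
  proof (intro sum.cong refl)
    fix e assume "e \<in> {..<2 * j}"
    then have "v ^ (2 * j) = v ^ (2 * j - e) * v ^ e" by (simp add: power_add[symmetric])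
    then show "4 ^ j * dpow (LS j) (2 * j - e) * v ^ e = 4 ^ j * v ^ (2 * j) * dpow (LS j / v) (2 * j - e)"
      using v by (simp add: dpow_def power_divide)
  qed
  also have "\<dots> \<le> 4 ^ j * v ^ (2 * j) * (exp (LS j / v) - 1)"
  proof (intro mult_left_mono)
    define y where "y = LS j / v"
    have y: "y \<ge> 0" using LS_nonneg v by (simp add: y_def)
    have "(\<lambda>n. dpow y n) sums exp y" using exp_converges[of y] by (simp add: dpow_def divide_inverse mult.commute)
    then have s: "summable (dpow y)" "suminf (dpow y) = exp y" by (auto simp: sums_iff)
    have "(\<Sum>e<2 * j. dpow y (2 * j - e)) = (\<Sum>i\<in>{1..2 * j}. dpow y i)"
      by (rule sum.reindex_bij_witness[of _ "\<lambda>i. 2 * j - i" "\<lambda>e. 2 * j - e"]) auto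
    moreover have "dpow y 0 + (\<Sum>i\<in>{1..2 * j}. dpow y i) = (\<Sum>i\<in>insert 0 {1..2 * j}. dpow y i)" by simp
    moreover have "(\<Sum>i\<in>insert 0 {1..2 * j}. dpow y i) \<le> suminf (dpow y)"
      using y by (intro sum_le_suminf s) (auto simp: dpow_def)
    ultimately show "(\<Sum>e<2 * j. dpow (LS j / v) (2 * j - e)) \<le> exp (LS j / v) - 1"
      using s(2) by (simp add: y_def[symmetric] dpow_def[of y 0])
  qed (use v in simp)
  finally show ?thesis unfolding P_def .
qed

lemma pi_ge_3: "pi \<ge> 3"
  using sin_x_le_x[of "pi / 6"] sin_30 by simp

definition VV :: "nat \<Rightarrow> nat \<Rightarrow> real \<Rightarrow> real" where
  "VV j n u = ((real n)\<^sup>2 * u) ^ (2 * j) * exp (- ((real n)\<^sup>2 * u))"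

definition WW :: "nat \<Rightarrow> nat \<Rightarrow> real \<Rightarrow> real" where
  "WW j n u = pe ((LL ^^ j) 1) ((real n)\<^sup>2 * u)"

lemma exp_two_thirds: "exp (2 / 3 :: real) \<le> 1 + 399 / 400"
proof -
  have "exp (1 / 12 :: real) \<le> 1 + 1 / 12 + (1 / 12)\<^sup>2" by (rule exp_bound) auto
  then have "exp (1 / 12 :: real) ^ 8 \<le> (1 + 1 / 12 + (1 / 12)\<^sup>2) ^ 8" by (rule power_mono) simp
  also have "exp (1 / 12 :: real) ^ 8 = exp (2 / 3)" by (simp add: exp_of_nat_mult[symmetric])
  also have "(1 + 1 / 12 + (1 / 12)\<^sup>2) ^ 8 \<le> (1 + 399 / 400 :: real)" by (simp add: power_divide eval_nat_numeral)
  finally show ?thesis .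
qed

lemma WW_bounds:
  assumes n: "n \<ge> j + 1" and u: "u \<ge> 3"
  shows "\<bar>WW j n u\<bar> \<le> 2 * 4 ^ j * VV j n u" "WW j n u \<ge> 4 ^ j * VV j n u / 400" "VV j n u > 0"
proof -
  define v where "v = (real n)\<^sup>2 * u"
  have v0: "v > 0" using n u by (simp add: v_def)
  have "(real (j + 1))\<^sup>2 \<le> (real n)\<^sup>2" using n by (intro power_mono) auto
  then have "(real (j + 1))\<^sup>2 * 3 \<le> v" unfolding v_def using u by (intro mult_mono) auto
  moreover have "2 * real j ^ 2 \<le> 2 * (real (j + 1))\<^sup>2" by (intro mult_left_mono power_mono) auto
  moreover have "LS j \<le> 2 * real j ^ 2" by (simp add: LS_def)
  ultimately have "LS j \<le> 2 / 3 * v" by linarith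
  then have "LS j / v \<le> 2 / 3" using v0 by (simp add: divide_le_eq)
  then have "exp (LS j / v) \<le> exp (2 / 3)" by simp
  then have e: "exp (LS j / v) - 1 \<le> 399 / 400" using exp_two_thirds by linarith
  define A where "A = 4 ^ j * v ^ (2 * j)"
  have A: "A > 0" using v0 by (simp add: A_def)
  have "\<bar>poly ((LL ^^ j) 1) v - A\<bar> \<le> A * (exp (LS j / v) - 1)"
    unfolding A_def by (rule poly_LL_power_approx[OF v0])
  also have "\<dots> \<le> A * (399 / 400)" using e A by (intro mult_left_mono) auto
  finally have 1: "\<bar>poly ((LL ^^ j) 1) v - A\<bar> \<le> A * (399 / 400)" .
  have lo: "poly ((LL ^^ j) 1) v \<ge> A / 400" and hi: "\<bar>poly ((LL ^^ j) 1) v\<bar> \<le> 2 * A" using 1 A by linarith+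
  have VVA: "4 ^ j * VV j n u = A * exp (- v)" by (simp add: VV_def A_def v_def)
  have WWv: "WW j n u = poly ((LL ^^ j) 1) v * exp (- v)" by (simp add: WW_def pe_def v_def)
  show "\<bar>WW j n u\<bar> \<le> 2 * 4 ^ j * VV j n u"
  proof -
    have "\<bar>WW j n u\<bar> \<le> 2 * A * exp (- v)" unfolding WWv abs_mult abs_exp_cancel by (rule mult_right_mono[OF hi]) simp
    also have "\<dots> = 2 * 4 ^ j * VV j n u" unfolding mult.assoc VVA ..
    finally show ?thesis .
  qed
  show "WW j n u \<ge> 4 ^ j * VV j n u / 400"
  proof -
    have "A / 400 * exp (- v) \<le> WW j n u" unfolding WWv by (rule mult_right_mono[OF lo]) simp
    then show ?thesis unfolding VVA by simp
  qed
  show "VV j n u > 0" using v0 by (simp add: VV_def v_def)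
qed

lemma VV_step:
  assumes n: "n \<ge> j" "n \<ge> 1" and u: "u \<ge> 3"
  shows "VV j (n + 1) u \<le> VV j n u * exp (4 - (2 * real n + 1) * u)"
proof -
  have "(1 + 1 / real n) ^ (4 * j) \<le> exp (1 / real n) ^ (4 * j)"
    using exp_ge_add_one_self[of "1 / real n"] by (intro power_mono) auto
  also have "\<dots> = exp (real (4 * j) * (1 / real n))" by (rule exp_of_nat_mult[symmetric])
  also have "\<dots> \<le> exp 4" using n by (simp add: divide_le_eq)
  finally have 1: "(1 + 1 / real n) ^ (4 * j) \<le> exp 4" .
  have "real (n + 1) = real n * (1 + 1 / real n)" using n by (simp add: field_simps)
  then have "((real (n + 1))\<^sup>2 * u) ^ (2 * j) = ((real n)\<^sup>2 * u) ^ (2 * j) * (1 + 1 / real n) ^ (4 * j)"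
    by (simp add: power_mult_distrib power_mult[symmetric])
  also have "\<dots> \<le> ((real n)\<^sup>2 * u) ^ (2 * j) * exp 4"
    using 1 u by (intro mult_left_mono) auto
  finally have "VV j (n + 1) u \<le> ((real n)\<^sup>2 * u) ^ (2 * j) * exp 4 * exp (- ((real (n + 1))\<^sup>2 * u))"
    unfolding VV_def by (rule mult_right_mono) simp
  also have "exp (- ((real (n + 1))\<^sup>2 * u)) = exp (- ((real n)\<^sup>2 * u)) * exp (- ((2 * real n + 1) * u))"
    unfolding exp_add[symmetric] by (simp add: power2_eq_square algebra_simps)
  also have "((real n)\<^sup>2 * u) ^ (2 * j) * exp 4 * (exp (- ((real n)\<^sup>2 * u)) * exp (- ((2 * real n + 1) * u)))
     = VV j n u * exp (4 - (2 * real n + 1) * u)"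
    by (simp add: VV_def exp_diff exp_minus divide_inverse)
  finally show ?thesis .
qed

lemma VV_geometric:
  assumes N: "N \<ge> j" "N \<ge> 1" and u: "u \<ge> 3"
  shows "VV j (N + g) u \<le> VV j N u * exp (4 - (2 * real N + 1) * u) ^ g"
proof (induction g)
  case (Suc g)
  have V0: "VV j N u \<ge> 0" unfolding VV_def using u by simp
  have "VV j (N + Suc g) u \<le> VV j (N + g) u * exp (4 - (2 * real (N + g) + 1) * u)"
    using VV_step[of j "N + g" u] N u by simp
  also have "\<dots> \<le> (VV j N u * exp (4 - (2 * real N + 1) * u) ^ g) * exp (4 - (2 * real N + 1) * u)"
    using Suc.IH V0 u by (intro mult_mono) (auto intro!: mult_right_mono)
  finally show ?case by (simp add: mult_ac)
qed simp

text \<open>The first omitted index dominates the rest of the series by a factor exponential in \<open>N\<close>.\<close>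
lemma WW_tail:
  fixes c :: "nat \<Rightarrow> real"
  assumes N: "N \<ge> j + 1" "N \<ge> 3" and u: "u \<ge> 3"
    and c: "\<And>n. n \<le> N \<Longrightarrow> c n = 0" "\<And>n. \<bar>c n\<bar> \<le> real n"
  shows "summable (\<lambda>n. c n * WW j n u)"
    and "\<bar>\<Sum>n. c n * WW j n u\<bar> \<le> 4 ^ j * VV j N u / 2000"
proof -
  define r where "r = exp (4 - (2 * real N + 1) * u)"
  define s where "s = exp 1 * r"
  have r0: "r > 0" by (simp add: r_def)
  have V0: "VV j N u \<ge> 0" unfolding VV_def using u by simp
  have Ns: "real N * s \<le> 1 / 16000" and s1: "s \<le> 1 / 2"
  proof -
    have "(2 * real N + 1) * 3 \<le> (2 * real N + 1) * u" using u by (intro mult_left_mono) auto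
    then have "6 * real N + 3 \<le> (2 * real N + 1) * u" by (simp only: distrib_right)
    then have "s \<le> exp (- real N - 13)"
      unfolding s_def r_def exp_add[symmetric] exp_le_cancel_iff using N by linarith
    also have "\<dots> = exp (- real N) * exp (- 13)" by (simp add: exp_add[symmetric])
    finally have s: "s \<le> exp (- real N) * exp (- 13)" .
    have "exp (real N) \<ge> real N" using exp_ge_add_one_self[of "real N"] by linarith
    then have NE: "real N * exp (- real N) \<le> 1" by (simp add: exp_minus divide_inverse[symmetric] divide_le_eq)
    have e13: "exp (- 13 :: real) \<le> 1 / 16000"
    proof -
      have "(2 :: real) \<le> exp 1" using exp_ge_add_one_self[of "1::real"] by simp
      have "(21 / 8 :: real) \<le> exp 1"
      proof -
        have "(1 + 1 / real 6) ^ 6 \<le> exp (1 :: real)" by (rule exp_ge_one_plus_x_over_n_power_n) auto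
        moreover have "(5 / 2 :: real) \<le> (1 + 1 / real 6) ^ 6" by (simp add: eval_nat_numeral)
        ultimately have "(5 / 2 :: real) \<le> exp 1" by linarith
        have "(1 + 1 / real 16) ^ 16 \<le> exp (1 :: real)" by (rule exp_ge_one_plus_x_over_n_power_n) auto
        moreover have "(21 / 8 :: real) \<le> (1 + 1 / real 16) ^ 16" by (simp add: eval_nat_numeral)
        ultimately show ?thesis by linarith
      qed
      then have "(21 / 8 :: real) ^ 13 \<le> exp 1 ^ 13" by (rule power_mono) simp
      moreover have "exp 1 ^ 13 = exp (13 :: real)" by (simp add: exp_of_nat_mult[symmetric])
      moreover have "(16000 :: real) \<le> (21 / 8) ^ 13" by (simp add: eval_nat_numeral)
      ultimately have "16000 \<le> exp (13 :: real)" by linarith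
      then show ?thesis by (simp add: exp_minus field_simps)
    qed
    have "real N * s \<le> real N * (exp (- real N) * exp (- 13))" using s by (intro mult_left_mono) auto
    also have "\<dots> = (real N * exp (- real N)) * exp (- 13)" by simp
    also have "\<dots> \<le> 1 * (1 / 16000)" using NE e13 by (intro mult_mono) auto
    finally show Ns: "real N * s \<le> 1 / 16000" by simp
    have "s \<le> real N * s" using N r0 by (simp add: s_def)
    then show "s \<le> 1 / 2" using Ns by linarith
  qed
  have s0: "s > 0" using r0 by (simp add: s_def)
  define f where "f g = 2 * 4 ^ j * VV j N u * (real N * s ^ g)" for g
  have bound: "\<bar>c (N + g) * WW j (N + g) u\<bar> \<le> f g" for g
  proof -
    have "real (N + g) \<le> real N * exp 1 ^ g"
    proof -
      have "1 + real g \<le> exp (real g)" by (rule exp_ge_add_one_self)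
      also have "exp (real g) = exp 1 ^ g" using exp_of_nat_mult[of g "1::real"] by simp
      finally have e: "1 + real g \<le> exp 1 ^ g" .
      have "1 * real g \<le> real N * real g" using N by (intro mult_right_mono) auto
      then have "real (N + g) \<le> real N * (1 + real g)" by (simp add: distrib_left)
      also have "\<dots> \<le> real N * exp 1 ^ g" using e by (intro mult_left_mono) auto
      finally show ?thesis .
    qed
    then have cN: "\<bar>c (N + g)\<bar> \<le> real N * exp 1 ^ g" using c(2)[of "N + g"] by linarith
    have "\<bar>WW j (N + g) u\<bar> \<le> 2 * 4 ^ j * VV j (N + g) u" using N u by (intro WW_bounds) auto
    also have "\<dots> \<le> 2 * 4 ^ j * (VV j N u * r ^ g)"
      unfolding r_def using N u by (intro mult_left_mono VV_geometric) auto
    finally have "\<bar>c (N + g)\<bar> * \<bar>WW j (N + g) u\<bar> \<le> (real N * exp 1 ^ g) * (2 * 4 ^ j * (VV j N u * r ^ g))"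
      using cN by (intro mult_mono) auto
    also have "\<dots> = f g" by (simp add: f_def s_def power_mult_distrib)
    finally show ?thesis by (simp add: abs_mult)
  qed
  have geo: "(\<lambda>g. s ^ Suc g) sums (s / (1 - s))"
    using geometric_sums[of s] s0 s1 sums_mult[of "\<lambda>g. s ^ g" "1 / (1 - s)" s] by simp
  have sf: "(\<lambda>g. f (Suc g)) sums (2 * 4 ^ j * VV j N u * (real N * (s / (1 - s))))"
    unfolding f_def by (intro sums_mult geo)
  have shift: "summable (\<lambda>g. \<bar>c (N + Suc g) * WW j (N + Suc g) u\<bar>)"
    by (rule summable_comparison_test'[OF sums_summable[OF sf], of 0]) (simp only: real_norm_def abs_idempotent bound)
  have addS: "N + Suc g = g + Suc N" for g by simp
  have shift': "summable (\<lambda>g. c (g + Suc N) * WW j (g + Suc N) u)"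
    using summable_rabs_cancel[OF shift] unfolding addS .
  then show summ: "summable (\<lambda>n. c n * WW j n u)"
    by (rule summable_iff_shift[of "\<lambda>n. c n * WW j n u" "Suc N", THEN iffD1])
  have "(\<Sum>n. c n * WW j n u) = (\<Sum>g. c (g + Suc N) * WW j (g + Suc N) u) + (\<Sum>n<Suc N. c n * WW j n u)"
    by (rule suminf_split_initial_segment[OF summ])
  also have "(\<Sum>n<Suc N. c n * WW j n u) = 0" using c(1) by (intro sum.neutral) auto
  finally have "\<bar>\<Sum>n. c n * WW j n u\<bar> = \<bar>\<Sum>g. c (N + Suc g) * WW j (N + Suc g) u\<bar>"
    unfolding addS by (simp only: add_0_right)
  also have "\<dots> \<le> (\<Sum>g. \<bar>c (N + Suc g) * WW j (N + Suc g) u\<bar>)" by (rule summable_rabs[OF shift])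
  also have "\<dots> \<le> (\<Sum>g. f (Suc g))" by (intro suminf_le bound shift sums_summable[OF sf])
  also have "\<dots> = 2 * 4 ^ j * VV j N u * (real N * (s / (1 - s)))" using sf by (simp add: sums_iff)
  also have "\<dots> \<le> 2 * 4 ^ j * VV j N u * (1 / 4000)"
  proof (intro mult_left_mono)
    have "s / (1 - s) \<le> s / (1 / 2)" using s0 s1 by (intro divide_left_mono) auto
    then have "real N * (s / (1 - s)) \<le> real N * (2 * s)" by (intro mult_left_mono) auto
    then show "real N * (s / (1 - s)) \<le> 1 / 4000" using Ns by linarith
  qed (use V0 in simp)
  finally show "\<bar>\<Sum>n. c n * WW j n u\<bar> \<le> 4 ^ j * VV j N u / 2000" by (simp add: mult_ac)
qed

section \<open>The theta function\<close>

definition one_w :: "nat \<Rightarrow> real" where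
  "one_w n = (if n = 0 then 0 else 1)"

lemma adm_one_w: "adm (1 / 2) one_w"
proof -
  have s: "summable (\<lambda>n. one_w n * real n powr (- 2 * \<sigma>))" if "\<sigma> > 1 / 2" for \<sigma>
  proof -
    have "summable (\<lambda>n. real n powr (- 2 * \<sigma>))" using that by (simp add: summable_real_powr_iff)
    then show ?thesis by (rule summable_comparison_test'[of _ 0]) (simp add: one_w_def)
  qed
  show ?thesis unfolding adm_def using s by (simp add: one_w_def)
qed

lemma has_sum_int_even:
  fixes f :: "nat \<Rightarrow> 'a::banach"
  assumes "summable (\<lambda>n. norm (f n))"
  shows "((\<lambda>n::int. f (nat \<bar>n\<bar>)) has_sum (f 0 + 2 *\<^sub>R (\<Sum>n. f (Suc n)))) UNIV"
proof -
  define S where "S = (\<Sum>n. f (Suc n))"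
  have sS: "summable (\<lambda>n. norm (f (Suc n)))" using assms by (subst summable_Suc_iff)
  have hS: "((\<lambda>n. f (Suc n)) has_sum S) UNIV"
    unfolding S_def by (rule norm_summable_imp_has_sum[OF sS summable_sums[OF summable_norm_cancel[OF sS]]])
  have 1: "((\<lambda>n::int. f (nat \<bar>n\<bar>)) has_sum S) {1..}"
  proof -
    have b: "bij_betw (\<lambda>n. int (Suc n)) UNIV {1..}"
      by (rule bij_betwI[of _ _ _ "\<lambda>i. nat i - 1"]) auto
    have "(\<lambda>n. f (nat \<bar>int (Suc n)\<bar>)) = (\<lambda>n. f (Suc n))" by (simp only: abs_of_nat nat_int)
    then show ?thesis using hS has_sum_reindex_bij_betw[OF b, of "\<lambda>n. f (nat \<bar>n\<bar>)"] by simp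
  qed
  have 2: "((\<lambda>n::int. f (nat \<bar>n\<bar>)) has_sum S) {..-1}"
  proof -
    have b: "bij_betw (\<lambda>n. - int (Suc n)) UNIV {..-1}"
      by (rule bij_betwI[of _ _ _ "\<lambda>i. nat (- i) - 1"]) auto
    have "(\<lambda>n. f (nat \<bar>- int (Suc n)\<bar>)) = (\<lambda>n. f (Suc n))" by (simp only: abs_minus_cancel abs_of_nat nat_int)
    then show ?thesis using hS has_sum_reindex_bij_betw[OF b, of "\<lambda>n. f (nat \<bar>n\<bar>)"] by simp
  qed
  have 0: "((\<lambda>n::int. f (nat \<bar>n\<bar>)) has_sum f 0) {0}" by (rule has_sum_finiteI) auto
  have 12: "((\<lambda>n::int. f (nat \<bar>n\<bar>)) has_sum (S + S)) ({1..} \<union> {..-1})" by (rule has_sum_Un_disjoint[OF 1 2]) auto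
  have 3: "((\<lambda>n::int. f (nat \<bar>n\<bar>)) has_sum (f 0 + (S + S))) ({0} \<union> ({1..} \<union> {..-1}))"
    by (rule has_sum_Un_disjoint[OF 0 12]) auto
  have U: "{0} \<union> ({1..} \<union> {..-1}) = (UNIV :: int set)" by auto
  show ?thesis using 3 unfolding U S_def[symmetric] scaleR_2 .
qed

lemma gaussian_fourier:
  fixes u :: real and k :: real
  assumes u: "u > 0"
  shows "integrable lborel (\<lambda>t. complex_of_real (exp (- u * t\<^sup>2)) * cis (2 * pi * k * t))"
    and "(\<integral>t. complex_of_real (exp (- u * t\<^sup>2)) * cis (2 * pi * k * t) \<partial>lborel) = of_real (sqrt (pi / u) * exp (- (pi\<^sup>2 * k\<^sup>2 / u)))"
proof -
  define s where "s = sqrt (2 * u)"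
  define a where "a = 2 * pi * k / s"
  have s: "s > 0" "s\<^sup>2 = 2 * u" using u by (auto simp: s_def)
  define F where "F x = std_normal_density x *\<^sub>R cis (a * x)" for x
  have m: "(\<lambda>x. cis (a * x)) \<in> borel_measurable borel"
    by (intro borel_measurable_continuous_onI continuous_intros)
  have intF: "integrable lborel F"
    unfolding F_def
  proof (rule Bochner_Integration.integrable_bound[where f = std_normal_density])
    show "(\<lambda>x. std_normal_density x *\<^sub>R cis (a * x)) \<in> borel_measurable lborel"
      using borel_measurable_scaleR[OF borel_measurable_normal_density m, of 0 1] by simp
  qed auto
  have "char std_normal_distribution a = (\<integral>x. F x \<partial>lborel)"
    unfolding char_def F_def by (subst integral_density) (auto simp: cis_conv_exp)
  then have valF: "(\<integral>x. F x \<partial>lborel) = of_real (exp (- (a\<^sup>2) / 2))"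
    by (simp add: char_std_normal_distribution)
  have FG: "F (0 + s * t) = of_real (1 / sqrt (2 * pi)) * (complex_of_real (exp (- u * t\<^sup>2)) * cis (2 * pi * k * t))" for t
  proof -
    have "(s * t)\<^sup>2 / 2 = u * t\<^sup>2" using s(2) by (simp add: power_mult_distrib)
    then have c1: "std_normal_density (s * t) = 1 / sqrt (2 * pi) * exp (- u * t\<^sup>2)"
      by (simp add: normal_density_def)
    have c2: "a * (s * t) = 2 * pi * k * t" using s(1) by (simp add: a_def)
    show ?thesis unfolding F_def add_0_left c1 c2 by (simp add: scaleR_conv_of_real)
  qed
  have "integrable lborel (\<lambda>t. F (0 + s * t))" using s(1) by (intro lborel_integrable_real_affine intF) auto
  then have i1: "integrable lborel (\<lambda>t. of_real (1 / sqrt (2 * pi)) * (complex_of_real (exp (- u * t\<^sup>2)) * cis (2 * pi * k * t)))"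
    unfolding FG .
  have "integrable lborel (\<lambda>t. of_real (sqrt (2 * pi)) * (of_real (1 / sqrt (2 * pi)) * (complex_of_real (exp (- u * t\<^sup>2)) * cis (2 * pi * k * t))))"
    by (rule integrable_mult_right) (rule i1)
  then show "integrable lborel (\<lambda>t. complex_of_real (exp (- u * t\<^sup>2)) * cis (2 * pi * k * t))"
    by (simp add: mult.assoc[symmetric])
  have "(\<integral>x. F x \<partial>lborel) = \<bar>s\<bar> *\<^sub>R (\<integral>t. F (0 + s * t) \<partial>lborel)"
    by (rule lborel_integral_real_affine) (use s in auto)
  also have "\<dots> = of_real (s / sqrt (2 * pi)) * (\<integral>t. complex_of_real (exp (- u * t\<^sup>2)) * cis (2 * pi * k * t) \<partial>lborel)"
    unfolding FG integral_mult_right_zero using s(1) by (simp add: scaleR_conv_of_real)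
  finally have e: "of_real (exp (- (a\<^sup>2) / 2)) = of_real (s / sqrt (2 * pi)) * (\<integral>t. complex_of_real (exp (- u * t\<^sup>2)) * cis (2 * pi * k * t) \<partial>lborel)"
    unfolding valF .
  have c: "sqrt (pi / u) * (s / sqrt (2 * pi)) = 1"
    using u by (simp add: s_def real_sqrt_mult real_sqrt_divide)
  have a2: "a\<^sup>2 / 2 = pi\<^sup>2 * k\<^sup>2 / u" using u by (simp add: a_def power_divide s(2) power_mult_distrib)
  have "of_real (sqrt (pi / u)) * of_real (exp (- (a\<^sup>2) / 2)) = of_real (sqrt (pi / u) * (s / sqrt (2 * pi))) * (\<integral>t. complex_of_real (exp (- u * t\<^sup>2)) * cis (2 * pi * k * t) \<partial>lborel)"
    unfolding e of_real_mult mult.assoc ..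
  then show "(\<integral>t. complex_of_real (exp (- u * t\<^sup>2)) * cis (2 * pi * k * t) \<partial>lborel) = of_real (sqrt (pi / u) * exp (- (pi\<^sup>2 * k\<^sup>2 / u)))"
    unfolding c using a2 by simp
qed

lemma summable_exp_neg_nat:
  assumes "(u::real) > 0"
  shows "summable (\<lambda>n. exp (- u * real n))"
proof -
  have "(\<lambda>n. exp (- u * real n)) = (\<lambda>n. exp (- u) ^ n)" by (simp add: exp_of_nat_mult[symmetric] mult.commute)
  then show ?thesis using assms by (simp add: summable_geometric)
qed

lemma poisson_summation_real:
  fixes g :: "real \<Rightarrow> complex" and B :: "int \<Rightarrow> real"
  assumes contg: "continuous_on UNIV g"
    and gB: "\<And>n t. t \<in> {0..1} \<Longrightarrow> norm (g (t + of_int n)) \<le> B n" and sB: "B summable_on UNIV"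
    and sc: "(\<lambda>k. norm (c k)) summable_on UNIV"
    and int: "\<And>k. integrable lborel (\<lambda>t. g t * fchar (- k) t)"
    and val: "\<And>k. (\<integral>t. g t * fchar (- k) t \<partial>lborel) = c k"
    and t: "t \<in> {0..1}"
  shows "(\<Sum>\<^sub>\<infinity>n. g (t + of_int n)) = (\<Sum>\<^sub>\<infinity>k. c k * fchar k t)"
proof -
  have coeff: "((\<lambda>n. integral {0..1} (\<lambda>t. g (t + of_int n) * fchar (- k) (t + of_int n))) has_sum c k) UNIV" for k
  proof -
    define G where "G t = g t * fchar (- k) t" for t
    have iG: "integrable lborel G" unfolding G_def[abs_def] by (rule int)
    have vG: "(\<integral>t. G t \<partial>lborel) = c k" unfolding G_def[abs_def] by (rule val)
    define f where "f n t = indicator {of_int n..<of_int n + 1} t *\<^sub>R G t" for n :: int and t :: real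
    have one: "f n t = (if n = \<lfloor>t\<rfloor> then G t else 0)" for n t
    proof (cases "n = \<lfloor>t\<rfloor>")
      case True
      have "t \<in> {of_int n..<of_int n + 1}" unfolding True using floor_correct[of t] by simp
      then show ?thesis using True by (simp add: f_def)
    next
      case False
      have "t \<notin> {of_int n..<of_int n + 1}" using floor_unique[of n t] False by auto
      then show ?thesis using False by (simp add: f_def)
    qed
    have intn: "integrable lborel (f n)" for n
      unfolding f_def[abs_def] by (rule integrable_mult_indicator[OF _ iG]) simp
    have hs: "((\<lambda>n. f n t) has_sum G t) UNIV" for t
      unfolding one by (rule has_sum_finite_neutralI[of "{\<lfloor>t\<rfloor>}"]) auto
    have valf: "(\<integral>t. f n t \<partial>lborel) = integral {0..1} (\<lambda>t. G (t + of_int n))"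
      and nval: "(\<integral>t. norm (f n t) \<partial>lborel) \<le> B n" for n
    proof -
      have contG: "continuous_on {0..1} (\<lambda>t. G (t + of_int n))"
        unfolding G_def by (intro continuous_intros continuous_on_compose2[OF contg] continuous_on_compose2[OF continuous_on_fchar]) auto
      have sh: "f n (of_int n + 1 * t) = indicator {0..<1} t *\<^sub>R G (t + of_int n)" for t
        by (auto simp: f_def indicator_def add.commute)
      have "(\<integral>t. f n t \<partial>lborel) = (\<integral>t. f n (of_int n + 1 * t) \<partial>lborel)"
        using lborel_integral_real_affine[of 1 "f n" "of_int n"] by simp
      also have "\<dots> = (\<integral>t. indicator {0..1} t *\<^sub>R G (t + of_int n) \<partial>lborel)"
        unfolding sh
      proof (rule integral_cong_AE)
        show "(\<lambda>t. indicator {0..<1} t *\<^sub>R G (t + of_int n)) \<in> borel_measurable lborel"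
        proof -
          have "continuous_on {0..<1} (\<lambda>t. G (t + of_int n))" by (rule continuous_on_subset[OF contG]) auto
          then show ?thesis using borel_measurable_continuous_on_indicator[of "{0..<1::real}"] by simp
        qed
        show "(\<lambda>t. indicator {0..1} t *\<^sub>R G (t + of_int n)) \<in> borel_measurable lborel"
          using borel_measurable_continuous_on_indicator[OF _ contG] by simp
        have "AE t in lborel. t \<noteq> (1::real)" by (rule AE_lborel_singleton)
        then show "AE t in lborel. indicator {0..<1} t *\<^sub>R G (t + of_int n) = indicator {0..1} t *\<^sub>R G (t + of_int n)"
          by (rule eventually_mono) (auto simp: indicator_def)
      qed
      also have "\<dots> = integral {0..1} (\<lambda>t. G (t + of_int n))"
        using set_borel_integral_eq_integral(2)[OF borel_integrable_atLeastAtMost'[OF contG]]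
        by (simp add: set_lebesgue_integral_def)
      finally show "(\<integral>t. f n t \<partial>lborel) = integral {0..1} (\<lambda>t. G (t + of_int n))" .
      have "(\<integral>t. norm (f n t) \<partial>lborel) \<le> (\<integral>t. indicator {real_of_int n..<of_int n + 1} t *\<^sub>R B n \<partial>lborel)"
      proof (rule Bochner_Integration.integral_mono)
        show "integrable lborel (\<lambda>t. norm (f n t))" using intn by (rule integrable_norm)
        show "integrable lborel (\<lambda>t. indicator {real_of_int n..<of_int n + 1} t *\<^sub>R B n)" by simp
        fix t :: real
        show "norm (f n t) \<le> indicator {of_int n..<of_int n + 1} t *\<^sub>R B n"
          using gB[of "t - of_int n" n] by (auto simp: f_def indicator_def G_def norm_mult)
      qed
      also have "\<dots> = B n" by simp
      finally show "(\<integral>t. norm (f n t) \<partial>lborel) \<le> B n" .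
    qed
    have "((\<lambda>n. LINT t:UNIV|lborel. f n t) has_sum (LINT t:UNIV|lborel. \<Sum>\<^sub>\<infinity>n. f n t)) UNIV"
    proof (rule set_integral_infsum(2)[OF bij_int_decode])
      show "set_integrable lborel UNIV (f n)" for n using intn[of n] by (simp add: set_integrable_def)
      show "(\<lambda>n. LINT t:UNIV|lborel. norm (f n t)) summable_on UNIV"
        by (rule summable_on_comparison_test[OF sB]) (use nval in \<open>auto simp: set_lebesgue_integral_def\<close>)
      show "(\<lambda>n. norm (f n t)) summable_on UNIV" for t
        unfolding one by (intro summable_on_cong_neutral[THEN iffD1, OF _ _ _ summable_on_finite[of "{\<lfloor>t\<rfloor>}"]]) auto
    qed
    then have "((\<lambda>n. \<integral>t. f n t \<partial>lborel) has_sum (\<integral>t. (\<Sum>\<^sub>\<infinity>n. f n t) \<partial>lborel)) UNIV"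
      by (simp add: set_lebesgue_integral_def)
    then show ?thesis unfolding infsumI[OF hs] vG valf unfolding G_def .
  qed
  show ?thesis by (rule poisson_summation[OF contg gB sB sc coeff t])
qed

lemma poisson_gaussian:
  assumes u: "u > 0"
  shows "(\<Sum>\<^sub>\<infinity>n::int. complex_of_real (exp (- u * (of_int n)\<^sup>2))) = (\<Sum>\<^sub>\<infinity>k::int. of_real (sqrt (pi / u) * exp (- (pi\<^sup>2 * (of_int k)\<^sup>2 / u))))"
proof -
  define g where "g t = complex_of_real (exp (- u * t\<^sup>2))" for t :: real
  define B where "B n = exp (2 * u) * exp (- u * real (nat \<bar>n\<bar>))" for n :: int
  define c where "c k = complex_of_real (sqrt (pi / u) * exp (- (pi\<^sup>2 * (of_int k)\<^sup>2 / u)))" for k :: int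
  have contg: "continuous_on S g" for S unfolding g_def by (intro continuous_intros)
  have sB: "B summable_on UNIV"
  proof -
    have "(\<lambda>n::int. exp (- u * real (nat \<bar>n\<bar>))) summable_on UNIV"
      using has_sum_int_even[of "\<lambda>n. exp (- u * real n)"] summable_exp_neg_nat[OF u] by (auto simp: summable_on_def)
    then show ?thesis unfolding B_def[abs_def] by (rule summable_on_cmult_right)
  qed
  have gB: "norm (g (t + of_int n)) \<le> B n" if "t \<in> {0..1}" for t :: real and n :: int
  proof -
    define y where "y = t + of_int n"
    have "\<bar>of_int n\<bar> \<le> \<bar>y\<bar> + 1" using that by (auto simp: y_def)
    moreover have "real (nat \<bar>n\<bar>) = \<bar>of_int n\<bar>" by simp
    moreover have "\<bar>y\<bar> \<le> y\<^sup>2 + 1"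
    proof -
      have "0 \<le> (\<bar>y\<bar> - 1 / 2)\<^sup>2" by simp
      then have "0 \<le> \<bar>y\<bar>\<^sup>2 - \<bar>y\<bar> + 1 / 4" by (simp add: power2_eq_square algebra_simps)
      then show ?thesis by simp
    qed
    ultimately have "real (nat \<bar>n\<bar>) \<le> y\<^sup>2 + 2" by linarith
    then have "u * real (nat \<bar>n\<bar>) \<le> u * (y\<^sup>2 + 2)" using u by (intro mult_left_mono) auto
    then have "- u * y\<^sup>2 \<le> 2 * u + (- u * real (nat \<bar>n\<bar>))" by (simp add: algebra_simps)
    then have "exp (- u * y\<^sup>2) \<le> exp (2 * u + (- u * real (nat \<bar>n\<bar>)))" by (simp only: exp_le_cancel_iff)
    then show ?thesis unfolding B_def g_def y_def[symmetric] exp_add by simp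
  qed
  have sc: "(\<lambda>k. norm (c k)) summable_on UNIV"
  proof -
    define v where "v = pi\<^sup>2 / u"
    have v: "v > 0" using u by (simp add: v_def)
    have "summable (\<lambda>n. exp (- v * (real n)\<^sup>2))"
    proof (rule summable_comparison_test'[OF summable_exp_neg_nat[OF v], of 0])
      fix n :: nat
      have "real n \<le> (real n)\<^sup>2" by (cases n) (auto simp: power2_eq_square)
      then show "norm (exp (- v * (real n)\<^sup>2)) \<le> exp (- v * real n)" using v by simp
    qed
    then have "(\<lambda>k::int. exp (- v * (real (nat \<bar>k\<bar>))\<^sup>2)) summable_on UNIV"
      using has_sum_int_even[of "\<lambda>n. exp (- v * (real n)\<^sup>2)"] by (auto simp: summable_on_def)
    then have "(\<lambda>k::int. sqrt (pi / u) * exp (- v * (real (nat \<bar>k\<bar>))\<^sup>2)) summable_on UNIV" by (rule summable_on_cmult_right)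
    moreover have "norm (c k) = sqrt (pi / u) * exp (- v * (real (nat \<bar>k\<bar>))\<^sup>2)" for k
      unfolding c_def norm_of_real v_def using u by (simp add: abs_mult)
    ultimately show ?thesis by simp
  qed
  have G_eq: "g t * fchar (- k) t = complex_of_real (exp (- u * t\<^sup>2)) * cis (2 * pi * (- of_int k) * t)" for t k
    by (simp add: g_def fchar_def)
  have int: "integrable lborel (\<lambda>t. g t * fchar (- k) t)" for k unfolding G_eq by (rule gaussian_fourier(1)[OF u])
  have val: "(\<integral>t. g t * fchar (- k) t \<partial>lborel) = c k" for k unfolding G_eq c_def using gaussian_fourier(2)[OF u, of "- of_int k"] by simp
  have "(\<Sum>\<^sub>\<infinity>n. g (0 + of_int n)) = (\<Sum>\<^sub>\<infinity>k. c k * fchar k 0)"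
    by (rule poisson_summation_real[OF contg gB sB sc int val]) auto
  then show ?thesis by (simp add: g_def c_def fchar_def)
qed

lemma theta_FE:
  assumes u: "u > 0"
  shows "1 / 2 + Psi one_w 1 (pi\<^sup>2 / u) = sqrt (u / pi) * (1 / 2 + Psi one_w 1 u)"
proof -
  have th: "(\<Sum>\<^sub>\<infinity>n::int. complex_of_real (exp (- v * (of_int n)\<^sup>2))) = of_real (1 + 2 * Psi one_w 1 v)" if v: "v > 0" for v
  proof -
    have P: "(\<lambda>n. one_w n * exp (- ((real n)\<^sup>2 * v))) sums Psi one_w 1 v"
      using Psi_sums[OF adm_one_w v, of 1] by (simp add: pe_def)
    have s: "summable (\<lambda>n. exp (- v * (real n)\<^sup>2))"
    proof (rule summable_comparison_test'[OF summable_exp_neg_nat[OF v], of 0])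
      fix n :: nat
      have "real n \<le> (real n)\<^sup>2" by (cases n) (auto simp: power2_eq_square)
      then show "norm (exp (- v * (real n)\<^sup>2)) \<le> exp (- v * real n)" using v by simp
    qed
    have "(\<lambda>n. one_w (Suc n) * exp (- ((real (Suc n))\<^sup>2 * v))) sums (Psi one_w 1 v)"
      using P by (subst sums_Suc_iff) (simp add: one_w_def)
    then have "(\<Sum>n. exp (- v * (real (Suc n))\<^sup>2)) = Psi one_w 1 v"
      by (simp add: one_w_def sums_iff mult.commute del: of_nat_Suc)
    moreover have "summable (\<lambda>n. norm (exp (- v * (real n)\<^sup>2)))" using s by simp
    ultimately have "((\<lambda>n::int. exp (- v * (real (nat \<bar>n\<bar>))\<^sup>2)) has_sum (1 + 2 * Psi one_w 1 v)) UNIV"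
      using has_sum_int_even[of "\<lambda>n. exp (- v * (real n)\<^sup>2)"] by simp
    then have "((\<lambda>n::int. complex_of_real (exp (- v * (real (nat \<bar>n\<bar>))\<^sup>2))) has_sum of_real (1 + 2 * Psi one_w 1 v)) UNIV"
      by (rule has_sum_of_real)
    moreover have "real (nat \<bar>n\<bar>) ^ 2 = (of_int n)\<^sup>2" for n :: int by simp
    ultimately show ?thesis by (simp add: infsumI)
  qed
  have "complex_of_real (1 + 2 * Psi one_w 1 u) = (\<Sum>\<^sub>\<infinity>k::int. of_real (sqrt (pi / u)) * complex_of_real (exp (- (pi\<^sup>2 / u) * (of_int k)\<^sup>2)))"
    unfolding th[OF u, symmetric] poisson_gaussian[OF u] by (simp only: of_real_mult times_divide_eq_left mult_minus_left)
  also have "\<dots> = of_real (sqrt (pi / u)) * of_real (1 + 2 * Psi one_w 1 (pi\<^sup>2 / u))"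
    using th[of "pi\<^sup>2 / u"] u by (simp add: infsum_cmult_right')
  finally have "1 + 2 * Psi one_w 1 u = sqrt (pi / u) * (1 + 2 * Psi one_w 1 (pi\<^sup>2 / u))"
    unfolding of_real_mult[symmetric] of_real_eq_iff .
  then have E: "1 + 2 * Psi one_w 1 u = sqrt (pi / u) * (1 + 2 * Psi one_w 1 (pi\<^sup>2 / u))" .
  have "sqrt (u / pi) * sqrt (pi / u) = sqrt ((u / pi) * (pi / u))" by (rule real_sqrt_mult[symmetric])
  also have "(u / pi) * (pi / u) = 1" using u by simp
  finally have ab: "sqrt (u / pi) * sqrt (pi / u) = 1" by (simp only: real_sqrt_one)
  have alg: "a * (1 + 2 * P) = 1 + 2 * Q \<Longrightarrow> 1 / 2 + Q = a * (1 / 2 + P)" for a P Q :: real by (simp add: algebra_simps)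
  have "sqrt (u / pi) * (1 + 2 * Psi one_w 1 u) = sqrt (u / pi) * sqrt (pi / u) * (1 + 2 * Psi one_w 1 (pi\<^sup>2 / u))"
    unfolding E by (rule mult.assoc[symmetric])
  also have "\<dots> = 1 + 2 * Psi one_w 1 (pi\<^sup>2 / u)" unfolding ab by (rule mult_1_left)
  finally show ?thesis by (rule alg)
qed

lemma FE_algebra:
  fixes u :: real
  assumes "u > 0"
  shows "0 + - (A / u) = S / (2 * u) * X + (0 + Y / u) * S \<Longrightarrow> - A = S * (X / 2 + Y)"
    and "- (- (A / u)) = S / (2 * u) * (X / 2 + Y) + ((0 + Y / u) / 2 + Z / u) * S \<Longrightarrow> A = S * (X / 4 + Y + Z)"
    and "2 * (- (S * (X / 2 + Y)) + 2 * (S * (X / 4 + Y + Z))) = S * (2 * (Y + 2 * Z))"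
proof -
  have 1: "u * (0 + - (A / u)) = - A" using assms by simp
  have 2: "u * (S / (2 * u) * X + (0 + Y / u) * S) = S * (X / 2 + Y)" using assms by (simp add: field_simps)
  assume "0 + - (A / u) = S / (2 * u) * X + (0 + Y / u) * S"
  then have "u * (0 + - (A / u)) = u * (S / (2 * u) * X + (0 + Y / u) * S)" by (rule arg_cong)
  then show "- A = S * (X / 2 + Y)" unfolding 1 2 .
next
  have 1: "u * (- (- (A / u))) = A" using assms by simp
  have 2: "u * (S / (2 * u) * (X / 2 + Y) + ((0 + Y / u) / 2 + Z / u) * S) = S * (X / 4 + Y + Z)" using assms by (simp add: field_simps)
  assume "- (- (A / u)) = S / (2 * u) * (X / 2 + Y) + ((0 + Y / u) / 2 + Z / u) * S"
  then have "u * (- (- (A / u))) = u * (S / (2 * u) * (X / 2 + Y) + ((0 + Y / u) / 2 + Z / u) * S)" by (rule arg_cong)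
  then show "A = S * (X / 4 + Y + Z)" unfolding 1 2 .
qed (simp add: algebra_simps)

lemma Psi_FE_step:
  assumes FE: "\<And>u. u > 0 \<Longrightarrow> c + Psi one_w p (pi\<^sup>2 / u) = sqrt (u / pi) * (c + Psi one_w p u)" and u: "u > 0"
  shows "Psi one_w (LL p) (pi\<^sup>2 / u) = sqrt (u / pi) * Psi one_w (LL p) u"
proof -
  note D = Psi_has_derivative[OF adm_one_w]
  define s where "s u = sqrt (u / pi)" for u
  have sD: "(s has_real_derivative s u / (2 * u)) (at u)" if "u > 0" for u
  proof -
    have "(s has_real_derivative (inverse (sqrt (u / pi)) / 2 * (1 / pi))) (at u)"
      unfolding s_def using that by (auto intro!: derivative_eq_intros simp: divide_less_0_iff)
    also have "inverse (sqrt (u / pi)) / 2 * (1 / pi) = s u / (2 * u)"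
    proof -
      have "s u * s u = u / pi" "s u > 0" using that by (auto simp: s_def)
      then have "inverse (s u) = s u * pi / u" using that by (simp add: field_simps)
      then show ?thesis by (simp add: s_def)
    qed
    finally show ?thesis .
  qed
  have inv: "((\<lambda>u. pi\<^sup>2 / u) has_real_derivative - (pi\<^sup>2 / u) / u) (at u)" if "u > 0" for u
    using that by (auto intro!: derivative_eq_intros simp: power2_eq_square)
  have pu: "pi\<^sup>2 / u > 0" if "u > 0" for u :: real using that by simp
  have Dinv: "((\<lambda>u. Psi one_w q (pi\<^sup>2 / u)) has_real_derivative - (Psi one_w (dop q) (pi\<^sup>2 / u) / u)) (at u)" if "u > 0" for u q
  proof -
    have "((\<lambda>u. Psi one_w q (pi\<^sup>2 / u)) has_real_derivative Psi one_w (dop q) (pi\<^sup>2 / u) / (pi\<^sup>2 / u) * (- (pi\<^sup>2 / u) / u)) (at u)"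
      by (rule DERIV_chain2[OF D[OF pu[OF that]] inv[OF that]])
    moreover have "Psi one_w (dop q) (pi\<^sup>2 / u) / (pi\<^sup>2 / u) * (- (pi\<^sup>2 / u) / u) = - (Psi one_w (dop q) (pi\<^sup>2 / u) / u)"
      using pu[OF that] by simp
    ultimately show ?thesis by simp
  qed
  have uniq: "x = y" if "(f has_real_derivative x) (at u)" "(g has_real_derivative y) (at u)" "\<And>u. u > 0 \<Longrightarrow> f u = g u" "u > 0"
    for f g x y and u :: real
  proof -
    have "eventually (\<lambda>v. v > 0) (nhds u)" using that(4) by (intro eventually_nhds_in_open[of "{0<..}", simplified]) auto
    then have "eventually (\<lambda>v. f v = g v) (nhds u)" by eventually_elim (rule that(3))
    then have "(g has_real_derivative x) (at u)" using that(1) DERIV_cong_ev[of u u f g x x] by simp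
    then show ?thesis using that(2) by (rule DERIV_unique)
  qed
  have step1: "- Psi one_w (dop p) (pi\<^sup>2 / u) = s u * ((c + Psi one_w p u) / 2 + Psi one_w (dop p) u)" if u: "u > 0" for u
  proof -
    have l: "((\<lambda>u. c + Psi one_w p (pi\<^sup>2 / u)) has_real_derivative 0 + - (Psi one_w (dop p) (pi\<^sup>2 / u) / u)) (at u)"
      by (intro DERIV_add DERIV_const Dinv u)
    have r: "((\<lambda>u. s u * (c + Psi one_w p u)) has_real_derivative s u / (2 * u) * (c + Psi one_w p u) + (0 + Psi one_w (dop p) u / u) * s u) (at u)"
      by (intro DERIV_mult DERIV_add DERIV_const D[OF u] sD u)
    show ?thesis by (rule FE_algebra(1)[OF u uniq[OF l r _ u]]) (unfold s_def, rule FE)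
  qed
  have step2: "Psi one_w (dop (dop p)) (pi\<^sup>2 / u) = s u * ((c + Psi one_w p u) / 4 + Psi one_w (dop p) u + Psi one_w (dop (dop p)) u)" if u: "u > 0" for u
  proof -
    have l: "((\<lambda>u. - Psi one_w (dop p) (pi\<^sup>2 / u)) has_real_derivative - (- (Psi one_w (dop (dop p)) (pi\<^sup>2 / u) / u))) (at u)"
      by (intro DERIV_minus Dinv u)
    have r: "((\<lambda>u. s u * ((c + Psi one_w p u) / 2 + Psi one_w (dop p) u)) has_real_derivative s u / (2 * u) * ((c + Psi one_w p u) / 2 + Psi one_w (dop p) u)
        + ((0 + Psi one_w (dop p) u / u) / 2 + Psi one_w (dop (dop p)) u / u) * s u) (at u)"
      by (intro DERIV_mult DERIV_add DERIV_const DERIV_cdivide D[OF u] sD u)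
    show ?thesis by (rule FE_algebra(2)[OF u uniq[OF l r step1 u]])
  qed
  have L: "Psi one_w (LL p) v = 2 * (Psi one_w (dop p) v + 2 * Psi one_w (dop (dop p)) v)" if "v > 0" for v
    unfolding LL_def dop_add dop_smult Psi_smult[OF adm_one_w that] Psi_add[OF adm_one_w that] by (rule refl)
  have e1: "Psi one_w (dop p) (pi\<^sup>2 / u) = - (s u * ((c + Psi one_w p u) / 2 + Psi one_w (dop p) u))"
    unfolding step1[OF u, symmetric] by (rule minus_minus[symmetric])
  show ?thesis unfolding L[OF u] L[OF pu[OF u]] e1 step2[OF u] s_def[symmetric] by (rule FE_algebra(3)[OF u])
qed

lemma Psi_LL_FE:
  assumes "u > 0" "j \<ge> 1"
  shows "Psi one_w ((LL ^^ j) 1) (pi\<^sup>2 / u) = sqrt (u / pi) * Psi one_w ((LL ^^ j) 1) u"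
proof -
  have "Psi one_w ((LL ^^ Suc i) 1) (pi\<^sup>2 / u) = sqrt (u / pi) * Psi one_w ((LL ^^ Suc i) 1) u" if "u > 0" for i u
    using that
  proof (induction i arbitrary: u)
    case 0
    have "(LL ^^ Suc 0) 1 = LL 1" by simp
    moreover have "Psi one_w (LL 1) (pi\<^sup>2 / u) = sqrt (u / pi) * Psi one_w (LL 1) u"
      by (rule Psi_FE_step[of "1 / 2", OF theta_FE 0])
    ultimately show ?case by (simp only:)
  next
    case (Suc i)
    have e: "(LL ^^ Suc (Suc i)) 1 = LL ((LL ^^ Suc i) 1)" by (simp only: funpow.simps comp_apply)
    show ?case unfolding e
    proof (rule Psi_FE_step[of 0])
      fix v :: real assume "v > 0"
      then show "0 + Psi one_w ((LL ^^ Suc i) 1) (pi\<^sup>2 / v) = sqrt (v / pi) * (0 + Psi one_w ((LL ^^ Suc i) 1) v)"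
        unfolding add_0_left by (rule Suc.IH)
    qed (rule Suc.prems)
  qed
  note S = this
  have "j = Suc (j - 1)" using assms(2) by simp
  then show ?thesis using S[OF assms(1), of "j - 1"] by (simp only:)
qed

section \<open>The expansion at the poles\<close>

definition indep :: "nat set \<Rightarrow> bool" where
  "indep B \<longleftrightarrow> (\<forall>b\<in>B. \<forall>c\<in>B. b \<noteq> c \<longrightarrow> (\<forall>r>0. \<forall>t>0. b ^ r \<noteq> c ^ t))"

lemma indep_subset: "indep B \<Longrightarrow> A \<subseteq> B \<Longrightarrow> indep A"
  unfolding indep_def by blast

lemma sin_ge_third:
  assumes "0 \<le> t" "t \<le> pi / 2"
  shows "t / 3 \<le> sin t"
proof (cases "t \<le> pi / 3")
  case True
  have "(\<lambda>x. sin x - x / 3) 0 \<le> (\<lambda>x. sin x - x / 3) t"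
  proof (rule DERIV_nonneg_imp_nondecreasing[OF assms(1)])
    fix x assume x: "0 \<le> x" "x \<le> t"
    have "cos (pi / 3) \<le> cos x" by (rule cos_monotone_0_pi_le) (use x True in auto)
    then have c: "cos x - 1 / 3 \<ge> 0" by (simp add: cos_60)
    have "((\<lambda>x. sin x - x / 3) has_real_derivative (cos x - 1 / 3)) (at x)"
      by (auto intro!: derivative_eq_intros)
    then show "\<exists>y. ((\<lambda>x. sin x - x / 3) has_real_derivative y) (at x) \<and> 0 \<le> y" using c by (intro exI conjI)
  qed
  then show ?thesis by simp
next
  case False
  have "sin (pi / 3) \<le> sin t" by (rule sin_monotone_2pi_le) (use False assms in auto)
  moreover have "sqrt 3 \<ge> 17 / 10" by (rule real_le_rsqrt) (simp add: power2_eq_square)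
  moreover have "t / 3 \<le> 4 / 6" using assms pi_less_4 by simp
  ultimately show ?thesis by (simp add: sin_60)
qed

lemma norm_one_minus_cis: "norm (1 - cis (2 * \<phi>)) = 2 * \<bar>sin \<phi>\<bar>"
proof -
  have id: "(2 * a\<^sup>2)\<^sup>2 + (2 * a * c)\<^sup>2 = 4 * a\<^sup>2 * (a\<^sup>2 + c\<^sup>2)" for a c :: real by (simp add: power2_eq_square algebra_simps)
  have "(norm (1 - cis (2 * \<phi>)))\<^sup>2 = (1 - cos (2 * \<phi>))\<^sup>2 + (sin (2 * \<phi>))\<^sup>2" by (simp add: cmod_power2)
  also have "\<dots> = (2 * (sin \<phi>)\<^sup>2)\<^sup>2 + (2 * sin \<phi> * cos \<phi>)\<^sup>2" by (simp add: cos_double_sin sin_double)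
  also have "\<dots> = 4 * (sin \<phi>)\<^sup>2 * ((sin \<phi>)\<^sup>2 + (cos \<phi>)\<^sup>2)" by (rule id)
  also have "\<dots> = (2 * \<bar>sin \<phi>\<bar>)\<^sup>2" by (simp add: power_mult_distrib)
  finally show ?thesis by (rule power2_eq_imp_eq) auto
qed

lemma norm_one_minus_cis_ge: "\<bar>x - of_int (round x)\<bar> \<le> norm (1 - cis (2 * pi * x))"
proof -
  define y where "y = x - of_int (round x)"
  have y: "\<bar>y\<bar> \<le> 1 / 2" using of_int_round_abs_le[of x] by (simp add: y_def abs_minus_commute)
  have "fchar 1 (y + of_int (round x)) = fchar 1 y" by (rule fchar_plus_int)
  then have e: "cis (2 * pi * x) = cis (2 * (pi * y))" by (simp add: fchar_def y_def mult.assoc)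
  have "\<bar>sin (pi * y)\<bar> = \<bar>sin (pi * \<bar>y\<bar>)\<bar>" by (cases "y \<ge> 0") auto
  moreover have "sin (pi * \<bar>y\<bar>) \<ge> pi * \<bar>y\<bar> / 3"
  proof (rule sin_ge_third)
    have "pi * \<bar>y\<bar> \<le> pi * (1 / 2)" by (intro mult_left_mono y) auto
    then show "pi * \<bar>y\<bar> \<le> pi / 2" by simp
  qed simp
  moreover have "pi * \<bar>y\<bar> \<ge> 3 * \<bar>y\<bar>" by (intro mult_right_mono pi_ge_3) auto
  ultimately have "\<bar>y\<bar> \<le> 2 * \<bar>sin (pi * y)\<bar>" by linarith
  then show ?thesis unfolding e norm_one_minus_cis y_def .
qed

lemma powr_of_pos: "v > 0 \<Longrightarrow> complex_of_real v powr z = exp (z * of_real (ln v))"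
  by (simp add: powr_def Ln_of_real)

lemma powr_pole_half:
  assumes "v > 0"
  shows "complex_of_real v powr (- (pole_B b n / 2)) = cis (- (pi * of_int n / ln (real b) * ln v))"
  unfolding powr_of_pos[OF assms] cis_conv_exp pole_B_def by (simp add: algebra_simps)

lemma powr_pole:
  assumes "c > 0"
  shows "of_nat c powr (- pole_B b n) = cis (- (2 * pi * of_int n * ln (real c) / ln (real b)))"
proof -
  have "of_nat c powr (- pole_B b n) = exp (- pole_B b n * of_real (ln (real c)))"
    using powr_of_pos[of "real c" "- pole_B b n"] assms by simp
  then show ?thesis unfolding cis_conv_exp pole_B_def by (simp add: algebra_simps)
qed

lemma factor_lower_bound:
  assumes b: "b \<ge> 2" and c: "c \<ge> 2" and ne: "\<And>r t. r > 0 \<Longrightarrow> t > 0 \<Longrightarrow> b ^ r \<noteq> c ^ t" and \<epsilon>: "\<epsilon> > 0"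
  shows "\<exists>K>0. \<forall>n. n \<noteq> 0 \<longrightarrow> K * exp (- \<epsilon> * \<bar>of_int n\<bar>) \<le> norm (1 - of_nat c powr (- pole_B b n))"
proof -
  have ne': "c ^ i \<noteq> b ^ j" if "i > 0" "j > 0" for i j using ne[OF that(2,1)] by (rule not_sym)
  obtain d where d: "d > 0" and lf: "\<And>(n::nat) (l::nat). n > 0 \<Longrightarrow> \<bar>real n * ln (real c) - real l * ln (real b)\<bar> \<ge> d * exp (- \<epsilon> * real n)"
    using linear_form_lower_bound[OF c b ne' \<epsilon>] by blast
  have lb: "ln (real b) > 0" using b by simp
  have lc: "ln (real c) > 0" using c by simp
  have c0: "c > 0" using c by simp
  have pos: "d / ln (real b) * exp (- \<epsilon> * real n) \<le> norm (1 - cis (2 * pi * (real n * ln (real c) / ln (real b))))" if "n > 0" for n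
  proof -
    define x where "x = real n * ln (real c) / ln (real b)"
    have "x \<ge> 0" using lb lc by (simp add: x_def)
    then have "round x \<ge> 0" unfolding round_def by simp
    then obtain l where l: "round x = int l" using nonneg_int_cases by blast
    have "d * exp (- \<epsilon> * real n) \<le> \<bar>real n * ln (real c) - real l * ln (real b)\<bar>" by (rule lf[OF that])
    also have "real n * ln (real c) - real l * ln (real b) = (x - real l) * ln (real b)" using lb by (simp add: x_def field_simps)
    finally have "d * exp (- \<epsilon> * real n) \<le> \<bar>x - real l\<bar> * ln (real b)" using lb by (simp add: abs_mult)
    then have "d / ln (real b) * exp (- \<epsilon> * real n) \<le> \<bar>x - real l\<bar>" using lb by (simp add: field_simps)
    also have "\<dots> \<le> norm (1 - cis (2 * pi * x))" using norm_one_minus_cis_ge[of x] l by simp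
    finally show ?thesis unfolding x_def .
  qed
  have "d / ln (real b) * exp (- \<epsilon> * \<bar>of_int n\<bar>) \<le> norm (1 - of_nat c powr (- pole_B b n))" if n: "n \<noteq> 0" for n
  proof -
    define m where "m = nat \<bar>n\<bar>"
    have m: "m > 0" "real m = \<bar>of_int n\<bar>" using n by (auto simp: m_def)
    have "norm (1 - cis (2 * pi * (real m * ln (real c) / ln (real b)))) = norm (1 - of_nat c powr (- pole_B b n))"
    proof (cases "n > 0")
      case True
      then have "real m = of_int n" using m(2) by linarith
      then have "2 * pi * (real m * ln (real c) / ln (real b)) = - (- (2 * pi * of_int n * ln (real c) / ln (real b)))" by simp
      then have "cis (2 * pi * (real m * ln (real c) / ln (real b))) = cnj (of_nat c powr (- pole_B b n))"
        unfolding powr_pole[OF c0] cis_cnj by (rule arg_cong)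
      then have "1 - cis (2 * pi * (real m * ln (real c) / ln (real b))) = cnj (1 - of_nat c powr (- pole_B b n))" by simp
      then show ?thesis by (simp only: complex_mod_cnj)
    next
      case False
      then have "real m = - of_int n" using m(2) by linarith
      then have "2 * pi * (real m * ln (real c) / ln (real b)) = (- (2 * pi * of_int n * ln (real c) / ln (real b)))" by simp
      then have "cis (2 * pi * (real m * ln (real c) / ln (real b))) = of_nat c powr (- pole_B b n)"
        unfolding powr_pole[OF c0] by (rule arg_cong)
      then show ?thesis by (simp only:)
    qed
    then show ?thesis using pos[OF m(1)] unfolding m(2) by simp
  qed
  then show ?thesis using d lb by (intro exI[of _ "d / ln (real b)"]) auto
qed

lemma factor_nonzero:
  assumes "b \<ge> 2" "c \<ge> 2" "\<And>r t. r > 0 \<Longrightarrow> t > 0 \<Longrightarrow> b ^ r \<noteq> c ^ t" "n \<noteq> 0"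
  shows "1 - of_nat c powr (- pole_B b n) \<noteq> 0"
proof -
  obtain K where "K > 0" "\<forall>n. n \<noteq> 0 \<longrightarrow> K * exp (- 1 * \<bar>of_int n\<bar>) \<le> norm (1 - of_nat c powr (- pole_B b n))"
    using factor_lower_bound[OF assms(1-3), of 1] by auto
  then have "K * exp (- 1 * \<bar>of_int n\<bar>) \<le> norm (1 - of_nat c powr (- pole_B b n))" "K * exp (- 1 * \<bar>real_of_int n\<bar>) > 0" using assms(4) by auto
  then show ?thesis by auto
qed

lemma zeta_B_insert: "finite A \<Longrightarrow> c \<notin> A \<Longrightarrow> zeta_B (insert c A) s = zeta_B A s * (1 / (1 - of_nat c powr (- s)))"
  by (simp add: zeta_B_def)

lemma zeta_pole_bound:
  assumes "finite A" "b \<ge> 2" "\<forall>c\<in>A. c \<ge> 2 \<and> (\<forall>r>0. \<forall>t>0. b ^ r \<noteq> c ^ t)" "\<epsilon> > 0"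
  shows "\<exists>K>0. \<forall>n. n \<noteq> 0 \<longrightarrow> norm (zeta_B A (pole_B b n)) \<le> K * exp (\<epsilon> * \<bar>of_int n\<bar>)"
  using assms(1,3,4)
proof (induction A arbitrary: \<epsilon> rule: finite_induct)
  case empty
  then show ?case by (intro exI[of _ 1]) (auto simp: zeta_B_def)
next
  case (insert c A)
  obtain K1 where K1: "K1 > 0" "\<And>n. n \<noteq> 0 \<Longrightarrow> norm (zeta_B A (pole_B b n)) \<le> K1 * exp (\<epsilon> / 2 * \<bar>of_int n\<bar>)"
    using insert.IH[of "\<epsilon> / 2"] insert.prems by auto
  obtain K2 where K2: "K2 > 0" "\<And>n. n \<noteq> 0 \<Longrightarrow> K2 * exp (- (\<epsilon> / 2) * \<bar>of_int n\<bar>) \<le> norm (1 - of_nat c powr (- pole_B b n))"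
    using factor_lower_bound[of b c "\<epsilon> / 2"] assms(2) insert.prems by auto
  have "norm (zeta_B (insert c A) (pole_B b n)) \<le> K1 / K2 * exp (\<epsilon> * \<bar>of_int n\<bar>)" if n: "n \<noteq> 0" for n
  proof -
    have p1: "0 < K2 * exp (- (\<epsilon> / 2) * \<bar>real_of_int n\<bar>)" using K2(1) by simp
    have p2: "0 < norm (1 - of_nat c powr (- pole_B b n))" by (rule less_le_trans[OF p1 K2(2)[OF n]])
    have "norm (zeta_B (insert c A) (pole_B b n)) = norm (zeta_B A (pole_B b n)) * (1 / norm (1 - of_nat c powr (- pole_B b n)))"
      using insert.hyps by (simp add: zeta_B_insert norm_mult norm_divide)
    also have "\<dots> \<le> (K1 * exp (\<epsilon> / 2 * \<bar>of_int n\<bar>)) * (1 / (K2 * exp (- (\<epsilon> / 2) * \<bar>of_int n\<bar>)))"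
      by (rule mult_mono[OF K1(2)[OF n] divide_left_mono[OF K2(2)[OF n] zero_le_one mult_pos_pos[OF p2 p1]]]) (use K1(1) in auto)
    also have "\<dots> = K1 / K2 * (exp (\<epsilon> / 2 * \<bar>of_int n\<bar>) * exp (\<epsilon> / 2 * \<bar>of_int n\<bar>))"
      by (simp add: exp_minus field_simps)
    also have "exp (\<epsilon> / 2 * \<bar>of_int n\<bar>) * exp (\<epsilon> / 2 * \<bar>of_int n\<bar>) = exp (\<epsilon> * \<bar>real_of_int n\<bar>)" by (simp add: exp_add[symmetric])
    finally show ?thesis .
  qed
  then show ?case using K1(1) K2(1) by (intro exI[of _ "K1 / K2"]) auto
qed

lemma norm_pochhammer_le: "norm (pochhammer (w::complex) i) \<le> (norm w + real i) ^ i"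
proof -
  have "norm (pochhammer w i) = (\<Prod>j<i. norm (w + of_nat j))" by (simp add: pochhammer_prod prod_norm atLeast0LessThan)
  also have "\<dots> \<le> (\<Prod>j<i. norm w + real i)"
  proof (rule prod_mono)
    fix j assume "j \<in> {..<i}"
    then show "0 \<le> norm (w + of_nat j) \<and> norm (w + of_nat j) \<le> norm w + real i"
      using norm_triangle_ineq[of w "of_nat j"] by auto
  qed
  finally show ?thesis by simp
qed

lemma imaginary_not_nonpos_Int: "\<eta> \<noteq> 0 \<Longrightarrow> \<i> * of_real \<eta> \<notin> \<int>\<^sub>\<le>\<^sub>0"
  by (auto elim!: nonpos_Ints_cases simp: complex_eq_iff)

lemma NN_imaginary_bound:
  assumes "\<delta> > 0"
  shows "\<exists>C\<ge>0. \<forall>\<eta>. \<bar>\<eta>\<bar> \<ge> \<delta> \<longrightarrow> norm (NN p (\<i> * of_real \<eta>)) \<le> C * exp (- \<bar>\<eta>\<bar> / 2)"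
proof -
  obtain C where C: "C > 0" "\<And>\<eta>. \<eta> \<ge> \<delta> \<Longrightarrow> norm (Gamma (\<i> * of_real \<eta>)) \<le> C * exp (- \<eta>)"
    using norm_Gamma_imaginary_le[OF assms] by blast
  define P where "P = (\<Sum>i\<le>degree p. Polynomial.smult \<bar>coeff p i\<bar> ([:real i, 1:] ^ i))"
  obtain D where D: "D \<ge> 0" "\<And>u. u \<ge> 0 \<Longrightarrow> \<bar>poly P u\<bar> \<le> D * exp (u / 2)" using poly_le_exp_half[of P] by blast
  have Pv: "poly P u = (\<Sum>i\<le>degree p. \<bar>coeff p i\<bar> * (u + real i) ^ i)" for u
    by (simp add: P_def poly_sum add.commute)
  have "norm (NN p (\<i> * of_real \<eta>)) \<le> (C * D) * exp (- \<bar>\<eta>\<bar> / 2)" if \<eta>: "\<bar>\<eta>\<bar> \<ge> \<delta>" for \<eta>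
  proof -
    have ne: "\<eta> \<noteq> 0" using \<eta> assms by auto
    have G: "norm (Gamma (\<i> * of_real \<eta>)) \<le> C * exp (- \<bar>\<eta>\<bar>)"
    proof (cases "\<eta> \<ge> 0")
      case True
      then show ?thesis using C(2)[of \<eta>] \<eta> by simp
    next
      case False
      have "Gamma (\<i> * of_real \<eta>) = cnj (Gamma (\<i> * of_real (- \<eta>)))" by (simp add: cnj_Gamma)
      then have "norm (Gamma (\<i> * of_real \<eta>)) = norm (Gamma (\<i> * of_real (- \<eta>)))" by (simp only: complex_mod_cnj)
      then show ?thesis using C(2)[of "- \<eta>"] \<eta> False by simp
    qed
    have "norm (\<Sum>i\<le>degree p. of_real (coeff p i) * pochhammer (\<i> * of_real \<eta>) i) \<le> (\<Sum>i\<le>degree p. \<bar>coeff p i\<bar> * (\<bar>\<eta>\<bar> + real i) ^ i)"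
    proof (rule sum_norm_le)
      fix i
      have "norm (pochhammer (\<i> * complex_of_real \<eta>) i) \<le> (\<bar>\<eta>\<bar> + real i) ^ i"
        using norm_pochhammer_le[of "\<i> * complex_of_real \<eta>" i] by (simp add: norm_mult)
      then show "norm (of_real (coeff p i) * pochhammer (\<i> * complex_of_real \<eta>) i) \<le> \<bar>coeff p i\<bar> * (\<bar>\<eta>\<bar> + real i) ^ i"
        by (simp add: norm_mult mult_left_mono)
    qed
    also have "\<dots> \<le> D * exp (\<bar>\<eta>\<bar> / 2)" using D(2)[of "\<bar>\<eta>\<bar>"] unfolding Pv by linarith
    finally have S: "norm (\<Sum>i\<le>degree p. of_real (coeff p i) * pochhammer (\<i> * of_real \<eta>) i) \<le> D * exp (\<bar>\<eta>\<bar> / 2)" .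
    have "norm (NN p (\<i> * of_real \<eta>)) \<le> (C * exp (- \<bar>\<eta>\<bar>)) * (D * exp (\<bar>\<eta>\<bar> / 2))"
      unfolding NN_conv_pochhammer[OF imaginary_not_nonpos_Int[OF ne]] norm_mult
      by (intro mult_mono G S) (use C(1) in auto)
    also have "\<dots> = (C * D) * (exp (- \<bar>\<eta>\<bar>) * exp (\<bar>\<eta>\<bar> / 2))" by simp
    also have "exp (- \<bar>\<eta>\<bar>) * exp (\<bar>\<eta>\<bar> / 2) = exp (- \<bar>\<eta>\<bar> / 2)" by (simp add: exp_add[symmetric])
    finally show ?thesis .
  qed
  then show ?thesis using C(1) D(1) by (intro exI[of _ "C * D"]) auto
qed

text \<open>The residue at \<open>pole_B b n / 2\<close> of the Mellin transform of the series with weights \<open>aB B\<close>.\<close>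
definition cf :: "nat set \<Rightarrow> nat \<Rightarrow> real poly \<Rightarrow> int \<Rightarrow> complex" where
  "cf B b p n = (if n = 0 then 0 else NN p (pole_B b n / 2) / (2 * of_real (ln (real b))) * zeta_B (B - {b}) (pole_B b n))"

lemma pole_B_half: "pole_B b n / 2 = \<i> * of_real (pi * of_int n / ln (real b))"
  by (simp add: pole_B_def)

lemma indep_factor:
  assumes "base_ok B" "indep B" "b \<in> B" "c \<in> B" "b \<noteq> c"
  shows "b \<ge> 2" "c \<ge> 2" "\<And>r t. r > 0 \<Longrightarrow> t > 0 \<Longrightarrow> b ^ r \<noteq> c ^ t"
  using assms unfolding base_ok_def indep_def by auto

lemma cf_summable:
  assumes ok: "base_ok B" and ind: "indep B" and b: "b \<in> B"
  shows "(\<lambda>n. norm (cf B b p n)) summable_on UNIV"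
proof -
  have b2: "b \<ge> 2" using ok b by (auto simp: base_ok_def)
  define \<delta> where "\<delta> = pi / ln (real b)"
  have \<delta>: "\<delta> > 0" using b2 by (simp add: \<delta>_def)
  obtain C where C: "C \<ge> 0" "\<And>\<eta>. \<bar>\<eta>\<bar> \<ge> \<delta> \<Longrightarrow> norm (NN p (\<i> * of_real \<eta>)) \<le> C * exp (- \<bar>\<eta>\<bar> / 2)"
    using NN_imaginary_bound[OF \<delta>, of p] by auto
  have "\<forall>c\<in>B - {b}. c \<ge> 2 \<and> (\<forall>r>0. \<forall>t>0. b ^ r \<noteq> c ^ t)"
    using indep_factor[OF ok ind b] by auto
  moreover have "finite (B - {b})" using ok by (auto simp: base_ok_def)
  ultimately obtain K where K: "K > 0" "\<And>n. n \<noteq> 0 \<Longrightarrow> norm (zeta_B (B - {b}) (pole_B b n)) \<le> K * exp (\<delta> / 4 * \<bar>of_int n\<bar>)"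
    using zeta_pole_bound[of "B - {b}" b "\<delta> / 4"] b2 \<delta> by auto
  define M where "M = C / (2 * ln (real b)) * K"
  have M: "M \<ge> 0" using C K b2 by (simp add: M_def)
  have bd: "norm (cf B b p n) \<le> M * exp (- (\<delta> / 4) * real (nat \<bar>n\<bar>))" for n
  proof (cases "n = 0")
    case False
    have n1: "\<bar>real_of_int n\<bar> \<ge> 1" using False by linarith
    have ab: "\<bar>pi * of_int n / ln (real b)\<bar> = \<delta> * \<bar>of_int n\<bar>" using b2 by (simp add: \<delta>_def abs_mult)
    have "\<delta> * 1 \<le> \<delta> * \<bar>of_int n\<bar>" using n1 \<delta> by (intro mult_left_mono) auto
    then have N: "norm (NN p (pole_B b n / 2)) \<le> C * exp (- (\<delta> * \<bar>of_int n\<bar>) / 2)"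
      unfolding pole_B_half using C(2)[of "pi * of_int n / ln (real b)"] unfolding ab by simp
    have "norm (cf B b p n) = norm (NN p (pole_B b n / 2)) / (2 * ln (real b)) * norm (zeta_B (B - {b}) (pole_B b n))"
      using False b2 by (simp add: cf_def norm_mult norm_divide)
    also have "\<dots> \<le> (C * exp (- (\<delta> * \<bar>of_int n\<bar>) / 2)) / (2 * ln (real b)) * (K * exp (\<delta> / 4 * \<bar>of_int n\<bar>))"
      by (intro mult_mono divide_right_mono N K(2)[OF False]) (use b2 C in auto)
    also have "\<dots> = M * (exp (- (\<delta> * \<bar>of_int n\<bar>) / 2) * exp (\<delta> / 4 * \<bar>of_int n\<bar>))" by (simp add: M_def)
    also have "exp (- (\<delta> * \<bar>of_int n\<bar>) / 2) * exp (\<delta> / 4 * \<bar>real_of_int n\<bar>) = exp (- (\<delta> / 4) * real (nat \<bar>n\<bar>))"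
      by (simp add: exp_add[symmetric])
    finally show ?thesis .
  qed (use M in \<open>simp add: cf_def\<close>)
  have "(\<lambda>n::int. exp (- (\<delta> / 4) * real (nat \<bar>n\<bar>))) summable_on UNIV"
    using has_sum_int_even[of "\<lambda>n. exp (- (\<delta> / 4) * real n)"] summable_exp_neg_nat[of "\<delta> / 4"] \<delta> by (auto simp: summable_on_def)
  then have "(\<lambda>n::int. M * exp (- (\<delta> / 4) * real (nat \<bar>n\<bar>))) summable_on UNIV" by (rule summable_on_cmult_right)
  then show ?thesis by (rule summable_on_comparison_test) (use bd in auto)
qed

lemma cf_dop:
  assumes "b \<ge> 2"
  shows "cf B b (dop p) n = - (pole_B b n / 2) * cf B b p n"
proof (cases "n = 0")
  case False
  have "pole_B b n / 2 \<notin> \<int>\<^sub>\<le>\<^sub>0" unfolding pole_B_half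
    by (rule imaginary_not_nonpos_Int) (use False assms in auto)
  from NN_dop[OF this, of p] show ?thesis using False by (simp add: cf_def)
qed (simp add: cf_def)

lemma cf_insert:
  assumes ok: "base_ok (insert c B)" and ind: "indep (insert c B)" and c: "c \<notin> B" and b: "b \<in> B"
  shows "cf (insert c B) b p n * (1 - of_nat c powr (- pole_B b n)) = cf B b p n"
proof (cases "n = 0")
  case False
  have bc: "b \<noteq> c" using b c by auto
  note f = indep_factor[OF ok ind insertI2[OF b] insertI1 bc]
  have nz: "1 - of_nat c powr (- pole_B b n) \<noteq> 0" by (rule factor_nonzero[OF f False])
  have "insert c B - {b} = insert c (B - {b})" using bc by auto
  then have "zeta_B (insert c B - {b}) (pole_B b n) = zeta_B (B - {b}) (pole_B b n) * (1 / (1 - of_nat c powr (- pole_B b n)))"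
    using c ok by (simp add: zeta_B_insert base_ok_def)
  then show ?thesis using False nz by (simp add: cf_def)
qed (simp add: cf_def)

text \<open>The value of \<^term>\<open>zeta_B B\<close> at \<open>- 2 * k\<close>; for \<open>k = 0\<close> it is 0 if \<open>B\<close> is nonempty, by \<open>1 / 0 = 0\<close>.\<close>
definition Zk :: "nat set \<Rightarrow> nat \<Rightarrow> real" where
  "Zk B k = (\<Prod>b\<in>B. 1 / (1 - real b ^ (2 * k)))"

definition Tf :: "nat set \<Rightarrow> real poly \<Rightarrow> nat \<Rightarrow> real \<Rightarrow> complex" where
  "Tf B p k x = complex_of_real (tay p k * Zk B k * exp (real k * x))"

definition Sf :: "nat set \<Rightarrow> nat \<Rightarrow> real poly \<Rightarrow> int \<Rightarrow> real \<Rightarrow> complex" where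
  "Sf B b p n x = cf B b p n * cis (- (pi * of_int n / ln (real b) * x))"

text \<open>The difference of the two sides of the expansion, in the variable \<open>x = ln u\<close>.\<close>
definition Hm :: "nat set \<Rightarrow> real poly \<Rightarrow> real \<Rightarrow> complex" where
  "Hm B p x = of_real (Psi (aB B) p (exp x)) - (\<Sum>\<^sub>\<infinity>k. Tf B p k x) - (\<Sum>b\<in>B. \<Sum>\<^sub>\<infinity>n. Sf B b p n x)"

lemma infsum_diff_eq:
  fixes f g :: "'i \<Rightarrow> complex"
  assumes "f summable_on A" "g summable_on A"
  shows "(\<Sum>\<^sub>\<infinity>i\<in>A. f i - g i) = infsum f A - infsum g A"
proof -
  have "((\<lambda>i. - g i) has_sum - infsum g A) A" using assms(2) by (simp add: has_sum_uminus has_sum_infsum)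
  from has_sum_add[OF has_sum_infsum[OF assms(1)] this] show ?thesis by (simp add: infsumI)
qed

lemma Zk_abs_le:
  assumes "base_ok B"
  shows "\<bar>Zk B k\<bar> \<le> 1"
proof -
  have "\<bar>Zk B k\<bar> = (\<Prod>b\<in>B. \<bar>1 / (1 - real b ^ (2 * k))\<bar>)" unfolding Zk_def by (rule abs_prod)
  also have "\<dots> \<le> 1"
  proof (rule prod_le_1)
    fix b assume b: "b \<in> B"
    have b2: "real b \<ge> 2" using assms b by (auto simp: base_ok_def)
    have "\<bar>1 / (1 - real b ^ (2 * k))\<bar> \<le> 1"
    proof (cases "k = 0")
      case False
      have "real b ^ 1 \<le> real b ^ (2 * k)" using b2 False by (intro power_increasing) auto
      then have "real b ^ (2 * k) \<ge> 2" unfolding power_one_right by (rule order_trans[OF b2])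
      then show ?thesis by (simp add: abs_div field_simps)
    qed simp
    then show "0 \<le> \<bar>1 / (1 - real b ^ (2 * k))\<bar> \<and> \<bar>1 / (1 - real b ^ (2 * k))\<bar> \<le> 1" by simp
  qed
  finally show ?thesis .
qed

lemma tay_bound_summable: "(\<lambda>k. \<bar>tay p k * exp R ^ k\<bar>) summable_on UNIV"
  using tay_abs_summable[of p "exp R"] by (subst summable_on_UNIV_nonneg_real_iff) (auto simp: real_norm_def)

lemma Tf_bound:
  assumes "base_ok B" "x \<le> R"
  shows "norm (Tf B p k x) \<le> \<bar>tay p k * exp R ^ k\<bar>"
proof -
  have "exp (real k * x) \<le> exp (real k * R)" using assms(2) by (simp add: mult_left_mono)
  then have e: "exp (real k * x) \<le> exp R ^ k" by (simp add: exp_of_nat_mult)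
  have "norm (Tf B p k x) = \<bar>tay p k\<bar> * \<bar>Zk B k\<bar> * exp (real k * x)" by (simp only: Tf_def norm_of_real abs_mult abs_exp_cancel)
  also have "\<dots> \<le> \<bar>tay p k\<bar> * 1 * exp R ^ k" by (intro mult_mono e Zk_abs_le[OF assms(1)]) auto
  finally show ?thesis by (simp add: abs_mult)
qed

lemma Tf_summable: "base_ok B \<Longrightarrow> (\<lambda>k. Tf B p k x) summable_on UNIV"
  by (rule abs_summable_summable, rule summable_on_comparison_test[OF tay_bound_summable[of p x]]) (use Tf_bound[of B x x] in auto)

lemma norm_Sf: "norm (Sf B b p n x) = norm (cf B b p n)"
  by (simp add: Sf_def norm_mult)

lemma Sf_summable:
  assumes "base_ok B" "indep B" "b \<in> B"
  shows "(\<lambda>n. Sf B b p n x) summable_on UNIV"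
  by (rule abs_summable_summable) (use cf_summable[OF assms, of p] in \<open>simp add: norm_Sf\<close>)

lemma Zk_insert:
  assumes "finite B" "c \<notin> B" shows "Zk (insert c B) k = Zk B k * (1 / (1 - real c ^ (2 * k)))"
  using assms by (simp add: Zk_def)

lemma Hm_rec:
  assumes ok: "base_ok (insert c B)" and ind: "indep (insert c B)" and c: "c \<notin> B" and t0: "tay p 0 = 0"
  shows "Hm (insert c B) p x - Hm (insert c B) p (x + 2 * ln (real c)) = Hm B p x"
proof -
  have okB: "base_ok B" and c2: "c \<ge> 2" using ok by simp_all
  have finB: "finite B" using okB by (simp add: base_ok_def)
  have indB: "indep B" by (rule indep_subset[OF ind]) auto
  define y where "y = x + 2 * ln (real c)"
  have ey: "exp y = (real c)\<^sup>2 * exp x"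
  proof -
    have "exp (2 * ln (real c)) = (real c)\<^sup>2" using c2 by (simp add: exp_double)
    then show ?thesis by (simp add: y_def exp_add)
  qed
  have P: "Psi (aB (insert c B)) p (exp x) - Psi (aB (insert c B)) p (exp y) = Psi (aB B) p (exp x)"
    using Psi_aB_rec[OF ok c, of "exp x" p] unfolding ey by simp
  have T: "Tf (insert c B) p k x - Tf (insert c B) p k y = Tf B p k x" for k
  proof (cases "k = 0")
    case False
    have c2': "2 \<le> real c" using c2 by simp
    have "real c ^ 1 \<le> real c ^ (2 * k)" using c2 False by (intro power_increasing) auto
    then have "2 \<le> real c ^ (2 * k)" unfolding power_one_right by (rule order_trans[OF c2'])
    then have nz: "1 - real c ^ (2 * k) \<noteq> 0" by linarith
    have "exp (real k * y) = exp y ^ k" by (simp add: exp_of_nat_mult)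
    also have "\<dots> = real c ^ (2 * k) * exp x ^ k" unfolding ey by (simp add: power_mult_distrib power_mult)
    finally have e: "exp (real k * y) = real c ^ (2 * k) * exp (real k * x)" by (simp add: exp_of_nat_mult)
    have e1: "(1 / (1 - real c ^ (2 * k))) * (1 - real c ^ (2 * k)) = 1" using nz by simp
    have id: "t * (Z * r) * e - t * (Z * r) * (C * e) = t * Z * e * (r * (1 - C))" for t Z r e C :: real by (simp add: algebra_simps)
    have E: "tay p k * Zk (insert c B) k * exp (real k * x) - tay p k * Zk (insert c B) k * exp (real k * y)
      = tay p k * Zk B k * exp (real k * x) * ((1 / (1 - real c ^ (2 * k))) * (1 - real c ^ (2 * k)))"
      unfolding e Zk_insert[OF finB c] by (rule id)
    show ?thesis unfolding Tf_def of_real_diff[symmetric] E e1 mult_1_right ..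
  qed (simp add: Tf_def t0)
  have Tsum: "(\<Sum>\<^sub>\<infinity>k. Tf (insert c B) p k x) - (\<Sum>\<^sub>\<infinity>k. Tf (insert c B) p k y) = (\<Sum>\<^sub>\<infinity>k. Tf B p k x)"
    unfolding T[symmetric] by (rule infsum_diff_eq[symmetric]) (intro Tf_summable ok)+
  have S: "Sf (insert c B) b p n x - Sf (insert c B) b p n y = (if b = c then 0 else Sf B b p n x)" if "b \<in> insert c B" for b n
  proof -
    have cc: "cis (- (pi * of_int n / ln (real b) * y)) = cis (- (pi * of_int n / ln (real b) * x)) * of_nat c powr (- pole_B b n)"
      using c2 by (simp add: powr_pole cis_mult y_def algebra_simps)
    show ?thesis
    proof (cases "b = c")
      case True
      have "of_nat c powr (- pole_B b n) = 1"
      proof -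
        have "- (2 * pi * of_int n * ln (real c) / ln (real b)) = 2 * pi * of_int (- n)" using True c2 by simp
        then have "cis (- (2 * pi * of_int n * ln (real c) / ln (real b))) = 1" by (simp only:) (rule cis_multiple_2pi, simp)
        then show ?thesis using c2 by (simp add: powr_pole)
      qed
      then show ?thesis using True cc by (simp add: Sf_def)
    next
      case False
      then have "b \<in> B" using that by simp
      have "Sf (insert c B) b p n x - Sf (insert c B) b p n y
        = (cf (insert c B) b p n * (1 - of_nat c powr (- pole_B b n))) * cis (- (pi * of_int n / ln (real b) * x))"
        unfolding Sf_def cc by (simp add: algebra_simps)
      then show ?thesis using cf_insert[OF ok ind c \<open>b \<in> B\<close>, of p n] False by (simp add: Sf_def)
    qed
  qed
  have Ssum: "(\<Sum>\<^sub>\<infinity>n. Sf (insert c B) b p n x) - (\<Sum>\<^sub>\<infinity>n. Sf (insert c B) b p n y) = (if b = c then 0 else (\<Sum>\<^sub>\<infinity>n. Sf B b p n x))" if "b \<in> insert c B" for b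
  proof -
    have "(\<Sum>\<^sub>\<infinity>n. Sf (insert c B) b p n x) - (\<Sum>\<^sub>\<infinity>n. Sf (insert c B) b p n y) = (\<Sum>\<^sub>\<infinity>n. Sf (insert c B) b p n x - Sf (insert c B) b p n y)"
      by (rule infsum_diff_eq[symmetric]) (intro Sf_summable ok ind that)+
    then show ?thesis unfolding S[OF that] by simp
  qed
  have "(\<Sum>b\<in>insert c B. \<Sum>\<^sub>\<infinity>n. Sf (insert c B) b p n x) - (\<Sum>b\<in>insert c B. \<Sum>\<^sub>\<infinity>n. Sf (insert c B) b p n y)
      = (\<Sum>b\<in>insert c B. if b = c then 0 else (\<Sum>\<^sub>\<infinity>n. Sf B b p n x))"
    unfolding sum_subtractf[symmetric] by (rule sum.cong[OF refl Ssum])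
  also have "\<dots> = (\<Sum>b\<in>B. \<Sum>\<^sub>\<infinity>n. Sf B b p n x)"
  proof -
    have "(\<Sum>b\<in>insert c B. if b = c then 0 else (\<Sum>\<^sub>\<infinity>n. Sf B b p n x)) = 0 + (\<Sum>b\<in>B. if b = c then 0 else (\<Sum>\<^sub>\<infinity>n. Sf B b p n x))"
      using finB c by (subst sum.insert) simp_all
    also have "(\<Sum>b\<in>B. if b = c then 0 else (\<Sum>\<^sub>\<infinity>n. Sf B b p n x)) = (\<Sum>b\<in>B. \<Sum>\<^sub>\<infinity>n. Sf B b p n x)"
      by (rule sum.cong) (use c in auto)
    finally show ?thesis by simp
  qed
  finally have SS: "(\<Sum>b\<in>insert c B. \<Sum>\<^sub>\<infinity>n. Sf (insert c B) b p n x) - (\<Sum>b\<in>insert c B. \<Sum>\<^sub>\<infinity>n. Sf (insert c B) b p n y) = (\<Sum>b\<in>B. \<Sum>\<^sub>\<infinity>n. Sf B b p n x)" .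
  have "Hm (insert c B) p x - Hm (insert c B) p y =
     of_real (Psi (aB (insert c B)) p (exp x) - Psi (aB (insert c B)) p (exp y))
     - ((\<Sum>\<^sub>\<infinity>k. Tf (insert c B) p k x) - (\<Sum>\<^sub>\<infinity>k. Tf (insert c B) p k y))
     - ((\<Sum>b\<in>insert c B. \<Sum>\<^sub>\<infinity>n. Sf (insert c B) b p n x) - (\<Sum>b\<in>insert c B. \<Sum>\<^sub>\<infinity>n. Sf (insert c B) b p n y))"
    unfolding Hm_def of_real_diff by (simp only: diff_diff_eq2 diff_add_eq) (simp add: algebra_simps)
  also have "\<dots> = Hm B p x" unfolding P Tsum SS Hm_def ..
  finally show ?thesis unfolding y_def .
qed

lemma infsum_FTC:
  fixes F f :: "'i \<Rightarrow> real \<Rightarrow> complex"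
  assumes ab: "a \<le> b"
    and D: "\<And>i x. x \<in> {a..b} \<Longrightarrow> (F i has_vector_derivative f i x) (at x within {a..b})"
    and cont: "\<And>i. continuous_on {a..b} (f i)"
    and B: "\<And>i x. x \<in> {a..b} \<Longrightarrow> norm (f i x) \<le> B i" "B summable_on UNIV"
    and s: "(\<lambda>i. F i a) summable_on UNIV" "(\<lambda>i. F i b) summable_on UNIV"
  shows "((\<lambda>x. \<Sum>\<^sub>\<infinity>i. f i x) has_integral ((\<Sum>\<^sub>\<infinity>i. F i b) - (\<Sum>\<^sub>\<infinity>i. F i a))) {a..b}"
proof -
  have c: "continuous_on {a..b} (\<lambda>x. \<Sum>\<^sub>\<infinity>i. f i x)" by (rule continuous_on_infsum[OF cont B])
  have i: "integral {a..b} (f i) = F i b - F i a" for i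
    using fundamental_theorem_of_calculus[OF ab D] by (rule integral_unique)
  have "((\<lambda>i. F i b - F i a) has_sum integral {a..b} (\<lambda>x. \<Sum>\<^sub>\<infinity>i. f i x)) UNIV"
    using has_sum_integral_interval[OF cont B] unfolding i .
  then have "integral {a..b} (\<lambda>x. \<Sum>\<^sub>\<infinity>i. f i x) = (\<Sum>\<^sub>\<infinity>i. F i b - F i a)" by (rule infsumI[symmetric])
  also have "\<dots> = (\<Sum>\<^sub>\<infinity>i. F i b) - (\<Sum>\<^sub>\<infinity>i. F i a)" by (rule infsum_diff_eq[OF s(2,1)])
  finally show ?thesis using integrable_integral[OF integrable_continuous_real[OF c]] by simp
qed

lemma continuous_on_Hm:
  assumes ok: "base_ok B" and ind: "indep B"
  shows "continuous_on {a..b} (Hm B p)"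
proof -
  have "continuous_on {a..b} (\<lambda>x. Psi (aB B) p (exp x))"
    by (rule continuous_on_compose2[OF continuous_on_Psi[OF adm_aB[OF ok]]]) (auto intro!: continuous_intros)
  moreover have "continuous_on {a..b} (\<lambda>x. \<Sum>\<^sub>\<infinity>k. Tf B p k x)"
  proof (rule continuous_on_infsum[OF _ _ tay_bound_summable[of p b]])
    show "continuous_on {a..b} (Tf B p k)" for k unfolding Tf_def[abs_def] by (intro continuous_intros)
    show "norm (Tf B p k x) \<le> \<bar>tay p k * exp b ^ k\<bar>" if "x \<in> {a..b}" for k x using Tf_bound[OF ok] that by simp
  qed
  moreover have "continuous_on {a..b} (\<lambda>x. \<Sum>b\<in>B. \<Sum>\<^sub>\<infinity>n. Sf B b p n x)"
  proof (rule continuous_on_sum)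
    fix c assume c: "c \<in> B"
    show "continuous_on {a..b} (\<lambda>x. \<Sum>\<^sub>\<infinity>n. Sf B c p n x)"
    proof (rule continuous_on_infsum[OF _ _ cf_summable[OF ok ind c, of p]])
      show "continuous_on {a..b} (Sf B c p n)" for n unfolding Sf_def[abs_def] by (intro continuous_intros)
      show "norm (Sf B c p n x) \<le> norm (cf B c p n)" if "x \<in> {a..b}" for n x by (simp add: norm_Sf)
    qed
  qed
  ultimately show ?thesis unfolding Hm_def[abs_def] by (intro continuous_on_diff continuous_on_of_real)
qed

lemma Hm_has_integral:
  assumes ok: "base_ok B" and ind: "indep B" and X: "0 \<le> X"
  shows "(Hm B (dop p) has_integral (Hm B p X - Hm B p 0)) {0..X}"
proof -
  have "((\<lambda>x. complex_of_real (Psi (aB B) (dop p) (exp x))) has_integral (of_real (Psi (aB B) p (exp X)) - of_real (Psi (aB B) p (exp 0)))) {0..X}"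
  proof (rule fundamental_theorem_of_calculus[OF X])
    fix x
    have "((\<lambda>x. Psi (aB B) p (exp x)) has_real_derivative (Psi (aB B) (dop p) (exp x) / exp x * exp x)) (at x within {0..X})"
      by (rule DERIV_chain2[OF Psi_has_derivative[OF adm_aB[OF ok]]]) (auto intro!: derivative_eq_intros)
    then have "((\<lambda>x. Psi (aB B) p (exp x)) has_real_derivative Psi (aB B) (dop p) (exp x)) (at x within {0..X})" by simp
    then show "((\<lambda>x. complex_of_real (Psi (aB B) p (exp x))) has_vector_derivative complex_of_real (Psi (aB B) (dop p) (exp x))) (at x within {0..X})"
      by (intro has_vector_derivative_of_real) (simp add: has_real_derivative_iff_has_vector_derivative)
  qed
  moreover have "((\<lambda>x. \<Sum>\<^sub>\<infinity>k. Tf B (dop p) k x) has_integral ((\<Sum>\<^sub>\<infinity>k. Tf B p k X) - (\<Sum>\<^sub>\<infinity>k. Tf B p k 0))) {0..X}"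
  proof (rule infsum_FTC[OF X _ _ _ tay_bound_summable[of "dop p" X] Tf_summable[OF ok] Tf_summable[OF ok]])
    fix k x
    have "((\<lambda>x. tay p k * Zk B k * exp (real k * x)) has_real_derivative (tay (dop p) k * Zk B k * exp (real k * x))) (at x within {0..X})"
      by (auto intro!: derivative_eq_intros simp: tay_dop)
    then show "(Tf B p k has_vector_derivative Tf B (dop p) k x) (at x within {0..X})"
      unfolding Tf_def[abs_def] by (intro has_vector_derivative_of_real) (simp add: has_real_derivative_iff_has_vector_derivative)
    show "continuous_on {0..X} (Tf B (dop p) k)" unfolding Tf_def[abs_def] by (intro continuous_intros)
  qed (use Tf_bound[OF ok] in auto)
  moreover have "((\<lambda>x. \<Sum>b\<in>B. \<Sum>\<^sub>\<infinity>n. Sf B b (dop p) n x) has_integral (\<Sum>b\<in>B. (\<Sum>\<^sub>\<infinity>n. Sf B b p n X) - (\<Sum>\<^sub>\<infinity>n. Sf B b p n 0))) {0..X}"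
  proof (rule has_integral_sum)
    show "finite B" using ok by (simp add: base_ok_def)
    fix b assume b: "b \<in> B"
    have b2: "b \<ge> 2" using b ok by (auto simp: base_ok_def)
    show "((\<lambda>x. \<Sum>\<^sub>\<infinity>n. Sf B b (dop p) n x) has_integral ((\<Sum>\<^sub>\<infinity>n. Sf B b p n X) - (\<Sum>\<^sub>\<infinity>n. Sf B b p n 0))) {0..X}"
    proof (rule infsum_FTC[OF X _ _ _ cf_summable[OF ok ind b, of "dop p"] Sf_summable[OF ok ind b] Sf_summable[OF ok ind b]])
      fix n x
      define \<alpha> where "\<alpha> = - (pi * of_int n / ln (real b))"
      have "((\<lambda>z. cf B b p n * exp (\<i> * of_real \<alpha> * z)) has_field_derivative (cf B b p n * (exp (\<i> * of_real \<alpha> * of_real x) * (\<i> * of_real \<alpha>)))) (at (of_real x))"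
        by (auto intro!: derivative_eq_intros)
      then have V: "((\<lambda>x. cf B b p n * exp (\<i> * of_real \<alpha> * of_real x)) has_vector_derivative (cf B b p n * (exp (\<i> * of_real \<alpha> * of_real x) * (\<i> * of_real \<alpha>)))) (at x within {0..X})"
        by (rule has_vector_derivative_real_field)
      have e: "cis (- (pi * of_int n / ln (real b) * y)) = exp (\<i> * of_real \<alpha> * of_real y)" for y
        unfolding cis_conv_exp \<alpha>_def by (simp only: of_real_mult mult.assoc minus_mult_left)
      have cd: "cf B b (dop p) n = cf B b p n * (\<i> * of_real \<alpha>)"
        unfolding cf_dop[OF b2] pole_B_half \<alpha>_def by simp
      have f1: "Sf B b p n = (\<lambda>x. cf B b p n * exp (\<i> * of_real \<alpha> * of_real x))" by (rule ext) (simp only: Sf_def e)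
      have f2: "Sf B b (dop p) n x = cf B b p n * (exp (\<i> * of_real \<alpha> * of_real x) * (\<i> * of_real \<alpha>))"
        unfolding Sf_def e cd by (simp only: mult_ac)
      show "(Sf B b p n has_vector_derivative Sf B b (dop p) n x) (at x within {0..X})" unfolding f1 f2 by (rule V)
      show "continuous_on {0..X} (Sf B b (dop p) n)" unfolding Sf_def[abs_def] by (intro continuous_intros)
    qed (auto simp: norm_Sf)
  qed
  ultimately have "(Hm B (dop p) has_integral (of_real (Psi (aB B) p (exp X)) - of_real (Psi (aB B) p (exp 0)))
      - ((\<Sum>\<^sub>\<infinity>k. Tf B p k X) - (\<Sum>\<^sub>\<infinity>k. Tf B p k 0))
      - (\<Sum>b\<in>B. (\<Sum>\<^sub>\<infinity>n. Sf B b p n X) - (\<Sum>\<^sub>\<infinity>n. Sf B b p n 0))) {0..X}"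
    unfolding Hm_def[abs_def] by (intro has_integral_diff)
  then show ?thesis by (rule back_subst[where P = "\<lambda>v. (Hm B (dop p) has_integral v) {0..X}"]) (simp add: Hm_def sum_subtractf algebra_simps)
qed

lemma Psi_empty: "Psi (aB {}) p u = pe p u"
proof -
  have "(\<lambda>n. aB {} n * pe p ((real n)\<^sup>2 * u)) = (\<lambda>n. if n = 1 then pe p ((real n)\<^sup>2 * u) else 0)"
    by (auto simp: aB_empty)
  then show ?thesis unfolding Psi_def using sums_unique[OF sums_single[of 1 "\<lambda>n. pe p ((real n)\<^sup>2 * u)"]] by simp
qed

lemma Hm_empty: "Hm {} p x = 0"
proof -
  have e: "exp (real k * x) = exp x ^ k" for k by (simp add: exp_of_nat_mult)
  have "(\<lambda>k. tay p k * exp x ^ k) sums pe p (exp x)" by (rule tay_sums)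
  then have "(\<lambda>k. Tf {} p k x) sums complex_of_real (pe p (exp x))"
    unfolding Tf_def Zk_def e by (simp add: sums_of_real_iff del: of_real_mult of_real_power)
  moreover have "summable (\<lambda>k. norm (Tf {} p k x))"
    using tay_abs_summable[of p "exp x"] unfolding Tf_def Zk_def e by (simp del: of_real_mult of_real_power)
  ultimately have "((\<lambda>k. Tf {} p k x) has_sum complex_of_real (pe p (exp x))) UNIV" by (intro norm_summable_imp_has_sum)
  then show ?thesis by (simp add: Hm_def Psi_empty infsumI)
qed

lemma NN_dop_zero:
  assumes "coeff r 0 = 0"
  shows "NN (dop r) 0 = 0"
proof -
  have s: "(\<Sum>i\<le>m. of_real (coeff (dop r) i) * Gamma (0 + of_nat i)) = complex_of_real (coeff r m * fact m)" for m
  proof (induction m)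
    case 0
    then show ?case using assms by (simp add: coeff_dop)
  next
    case (Suc m)
    have "Gamma (0 + of_nat (Suc m)) = (fact m :: complex)" using Gamma_fact[of m, where 'a = complex] by (simp add: add.commute)
    then show ?case unfolding sum.atMost_Suc Suc.IH by (simp add: coeff_dop algebra_simps)
  qed
  define m where "m = max (degree (dop r)) (Suc (degree r))"
  have "degree (dop r) \<le> m" "coeff r m = 0" by (auto simp: m_def intro: coeff_eq_0)
  then show ?thesis using NN_extend[of "dop r" m 0] s[of m] by simp
qed

lemma set_integrable_lborel_imp_absolutely_integrable:
  fixes f :: "real \<Rightarrow> complex"
  assumes "set_integrable lborel S f"
  shows "f absolutely_integrable_on S"
  using assms unfolding set_integrable_def by (simp add: integrable_completion borel_measurable_integrable)

lemma mellin_exp_substitution: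
  fixes f :: "real \<Rightarrow> complex"
  assumes L: "L > 0" and f: "set_integrable lborel {0<..} f" "continuous_on {0<..} f"
  shows "integrable lborel (\<lambda>t. of_real (exp (L * t)) * f (exp (L * t)))"
    and "(\<integral>t. of_real (exp (L * t)) * f (exp (L * t)) \<partial>lborel) = (LINT u:{0<..}|lborel. f u) / of_real L"
proof -
  define G where "G t = of_real (exp (L * t)) * f (exp (L * t))" for t
  have cont: "continuous_on UNIV G" unfolding G_def
    by (intro continuous_intros continuous_on_compose2[OF f(2)]) auto
  have img: "range (\<lambda>t. exp (L * t)) = {0<..}"
  proof (intro equalityI subsetI)
    fix u :: real assume "u \<in> {0<..}"
    then have "u = exp (L * (ln u / L))" using L by simp
    then show "u \<in> range (\<lambda>t. exp (L * t))" by (rule range_eqI)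
  qed auto
  have der: "((\<lambda>t. exp (L * t)) has_field_derivative L * exp (L * t)) (at t within UNIV)" for t
    by (auto intro!: derivative_eq_intros)
  have inj: "inj_on (\<lambda>t. exp (L * t)) UNIV" using L by (auto intro: inj_onI)
  have e: "\<bar>L * exp (L * t)\<bar> *\<^sub>R f (exp (L * t)) = L *\<^sub>R G t" for t
    using L by (simp add: G_def scaleR_conv_of_real abs_mult)
  have ai: "f absolutely_integrable_on range (\<lambda>t. exp (L * t))"
    unfolding img by (rule set_integrable_lborel_imp_absolutely_integrable[OF f(1)])
  have cv: "(\<lambda>t. \<bar>L * exp (L * t)\<bar> *\<^sub>R f (exp (L * t))) absolutely_integrable_on UNIV
      \<and> integral UNIV (\<lambda>t. \<bar>L * exp (L * t)\<bar> *\<^sub>R f (exp (L * t))) = integral (range (\<lambda>t. exp (L * t))) f"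
    by (subst has_absolute_integral_change_of_variables_real[OF _ der inj]) (use ai in auto)
  from cv[THEN conjunct1]
  have "(\<lambda>t. inverse L *\<^sub>R (L *\<^sub>R G t)) absolutely_integrable_on UNIV" unfolding e by (rule set_integrable_scaleR_right)
  then have aG: "G absolutely_integrable_on UNIV" using L by simp
  then have sG: "set_integrable lborel UNIV G" by (intro set_integrable_lborel_iff_continuous cont) auto
  then show "integrable lborel (\<lambda>t. of_real (exp (L * t)) * f (exp (L * t)))" unfolding G_def[symmetric] by (simp add: set_integrable_def)
  from cv[THEN conjunct2]
  have "L *\<^sub>R integral UNIV G = integral {0<..} f" unfolding e img by simp
  moreover have "integral {0<..} f = (LINT u:{0<..}|lborel. f u)" by (rule set_borel_integral_eq_integral(2)[OF f(1), symmetric])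
  moreover have "integral UNIV G = (\<integral>t. G t \<partial>lborel)" using set_borel_integral_eq_integral(2)[OF sG] by (simp add: set_lebesgue_integral_def)
  ultimately show "(\<integral>t. of_real (exp (L * t)) * f (exp (L * t)) \<partial>lborel) = (LINT u:{0<..}|lborel. f u) / of_real L"
    unfolding G_def[symmetric] using L by (simp add: scaleR_conv_of_real field_simps)
qed

lemma filterlim_int_intervals: "filterlim (\<lambda>N. {- int N..<int N}) (finite_subsets_at_top UNIV) sequentially"
  unfolding filterlim_finite_subsets_at_top
proof (intro allI impI)
  fix X :: "int set" assume "finite X \<and> X \<subseteq> UNIV"
  then have fin: "finite X" by simp
  define K where "K = Suc (\<Sum>n\<in>X. nat \<bar>n\<bar>)"
  have K: "nat \<bar>n\<bar> < K" if "n \<in> X" for n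
    unfolding K_def using member_le_sum[OF that _ fin, of "\<lambda>n. nat \<bar>n\<bar>"] by simp
  have "X \<subseteq> {- int N..<int N}" if "N \<ge> K" for N
  proof
    fix n assume "n \<in> X"
    then show "n \<in> {- int N..<int N}" using K[of n] that by auto
  qed
  then show "\<forall>\<^sub>F N in sequentially. finite {- int N..<int N} \<and> X \<subseteq> {- int N..<int N} \<and> {- int N..<int N} \<subseteq> UNIV"
    unfolding eventually_sequentially by blast
qed

lemma has_sum_telescope:
  fixes h F :: "real \<Rightarrow> complex"
  assumes "((\<lambda>n. h (x + of_int n * L)) has_sum s) UNIV" and F: "\<And>x. F x - F (x + L) = h x"
  shows "(\<lambda>N. F (x - real N * L) - F (x + real N * L)) \<longlonglongrightarrow> s"
proof -
  have "(\<Sum>n\<in>{- int N..<int N}. h (x + of_int n * L)) = F (x - real N * L) - F (x + real N * L)" for N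
  proof (induction N)
    case (Suc N)
    have "{- int (Suc N)..<int (Suc N)} = insert (- int N - 1) (insert (int N) {- int N..<int N})" by auto
    then have "(\<Sum>n\<in>{- int (Suc N)..<int (Suc N)}. h (x + of_int n * L)) = h (x + of_int (- int N - 1) * L) + (h (x + of_int (int N) * L) + (\<Sum>n\<in>{- int N..<int N}. h (x + of_int n * L)))"
      by simp
    also have "\<dots> = h (x - real (Suc N) * L) + (h (x + real N * L) + (F (x - real N * L) - F (x + real N * L)))"
      unfolding Suc.IH by (simp add: algebra_simps)
    also have "h (x - real (Suc N) * L) = F (x - real (Suc N) * L) - F (x - real N * L)"
      using F[of "x - real (Suc N) * L"] by (simp add: algebra_simps)
    also have "h (x + real N * L) = F (x + real N * L) - F (x + real (Suc N) * L)"
      using F[of "x + real N * L"] by (simp add: algebra_simps)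
    finally show ?case by simp
  qed simp
  moreover have "(\<lambda>N. \<Sum>n\<in>{- int N..<int N}. h (x + of_int n * L)) \<longlonglongrightarrow> s"
    using filterlim_compose[OF assms(1)[unfolded has_sum_def] filterlim_int_intervals] .
  ultimately show ?thesis by simp
qed

lemma Hm_single:
  assumes b: "b \<ge> 2"
  shows "Hm {b} (dop (dop q)) x = 0"
proof -
  define p where "p = dop (dop q)"
  define L where "L = 2 * ln (real b)"
  have L: "L > 0" using b by (simp add: L_def)
  have ok: "base_ok {b}" and okE: "base_ok {}" using b by (simp_all add: base_ok_def)
  have ind: "indep {b}" by (simp add: indep_def)
  have t0: "tay p 0 = 0" by (simp add: p_def tay_dop)
  have c0: "coeff p 0 = 0" by (simp add: p_def coeff_dop)
  define h where "h x = complex_of_real (pe p (exp x))" for x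
  define P where "P x = complex_of_real (Psi (aB {b}) p (exp x))" for x
  define T where "T x = (\<Sum>\<^sub>\<infinity>k. Tf {b} p k x)" for x
  define S where "S x = (\<Sum>\<^sub>\<infinity>n. Sf {b} b p n x)" for x
  have Hm: "Hm {b} p x = P x - T x - S x" for x by (simp add: Hm_def P_def T_def S_def)
  have Hper: "Hm {b} p (x + L) = Hm {b} p x" for x
    using Hm_rec[OF ok ind _ t0, of x] by (simp add: Hm_empty L_def)
  have Hper': "Hm {b} p (x - real N * L) = Hm {b} p x" for x N
  proof (induction N)
    case (Suc N)
    have e: "x - real (Suc N) * L + L = x - real N * L" by (simp add: algebra_simps)
    have "Hm {b} p (x - real (Suc N) * L) = Hm {b} p (x - real (Suc N) * L + L)" by (rule Hper[symmetric])
    then show ?case unfolding e Suc.IH .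
  qed simp
  have Sper: "S (x - real N * L) = S x" for x N
  proof -
    have "cis (- (pi * of_int n / ln (real b) * (x - real N * L))) = cis (- (pi * of_int n / ln (real b) * x))" for n :: int
    proof -
      have "- (pi * of_int n / ln (real b) * (x - real N * L)) = - (pi * of_int n / ln (real b) * x) + 2 * pi * of_int (n * int N)"
        using b by (simp add: L_def field_simps)
      moreover have "cis (2 * pi * of_int (n * int N)) = 1" by (rule cis_multiple_2pi) simp
      ultimately show ?thesis by (simp only: cis_mult[symmetric] mult_1_right)
    qed
    then show ?thesis by (simp add: S_def Sf_def)
  qed
  have Pper: "P x - P (x + L) = h x" for x
  proof -
    have "exp (x + L) = (real b)\<^sup>2 * exp x" using b by (simp add: L_def exp_add exp_double)
    then show ?thesis using Psi_aB_rec[OF ok, of "exp x" p] by (simp add: P_def h_def Psi_empty)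
  qed
  have Tlim: "(\<lambda>N. T (x - real N * L)) \<longlonglongrightarrow> 0" for x
  proof -
    define M where "M = (\<Sum>\<^sub>\<infinity>k. \<bar>tay p k * exp 0 ^ k\<bar>)"
    have bd: "norm (T y) \<le> M * exp y" if y: "y \<le> 0" for y
    proof -
      have tb: "norm (Tf {b} p k y) \<le> \<bar>tay p k * exp 0 ^ k\<bar> * exp y" for k
      proof (cases "k = 0")
        case False
        have "real k * y \<le> 1 * y" using False y by (intro mult_right_mono_neg) auto
        then have ek: "exp (real k * y) \<le> exp y" by simp
        have "norm (Tf {b} p k y) = \<bar>tay p k\<bar> * \<bar>Zk {b} k\<bar> * exp (real k * y)" by (simp only: Tf_def norm_of_real abs_mult abs_exp_cancel)
        also have "\<dots> \<le> \<bar>tay p k\<bar> * 1 * exp y" by (intro mult_mono ek Zk_abs_le[OF ok]) auto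
        finally show ?thesis by simp
      qed (simp add: Tf_def t0)
      have sm: "(\<lambda>k. \<bar>tay p k * exp 0 ^ k\<bar> * exp y) summable_on UNIV" by (intro summable_on_cmult_left tay_bound_summable)
      have "norm (T y) \<le> (\<Sum>\<^sub>\<infinity>k. \<bar>tay p k * exp 0 ^ k\<bar> * exp y)"
        unfolding T_def by (rule norm_infsum_le[OF has_sum_infsum[OF Tf_summable[OF ok]] has_sum_infsum[OF sm]]) (rule tb)
      also have "\<dots> = M * exp y" unfolding M_def by (rule infsum_cmult_left')
      finally show ?thesis .
    qed
    have "(\<lambda>N. M * exp (x - real N * L)) \<longlonglongrightarrow> 0" using L by real_asymp
    moreover have "\<forall>\<^sub>F N in sequentially. norm (T (x - real N * L)) \<le> M * exp (x - real N * L)"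
    proof -
      have "\<forall>\<^sub>F N in sequentially. x - real N * L \<le> 0" using L by real_asymp
      then show ?thesis by (rule eventually_mono) (rule bd)
    qed
    ultimately show ?thesis by (rule Lim_null_comparison[rotated])
  qed
  have Plim: "(\<lambda>N. P (x + real N * L)) \<longlonglongrightarrow> 0" for x
  proof -
    obtain C where C: "C \<ge> 0" "\<And>u. u > 0 \<Longrightarrow> \<bar>Psi (aB {b}) p u\<bar> \<le> C * exp (- u / 2) / u"
      using Psi_bound[OF adm_aB[OF ok], of p] by auto
    have bP: "norm (P y) \<le> C * exp (- y)" for y
    proof -
      have "norm (P y) \<le> C * exp (- exp y / 2) / exp y" unfolding P_def using C(2)[of "exp y"] by simp
      also have "\<dots> \<le> C * 1 / exp y" using C(1) by (intro divide_right_mono mult_left_mono) auto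
      finally show ?thesis by (simp add: exp_minus field_simps)
    qed
    have "\<forall>\<^sub>F N in sequentially. norm (P (x + real N * L)) \<le> C * exp (- (x + real N * L))" by (intro always_eventually allI bP)
    moreover have "(\<lambda>N. C * exp (- (x + real N * L))) \<longlonglongrightarrow> 0" using L by real_asymp
    ultimately show ?thesis by (rule Lim_null_comparison)
  qed
  define g where "g t = h (L * t)" for t
  obtain C1 where C1: "C1 \<ge> 0" "\<And>u. u \<ge> 0 \<Longrightarrow> \<bar>pe p u\<bar> \<le> C1 * exp (- u / 2)" "\<And>u. u \<ge> 0 \<Longrightarrow> u * \<bar>pe p u\<bar> \<le> C1 * exp (- u / 2)"
    by (rule pe_bounds[of p], rule that, assumption+)
  obtain r where r: "p = [:0, 1:] * r" by (simp add: p_def dop_def)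
  obtain C2 where C2: "C2 \<ge> 0" "\<And>u. u \<ge> 0 \<Longrightarrow> \<bar>pe r u\<bar> \<le> C2 * exp (- u / 2)" "\<And>u. u \<ge> 0 \<Longrightarrow> u * \<bar>pe r u\<bar> \<le> C2 * exp (- u / 2)"
    by (rule pe_bounds[of r], rule that, assumption+)
  define C where "C = C1 + C2"
  have hb: "norm (h y) \<le> C * exp (- \<bar>y\<bar>)" for y
  proof (cases "y \<ge> 0")
    case True
    have "exp y * \<bar>pe p (exp y)\<bar> \<le> C1 * exp (- exp y / 2)" by (rule C1(3)) simp
    also have "\<dots> \<le> C1 * 1" using C1(1) by (intro mult_left_mono) auto
    finally have "exp (- y) * (exp y * \<bar>pe p (exp y)\<bar>) \<le> exp (- y) * (C1 * 1)" by (rule mult_left_mono) simp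
    moreover have "exp (- y) * (exp y * a) = a" for a :: real by (simp add: exp_minus)
    ultimately have "\<bar>pe p (exp y)\<bar> \<le> C1 * exp (- y)" by (simp only: mult_1_right mult.commute[of C1])
    also have "\<dots> \<le> C * exp (- y)" using C2 by (intro mult_right_mono) (auto simp: C_def)
    finally show ?thesis using True by (simp add: h_def)
  next
    case False
    have "pe p (exp y) = exp y * pe r (exp y)" by (simp add: r pe_def)
    then have "\<bar>pe p (exp y)\<bar> = exp y * \<bar>pe r (exp y)\<bar>" by (simp add: abs_mult)
    also have "\<dots> \<le> exp y * (C2 * exp (- exp y / 2))" by (intro mult_left_mono C2(2)) auto
    also have "\<dots> \<le> exp y * (C2 * 1)" using C2(1) by (intro mult_left_mono) auto
    also have "\<dots> \<le> C * exp y" using C1(1) by (simp add: C_def)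
    finally show ?thesis using False by (simp add: h_def)
  qed
  have C0: "C \<ge> 0" using C1(1) C2(1) by (simp add: C_def)
  define B where "B n = C * exp L * exp (- L * real (nat \<bar>n\<bar>))" for n :: int
  have sB: "B summable_on UNIV"
  proof -
    have "(\<lambda>n::int. exp (- L * real (nat \<bar>n\<bar>))) summable_on UNIV"
      using has_sum_int_even[of "\<lambda>n. exp (- L * real n)"] summable_exp_neg_nat[OF L] by (auto simp: summable_on_def)
    then show ?thesis unfolding B_def[abs_def] by (rule summable_on_cmult_right)
  qed
  have gB: "norm (g (t + of_int n)) \<le> B n" if "t \<in> {0..1}" for t :: real and n :: int
  proof -
    have "\<bar>of_int n\<bar> \<le> \<bar>t + of_int n\<bar> + 1" using that by auto
    then have "L * \<bar>of_int n\<bar> \<le> L * (\<bar>t + of_int n\<bar> + 1)" using L by (intro mult_left_mono) auto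
    moreover have "\<bar>L * (t + of_int n)\<bar> = L * \<bar>t + of_int n\<bar>" using L by (simp add: abs_mult)
    ultimately have ex: "- \<bar>L * (t + of_int n)\<bar> \<le> L + - L * real (nat \<bar>n\<bar>)" by (simp add: algebra_simps)
    have "norm (g (t + of_int n)) \<le> C * exp (- \<bar>L * (t + of_int n)\<bar>)" unfolding g_def by (rule hb)
    also have "\<dots> \<le> C * exp (L + - L * real (nat \<bar>n\<bar>))" by (intro mult_left_mono C0) (simp only: exp_le_cancel_iff ex)
    also have "\<dots> = B n" by (simp only: B_def exp_add mult.assoc)
    finally show ?thesis .
  qed
  have contg: "continuous_on UNIV g" unfolding g_def[abs_def] h_def
    by (intro continuous_intros continuous_on_compose2[OF continuous_on_pe[of UNIV]]) auto
  define c where "c k = cf {b} b p (- k)" for k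
  have sc: "(\<lambda>k. norm (c k)) summable_on UNIV"
    unfolding c_def using cf_summable[OF ok ind, of b p] summable_on_reindex_bij_betw[of uminus UNIV UNIV "\<lambda>n. norm (cf {b} b p n)"] by (simp add: bij_uminus)
  have mel: "integrable lborel (\<lambda>t. g t * fchar (- k) t) \<and> (\<integral>t. g t * fchar (- k) t \<partial>lborel) = c k" for k
  proof -
    define w where "w = pole_B b (- k) / 2"
    have rw: "Re w = 0" by (simp add: w_def pole_B_def)
    have m0: "\<And>i. coeff p i \<noteq> 0 \<Longrightarrow> Re w + real i > 0" using c0 rw by (metis add_0 gr0I of_nat_0_less_iff)
    define f where "f u = complex_of_real (pe p (1 * u)) * of_real u powr (w - 1)" for u
    have ml1: "set_integrable lborel {0<..} f" unfolding f_def by (rule pe_mellin(1)) (erule m0, simp)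
    have ml2: "(LINT u:{0<..}|lborel. f u) = of_real 1 powr (- w) * NN p w" unfolding f_def by (rule pe_mellin(2)) (erule m0, simp)
    have cf: "continuous_on {0<..} f" unfolding f_def
      by (intro continuous_intros continuous_on_compose2[OF continuous_on_pe[of UNIV]]) (auto simp: complex_nonpos_Reals_iff)
    have eq: "of_real (exp (L * t)) * f (exp (L * t)) = g t * fchar (- k) t" for t
    proof -
      have "complex_of_real (exp (L * t)) * complex_of_real (exp (L * t)) powr (w - 1) = exp (of_real (L * t) + (w - 1) * of_real (L * t))"
        by (simp only: powr_of_pos[OF exp_gt_zero] exp_add exp_of_real ln_exp)
      also have "of_real (L * t) + (w - 1) * of_real (L * t) = w * of_real (L * t)" by (simp add: algebra_simps)
      also have "w * of_real (L * t) = \<i> * of_real (2 * pi * of_int (- k) * t)"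
        using b by (simp add: w_def pole_B_def L_def)
      finally show ?thesis by (simp add: f_def g_def h_def fchar_def cis_conv_exp mult_ac)
    qed
    have val: "(LINT u:{0<..}|lborel. f u) / of_real L = c k"
    proof (cases "k = 0")
      case True
      have "NN p 0 = 0" unfolding p_def by (rule NN_dop_zero) (simp add: coeff_dop)
      moreover have "w = 0" using True by (simp add: w_def pole_B_def)
      ultimately show ?thesis using ml2 True by (simp add: c_def cf_def)
    next
      case False
      then show ?thesis using ml2 by (simp add: c_def cf_def w_def[symmetric] L_def zeta_B_def)
    qed
    show ?thesis using mellin_exp_substitution[OF L ml1 cf] unfolding eq val by simp
  qed
  have poi: "(\<Sum>\<^sub>\<infinity>n. g (t + of_int n)) = (\<Sum>\<^sub>\<infinity>k. c k * fchar k t)" if "t \<in> {0..1}" for t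
    by (rule poisson_summation_real[OF contg gB sB sc]) (use mel that in auto)
  have H01: "Hm {b} p (L * t) = 0" if t: "t \<in> {0..1}" for t
  proof -
    have S: "(\<Sum>\<^sub>\<infinity>k. c k * fchar k t) = S (L * t)"
    proof -
      have "Sf {b} b p n (L * t) = c (- n) * fchar (- n) t" for n
        using b by (simp add: Sf_def c_def fchar_def L_def mult_ac)
      then have "S (L * t) = (\<Sum>\<^sub>\<infinity>n. c (- n) * fchar (- n) t)" by (simp add: S_def)
      also have "\<dots> = (\<Sum>\<^sub>\<infinity>n. c n * fchar n t)"
        by (rule infsum_reindex_bij_betw[where g = uminus]) (simp add: bij_uminus)
      finally show ?thesis ..
    qed
    have "(\<lambda>n. g (t + of_int n)) summable_on UNIV"
      by (rule abs_summable_summable, rule summable_on_comparison_test[OF sB]) (use gB[OF t] in auto)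
    then have "((\<lambda>n. g (t + of_int n)) has_sum S (L * t)) UNIV" using poi[OF t] S by (metis has_sum_infsum)
    then have "((\<lambda>n. h (L * t + of_int n * L)) has_sum S (L * t)) UNIV" by (simp add: g_def algebra_simps)
    from has_sum_telescope[OF this Pper]
    have l1: "(\<lambda>N. P (L * t - real N * L) - P (L * t + real N * L)) \<longlonglongrightarrow> S (L * t)" .
    have "P (L * t - real N * L) = Hm {b} p (L * t) + S (L * t) + T (L * t - real N * L)" for N
      using Hm[of "L * t - real N * L"] unfolding Hper' Sper by simp
    then have "(\<lambda>N. P (L * t - real N * L) - P (L * t + real N * L)) \<longlonglongrightarrow> Hm {b} p (L * t) + S (L * t) + 0 - 0"
      by (simp only:) (intro tendsto_intros Tlim Plim)
    from LIMSEQ_unique[OF l1 this] show ?thesis by simp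
  qed
  define n where "n = \<lfloor>x / L\<rfloor>"
  define t where "t = x / L - of_int n"
  have t: "t \<in> {0..1}" unfolding t_def n_def by (simp add: le_floor_iff) linarith
  have Hm_int: "Hm {b} p (y + of_int n * L) = Hm {b} p y" for y
  proof (cases "n \<ge> 0")
    case True
    then have e: "real_of_int n = real (nat n)" by simp
    show ?thesis using Hper'[of "y + of_int n * L" "nat n"] unfolding e by simp
  next
    case False
    then have e: "real_of_int n = - real (nat (- n))" by simp
    show ?thesis using Hper'[of y "nat (- n)"] unfolding e by simp
  qed
  have "x = L * t + of_int n * L" using L by (simp add: t_def field_simps)
  then show ?thesis using Hm_int[of "L * t"] H01[OF t] unfolding p_def by simp
qed

lemma periodic_int:
  fixes F :: "real \<Rightarrow> 'a"
  assumes "\<And>x. F (x + P) = F x"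
  shows "F (x + of_int k * P) = F x"
proof -
  have n: "F (x + real N * P) = F x" for x N
  proof (induction N)
    case (Suc N)
    have "F (x + real (Suc N) * P) = F ((x + real N * P) + P)" by (simp add: algebra_simps)
    then show ?case using assms Suc.IH by simp
  qed simp
  show ?thesis
  proof (cases "k \<ge> 0")
    case True
    then show ?thesis using n[of x "nat k"] by simp
  next
    case False
    then have e: "real_of_int k = - real (nat (- k))" by simp
    show ?thesis using n[of "x + of_int k * P" "nat (- k)"] unfolding e by simp
  qed
qed

lemma ln_ratio_irrational:
  assumes "c \<ge> 2" "d \<ge> 2" "\<And>r t. r > 0 \<Longrightarrow> t > 0 \<Longrightarrow> c ^ r \<noteq> d ^ t"
  shows "ln (real d) / ln (real c) \<notin> \<rat>"
proof
  have pos: "ln (real c) > 0" "ln (real d) > 0" using assms by simp_all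
  assume "ln (real d) / ln (real c) \<in> \<rat>"
  then obtain m n where mn: "n \<noteq> 0" "\<bar>ln (real d) / ln (real c)\<bar> = real m / real n"
    by (rule Rats_abs_nat_div_natE)
  have "ln (real d) / ln (real c) > 0" using pos by simp
  then have e: "ln (real d) / ln (real c) = real m / real n" using mn(2) by (simp only: abs_of_pos)
  then have m: "m > 0" using \<open>ln (real d) / ln (real c) > 0\<close> by (cases m) auto
  have "real n * ln (real d) = real m * ln (real c)" using e pos mn by (simp add: field_simps)
  then have "ln (real d ^ n) = ln (real c ^ m)" using assms by (simp add: ln_realpow)
  then have "real d ^ n = real c ^ m" using assms by (subst (asm) ln_inj_iff) auto
  then have "real (d ^ n) = real (c ^ m)" by simp
  then have "c ^ m = d ^ n" by linarith
  then show False using assms(3)[OF m] mn(1) by simp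
qed

theorem Hm_zero:
  assumes "base_ok B" "indep B"
  shows "Hm B ((dop ^^ (card B + 1)) q) x = 0"
  using assms
proof (induction "card B" arbitrary: B q x rule: less_induct)
  case less
  have fin: "finite B" using less.prems by (simp add: base_ok_def)
  show ?case
  proof (cases "card B \<le> 1")
    case True
    show ?thesis
    proof (cases "B = {}")
      case False
      then have "card B = 1" using True fin by (simp add: le_Suc_eq)
      then obtain b where B: "B = {b}" by (rule card_1_singletonE)
      then have "b \<ge> 2" using less.prems by (simp add: base_ok_def)
      from Hm_single[OF this, of q x] show ?thesis by (simp add: B)
    qed (simp add: Hm_empty)
  next
    case False
    then obtain c where c: "c \<in> B" by fastforce
    have cc: "card (B - {c}) = card B - 1" using c by simp
    have "B - {c} \<noteq> {}"
    proof
      assume "B - {c} = {}"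
      then have "card (B - {c}) = 0" by (simp only: card.empty)
      then show False using cc False by simp
    qed
    then obtain d where d: "d \<in> B" "d \<noteq> c" by blast
    have per: "Hm B ((dop ^^ card B) r) (x + 2 * ln (real e)) = Hm B ((dop ^^ card B) r) x" if e: "e \<in> B" for e r x
    proof -
      have B: "insert e (B - {e}) = B" using e by auto
      have card: "card (B - {e}) + 1 = card B" using e False by simp
      have ok': "base_ok (B - {e})" by (rule base_ok_subset[OF less.prems(1)]) auto
      have ind': "indep (B - {e})" by (rule indep_subset[OF less.prems(2)]) auto
      have z: "Hm (B - {e}) ((dop ^^ card B) r) x = 0"
      proof -
        have lt: "card (B - {e}) < card B" using card by linarith
        show ?thesis using less.hyps[OF lt ok' ind', of r x] unfolding card .
      qed
      have "tay ((dop ^^ card B) r) 0 = 0"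
      proof -
        have "(dop ^^ card B) r = dop ((dop ^^ (card B - 1)) r)" using False by (cases "card B") auto
        then show ?thesis by (simp add: tay_dop)
      qed
      then show ?thesis using Hm_rec[of e "B - {e}" "(dop ^^ card B) r" x] z less.prems unfolding B by simp
    qed
    define p' where "p' = (dop ^^ card B) q"
    define p where "p = (dop ^^ (card B + 1)) q"
    have pd: "p = dop p'" "p = (dop ^^ card B) (dop q)" by (simp_all add: p_def p'_def funpow_swap1)
    define F where "F x = Hm B p x" for x
    have perF: "F (x + 2 * ln (real e)) = F x" if "e \<in> B" for e x
      unfolding F_def pd(2) by (rule per[OF that])
    note f = indep_factor[OF less.prems c d(1) not_sym[OF d(2)]]
    define \<theta> where "\<theta> = ln (real d) / ln (real c)"
    have irr: "\<theta> \<notin> \<rat>" unfolding \<theta>_def by (rule ln_ratio_irrational[OF f])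
    define X where "X = 2 * ln (real c)"
    have X: "X > 0" using f(1) by (simp add: X_def)
    have pX: "F (x + X) = F x" for x unfolding X_def by (rule perF[OF c])
    have X\<theta>: "X * \<theta> = 2 * ln (real d)" using X by (simp add: X_def \<theta>_def)
    have cl: "closure (range (\<lambda>n. frac (real n * \<theta>))) = {0..1}"
      by (rule Kronecker_approx_1[OF irr])
    have const: "F (X * s) = F 0" if s: "s \<in> {0..1}" for s
    proof (rule continuous_constant_on_closure[where S = "range (\<lambda>n. frac (real n * \<theta>))" and f = "\<lambda>s. F (X * s)"])
      show "continuous_on (closure (range (\<lambda>n. frac (real n * \<theta>)))) (\<lambda>s. F (X * s))"
        unfolding cl F_def
        by (rule continuous_on_compose2[OF continuous_on_Hm[OF less.prems, of 0 X p]]) (use X in \<open>auto intro!: continuous_intros\<close>)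
      show "s \<in> closure (range (\<lambda>n. frac (real n * \<theta>)))" unfolding cl by (rule s)
      fix y assume "y \<in> range (\<lambda>n. frac (real n * \<theta>))"
      then obtain n where y: "y = frac (real n * \<theta>)" by blast
      have e: "X * y = (0 + of_int (int n) * (2 * ln (real d))) + of_int (- \<lfloor>real n * \<theta>\<rfloor>) * X"
        unfolding X\<theta>[symmetric] y frac_def by (simp add: algebra_simps)
      have "F (X * y) = F (0 + of_int (int n) * (2 * ln (real d)))"
        unfolding e by (rule periodic_int[where F = F and P = X, OF pX])
      also have "\<dots> = F 0" by (rule periodic_int[where F = F and P = "2 * ln (real d)", OF perF[OF d(1)]])
      finally show "F (X * y) = F 0" .
    qed
    have const': "F y = F 0" for y
    proof -
      have "y = X * frac (y / X) + of_int \<lfloor>y / X\<rfloor> * X" using X by (simp add: frac_def field_simps)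
      then have "F y = F (X * frac (y / X) + of_int \<lfloor>y / X\<rfloor> * X)" by (rule arg_cong)
      also have "\<dots> = F (X * frac (y / X))" by (rule periodic_int[where F = F and P = X, OF pX])
      also have "\<dots> = F 0" by (rule const) (simp add: frac_ge_0 less_imp_le[OF frac_lt_1])
      finally show ?thesis .
    qed
    have "(F has_integral (Hm B p' X - Hm B p' 0)) {0..X}"
      unfolding F_def[abs_def] pd(1) by (rule Hm_has_integral[OF less.prems less_imp_le[OF X]])
    moreover have "Hm B p' X - Hm B p' 0 = 0" using per[OF c, of q 0] unfolding p'_def X_def by simp
    ultimately have "(F has_integral 0) {0..X}" by simp
    moreover have "(F has_integral (X *\<^sub>R F 0)) {0..X}"
    proof -
      have "((\<lambda>_. F 0) has_integral (X *\<^sub>R F 0)) {0..X}" using has_integral_const_real[of "F 0" 0 X] X by simp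
      moreover have "F = (\<lambda>_. F 0)" using const' by (rule ext)
      ultimately show ?thesis by (simp only:)
    qed
    ultimately have "X *\<^sub>R F 0 = 0" by (rule has_integral_unique[rotated])
    then have "F 0 = 0" using X by simp
    then show ?thesis using const'[of x] unfolding F_def p_def by simp
  qed
qed

section \<open>Comparison of the errors\<close>

lemma Psi_diff_sums:
  assumes "adm \<sigma> a" "u > 0"
  shows "(\<lambda>n. (a n - one_w n) * WW j n u) sums (Psi a ((LL ^^ j) 1) u - Psi one_w ((LL ^^ j) 1) u)"
  using sums_diff[OF Psi_sums[OF assms, of "(LL ^^ j) 1"] Psi_sums[OF adm_one_w assms(2), of "(LL ^^ j) 1"]]
  by (simp only: WW_def left_diff_distrib)

lemma Psi_diff_leading:
  assumes a: "adm \<sigma> a" and N: "N \<ge> j + 1" "N \<ge> 3" and u: "u \<ge> 3"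
    and c: "\<And>n. n < N \<Longrightarrow> a n = one_w n" "\<And>n. \<bar>a n - one_w n\<bar> \<le> real n"
  shows "\<bar>Psi a ((LL ^^ j) 1) u - Psi one_w ((LL ^^ j) 1) u - (a N - one_w N) * WW j N u\<bar> \<le> 4 ^ j * VV j N u / 2000"
proof -
  define c' where "c' n = (if n = N then 0 else a n - one_w n)" for n
  define D where "D = Psi a ((LL ^^ j) 1) u - Psi one_w ((LL ^^ j) 1) u"
  have 1: "(\<lambda>n. (a n - one_w n) * WW j n u - (if n = N then (a n - one_w n) * WW j n u else 0)) sums (D - (a N - one_w N) * WW j N u)"
    unfolding D_def by (intro sums_diff Psi_diff_sums[OF a] sums_single) (use u in simp)
  have 2: "(\<lambda>n. (a n - one_w n) * WW j n u - (if n = N then (a n - one_w n) * WW j n u else 0)) = (\<lambda>n. c' n * WW j n u)"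
    by (auto simp: c'_def)
  have "\<bar>\<Sum>n. c' n * WW j n u\<bar> \<le> 4 ^ j * VV j N u / 2000"
    by (rule WW_tail[OF N u]) (use c in \<open>auto simp: c'_def\<close>)
  then show ?thesis using sums_unique[OF 1[unfolded 2]] unfolding D_def by (simp only:)
qed

lemma exp_bound_step:
  fixes N :: nat and u :: real
  assumes "N \<ge> 3" "u \<ge> 3"
  shows "4 * (((real (N + 1))\<^sup>2 * u)\<^sup>2 * exp (4 - (2 * real N + 1) * u)) < 1"
proof -
  define x where "x = real (N + 1) * u"
  have "real (N + 1) * u \<ge> 4 * 3" by (intro mult_mono) (use assms in auto)
  then have x: "x \<ge> 12" by (simp add: x_def)
  have "real (N + 1) \<ge> 4" using assms by simp
  then have "7 / 4 * real (N + 1) \<le> 2 * real N + 1" by simp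
  then have "7 / 4 * real (N + 1) * u \<le> (2 * real N + 1) * u" using assms by (intro mult_right_mono) auto
  then have "7 / 4 * x \<le> (2 * real N + 1) * u" by (simp only: x_def mult.assoc)
  then have e: "exp (4 - (2 * real N + 1) * u) \<le> exp (4 - 7 / 4 * x)" by (simp only: exp_le_cancel_iff diff_left_mono)
  have "((real (N + 1))\<^sup>2 * u)\<^sup>2 = (real (N + 1)) ^ 4 * u\<^sup>2" by (simp add: power_mult_distrib)
  also have "\<dots> \<le> (real (N + 1)) ^ 4 * u ^ 4"
    using assms by (intro mult_left_mono power_increasing) auto
  also have "\<dots> = x ^ 4" by (simp add: x_def power_mult_distrib)
  finally have y: "((real (N + 1))\<^sup>2 * u)\<^sup>2 \<le> x ^ 4" .
  have "x / 4 \<le> exp (x / 4 - 1)" using exp_ge_add_one_self[of "x / 4 - 1"] by simp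
  then have "(x / 4) ^ 4 \<le> exp (x / 4 - 1) ^ 4" using x by (intro power_mono) auto
  also have "\<dots> = exp (x - 4)" by (simp add: exp_of_nat_mult[symmetric])
  finally have x4: "x ^ 4 \<le> 256 * exp (x - 4)" by (simp add: power_divide)
  have h: "3 / 2 \<le> exp (1 / 2 :: real)" using exp_ge_add_one_self[of "1 / 2"] by simp
  have "(3 / 2) ^ 18 \<le> exp (1 / 2 :: real) ^ 18" by (rule power_mono[OF h]) simp
  also have "exp (1 / 2 :: real) ^ 18 = exp (of_nat 18 * (1 / 2))" by (rule exp_of_nat_mult[symmetric])
  also have "of_nat 18 * (1 / 2) = (9 :: real)" by simp
  finally have "(3 / 2) ^ 18 \<le> exp (9 :: real)" .
  moreover have "(3 / 2 :: real) ^ 18 > 1024" by (simp add: power_divide)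
  ultimately have e9: "exp (9 :: real) > 1024" by (rule less_le_trans[rotated])
  have "((real (N + 1))\<^sup>2 * u)\<^sup>2 * exp (4 - (2 * real N + 1) * u) \<le> x ^ 4 * exp (4 - 7 / 4 * x)"
    by (intro mult_mono y e) auto
  also have "\<dots> \<le> (256 * exp (x - 4)) * exp (4 - 7 / 4 * x)" by (intro mult_right_mono x4) auto
  also have "\<dots> = 256 * exp (- (3 / 4 * x))"
  proof -
    have "x - 4 + (4 - 7 / 4 * x) = - (3 / 4 * x)" by simp
    then show ?thesis by (simp only: mult.assoc exp_add[symmetric])
  qed
  also have "\<dots> \<le> 256 * exp (- 9)" using x by simp
  finally have f: "((real (N + 1))\<^sup>2 * u)\<^sup>2 * exp (4 - (2 * real N + 1) * u) \<le> 256 * exp (- 9)" .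
  have "256 * exp (- 9 :: real) < 1 / 4" using e9 by (simp add: exp_minus field_simps)
  then show ?thesis using f by linarith
qed

lemma VV_Suc: "VV (Suc j) n u = VV j n u * ((real n)\<^sup>2 * u)\<^sup>2"
  by (simp add: VV_def power2_eq_square)

lemma base_ok_primes: "base_ok {r. prime r \<and> r < N}"
  unfolding base_ok_def using prime_ge_2_nat by auto

lemma aB_primes_below:
  assumes "0 < n" "n < N" shows "aB {r. prime r \<and> r < N} n = 1"
proof -
  have "prime_factors n \<subseteq> {r. prime r \<and> r < N}"
  proof
    fix r assume "r \<in> prime_factors n"
    then have "prime r" "r dvd n" by auto
    then show "r \<in> {r. prime r \<and> r < N}" using dvd_imp_le[of r n] assms by simp
  qed
  then show ?thesis using aB_primes[of "{r. prime r \<and> r < N}" n] assms by simp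
qed

lemma aB_primes_le: "aB {r. prime r \<and> r < N} n \<le> 1"
proof (cases "n = 0")
  case True
  then show ?thesis using aB_zero[OF base_ok_primes] by simp
next
  case False
  then show ?thesis using aB_primes[of "{r. prime r \<and> r < N}" n] by simp
qed

lemma one_w_simps: "one_w 0 = 0" "n > 0 \<Longrightarrow> one_w n = 1"
  by (simp_all add: one_w_def)

lemma aB_minus_one_w:
  assumes "base_ok B" "\<And>n. aB B n \<le> real n \<or> aB B n \<le> 1"
  shows "\<bar>aB B n - one_w n\<bar> \<le> real n"
proof (cases "n = 0")
  case True
  then show ?thesis using aB_zero[OF assms(1)] by (simp add: one_w_simps)
next
  case False
  then have "real n \<ge> 1" by simp
  then show ?thesis using assms(2)[of n] aB_nonneg[of B n] False by (auto simp: one_w_simps)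
qed

lemma card_primes_below:
  assumes "N \<ge> 2" shows "card {r. prime r \<and> r < N} + 2 \<le> N"
proof -
  have "card {r. prime r \<and> r < N} \<le> card {2..<N}"
    by (rule card_mono) (use prime_ge_2_nat in auto)
  then show ?thesis using assms by simp
qed

lemma card_primes_below':
  assumes "N \<ge> 5" shows "card {r. prime r \<and> r < N} + 3 \<le> N"
proof -
  have "\<not> prime (4::nat)" using prime_odd_nat[of 4] by auto
  then have "{r. prime r \<and> r < N} \<subseteq> {2..<N} - {4}" using prime_ge_2_nat by auto
  then have "card {r. prime r \<and> r < N} \<le> card ({2..<N} - {4})" by (intro card_mono) auto
  also have "\<dots> = N - 2 - 1" using assms by (subst card_Diff_singleton) auto
  finally show ?thesis using assms by simp
qed

lemma compare_prime:
  fixes N :: nat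
  defines "B \<equiv> {r. prime r \<and> r < N}"
  assumes N: "prime N" "N \<ge> 3" and u: "u \<ge> 3"
  shows "4 * \<bar>Psi (aB (insert N B)) ((LL ^^ (card B + 2)) 1) u - Psi one_w ((LL ^^ (card B + 2)) 1) u\<bar>
    < Psi one_w ((LL ^^ (card B + 1)) 1) u - Psi (aB B) ((LL ^^ (card B + 1)) 1) u"
proof -
  define j where "j = card B + 1"
  have jN: "N \<ge> j + 1" using card_primes_below[of N] N by (simp add: j_def B_def)
  have okB: "base_ok B" unfolding B_def by (rule base_ok_primes)
  have N1: "\<not> prime (N + 1)"
  proof
    assume "prime (N + 1)"
    then have "odd (N + 1)" using prime_odd_nat[of "N + 1"] N by simp
    moreover have "odd N" using prime_odd_nat[of N] N by simp
    ultimately show False by simp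
  qed
  have B': "insert N B = {r. prime r \<and> r < N + 2}"
  proof (intro equalityI subsetI)
    fix r assume "r \<in> insert N B"
    then show "r \<in> {r. prime r \<and> r < N + 2}" using N(1) by (auto simp: B_def)
  next
    fix r assume r: "r \<in> {r. prime r \<and> r < N + 2}"
    have "r \<noteq> N + 1"
    proof
      assume e: "r = N + 1"
      have "prime r" using r by simp
      then show False using N1 unfolding e by (rule notE[rotated])
    qed
    then show "r \<in> insert N B" using r by (auto simp: B_def)
  qed
  have aN: "aB B N = 0"
  proof -
    have "prime_factors N = {N}" using N(1) by (simp add: prime_factorization_prime)
    moreover have "N \<notin> B" by (simp add: B_def)
    moreover have "\<forall>b\<in>B. prime b" by (simp add: B_def)
    ultimately show ?thesis using aB_primes[of B N] N(2) by simp
  qed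
  have A1: "\<bar>Psi (aB B) ((LL ^^ j) 1) u - Psi one_w ((LL ^^ j) 1) u - (aB B N - one_w N) * WW j N u\<bar> \<le> 4 ^ j * VV j N u / 2000"
  proof (rule Psi_diff_leading[OF adm_aB[OF okB] jN N(2) u])
    fix n assume "n < N"
    then show "aB B n = one_w n" using aB_primes_below[of n N] aB_zero[OF okB] by (cases "n = 0") (simp_all add: one_w_simps B_def)
  next
    show "\<bar>aB B n - one_w n\<bar> \<le> real n" for n
      by (rule aB_minus_one_w[OF okB]) (use aB_primes_le in \<open>simp add: B_def\<close>)
  qed
  have ok': "base_ok (insert N B)" unfolding B' by (rule base_ok_primes)
  have w: "WW j N u \<ge> 4 ^ j * VV j N u / 400" "VV j N u > 0" using WW_bounds[OF jN u] by auto
  define X where "X = 4 ^ j * VV j N u"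
  have X: "X > 0" using w by (simp add: X_def)
  have e1: "card B + 2 = j + 1" and e2: "card B + 1 = j" by (simp_all add: j_def)
  have lin2: "\<bar>D\<bar> \<le> T / 2000 \<Longrightarrow> T < X \<Longrightarrow> E \<ge> X / 500 \<Longrightarrow> 4 * \<bar>D\<bar> < E" for D T E :: real by linarith
  have lin: "\<bar>P - Q - (- 1) * W\<bar> \<le> X / 2000 \<Longrightarrow> W \<ge> X / 400 \<Longrightarrow> Q - P \<ge> X / 500" for P Q W :: real
    using X by linarith
  have m1: "aB B N - one_w N = - 1" using aN N by (simp add: one_w_simps)
  have lo: "Psi one_w ((LL ^^ j) 1) u - Psi (aB B) ((LL ^^ j) 1) u \<ge> X / 500"
    by (rule lin[OF A1[unfolded m1 X_def[symmetric]] w(1)[folded X_def]])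
  have jN': "N + 1 \<ge> (j + 1) + 1" using jN by simp
  have A2: "\<bar>Psi (aB (insert N B)) ((LL ^^ (j + 1)) 1) u - Psi one_w ((LL ^^ (j + 1)) 1) u - (aB (insert N B) (N + 1) - one_w (N + 1)) * WW (j + 1) (N + 1) u\<bar>
      \<le> 4 ^ (j + 1) * VV (j + 1) (N + 1) u / 2000"
  proof (rule Psi_diff_leading[OF adm_aB[OF ok'] jN' _ u])
    show "N + 1 \<ge> 3" using N by simp
    fix n assume "n < N + 1"
    then show "aB (insert N B) n = one_w n" using aB_primes_below[of n "N + 2"] aB_zero[OF ok'] unfolding B' by (cases "n = 0") (simp_all add: one_w_simps)
  next
    show "\<bar>aB (insert N B) n - one_w n\<bar> \<le> real n" for n
      by (rule aB_minus_one_w[OF ok']) (use aB_primes_le in \<open>simp add: B'\<close>)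
  qed
  have z: "aB (insert N B) (N + 1) - one_w (N + 1) = 0" unfolding B' using aB_primes_below[of "N + 1" "N + 2"] by (simp add: one_w_simps)
  have up: "\<bar>Psi (aB (insert N B)) ((LL ^^ (j + 1)) 1) u - Psi one_w ((LL ^^ (j + 1)) 1) u\<bar> \<le> 4 ^ (j + 1) * VV (j + 1) (N + 1) u / 2000"
    using A2 unfolding z by simp
  have "VV (j + 1) (N + 1) u = VV j (N + 1) u * ((real (N + 1))\<^sup>2 * u)\<^sup>2" using VV_Suc[of j "N + 1" u] by simp
  also have "\<dots> \<le> (VV j N u * exp (4 - (2 * real N + 1) * u)) * ((real (N + 1))\<^sup>2 * u)\<^sup>2"
    by (intro mult_right_mono VV_step u) (use jN N in auto)
  finally have "4 * VV (j + 1) (N + 1) u \<le> VV j N u * (4 * (((real (N + 1))\<^sup>2 * u)\<^sup>2 * exp (4 - (2 * real N + 1) * u)))" by argo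
  also have "\<dots> < VV j N u * 1" by (intro mult_strict_left_mono exp_bound_step N u w)
  finally have "4 * VV (j + 1) (N + 1) u < VV j N u" by simp
  then have "4 ^ j * (4 * VV (j + 1) (N + 1) u) < 4 ^ j * VV j N u" by (intro mult_strict_left_mono) auto
  then have "4 ^ (j + 1) * VV (j + 1) (N + 1) u < X" unfolding X_def by simp
  then have "4 ^ (j + 1) * VV (j + 1) (N + 1) u < X" .
  from lin2[OF up this lo] show ?thesis unfolding e1 e2 .
qed

lemma compare_composite:
  fixes q N :: nat
  defines "B \<equiv> {r. prime r \<and> r < N}"
  assumes q: "q < N" "\<not> prime q" "q \<ge> 6" "B = {r. prime r \<and> r < q}" and u: "u \<ge> 3"
  shows "\<bar>Psi (aB B) ((LL ^^ (card B + 1)) 1) u - Psi one_w ((LL ^^ (card B + 1)) 1) u\<bar> \<le>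
    4 * (Psi (aB (insert q B)) ((LL ^^ (card B + 2)) 1) u - Psi one_w ((LL ^^ (card B + 2)) 1) u)"
proof -
  define j where "j = card B + 1"
  have jN: "q \<ge> j + 1 + 1" using card_primes_below'[of q] q by (simp add: j_def)
  have okB: "base_ok B" unfolding B_def by (rule base_ok_primes)
  then have ok': "base_ok (insert q B)" using q by simp
  have qB: "q \<notin> B" unfolding B_def using q by simp
  have a1: "aB B n = 1" if "0 < n" "n < N" for n unfolding B_def by (rule aB_primes_below[OF that])
  have ins: "aB (insert q B) n = aB B n + (if q dvd n then aB (insert q B) (n div q) else 0)" for n
    by (rule aB_insert[OF ok' qB])
  have aq: "aB (insert q B) q = 2"
  proof -
    have "aB (insert q B) 1 = 1" using ins[of 1] a1[of 1] q by simp
    then show ?thesis using ins[of q] a1[of q] q by simp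
  qed
  have A1: "\<bar>Psi (aB B) ((LL ^^ j) 1) u - Psi one_w ((LL ^^ j) 1) u - (aB B q - one_w q) * WW j q u\<bar> \<le> 4 ^ j * VV j q u / 2000"
  proof (rule Psi_diff_leading[OF adm_aB[OF okB] _ _ u])
    fix n assume "n < q"
    then show "aB B n = one_w n" using a1[of n] aB_zero[OF okB] q by (cases "n = 0") (simp_all add: one_w_simps)
  next
    show "\<bar>aB B n - one_w n\<bar> \<le> real n" for n
      by (rule aB_minus_one_w[OF okB]) (use aB_primes_le in \<open>simp add: B_def\<close>)
  qed (use jN q in auto)
  have z: "aB B q - one_w q = 0" using a1[of q] q by (simp add: one_w_simps)
  have A2: "\<bar>Psi (aB (insert q B)) ((LL ^^ (j + 1)) 1) u - Psi one_w ((LL ^^ (j + 1)) 1) u - (aB (insert q B) q - one_w q) * WW (j + 1) q u\<bar>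
      \<le> 4 ^ (j + 1) * VV (j + 1) q u / 2000"
  proof (rule Psi_diff_leading[OF adm_aB[OF ok'] _ _ u])
    fix n assume n: "n < q"
    show "aB (insert q B) n = one_w n"
    proof (cases "n = 0")
      case True
      then show ?thesis using aB_zero[OF ok'] by (simp add: one_w_simps)
    next
      case False
      then have "\<not> q dvd n" using n dvd_imp_le[of q n] by auto
      then show ?thesis using ins[of n] a1[of n] n False q by (simp add: one_w_simps)
    qed
  next
    show "\<bar>aB (insert q B) n - one_w n\<bar> \<le> real n" for n
    proof (rule aB_minus_one_w[OF ok'])
      fix n
      have "aB (insert q B) n \<le> real n"
        by (rule aB_insert_le) (use q okB qB in \<open>auto simp: B_def\<close>)
      then show "aB (insert q B) n \<le> real n \<or> aB (insert q B) n \<le> 1" by blast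
    qed
  qed (use jN q in auto)
  have z': "aB (insert q B) q - one_w q = 1" using aq q by (simp add: one_w_simps)
  have w: "WW (j + 1) q u \<ge> 4 ^ (j + 1) * VV (j + 1) q u / 400" "VV (j + 1) q u > 0" using WW_bounds[OF jN u] by auto
  have vj: "VV j q u > 0" using WW_bounds(3)[of j q u] jN u by simp
  have "(real q)\<^sup>2 \<ge> 1" by (rule one_le_power) (use q in simp)
  then have "1 * 1 \<le> (real q)\<^sup>2 * u" by (intro mult_mono) (use u in auto)
  then have "((real q)\<^sup>2 * u)\<^sup>2 \<ge> 1" by (intro one_le_power) simp
  then have "VV j q u * 1 \<le> VV j q u * ((real q)\<^sup>2 * u)\<^sup>2" using vj by (intro mult_left_mono) auto
  then have vv: "VV j q u \<le> VV (j + 1) q u" using VV_Suc[of j q u] by simp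
  define X where "X = 4 ^ j * VV j q u"
  define Y where "Y = 4 ^ (j + 1) * VV (j + 1) q u"
  have X: "X > 0" using vj by (simp add: X_def)
  have "4 ^ j * VV j q u \<le> 4 ^ (j + 1) * VV (j + 1) q u" by (intro mult_mono vv) (use vj in auto)
  then have XY: "X \<le> Y" by (simp add: X_def Y_def)
  have l: "\<bar>Psi (aB B) ((LL ^^ j) 1) u - Psi one_w ((LL ^^ j) 1) u\<bar> \<le> X / 2000" using A1 unfolding z X_def by simp
  have e1: "card B + 2 = j + 1" and e2: "card B + 1 = j" by (simp_all add: j_def)
  have lin: "\<bar>P - Q - 1 * W\<bar> \<le> Y / 2000 \<Longrightarrow> W \<ge> Y / 400 \<Longrightarrow> \<bar>E\<bar> \<le> X / 2000 \<Longrightarrow> \<bar>E\<bar> \<le> 4 * (P - Q)" for P Q W E :: real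
  proof -
    assume a: "\<bar>P - Q - 1 * W\<bar> \<le> Y / 2000" "W \<ge> Y / 400" "\<bar>E\<bar> \<le> X / 2000"
    have "W - Y / 2000 \<le> P - Q" using abs_le_D2[OF a(1)] by simp
    then have "Y / 400 - Y / 2000 \<le> P - Q" using a(2) by linarith
    then have "4 * (Y / 400 - Y / 2000) \<le> 4 * (P - Q)" by (rule mult_left_mono) simp
    moreover have "X / 2000 \<le> 4 * (Y / 400 - Y / 2000)" using X XY by (simp add: field_simps)
    ultimately show ?thesis using a(3) by (meson order_trans)
  qed
  show ?thesis unfolding e1 e2 by (rule lin[OF A2[unfolded z' Y_def[symmetric]] w(1)[folded Y_def] l])
qed

section \<open>The Riemann xi function at 1/2\<close>

lemma pi_le_pos: "pi \<le> x \<Longrightarrow> 0 < x"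
  using pi_gt_zero by linarith

lemma set_borel_measurable_cont:
  fixes f :: "real \<Rightarrow> complex"
  assumes "continuous_on A f" "A \<in> sets borel"
  shows "set_borel_measurable lborel A f"
  using borel_measurable_continuous_on_indicator[OF assms(2,1)] by (simp add: set_borel_measurable_def)

lemma Psi_tail_integrable:
  assumes a: "adm \<sigma>0 a"
  shows "set_integrable lborel {pi..} (\<lambda>v. complex_of_real (Psi a p v) * of_real v powr z)"
proof -
  define w :: complex where "w = of_real (max 2 (Re z + 1))"
  have w: "Re w > \<sigma>0" using admD(1)[OF a] by (simp add: w_def)
  have pi1: "pi \<ge> 1" using pi_ge_3 by simp
  have 1: "set_integrable lborel {pi..} (\<lambda>v. complex_of_real (Psi a p v) * of_real v powr (w - 1))"
    by (rule set_integrable_subset[OF Psi_mellin(1)[OF a w]]) (auto intro: pi_le_pos)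
  show ?thesis
  proof (rule set_integrable_bound[OF 1])
    have c: "continuous_on {pi..} (Psi a p)" by (rule continuous_on_subset[OF continuous_on_Psi[OF a]]) (auto intro: pi_le_pos)
    show "set_borel_measurable lborel {pi..} (\<lambda>v. complex_of_real (Psi a p v) * of_real v powr z)"
      by (rule set_borel_measurable_cont) (auto intro!: continuous_intros c dest: pi_le_pos simp: complex_nonpos_Reals_iff)
    show "AE v in lborel. v \<in> {pi..} \<longrightarrow> norm (complex_of_real (Psi a p v) * of_real v powr z) \<le> norm (complex_of_real (Psi a p v) * of_real v powr (w - 1))"
    proof (rule AE_I2, rule impI)
      fix v assume "v \<in> {pi..}"
      then have v: "v \<ge> 1" using pi1 by simp
      have "v powr Re z \<le> v powr (Re w - 1)" by (rule powr_mono) (use v in \<open>auto simp: w_def\<close>)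
      then show "norm (complex_of_real (Psi a p v) * of_real v powr z) \<le> norm (complex_of_real (Psi a p v) * of_real v powr (w - 1))"
        using v by (simp add: norm_mult norm_powr_real_powr mult_left_mono)
    qed
  qed
qed

definition Ig :: "nat \<Rightarrow> complex \<Rightarrow> real \<Rightarrow> complex" where
  "Ig j w v = of_real (Psi one_w ((LL ^^ j) 1) v) * (of_real v powr (w - 1) + of_real pi powr (2 * w - 1 / 2) * of_real v powr (- 1 / 2 - w))"

text \<open>The integral over \<open>(0, \<infinity>)\<close> folded at the fixed point \<open>pi\<close> of \<open>u \<mapsto> pi\<^sup>2 / u\<close>, which makes it entire.\<close>
definition XX :: "nat \<Rightarrow> complex \<Rightarrow> complex" where
  "XX j w = (LINT v:{pi..}|lborel. Ig j w v)"

lemma Ig_integrable: "set_integrable lborel {pi..} (Ig j w)"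
proof -
  have "set_integrable lborel {pi..} (\<lambda>v. of_real (Psi one_w ((LL ^^ j) 1) v) * of_real v powr (w - 1)
    + of_real pi powr (2 * w - 1 / 2) * (of_real (Psi one_w ((LL ^^ j) 1) v) * of_real v powr (- 1 / 2 - w)))"
    by (intro set_integral_add(1) set_integrable_mult_right impI Psi_tail_integrable[OF adm_one_w])
  moreover have "Ig j w = (\<lambda>v. of_real (Psi one_w ((LL ^^ j) 1) v) * of_real v powr (w - 1)
    + of_real pi powr (2 * w - 1 / 2) * (of_real (Psi one_w ((LL ^^ j) 1) v) * of_real v powr (- 1 / 2 - w)))"
    by (rule ext) (simp add: Ig_def algebra_simps)
  ultimately show ?thesis by simp
qed

lemma Ig_exp: "v > 0 \<Longrightarrow> Ig j w v = of_real (Psi one_w ((LL ^^ j) 1) v) *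
    (exp ((w - 1) * of_real (ln v)) + exp ((2 * w - 1 / 2) * of_real (ln pi) + (- 1 / 2 - w) * of_real (ln v)))"
  by (simp add: Ig_def powr_of_pos exp_add)

lemma XX_part_holomorphic: "(\<lambda>w. integral {pi..pi + real n} (Ig j w)) holomorphic_on UNIV"
proof -
  define K where "K v = complex_of_real (Psi one_w ((LL ^^ j) 1) v)" for v
  define f where "f w v = K v * (exp ((w - 1) * of_real (ln v)) + exp ((2 * w - 1 / 2) * of_real (ln pi) + (- 1 / 2 - w) * of_real (ln v)))" for w v
  define fx where "fx w v = K v * (exp ((w - 1) * of_real (ln v)) * of_real (ln v) + exp ((2 * w - 1 / 2) * of_real (ln pi) + (- 1 / 2 - w) * of_real (ln v)) * (2 * of_real (ln pi) - of_real (ln v)))" for w v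
  have pos: "v > 0" if "v \<in> {pi..pi + real n}" for v using that by (auto intro: pi_le_pos)
  have contK: "continuous_on {pi..pi + real n} K"
    unfolding K_def by (intro continuous_on_of_real continuous_on_subset[OF continuous_on_Psi[OF adm_one_w]]) (use pos in auto)
  have eq: "integral {pi..pi + real n} (Ig j w) = integral (cbox pi (pi + real n)) (f w)" for w
    unfolding cbox_interval by (rule integral_cong) (use pos in \<open>simp add: Ig_exp f_def K_def\<close>)
  have "(\<lambda>w. integral (cbox pi (pi + real n)) (f w)) holomorphic_on UNIV"
  proof (rule leibniz_rule_holomorphic[where fx = fx])
    show "((\<lambda>w. f w v) has_field_derivative fx w v) (at w within UNIV)" for w v
      unfolding f_def fx_def by (auto intro!: derivative_eq_intros simp: algebra_simps)
    show "f w integrable_on cbox pi (pi + real n)" for w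
      unfolding f_def cbox_interval by (intro integrable_continuous_real continuous_intros contK) (use pos in force)+
    have c2: "continuous_on (UNIV \<times> {pi..pi + real n}) (\<lambda>x. K (snd x))" for U :: "complex set"
      by (rule continuous_on_compose2[OF contK continuous_on_snd[OF continuous_on_id]]) auto
    have c3: "continuous_on (UNIV \<times> {pi..pi + real n}) (\<lambda>x :: complex \<times> real. complex_of_real (ln (snd x)))"
    proof (intro continuous_on_of_real continuous_on_ln continuous_on_snd continuous_on_id ballI)
      fix x :: "complex \<times> real" assume "x \<in> UNIV \<times> {pi..pi + real n}"
      then show "snd x \<noteq> 0" using pos[of "snd x"] by auto
    qed
    show "continuous_on (UNIV \<times> cbox pi (pi + real n)) (\<lambda>(w, v). fx w v)"
      unfolding fx_def split_def cbox_interval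
      by (intro continuous_on_mult continuous_on_add continuous_on_diff continuous_on_exp c2 c3 continuous_on_fst continuous_on_id continuous_on_const)
  qed auto
  then show ?thesis unfolding eq .
qed

lemma XX_holomorphic: "XX j holomorphic_on UNIV"
proof (rule holomorphic_uniform_sequence[where f = "\<lambda>n w. integral {pi..pi + real n} (Ig j w)"])
  fix x :: complex assume "x \<in> UNIV"
  define \<sigma> where "\<sigma> = norm x + 2"
  define G where "G v = complex_of_real (Psi one_w ((LL ^^ j) 1) v) * of_real v powr of_real \<sigma> * of_real (1 + pi powr (2 * \<sigma>))" for v
  have pi1: "pi \<ge> 1" using pi_ge_3 by simp
  have iG: "set_integrable lborel {pi..} G"
    unfolding G_def by (intro set_integrable_mult_left impI Psi_tail_integrable[OF adm_one_w])
  have bound: "norm (Ig j w v) \<le> norm (G v)" if "w \<in> cball x 1" "v \<ge> pi" for w v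
  proof -
    have v: "v \<ge> 1" using that pi1 by simp
    have "norm w \<le> norm x + norm (w - x)" by norm
    moreover have "norm (w - x) \<le> 1" using that(1) by (simp add: dist_norm norm_minus_commute)
    ultimately have "\<bar>Re w\<bar> \<le> norm x + 1" using abs_Re_le_cmod[of w] by linarith
    then have re: "Re w - 1 \<le> \<sigma>" "- 1 / 2 - Re w \<le> \<sigma>" "2 * Re w - 1 / 2 \<le> 2 * \<sigma>" by (auto simp: \<sigma>_def)
    have a: "norm (of_real v powr (w - 1)) \<le> v powr \<sigma>"
      using v re(1) by (simp add: norm_powr_real_powr powr_mono)
    have b: "norm (of_real v powr (- 1 / 2 - w)) \<le> v powr \<sigma>"
      using v re(2) by (simp add: norm_powr_real_powr powr_mono)
    have c: "norm (of_real pi powr (2 * w - 1 / 2)) \<le> pi powr (2 * \<sigma>)"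
      using pi1 re(3) by (simp add: norm_powr_real_powr powr_mono)
    have "norm (of_real v powr (w - 1) + of_real pi powr (2 * w - 1 / 2) * of_real v powr (- 1 / 2 - w)) \<le> v powr \<sigma> + pi powr (2 * \<sigma>) * v powr \<sigma>"
      by (rule order_trans[OF norm_triangle_ineq], unfold norm_mult, intro add_mono mult_mono a b c) auto
    also have "\<dots> = v powr \<sigma> * (1 + pi powr (2 * \<sigma>))" by (simp add: algebra_simps)
    finally have "norm (Ig j w v) \<le> \<bar>Psi one_w ((LL ^^ j) 1) v\<bar> * (v powr \<sigma> * (1 + pi powr (2 * \<sigma>)))"
      unfolding Ig_def norm_mult norm_of_real by (rule mult_left_mono) simp
    moreover have "norm (complex_of_real (1 + pi powr (2 * \<sigma>))) = 1 + pi powr (2 * \<sigma>)" by (simp only: norm_of_real) (simp add: abs_of_pos add_pos_nonneg)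
    moreover have "norm (complex_of_real v powr of_real \<sigma>) = v powr \<sigma>" using v by (simp add: norm_powr_real_powr)
    ultimately show ?thesis unfolding G_def norm_mult norm_of_real by (simp only: mult.assoc)
  qed
  define g where "g v = indicator {pi..} v *\<^sub>R norm (G v)" for v
  have ig: "integrable lborel g"
  proof -
    have "(\<lambda>v. norm (indicator {pi..} v *\<^sub>R G v)) = g" by (rule ext) (simp add: g_def indicator_def)
    then show ?thesis using integrable_norm[OF iG[unfolded set_integrable_def]] by (simp only:)
  qed
  have tail: "(\<lambda>n. (\<integral>v. g v \<partial>lborel) - (\<integral>v. indicator {..pi + real n} v *\<^sub>R g v \<partial>lborel)) \<longlonglongrightarrow> 0"
  proof -
    have "((\<lambda>y. \<integral>v. indicator {..y} v *\<^sub>R g v \<partial>lborel) \<longlongrightarrow> (\<integral>v. g v \<partial>lborel)) at_top"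
      by (rule tendsto_integral_at_top[OF _ ig]) simp
    moreover have "filterlim (\<lambda>n. pi + real n) at_top sequentially"
      by (rule filterlim_tendsto_add_at_top[OF tendsto_const filterlim_real_sequentially])
    ultimately have "(\<lambda>n. \<integral>v. indicator {..pi + real n} v *\<^sub>R g v \<partial>lborel) \<longlonglongrightarrow> (\<integral>v. g v \<partial>lborel)"
      by (rule filterlim_compose)
    from tendsto_diff[OF tendsto_const[of "\<integral>v. g v \<partial>lborel"] this] show ?thesis by simp
  qed
  have close: "norm (integral {pi..pi + real n} (Ig j w) - XX j w) \<le> (\<integral>v. g v \<partial>lborel) - (\<integral>v. indicator {..pi + real n} v *\<^sub>R g v \<partial>lborel)"
    if w: "w \<in> cball x 1" for n w
  proof -
    define f where "f v = indicator {pi..} v *\<^sub>R Ig j w v" for v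
    have if': "integrable lborel f" using Ig_integrable[of j w] by (simp add: set_integrable_def f_def[abs_def])
    have if2: "integrable lborel (\<lambda>v. indicator {..pi + real n} v *\<^sub>R f v)" by (rule integrable_mult_indicator[OF _ if']) simp
    have ig2: "integrable lborel (\<lambda>v. indicator {..pi + real n} v *\<^sub>R g v)" by (rule integrable_mult_indicator[OF _ ig]) simp
    have "integral {pi..pi + real n} (Ig j w) = (LINT v:{pi..pi + real n}|lborel. Ig j w v)"
      by (rule set_borel_integral_eq_integral(2)[symmetric], rule set_integrable_subset[OF Ig_integrable[of j w]]) auto
    also have "\<dots> = (\<integral>v. indicator {..pi + real n} v *\<^sub>R f v \<partial>lborel)"
      unfolding set_lebesgue_integral_def by (rule Bochner_Integration.integral_cong) (auto simp: f_def indicator_def)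
    finally have I: "integral {pi..pi + real n} (Ig j w) = (\<integral>v. indicator {..pi + real n} v *\<^sub>R f v \<partial>lborel)" .
    have XXf: "XX j w = (\<integral>v. f v \<partial>lborel)" unfolding XX_def set_lebesgue_integral_def f_def ..
    have "integral {pi..pi + real n} (Ig j w) - XX j w = (\<integral>v. indicator {..pi + real n} v *\<^sub>R f v - f v \<partial>lborel)"
      unfolding I XXf by (rule Bochner_Integration.integral_diff[OF if2 if', symmetric])
    also have "norm \<dots> \<le> (\<integral>v. g v - indicator {..pi + real n} v *\<^sub>R g v \<partial>lborel)"
    proof (rule Bochner_Integration.integral_norm_bound_integral)
      show "integrable lborel (\<lambda>v. indicator {..pi + real n} v *\<^sub>R f v - f v)" by (rule Bochner_Integration.integrable_diff[OF if2 if'])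
      show "integrable lborel (\<lambda>v. g v - indicator {..pi + real n} v *\<^sub>R g v)" by (rule Bochner_Integration.integrable_diff[OF ig ig2])
      fix v :: real
      show "norm (indicator {..pi + real n} v *\<^sub>R f v - f v) \<le> g v - indicator {..pi + real n} v *\<^sub>R g v"
        using bound[OF w, of v] by (auto simp: f_def g_def indicator_def)
    qed
    also have "\<dots> = (\<integral>v. g v \<partial>lborel) - (\<integral>v. indicator {..pi + real n} v *\<^sub>R g v \<partial>lborel)"
      by (rule Bochner_Integration.integral_diff[OF ig ig2])
    finally show ?thesis .
  qed
  have "uniform_limit (cball x 1) (\<lambda>n w. integral {pi..pi + real n} (Ig j w)) (XX j) sequentially"
  proof (rule uniform_limitI)
    fix e :: real assume "e > 0"
    with tail have "\<forall>\<^sub>F n in sequentially. (\<integral>v. g v \<partial>lborel) - (\<integral>v. indicator {..pi + real n} v *\<^sub>R g v \<partial>lborel) < e"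
      by (rule order_tendstoD(2))
    then show "\<forall>\<^sub>F n in sequentially. \<forall>w\<in>cball x 1. dist (integral {pi..pi + real n} (Ig j w)) (XX j w) < e"
    proof (rule eventually_mono)
      fix n assume *: "(\<integral>v. g v \<partial>lborel) - (\<integral>v. indicator {..pi + real n} v *\<^sub>R g v \<partial>lborel) < e"
      show "\<forall>w\<in>cball x 1. dist (integral {pi..pi + real n} (Ig j w)) (XX j w) < e"
        unfolding dist_norm using le_less_trans[OF close *] by blast
    qed
  qed
  then show "\<exists>d>0. cball x d \<subseteq> UNIV \<and> uniform_limit (cball x d) (\<lambda>n w. integral {pi..pi + real n} (Ig j w)) (XX j) sequentially"
    by (intro exI[of _ 1]) auto
qed (use XX_part_holomorphic in auto)

lemma LINT_closed_open:
  fixes f :: "real \<Rightarrow> complex"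
  assumes "set_integrable lborel {a..} f"
  shows "(LINT v:{a<..}|lborel. f v) = (LINT v:{a..}|lborel. f v)"
proof (rule set_integral_cong_set)
  have 1: "set_integrable lborel {a<..} f" by (rule set_integrable_subset[OF assms]) auto
  show "set_borel_measurable lborel {a<..} f" "set_borel_measurable lborel {a..} f"
    using 1 assms unfolding set_integrable_def set_borel_measurable_def by (auto intro: borel_measurable_integrable)
  show "AE x in lborel. (x \<in> {a..}) = (x \<in> {a<..})"
    using AE_lborel_singleton[of a] by (rule eventually_mono) auto
qed

lemma XX_mellin:
  assumes w: "Re w > 1 / 2" and j: "j \<ge> 1"
  shows "XX j w = (LINT u:{0<..}|lborel. of_real (Psi one_w ((LL ^^ j) 1) u) * of_real u powr (w - 1))"
proof -
  define K where "K = Psi one_w ((LL ^^ j) 1)"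
  define f where "f u = complex_of_real (K u) * of_real u powr (w - 1)" for u
  define h where "h v = of_real pi powr (2 * w - 1 / 2) * (complex_of_real (K v) * of_real v powr (- 1 / 2 - w))" for v
  have int: "set_integrable lborel {0<..} f" unfolding f_def K_def by (rule Psi_mellin(1)[OF adm_one_w w])
  have i0: "set_integrable lborel {0<..<pi} f" by (rule set_integrable_subset[OF int]) auto
  have i1: "set_integrable lborel {pi..} f" by (rule set_integrable_subset[OF int]) (auto intro: pi_le_pos)
  have ih: "set_integrable lborel {pi..} h"
    unfolding h_def K_def by (intro set_integrable_mult_right impI Psi_tail_integrable[OF adm_one_w])
  have ih': "set_integrable lborel {pi<..} h" by (rule set_integrable_subset[OF ih]) auto
  have un: "{0<..} = {0<..<pi} \<union> {pi..}" by (auto intro: pi_le_pos)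
  have split: "(LINT u:{0<..}|lborel. f u) = (LINT u:{0<..<pi}|lborel. f u) + (LINT u:{pi..}|lborel. f u)"
    unfolding un by (rule set_integral_Un[OF _ i0 i1]) auto
  have img: "(\<lambda>v. pi\<^sup>2 / v) ` {pi<..} = {0<..<pi}"
  proof (intro equalityI subsetI)
    fix u assume u: "u \<in> {0<..<pi}"
    then have "u = pi\<^sup>2 / (pi\<^sup>2 / u)" by simp
    moreover have "pi\<^sup>2 / u \<in> {pi<..}" using u by (simp add: field_simps power2_eq_square)
    ultimately show "u \<in> (\<lambda>v. pi\<^sup>2 / v) ` {pi<..}" by (rule image_eqI)
  next
    fix u assume "u \<in> (\<lambda>v. pi\<^sup>2 / v) ` {pi<..}"
    then obtain v where v: "u = pi\<^sup>2 / v" "v > pi" by auto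
    then have v0: "v > 0" using pi_gt_zero by linarith
    have "pi * pi < pi * v" using v by simp
    then have "pi\<^sup>2 / v < pi" using v0 by (simp add: divide_less_eq power2_eq_square)
    moreover have "0 < pi\<^sup>2 / v" using v0 by simp
    ultimately show "u \<in> {0<..<pi}" using v by simp
  qed
  have vpos: "v > 0" if "v \<in> {pi<..}" for v using less_trans[OF pi_gt_zero, of v] that by simp
  have der: "((\<lambda>v. pi\<^sup>2 / v) has_field_derivative - (pi\<^sup>2 / v\<^sup>2)) (at v within {pi<..})" if "v \<in> {pi<..}" for v
    using vpos[OF that] by (auto intro!: derivative_eq_intros simp: power2_eq_square)
  have inj: "inj_on (\<lambda>v. pi\<^sup>2 / v) {pi<..}"
  proof (rule inj_onI)
    fix x y assume xy: "x \<in> {pi<..}" "y \<in> {pi<..}" "pi\<^sup>2 / x = pi\<^sup>2 / y"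
    then show "x = y" using vpos[OF xy(1)] vpos[OF xy(2)] by (simp add: field_simps)
  qed
  have eq: "\<bar>- (pi\<^sup>2 / v\<^sup>2)\<bar> *\<^sub>R f (pi\<^sup>2 / v) = h v" if "v \<in> {pi<..}" for v
  proof -
    have v: "v > 0" by (rule vpos[OF that])
    have FE: "K (pi\<^sup>2 / v) = sqrt (v / pi) * K v" unfolding K_def by (rule Psi_LL_FE[OF v j])
    have l1: "ln (pi\<^sup>2 / v) = 2 * ln pi - ln v" using v by (simp add: ln_div ln_realpow)
    have s1: "complex_of_real (sqrt (v / pi)) = exp (of_real ((ln v - ln pi) / 2))"
    proof -
      have "sqrt (v / pi) = (v / pi) powr (1 / 2)" using v by (simp add: powr_half_sqrt)
      also have "\<dots> = exp ((ln v - ln pi) / 2)" using v by (simp add: powr_def ln_div)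
      finally show ?thesis by (simp only: exp_of_real)
    qed
    have s2: "complex_of_real \<bar>- (pi\<^sup>2 / v\<^sup>2)\<bar> = exp (of_real (2 * ln pi - 2 * ln v))"
    proof -
      have "\<bar>- (pi\<^sup>2 / v\<^sup>2)\<bar> = exp (ln (pi\<^sup>2 / v\<^sup>2))" using v by simp
      also have "ln (pi\<^sup>2 / v\<^sup>2) = 2 * ln pi - 2 * ln v" using v by (simp add: ln_div ln_realpow)
      finally show ?thesis by (simp only: exp_of_real)
    qed
    have pv: "pi\<^sup>2 / v > 0" using v by simp
    have "\<bar>- (pi\<^sup>2 / v\<^sup>2)\<bar> *\<^sub>R f (pi\<^sup>2 / v) = of_real (K v) *
       (exp (of_real (2 * ln pi - 2 * ln v)) * exp (of_real ((ln v - ln pi) / 2)) * exp ((w - 1) * of_real (2 * ln pi - ln v)))"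
      unfolding scaleR_conv_of_real f_def FE of_real_mult s1 s2 powr_of_pos[OF pv] l1 by (simp only: mult_ac)
    also have "exp (of_real (2 * ln pi - 2 * ln v)) * exp (of_real ((ln v - ln pi) / 2)) * exp ((w - 1) * of_real (2 * ln pi - ln v))
       = exp ((2 * w - 1 / 2) * of_real (ln pi)) * exp ((- 1 / 2 - w) * of_real (ln v))"
      unfolding exp_add[symmetric] by (rule arg_cong[where f = exp]) (simp add: algebra_simps add_divide_distrib diff_divide_distrib)
    finally show ?thesis unfolding h_def powr_of_pos[OF v] powr_of_pos[OF pi_gt_zero] by (simp only: mult_ac)
  qed
  have ai: "f absolutely_integrable_on {0<..<pi}" by (rule set_integrable_lborel_imp_absolutely_integrable[OF i0])
  have "(\<lambda>v. \<bar>- (pi\<^sup>2 / v\<^sup>2)\<bar> *\<^sub>R f (pi\<^sup>2 / v)) absolutely_integrable_on {pi<..} \<and>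
     integral {pi<..} (\<lambda>v. \<bar>- (pi\<^sup>2 / v\<^sup>2)\<bar> *\<^sub>R f (pi\<^sup>2 / v)) = integral {0<..<pi} f"
    by (subst has_absolute_integral_change_of_variables_real[OF _ der inj]) (use ai img in auto)
  then have "integral {0<..<pi} f = integral {pi<..} (\<lambda>v. \<bar>- (pi\<^sup>2 / v\<^sup>2)\<bar> *\<^sub>R f (pi\<^sup>2 / v))" by simp
  also have "\<dots> = integral {pi<..} h" by (rule integral_cong) (rule eq)
  finally have "(LINT u:{0<..<pi}|lborel. f u) = (LINT v:{pi<..}|lborel. h v)"
    using set_borel_integral_eq_integral(2)[OF i0] set_borel_integral_eq_integral(2)[OF ih'] by simp
  also have "\<dots> = (LINT v:{pi..}|lborel. h v)" by (rule LINT_closed_open[OF ih])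
  finally have "(LINT u:{0<..}|lborel. f u) = (LINT v:{pi..}|lborel. f v + h v)"
    unfolding split by (subst set_integral_add(2)[OF i1 ih]) simp
  moreover have "(\<lambda>v. f v + h v) = Ig j w" by (rule ext) (simp add: f_def h_def Ig_def K_def algebra_simps)
  ultimately show ?thesis unfolding XX_def f_def K_def by simp
qed

lemma NN_add: "NN (p + q) w = NN p w + NN q w"
proof -
  define m where "m = max (degree p) (degree q)"
  have "degree (p + q) \<le> m" "degree p \<le> m" "degree q \<le> m" by (auto simp: m_def degree_add_le)
  then show ?thesis by (simp add: NN_extend[of _ m] sum.distrib[symmetric] algebra_simps)
qed

lemma NN_smult: "NN (Polynomial.smult c p) w = of_real c * NN p w"
  by (simp add: NN_extend[of "Polynomial.smult c p" "degree p"] degree_smult_le NN_def sum_distrib_left mult.assoc)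

lemma NN_LL: "w \<notin> \<int>\<^sub>\<le>\<^sub>0 \<Longrightarrow> NN (LL p) w = (- 2 * w * (1 - 2 * w)) * NN p w"
  by (simp add: LL_def NN_smult NN_add NN_dop algebra_simps)

lemma NN_LL_power:
  assumes "w \<notin> \<int>\<^sub>\<le>\<^sub>0"
  shows "NN ((LL ^^ j) 1) w = (- 2 * w * (1 - 2 * w)) ^ j * Gamma w"
proof (induction j)
  case (Suc j)
  have "(LL ^^ Suc j) 1 = LL ((LL ^^ j) 1)" by (simp only: funpow.simps comp_apply)
  then show ?case using NN_LL[OF assms, of "(LL ^^ j) 1"] Suc.IH by (simp only: power_Suc mult.assoc)
qed (simp add: NN_def)

lemma not_nonpos_Ints_Re: "Re w > 0 \<Longrightarrow> w \<notin> \<int>\<^sub>\<le>\<^sub>0"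
  by (auto elim!: nonpos_Ints_cases)

lemma Gamma_rGamma:
  assumes "Re w > 0"
  shows "w * Gamma w * rGamma (w + 1) = 1"
proof -
  have nn: "w \<notin> \<int>\<^sub>\<le>\<^sub>0" "w + 1 \<notin> \<int>\<^sub>\<le>\<^sub>0" using assms by (auto intro!: not_nonpos_Ints_Re)
  have "Gamma (w + 1) \<noteq> 0" unfolding Gamma_eq_zero_iff by (rule nn(2))
  then have "Gamma (w + 1) * inverse (Gamma (w + 1)) = 1" by (rule right_inverse)
  then show ?thesis unfolding rGamma_inverse_Gamma Gamma_plus1[OF nn(1)] .
qed

lemma XX_dirichlet:
  assumes w: "Re w > 1 / 2" and j: "j \<ge> 1"
  shows "XX j w = (- 2 * w * (1 - 2 * w)) ^ j * Gamma w * (\<Sum>n. of_real (one_w n) * of_nat n powr (- 2 * w))"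
proof -
  have s: "(\<lambda>n. of_real (one_w n) * of_nat n powr (- 2 * w)) sums (\<Sum>n. of_real (one_w n) * of_nat n powr (- 2 * w))"
    by (rule summable_sums[OF Psi_mellin(3)[OF adm_one_w w]])
  have nn: "w \<notin> \<int>\<^sub>\<le>\<^sub>0" by (rule not_nonpos_Ints_Re) (use w in simp)
  show ?thesis unfolding XX_mellin[OF w j] Psi_mellin(2)[OF adm_one_w w s] NN_LL_power[OF nn] ..
qed

lemma XX_eq: "XX (Suc m) w = (- 2 * w * (1 - 2 * w)) ^ m * XX 1 w"
proof (rule analytic_continuation_open[where s = "{w. Re w > 1 / 2}" and s' = UNIV and f = "XX (Suc m)" and g = "\<lambda>w. (- 2 * w * (1 - 2 * w)) ^ m * XX 1 w"])
  show "open {w. Re w > 1 / 2}" by (rule open_halfspace_Re_gt)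
  show "{w. Re w > 1 / 2} \<noteq> {}" using exI[of "\<lambda>w. Re w > 1 / 2" 1] by auto
  show "(\<lambda>w. (- 2 * w * (1 - 2 * w)) ^ m * XX 1 w) holomorphic_on UNIV"
    by (intro holomorphic_intros XX_holomorphic)
  show "XX (Suc m) w = (- 2 * w * (1 - 2 * w)) ^ m * XX 1 w" if "w \<in> {w. Re w > 1 / 2}" for w
    using that XX_dirichlet[of w "Suc m"] XX_dirichlet[of w 1] by (simp add: mult_ac)
qed (auto simp: XX_holomorphic)

definition Zt :: "complex \<Rightarrow> complex" where
  "Zt s = (if s = 1 then 0 else - XX 1 (s / 2) * rGamma (s / 2 + 1) / (2 * (1 - s)))"

lemma Zt_holomorphic: "Zt holomorphic_on (- {1})"
proof -
  have "(\<lambda>s. XX 1 (s / 2)) holomorphic_on (- {1})"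
  proof -
    have d: "(\<lambda>s::complex. s / 2) holomorphic_on - {1}" by (intro holomorphic_intros) auto
    have "XX 1 \<circ> (\<lambda>s. s / 2) holomorphic_on - {1}" by (rule holomorphic_on_compose_gen[OF d XX_holomorphic]) auto
    then show ?thesis by (simp only: o_def)
  qed
  then have "(\<lambda>s. - XX 1 (s / 2) * rGamma (s / 2 + 1) / (2 * (1 - s))) holomorphic_on (- {1})"
    by (intro holomorphic_intros) auto
  then show ?thesis by (rule holomorphic_transform) (auto simp: Zt_def)
qed

lemma Zt_sums:
  assumes s: "Re s > 1"
  shows "(\<lambda>n. 1 / of_nat (Suc n) powr s) sums Zt s"
proof -
  define w where "w = s / 2"
  have w: "Re w > 1 / 2" using s by (simp add: w_def)
  define D where "D = (\<Sum>n. of_real (one_w n) * of_nat n powr (- 2 * w))"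
  have "(\<lambda>n. of_real (one_w n) * of_nat n powr (- 2 * w)) sums D"
    unfolding D_def by (rule summable_sums[OF Psi_mellin(3)[OF adm_one_w w]])
  then have "(\<lambda>n. of_real (one_w (Suc n)) * of_nat (Suc n) powr (- 2 * w)) sums D"
    by (subst sums_Suc_iff) (simp add: one_w_def)
  moreover have "(\<lambda>n. of_real (one_w (Suc n)) * (of_nat (Suc n) :: complex) powr (- 2 * w)) = (\<lambda>n. 1 / of_nat (Suc n) powr s)"
    by (rule ext) (simp add: one_w_def w_def powr_minus_divide)
  moreover have "Zt s = D"
  proof -
    have s1: "s \<noteq> 1" using s by auto
    have "w \<noteq> 0" using w by auto
    have G: "w * Gamma w * rGamma (w + 1) = 1" by (rule Gamma_rGamma) (use w in simp)
    have "- XX 1 w * rGamma (w + 1) = 2 * (1 - 2 * w) * (w * Gamma w * rGamma (w + 1)) * D"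
      using XX_dirichlet[OF w, of 1] by (simp add: D_def mult_ac)
    then have "- XX 1 w * rGamma (w + 1) = 2 * (1 - 2 * w) * D" unfolding G by simp
    moreover have "2 * w = s" by (simp add: w_def)
    ultimately show ?thesis using s1 by (simp add: Zt_def w_def[symmetric])
  qed
  ultimately show ?thesis by simp
qed

lemma zeta_eq_Zt: "zeta = Zt"
  unfolding zeta_def
proof (rule the_equality)
  show "Zt holomorphic_on - {1} \<and> (\<forall>s. 1 < Re s \<longrightarrow> (\<lambda>n. 1 / of_nat (Suc n) powr s) sums Zt s) \<and> Zt 1 = 0"
    using Zt_holomorphic Zt_sums by (simp add: Zt_def)
next
  fix f :: "complex \<Rightarrow> complex"
  assume f: "f holomorphic_on - {1} \<and> (\<forall>s. 1 < Re s \<longrightarrow> (\<lambda>n. 1 / of_nat (Suc n) powr s) sums f s) \<and> f 1 = 0"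
  show "f = Zt"
  proof
    fix s
    show "f s = Zt s"
    proof (cases "s = 1")
      case False
      show ?thesis
      proof (rule analytic_continuation_open[where s = "{s. Re s > 1}" and s' = "- {1}" and f = f and g = Zt])
        show "open {s. Re s > 1}" by (rule open_halfspace_Re_gt)
        show "{s. Re s > 1} \<noteq> {}" using exI[of "\<lambda>w. Re w > 1" 2] by auto
        show "connected (- {1::complex})" by (rule connected_punctured_universe) simp
        show "f z = Zt z" if "z \<in> {s. Re s > 1}" for z
          using f Zt_sums[of z] that sums_unique2 by blast
      qed (use f False Zt_holomorphic in auto)
    qed (use f in \<open>simp add: Zt_def\<close>)
  qed
qed

lemma gfac_raw_holomorphic: "(\<lambda>s. s * (s - 1) / 2 * of_real pi powr (- s / 2) * Gamma (s / 2)) holomorphic_on {s. Re s > 0}"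
proof (intro holomorphic_intros)
  fix s :: complex assume "s \<in> {s. Re s > 0}"
  then show "s / 2 \<notin> \<int>\<^sub>\<le>\<^sub>0" by (intro not_nonpos_Ints_Re) simp
qed auto

lemma gfac_eq:
  assumes "Re s > 0"
  shows "gfac s = s * (s - 1) / 2 * of_real pi powr (- s / 2) * Gamma (s / 2)"
  unfolding gfac_def
  by (rule remove_sings_at_analytic)
    (use assms gfac_raw_holomorphic in \<open>auto simp: analytic_on_holomorphic intro!: exI[of _ "{s. Re s > 0}"] open_halfspace_Re_gt\<close>)

lemma gfac_holomorphic: "gfac holomorphic_on {s. Re s > 0}"
  by (rule holomorphic_transform[OF gfac_raw_holomorphic]) (simp add: gfac_eq)

definition Jint :: "(nat \<Rightarrow> real) \<Rightarrow> nat \<Rightarrow> real" where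
  "Jint a m = (LINT u:{pi..}|lborel. Psi a ((LL ^^ (m + 1)) 1) u * u powr (- 3 / 4))"

lemma of_real_Jint: "complex_of_real (Jint a m) = (LINT u:{pi..}|lborel. of_real (Psi a ((LL ^^ (m + 1)) 1) u) * of_real u powr (- 3 / 4))"
proof -
  have "(LINT u:{pi..}|lborel. of_real (Psi a ((LL ^^ (m + 1)) 1) u) * complex_of_real u powr (- 3 / 4))
    = (LINT u:{pi..}|lborel. complex_of_real (Psi a ((LL ^^ (m + 1)) 1) u * u powr (- 3 / 4)))"
  proof (rule set_lebesgue_integral_cong)
    show "\<forall>u. u \<in> {pi..} \<longrightarrow> of_real (Psi a ((LL ^^ (m + 1)) 1) u) * complex_of_real u powr (- 3 / 4) = complex_of_real (Psi a ((LL ^^ (m + 1)) 1) u * u powr (- 3 / 4))"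
    proof (intro allI impI)
      fix u assume "u \<in> {pi..}"
      then have "u \<ge> 0" using pi_le_pos[of u] by simp
      then have "complex_of_real (u powr (- 3 / 4)) = of_real u powr of_real (- 3 / 4)" by (rule powr_of_real[symmetric])
      then show "of_real (Psi a ((LL ^^ (m + 1)) 1) u) * complex_of_real u powr (- 3 / 4) = complex_of_real (Psi a ((LL ^^ (m + 1)) 1) u * u powr (- 3 / 4))"
        by simp
    qed
  qed simp
  then show ?thesis unfolding Jint_def by (simp only: set_integral_complex_of_real)
qed

theorem xi_half: "xi (1 / 2) = of_real ((- 4) ^ m * pi powr (- 1 / 4) * Jint one_w m)"
proof -
  have an: "(\<lambda>s. gfac s * zeta s) analytic_on {1 / 2}"
    unfolding analytic_on_holomorphic
  proof (intro exI conjI)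
    show "open ({s. Re s > 0} - {1 :: complex})" by (intro open_Diff open_halfspace_Re_gt) auto
    show "(\<lambda>s. gfac s * zeta s) holomorphic_on ({s. Re s > 0} - {1})"
      unfolding zeta_eq_Zt by (intro holomorphic_on_mult holomorphic_on_subset[OF gfac_holomorphic] holomorphic_on_subset[OF Zt_holomorphic]) auto
  qed auto
  have "xi (1 / 2) = gfac (1 / 2) * Zt (1 / 2)"
    unfolding xi_def by (subst remove_sings_at_analytic[OF an]) (simp only: zeta_eq_Zt)
  also have "gfac (1 / 2) = - 1 / 8 * of_real pi powr (- 1 / 4) * Gamma (1 / 4)"
    using gfac_eq[of "1 / 2"] by simp
  also have "Zt (1 / 2) = - XX 1 (1 / 4) * rGamma (1 / 4 + 1)" by (simp add: Zt_def)
  finally have 1: "xi (1 / 2) = 1 / 2 * of_real pi powr (- 1 / 4) * XX 1 (1 / 4) * (1 / 4 * Gamma (1 / 4) * rGamma (1 / 4 + 1))"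
    by simp
  have G: "1 / 4 * Gamma (1 / 4) * rGamma (1 / 4 + 1 :: complex) = 1" by (rule Gamma_rGamma) simp
  have e: "- 2 * (1 / 4) * (1 - 2 * (1 / 4)) = (- 1 / 4 :: complex)" by simp
  have X: "XX (Suc m) (1 / 4) = (- 1 / 4) ^ m * XX 1 (1 / 4)" using XX_eq[of m "1 / 4"] unfolding e .
  have "(- 4) ^ m * (- 1 / 4) ^ m = (1 :: complex)" unfolding power_mult_distrib[symmetric] by simp
  then have X1: "XX 1 (1 / 4) = (- 4) ^ m * XX (Suc m) (1 / 4)" unfolding X mult.assoc[symmetric] by simp
  have "XX (Suc m) (1 / 4) = (LINT v:{pi..}|lborel. 2 * (of_real (Psi one_w ((LL ^^ (m + 1)) 1) v) * of_real v powr (- 3 / 4)))"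
    unfolding XX_def by (rule set_lebesgue_integral_cong) (auto simp: Ig_def)
  also have "\<dots> = 2 * of_real (Jint one_w m)" unfolding of_real_Jint by (rule set_integral_mult_right)
  finally have X2: "XX (Suc m) (1 / 4) = 2 * of_real (Jint one_w m)" .
  have "complex_of_real pi powr (- 1 / 4) = of_real (pi powr (- 1 / 4))" using powr_of_real[of pi "- 1 / 4"] by simp
  then show ?thesis unfolding 1 G X1 X2 by simp
qed

section \<open>The approximation at 1/2\<close>

lemma powr_integral_0_pi:
  assumes z: "Re z > 0"
  shows "set_integrable lborel {0<..<pi} (\<lambda>u. complex_of_real u powr (z - 1))"
    and "(LINT u:{0<..<pi}|lborel. complex_of_real u powr (z - 1)) = of_real pi powr z / z"
proof -
  have z0: "z \<noteq> 0" using z by auto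
  have contF: "continuous_on {0..pi} (\<lambda>u. complex_of_real u powr z / z)"
    by (intro continuous_intros) (use z z0 in auto)
  have der: "((\<lambda>u. complex_of_real u powr z / z) has_vector_derivative of_real u powr (z - 1)) (at u)" if u: "u \<in> {0<..<pi}" for u
  proof -
    have nn: "complex_of_real u \<notin> \<real>\<^sub>\<le>\<^sub>0" using u by (simp add: complex_nonpos_Reals_iff)
    have "((\<lambda>x. x powr z / z) has_field_derivative (z * of_real u powr (z - 1)) / z) (at (complex_of_real u))"
      by (intro DERIV_cdivide has_field_derivative_powr nn)
    then have "((\<lambda>x. x powr z / z) has_field_derivative of_real u powr (z - 1)) (at (complex_of_real u))" using z0 by simp
    then show ?thesis by (rule has_vector_derivative_real_field)
  qed
  have "((\<lambda>u. complex_of_real u powr (z - 1)) has_integral (of_real pi powr z / z - of_real 0 powr z / z)) {0..pi}"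
    by (rule fundamental_theorem_of_calculus_interior[OF _ contF der]) simp_all
  then have hi: "((\<lambda>u. complex_of_real u powr (z - 1)) has_integral (of_real pi powr z / z)) {0<..<pi}"
    unfolding has_integral_Icc_iff_Ioo by simp
  have cont: "continuous_on {0<..<pi} (\<lambda>u. complex_of_real u powr (z - 1))"
    by (intro continuous_intros) (auto simp: complex_nonpos_Reals_iff)
  have rint: "(\<lambda>u. u powr (Re z - 1)) integrable_on {0<..<pi}"
  proof -
    have "((\<lambda>u. u powr (Re z - 1)) has_integral (pi powr (Re z - 1 + 1) / (Re z - 1 + 1))) {0..pi}"
      by (rule has_integral_powr_from_0) (use z in auto)
    then show ?thesis unfolding has_integral_Icc_iff_Ioo by blast
  qed
  have "(\<lambda>u. complex_of_real u powr (z - 1)) absolutely_integrable_on {0<..<pi}"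
  proof (rule measurable_bounded_by_integrable_imp_absolutely_integrable[OF _ _ rint])
    show "(\<lambda>u. complex_of_real u powr (z - 1)) \<in> borel_measurable (lebesgue_on {0<..<pi})"
      by (rule continuous_imp_measurable_on_sets_lebesgue[OF cont]) simp
    show "norm (complex_of_real u powr (z - 1)) \<le> u powr (Re z - 1)" if "u \<in> {0<..<pi}" for u
      using that by (simp add: norm_powr_real_powr)
  qed simp
  then show si: "set_integrable lborel {0<..<pi} (\<lambda>u. complex_of_real u powr (z - 1))"
    by (intro set_integrable_lborel_iff_continuous cont) auto
  show "(LINT u:{0<..<pi}|lborel. complex_of_real u powr (z - 1)) = of_real pi powr z / z"
    unfolding set_borel_integral_eq_integral(2)[OF si] using hi by (rule integral_unique)
qed

lemma powr_series_integral:
  fixes c e :: "'i \<Rightarrow> complex" and g :: "nat \<Rightarrow> 'i"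
  assumes g: "bij g" and w: "Re w > 0" and e: "\<And>i. Re (e i) \<ge> 0"
    and s: "(\<lambda>i. norm (c i) * pi powr Re (e i)) summable_on UNIV"
  shows "set_integrable lborel {0<..<pi} (\<lambda>u. \<Sum>\<^sub>\<infinity>i. c i * complex_of_real u powr (e i + w - 1))"
    and "((\<lambda>i. c i * (of_real pi powr (e i + w) / (e i + w))) has_sum
      (LINT u:{0<..<pi}|lborel. \<Sum>\<^sub>\<infinity>i. c i * complex_of_real u powr (e i + w - 1))) UNIV"
proof -
  define f where "f i u = c i * complex_of_real u powr (e i + w - 1)" for i u
  have rw: "Re (e i + w) > 0" for i using w e[of i] by simp
  have int: "set_integrable lborel {0<..<pi} (f i)" for i
    unfolding f_def by (intro set_integrable_mult_right impI powr_integral_0_pi(1) rw)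
  have val: "(LINT u:{0<..<pi}|lborel. f i u) = c i * (of_real pi powr (e i + w) / (e i + w))" for i
    unfolding f_def powr_integral_0_pi(2)[OF rw, symmetric] by (rule set_integral_mult_right)
  define h where "h u = norm (complex_of_real u powr (w - 1))" for u
  have inth: "set_integrable lborel {0<..<pi} h" unfolding h_def by (rule set_integrable_norm[OF powr_integral_0_pi(1)[OF w]])
  have nb: "norm (f i u) \<le> (norm (c i) * pi powr Re (e i)) * h u" if u: "u \<in> {0<..<pi}" for i u
  proof -
    have "norm (complex_of_real u powr (e i + w - 1)) = u powr (Re (e i) + (Re w - 1))"
      using u by (simp add: norm_powr_real_powr algebra_simps)
    also have "\<dots> = u powr Re (e i) * h u" using u by (simp add: h_def norm_powr_real_powr powr_add)
    also have "\<dots> \<le> pi powr Re (e i) * h u" by (intro mult_right_mono powr_mono2 e) (use u in \<open>auto simp: h_def\<close>)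
    finally show ?thesis unfolding f_def norm_mult mult.assoc by (intro mult_left_mono) auto
  qed
  have sum: "(\<lambda>i. LINT u:{0<..<pi}|lborel. norm (f i u)) summable_on UNIV"
  proof (rule summable_on_comparison_test)
    show "(\<lambda>i. (norm (c i) * pi powr Re (e i)) * (LINT u:{0<..<pi}|lborel. h u)) summable_on UNIV"
      by (rule summable_on_cmult_left[OF s])
    fix i
    have "(LINT u:{0<..<pi}|lborel. norm (f i u)) \<le> (LINT u:{0<..<pi}|lborel. (norm (c i) * pi powr Re (e i)) * h u)"
      by (rule set_integral_mono[OF set_integrable_norm[OF int]]) (intro set_integrable_mult_right impI inth, rule nb)
    also have "\<dots> = (norm (c i) * pi powr Re (e i)) * (LINT u:{0<..<pi}|lborel. h u)" by (rule set_integral_mult_right)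
    finally show "(LINT u:{0<..<pi}|lborel. norm (f i u)) \<le> (norm (c i) * pi powr Re (e i)) * (LINT u:{0<..<pi}|lborel. h u)" .
    show "0 \<le> (LINT u:{0<..<pi}|lborel. norm (f i u))"
      unfolding set_lebesgue_integral_def by (rule Bochner_Integration.integral_nonneg) (simp add: indicator_def)
  qed
  have pt: "(\<lambda>i. norm (f i u)) summable_on UNIV" if "u \<in> {0<..<pi}" for u
    by (rule summable_on_comparison_test[OF summable_on_cmult_left[OF s]]) (use nb[OF that] in auto)
  note r = set_integral_infsum[OF g int sum pt]
  show "set_integrable lborel {0<..<pi} (\<lambda>u. \<Sum>\<^sub>\<infinity>i. c i * complex_of_real u powr (e i + w - 1))"
    using r(1) unfolding f_def .
  show "((\<lambda>i. c i * (of_real pi powr (e i + w) / (e i + w))) has_sum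
      (LINT u:{0<..<pi}|lborel. \<Sum>\<^sub>\<infinity>i. c i * complex_of_real u powr (e i + w - 1))) UNIV"
    using r(2) unfolding val unfolding f_def .
qed

lemma LL_power_dop: "\<exists>q. (LL ^^ j) 1 = (dop ^^ j) q"
proof -
  define M where "M p = Polynomial.smult 2 (p + Polynomial.smult 2 (dop p))" for p :: "real poly"
  have LM: "LL p = dop (M p)" for p by (simp only: LL_def M_def dop_smult)
  have comm: "M (dop p) = dop (M p)" for p by (simp only: M_def dop_smult dop_add)
  have comm': "M ((dop ^^ j) p) = (dop ^^ j) (M p)" for j p
    by (induction j) (simp_all only: funpow.simps comp_apply comm id_apply)
  show ?thesis
  proof (induction j)
    case 0
    show ?case by (rule exI[of _ 1]) (simp only: funpow.simps id_apply)
  next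
    case (Suc j)
    then obtain q where q: "(LL ^^ j) 1 = (dop ^^ j) q" by (rule exE)
    have "(LL ^^ Suc j) 1 = (dop ^^ Suc j) (M q)" by (simp only: funpow.simps comp_apply q LM comm')
    then show ?case by (rule exI)
  qed
qed

lemma Psi_expansion:
  assumes "base_ok B" "indep B" "u > 0"
  shows "complex_of_real (Psi (aB B) ((LL ^^ (card B + 1)) 1) u) =
    (\<Sum>\<^sub>\<infinity>k. Tf B ((LL ^^ (card B + 1)) 1) k (ln u)) + (\<Sum>b\<in>B. \<Sum>\<^sub>\<infinity>n. Sf B b ((LL ^^ (card B + 1)) 1) n (ln u))"
proof -
  obtain q where q: "(LL ^^ (card B + 1)) 1 = (dop ^^ (card B + 1)) q" using LL_power_dop by (rule exE)
  have "Hm B ((LL ^^ (card B + 1)) 1) (ln u) = 0" unfolding q by (rule Hm_zero[OF assms(1,2)])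
  then show ?thesis unfolding Hm_def exp_ln[OF assms(3)] by (simp add: diff_diff_eq)
qed

lemma set_lint_sum:
  fixes f :: "'b \<Rightarrow> real \<Rightarrow> complex"
  assumes "finite A" "\<And>b. b \<in> A \<Longrightarrow> set_integrable lborel S (f b)"
  shows "set_integrable lborel S (\<lambda>x. \<Sum>b\<in>A. f b x) \<and> (LINT x:S|lborel. (\<Sum>b\<in>A. f b x)) = (\<Sum>b\<in>A. LINT x:S|lborel. f b x)"
  using assms
proof (induction A rule: finite_induct)
  case empty
  then show ?case by (simp add: set_integrable_def set_lebesgue_integral_def)
next
  case (insert b A)
  have 1: "set_integrable lborel S (f b)" "set_integrable lborel S (\<lambda>x. \<Sum>b\<in>A. f b x)" using insert by auto
  then show ?case using insert set_integral_add[OF 1] by simp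
qed

lemma base_ok_pos: "base_ok B \<Longrightarrow> c \<in> B \<Longrightarrow> c \<ge> 2"
  by (simp add: base_ok_def)

lemma zeta_B_analytic:
  assumes "base_ok B" "\<And>c. c \<in> B \<Longrightarrow> 1 - of_nat c powr (- s) \<noteq> (0::complex)"
  shows "zeta_B B analytic_on {s}"
proof -
  have "(\<lambda>s. \<Prod>b\<in>B. 1 / (1 - of_nat b powr (- s))) analytic_on {s}"
  proof (intro analytic_on_prod analytic_on_divide analytic_on_diff analytic_on_const analytic_on_powr analytic_on_neg analytic_on_ident)
    fix c x assume c: "c \<in> B" and x: "x \<in> {s}"
    show "(of_nat c :: complex) \<notin> \<real>\<^sub>\<le>\<^sub>0" using base_ok_pos[OF assms(1) c] by (simp add: complex_nonpos_Reals_iff)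
    show "1 - of_nat c powr (- x) \<noteq> (0::complex)" using assms(2)[OF c] x by simp
  qed
  moreover have "zeta_B B = (\<lambda>s. \<Prod>b\<in>B. 1 / (1 - of_nat b powr (- s)))" by (rule ext) (rule zeta_B_def)
  ultimately show ?thesis by simp
qed

lemma xi_colon_eq:
  assumes ok: "base_ok B" and s: "s / 2 \<notin> \<int>\<^sub>\<le>\<^sub>0" and nz: "\<And>c. c \<in> B \<Longrightarrow> 1 - of_nat c powr (- s) \<noteq> (0::complex)"
  shows "xi_colon B s = s ^ card B * (1 - s) ^ card B * (s * (s - 1) / 2 * of_real pi powr (- s / 2) * Gamma (s / 2) * zeta_B B s)"
proof -
  have pin: "complex_of_real pi \<notin> \<real>\<^sub>\<le>\<^sub>0" by (simp add: complex_nonpos_Reals_iff not_le)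
  have an0: "(\<lambda>s. s * (s - 1) / 2 * of_real pi powr (- s / 2) * Gamma (s / 2)) analytic_on {s}"
    by (intro analytic_intros) (use pin s in auto)
  have an1: "gfac analytic_on {s}" unfolding gfac_def by (rule remove_sings_analytic_on[OF an0])
  have v1: "gfac s = s * (s - 1) / 2 * of_real pi powr (- s / 2) * Gamma (s / 2)"
    unfolding gfac_def by (rule remove_sings_at_analytic[OF an0])
  have an2: "(\<lambda>s. gfac s * zeta_B B s) analytic_on {s}" by (intro analytic_on_mult an1 zeta_B_analytic[OF ok nz])
  have an3: "xi_B B analytic_on {s}" unfolding xi_B_def by (rule remove_sings_analytic_on[OF an2])
  have v3: "xi_B B s = gfac s * zeta_B B s" unfolding xi_B_def by (rule remove_sings_at_analytic[OF an2])
  have an4: "(\<lambda>s. s ^ card B * (1 - s) ^ card B * xi_B B s) analytic_on {s}"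
    by (intro analytic_on_mult analytic_on_power analytic_on_diff analytic_on_const analytic_on_ident an3)
  have "xi_colon B s = s ^ card B * (1 - s) ^ card B * xi_B B s"
    unfolding xi_colon_def by (rule remove_sings_at_analytic[OF an4])
  then show ?thesis unfolding v3 v1 .
qed

lemma zeta_colon_eq:
  assumes ok: "base_ok B" and nz: "\<And>c. c \<in> B \<Longrightarrow> 1 - of_nat c powr (- s) \<noteq> (0::complex)"
  shows "zeta_colon B s = s ^ card B * (1 - s) ^ card B * zeta_B B s"
proof -
  have "(\<lambda>s. s ^ card B * (1 - s) ^ card B * zeta_B B s) analytic_on {s}"
    by (intro analytic_on_mult analytic_on_power analytic_on_diff analytic_on_const analytic_on_ident zeta_B_analytic[OF ok nz])
  then show ?thesis unfolding zeta_colon_def by (rule remove_sings_at_analytic)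
qed

lemma minus_one_power_sq: "(- 1) ^ m * (- 1) ^ m = (1::complex)"
  unfolding power_mult_distrib[symmetric] by simp

lemma gamma_factor_eq_NN:
  assumes "s / 2 \<notin> \<int>\<^sub>\<le>\<^sub>0"
  shows "s ^ m * (1 - s) ^ m * (s * (s - 1) / 2 * p * Gamma (s / 2) * Z) = (- 1) ^ m / 2 * p * NN ((LL ^^ (m + 1)) 1) (s / 2) * Z"
proof -
  have e: "- 2 * (s / 2) * (1 - 2 * (s / 2)) = (- 1) * (s * (1 - s))" by (simp add: algebra_simps)
  have "(- 1) ^ m * ((- 1) * (s * (1 - s))) ^ (m + 1) = ((- 1) ^ m * (- 1) ^ m) * (- 1) * (s ^ m * (1 - s) ^ m) * (s * (1 - s))"
    unfolding power_mult_distrib power_add power_one_right by (simp only: mult_ac)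
  then have k: "(- 1) ^ m * ((- 1) * (s * (1 - s))) ^ (m + 1) = s ^ m * (1 - s) ^ m * (s * (s - 1))"
    unfolding minus_one_power_sq by (simp add: algebra_simps)
  have "(- 1) ^ m / 2 * p * NN ((LL ^^ (m + 1)) 1) (s / 2) * Z = ((- 1) ^ m * ((- 1) * (s * (1 - s))) ^ (m + 1)) / 2 * p * Gamma (s / 2) * Z"
    unfolding NN_LL_power[OF assms] e by simp
  moreover have alg: "a * b * (c / 2 * p * G * Z) = (a * b * c) / 2 * p * G * Z" for a b c G :: complex by simp
  ultimately show ?thesis unfolding k by (simp only: alg)
qed

lemma tay_add: "tay (p + q) k = tay p k + tay q k"
  by (simp add: tay_def distrib_right add_divide_distrib sum.distrib)

lemma tay_smult: "tay (Polynomial.smult c p) k = c * tay p k"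
  by (simp add: tay_def sum_distrib_left mult.assoc)

lemma tay_one: "tay 1 k = (- 1) ^ k / fact k"
proof -
  have "tay 1 k = (\<Sum>i\<in>{0}. coeff 1 i * (- 1) ^ (k - i) / fact (k - i))"
    unfolding tay_def by (rule sum.mono_neutral_right) auto
  then show ?thesis by simp
qed

lemma tay_LL_power: "tay ((LL ^^ j) 1) k = (2 * real k * (2 * real k + 1)) ^ j * ((- 1) ^ k / fact k)"
proof (induction j)
  case (Suc j)
  have "(LL ^^ Suc j) 1 = LL ((LL ^^ j) 1)" by (simp only: funpow.simps comp_apply)
  moreover have "tay (LL p) k = 2 * real k * (2 * real k + 1) * tay p k" for p
    by (simp add: LL_def tay_smult tay_dop tay_add algebra_simps)
  ultimately show ?case using Suc.IH by simp
qed (simp add: tay_one)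

lemma taylor_term_algebra:
  fixes kk G D :: complex
  assumes "kk \<noteq> 0" "G \<noteq> 0" "D \<noteq> 0"
  shows "a * (2 * p * (2 * kk + 1) * (b * ym * z) / (G * (2 * D))) = (b / 2) * ((2 * kk * (2 * kk + 1) * ym * (a / (kk * G))) * z * (p / D))"
  using assms by (simp add: field_simps)

lemma taylor_term:
  assumes ok: "base_ok B" and s: "Re s > 0" and k: "k \<ge> 1"
  defines "m \<equiv> card B"
  shows "(- 1) ^ k * (2 * of_real pi ^ k * (2 * of_nat k + 1) * zeta_colon B (- 2 * of_nat k) / (Gamma (of_nat k) * (s + 2 * of_nat k)))
    = (- 1) ^ m / 2 * of_real pi powr (- (s / 2)) * (of_real (tay ((LL ^^ (m + 1)) 1) k * Zk B k) * (of_real pi powr (of_nat k + s / 2) / (of_nat k + s / 2)))"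
proof -
  define kk where "kk = (of_nat k :: complex)"
  define D where "D = kk + s / 2"
  define G where "G = Gamma kk"
  have kk0: "kk \<noteq> 0" using k by (simp add: kk_def)
  have kn: "kk \<notin> \<int>\<^sub>\<le>\<^sub>0" unfolding kk_def by (rule not_nonpos_Ints_Re) (use k in simp)
  have G0: "G \<noteq> 0" unfolding G_def Gamma_eq_zero_iff by (rule kn)
  have "Re D > 0" using s by (simp add: D_def kk_def add_nonneg_pos)
  then have D0: "D \<noteq> 0" by auto
  have fact: "(fact k :: complex) = kk * G"
    using Gamma_fact[of k, where 'a = complex] Gamma_plus1[OF kn] by (simp add: kk_def G_def add.commute)
  have cpow: "of_nat c powr (2 * kk) = complex_of_real (real c ^ (2 * k))" if "c \<in> B" for c
  proof -
    have c0: "(of_nat c :: complex) \<noteq> 0" using base_ok_pos[OF ok that] by simp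
    have "of_nat c powr (2 * kk) = (of_nat c :: complex) powr of_nat (2 * k)" by (simp add: kk_def)
    also have "\<dots> = of_nat c ^ (2 * k)" by (rule powr_nat') (use c0 in simp)
    finally show ?thesis by simp
  qed
  have nz: "1 - of_nat c powr (- (- 2 * kk)) \<noteq> (0::complex)" if "c \<in> B" for c
  proof -
    have c2: "2 \<le> real c" using base_ok_pos[OF ok that] by simp
    have "real c ^ 1 \<le> real c ^ (2 * k)" using c2 k by (intro power_increasing) auto
    then have "1 - real c ^ (2 * k) \<noteq> 0" using c2 unfolding power_one_right by linarith
    then have "complex_of_real (1 - real c ^ (2 * k)) \<noteq> 0" by (simp only: of_real_eq_0_iff not_False_eq_True)
    then show ?thesis using cpow[OF that] by simp
  qed
  have zB: "zeta_B B (- 2 * kk) = of_real (Zk B k)"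
  proof -
    have "zeta_B B (- 2 * kk) = (\<Prod>b\<in>B. complex_of_real (1 / (1 - real b ^ (2 * k))))"
      unfolding zeta_B_def by (rule prod.cong[OF refl]) (simp add: cpow)
    then show ?thesis by (simp add: Zk_def)
  qed
  define Y where "Y = 2 * kk * (2 * kk + 1)"
  have zc: "zeta_colon B (- 2 * kk) = (- 1) ^ m * Y ^ m * of_real (Zk B k)"
  proof -
    have "zeta_colon B (- 2 * kk) = (- 2 * kk) ^ m * (1 - (- 2 * kk)) ^ m * zeta_B B (- 2 * kk)"
      unfolding m_def by (rule zeta_colon_eq[OF ok nz])
    also have "zeta_B B (- 2 * kk) = of_real (Zk B k)" by (rule zB)
    also have "(- 2 * kk) ^ m * (1 - (- 2 * kk)) ^ m = ((- 1) * Y) ^ m"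
      unfolding power_mult_distrib[symmetric] by (rule arg_cong[where f = "\<lambda>x. x ^ m"]) (simp add: Y_def algebra_simps)
    finally show ?thesis by (simp only: power_mult_distrib)
  qed
  have ty: "complex_of_real (tay ((LL ^^ (m + 1)) 1) k) = Y * Y ^ m * ((- 1) ^ k / (kk * G))"
    unfolding tay_LL_power by (simp add: Y_def kk_def[symmetric] fact[symmetric])
  have pw: "of_real pi powr (- (s / 2)) * complex_of_real pi powr (kk + s / 2) = of_real pi ^ k"
  proof -
    have "of_real pi powr (- (s / 2)) * complex_of_real pi powr (kk + s / 2) = complex_of_real pi powr of_nat k"
      unfolding powr_add[symmetric] by (simp add: kk_def)
    also have "\<dots> = of_real pi ^ k" by (rule powr_nat') simp
    finally show ?thesis .
  qed
  have sD: "s + 2 * kk = 2 * D" by (simp add: D_def algebra_simps)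
  have "(- 1) ^ k * (2 * of_real pi ^ k * (2 * kk + 1) * ((- 1) ^ m * Y ^ m * of_real (Zk B k)) / (G * (2 * D)))
    = ((- 1) ^ m / 2) * ((2 * kk * (2 * kk + 1) * Y ^ m * ((- 1) ^ k / (kk * G))) * of_real (Zk B k) * (of_real pi ^ k / D))"
    by (rule taylor_term_algebra[OF kk0 G0 D0])
  also have "\<dots> = (- 1) ^ m / 2 * of_real pi powr (- (s / 2)) * (of_real (tay ((LL ^^ (m + 1)) 1) k * Zk B k) * (of_real pi powr (kk + s / 2) / D))"
    unfolding pw[symmetric] of_real_mult ty Y_def[symmetric] by (simp add: mult_ac)
  finally show ?thesis unfolding zc[symmetric] sD[symmetric] unfolding G_def D_def kk_def .
qed

lemma pole_term:
  assumes ok: "base_ok B" and ind: "indep B" and b: "b \<in> B" and s: "Re s > 0"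
  defines "m \<equiv> card B"
  shows "pole_B b n * (1 - pole_B b n) * xi_colon (B - {b}) (pole_B b n) / (of_real (ln (real b)) * (s - pole_B b n))
    = (- 1) ^ m / 2 * of_real pi powr (- (s / 2)) * (cf B b ((LL ^^ (m + 1)) 1) n * (of_real pi powr (- (pole_B b n / 2) + s / 2) / (- (pole_B b n / 2) + s / 2)))"
proof (cases "n = 0")
  case True
  then show ?thesis by (simp add: pole_B_def cf_def)
next
  case False
  define \<rho> where "\<rho> = pole_B b n"
  define B' where "B' = B - {b}"
  have b2: "b \<ge> 2" by (rule base_ok_pos[OF ok b])
  have ok': "base_ok B'" unfolding B'_def by (rule base_ok_subset[OF ok]) auto
  have fin: "finite B" using ok by (simp add: base_ok_def)
  have m: "m = Suc (card B')" unfolding m_def B'_def using card_Suc_Diff1[OF fin b] by simp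
  have nn: "\<rho> / 2 \<notin> \<int>\<^sub>\<le>\<^sub>0" unfolding \<rho>_def pole_B_half
    by (rule imaginary_not_nonpos_Int) (use False b2 in auto)
  have nz: "1 - of_nat c powr (- \<rho>) \<noteq> (0::complex)" if "c \<in> B'" for c
  proof -
    have c: "c \<in> B" "b \<noteq> c" using that by (auto simp: B'_def)
    show ?thesis unfolding \<rho>_def by (rule factor_nonzero[OF indep_factor[OF ok ind b c] False])
  qed
  have xce: "xi_colon B' \<rho> = \<rho> ^ card B' * (1 - \<rho>) ^ card B' * (\<rho> * (\<rho> - 1) / 2 * of_real pi powr (- \<rho> / 2) * Gamma (\<rho> / 2) * zeta_B B' \<rho>)"
    by (rule xi_colon_eq[OF ok' nn nz])
  have "\<rho> * (1 - \<rho>) * xi_colon B' \<rho> = \<rho> ^ m * (1 - \<rho>) ^ m * (\<rho> * (\<rho> - 1) / 2 * of_real pi powr (- \<rho> / 2) * Gamma (\<rho> / 2) * zeta_B B' \<rho>)"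
    unfolding xce m power_Suc by (simp only: mult_ac)
  also have "\<dots> = (- 1) ^ m / 2 * of_real pi powr (- \<rho> / 2) * NN ((LL ^^ (m + 1)) 1) (\<rho> / 2) * zeta_B B' \<rho>"
    by (rule gamma_factor_eq_NN[OF nn])
  finally have L: "\<rho> * (1 - \<rho>) * xi_colon B' \<rho> = (- 1) ^ m / 2 * of_real pi powr (- \<rho> / 2) * NN ((LL ^^ (m + 1)) 1) (\<rho> / 2) * zeta_B B' \<rho>" .
  have cf: "cf B b ((LL ^^ (m + 1)) 1) n = NN ((LL ^^ (m + 1)) 1) (\<rho> / 2) / (2 * of_real (ln (real b))) * zeta_B B' \<rho>"
    using False by (simp add: cf_def \<rho>_def B'_def)
  have pw: "of_real pi powr (- \<rho> / 2) = of_real pi powr (- (s / 2)) * complex_of_real pi powr (- (\<rho> / 2) + s / 2)"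
    unfolding powr_add[symmetric] by simp
  have D: "s - \<rho> = 2 * (- (\<rho> / 2) + s / 2)" by (simp add: algebra_simps)
  have alg: "a * (p * q) * N * Z / (l * (2 * d)) = a * p * (N / (2 * l) * Z * (q / d))" for a p q N Z l d :: complex
    by (simp only: times_divide_eq_left times_divide_eq_right divide_divide_eq_left mult_ac)
  show ?thesis unfolding \<rho>_def[symmetric] B'_def[symmetric] L unfolding cf pw D by (rule alg)
qed

lemma xi_colon_minus_pp:
  assumes ok: "base_ok B" and ind: "indep B" and s: "Re s > 0"
  defines "m \<equiv> card B"
  shows "xi_colon B s - xi_pp B s = (- 1) ^ m / 2 * of_real pi powr (- (s / 2)) *
    (LINT u:{pi..}|lborel. of_real (Psi (aB B) ((LL ^^ (m + 1)) 1) u) * of_real u powr (s / 2 - 1))"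
proof -
  define P where "P = (LL ^^ (m + 1)) 1"
  define w where "w = s / 2"
  define K where "K = (- 1) ^ m / 2 * complex_of_real pi powr (- w)"
  have w0: "Re w > 0" using s by (simp add: w_def)
  have fin: "finite B" using ok by (simp add: base_ok_def)
  define f where "f u = complex_of_real (Psi (aB B) P u) * of_real u powr (w - 1)" for u
  have int: "set_integrable lborel {0<..} f" unfolding f_def by (rule Psi_mellin(1)[OF adm_aB[OF ok] w0])
  have mel: "(LINT u:{0<..}|lborel. f u) = NN P w * zeta_B B (2 * w)"
    unfolding f_def by (rule Psi_mellin(2)[OF adm_aB[OF ok] w0 aB_dirichlet_sums[OF ok w0]])
  have i0: "set_integrable lborel {0<..<pi} f" by (rule set_integrable_subset[OF int]) auto
  have i1: "set_integrable lborel {pi..} f" by (rule set_integrable_subset[OF int]) (auto intro: pi_le_pos)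
  have un: "{0<..} = {0<..<pi} \<union> {pi..}" by (auto intro: pi_le_pos)
  have split: "(LINT u:{0<..}|lborel. f u) = (LINT u:{0<..<pi}|lborel. f u) + (LINT u:{pi..}|lborel. f u)"
    unfolding un by (rule set_integral_Un[OF _ i0 i1]) auto
  define cT where "cT k = complex_of_real (tay P k * Zk B k)" for k
  define T where "T u = (\<Sum>\<^sub>\<infinity>k::nat. cT k * complex_of_real u powr (of_nat k + w - 1))" for u
  define S where "S b u = (\<Sum>\<^sub>\<infinity>n::int. cf B b P n * complex_of_real u powr (- (pole_B b n / 2) + w - 1))" for b u
  have exp: "f u = T u + (\<Sum>b\<in>B. S b u)" if u: "u \<in> {0<..<pi}" for u
  proof -
    have u0: "u > 0" using u by simp
    have t: "Tf B P k (ln u) * of_real u powr (w - 1) = cT k * complex_of_real u powr (of_nat k + w - 1)" for k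
    proof -
      have "complex_of_real (exp (real k * ln u)) = of_real u powr of_nat k"
        unfolding powr_of_pos[OF u0] by (simp add: exp_of_real[symmetric])
      then have "Tf B P k (ln u) * of_real u powr (w - 1) = cT k * (of_real u powr of_nat k * of_real u powr (w - 1))"
        unfolding Tf_def cT_def of_real_mult by (simp only: mult_ac)
      then show ?thesis unfolding powr_add[symmetric] by (simp only: add_diff_eq)
    qed
    have ss: "Sf B b P n (ln u) * of_real u powr (w - 1) = cf B b P n * complex_of_real u powr (- (pole_B b n / 2) + w - 1)" for b n
      unfolding Sf_def powr_pole_half[OF u0, symmetric] mult.assoc powr_add[symmetric] by (simp only: add_diff_eq)
    have "f u = (\<Sum>\<^sub>\<infinity>k. Tf B P k (ln u)) * of_real u powr (w - 1) + (\<Sum>b\<in>B. (\<Sum>\<^sub>\<infinity>n. Sf B b P n (ln u)) * of_real u powr (w - 1))"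
      unfolding f_def P_def m_def Psi_expansion[OF ok ind u0] distrib_right sum_distrib_right ..
    also have "\<dots> = T u + (\<Sum>b\<in>B. S b u)"
      unfolding infsum_cmult_left'[symmetric] t ss T_def S_def ..
    finally show ?thesis .
  qed
  have sumT: "(\<lambda>k. norm (cT k) * pi powr Re (of_nat k)) summable_on UNIV"
  proof (rule summable_on_comparison_test[OF tay_bound_summable[of P "ln pi"]])
    fix k :: nat
    have "norm (cT k) * pi powr Re (of_nat k) = \<bar>tay P k\<bar> * \<bar>Zk B k\<bar> * pi ^ k"
      by (simp add: cT_def norm_mult powr_realpow)
    also have "\<dots> \<le> \<bar>tay P k\<bar> * 1 * pi ^ k" by (intro mult_mono Zk_abs_le[OF ok]) auto
    finally show "norm (cT k) * pi powr Re (of_nat k) \<le> \<bar>tay P k * exp (ln pi) ^ k\<bar>" by (simp add: abs_mult)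
  qed simp
  note rT = powr_series_integral[OF bij_id w0, of "of_nat" cT, OF _ sumT, folded T_def]
  have rS: "set_integrable lborel {0<..<pi} (S b) \<and>
    ((\<lambda>n. cf B b P n * (of_real pi powr (- (pole_B b n / 2) + w) / (- (pole_B b n / 2) + w))) has_sum (LINT u:{0<..<pi}|lborel. S b u)) UNIV"
    if b: "b \<in> B" for b
  proof -
    have re: "Re (- (pole_B b n / 2)) = 0" for n by (simp add: pole_B_half)
    have "(\<lambda>n. norm (cf B b P n) * pi powr Re (- (pole_B b n / 2))) summable_on UNIV"
      unfolding re using cf_summable[OF ok ind b, of P] by simp
    from powr_series_integral[OF bij_int_decode w0 _ this] show ?thesis unfolding S_def using re by simp
  qed
  have iT: "set_integrable lborel {0<..<pi} T" by (rule rT(1)) simp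
  have hT: "((\<lambda>k. cT k * (of_real pi powr (of_nat k + w) / (of_nat k + w))) has_sum (LINT u:{0<..<pi}|lborel. T u)) UNIV" by (rule rT(2)) simp
  note sS = set_lint_sum[OF fin, of "{0<..<pi}" S, OF rS[THEN conjunct1]]
  have "(LINT u:{0<..<pi}|lborel. f u) = (LINT u:{0<..<pi}|lborel. T u + (\<Sum>b\<in>B. S b u))"
    by (rule set_lebesgue_integral_cong) (use exp in auto)
  also have "\<dots> = (LINT u:{0<..<pi}|lborel. T u) + (\<Sum>b\<in>B. LINT u:{0<..<pi}|lborel. S b u)"
    using set_integral_add(2)[OF iT sS[THEN conjunct1]] sS[THEN conjunct2] by simp
  finally have lower: "(LINT u:{0<..<pi}|lborel. f u) = (LINT u:{0<..<pi}|lborel. T u) + (\<Sum>b\<in>B. LINT u:{0<..<pi}|lborel. S b u)" .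
  have pp1: "(\<Sum>\<^sub>\<infinity>n\<in>(UNIV :: int set). pole_B b n * (1 - pole_B b n) * xi_colon (B - {b}) (pole_B b n) / (of_real (ln (real b)) * (s - pole_B b n)))
      = K * (LINT u:{0<..<pi}|lborel. S b u)" if b: "b \<in> B" for b
    unfolding pole_term[OF ok ind b s] unfolding K_def w_def P_def m_def[symmetric]
    using has_sum_cmult_right[OF rS[OF b, THEN conjunct2], of K] unfolding K_def w_def P_def by (rule infsumI)
  have pp2: "(\<Sum>\<^sub>\<infinity>n\<in>{1::nat..}. (- 1) ^ n * (2 * of_real pi ^ n * (2 * of_nat n + 1) * zeta_colon B (- 2 * of_nat n) / (Gamma (of_nat n) * (s + 2 * of_nat n))))
      = K * (LINT u:{0<..<pi}|lborel. T u)"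
  proof -
    have cT0: "cT 0 = 0" unfolding cT_def P_def tay_LL_power by simp
    have "(\<Sum>\<^sub>\<infinity>n\<in>{1::nat..}. (- 1) ^ n * (2 * of_real pi ^ n * (2 * of_nat n + 1) * zeta_colon B (- 2 * of_nat n) / (Gamma (of_nat n) * (s + 2 * of_nat n))))
      = (\<Sum>\<^sub>\<infinity>n. K * (cT n * (of_real pi powr (of_nat n + w) / (of_nat n + w))))"
    proof (rule infsum_cong_neutral)
      fix n assume "n \<in> {1::nat..} \<inter> UNIV"
      then have n: "n \<ge> 1" by simp
      show "(- 1) ^ n * (2 * of_real pi ^ n * (2 * of_nat n + 1) * zeta_colon B (- 2 * of_nat n) / (Gamma (of_nat n) * (s + 2 * of_nat n)))
        = K * (cT n * (of_real pi powr (of_nat n + w) / (of_nat n + w)))"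
        unfolding taylor_term[OF ok s n] K_def cT_def w_def P_def m_def ..
    next
      fix n assume "n \<in> UNIV - {1::nat..}"
      then have "n = 0" by auto
      then show "K * (cT n * (of_real pi powr (of_nat n + w) / (of_nat n + w))) = 0" using cT0 by simp
    qed simp
    also have "\<dots> = K * (LINT u:{0<..<pi}|lborel. T u)" by (rule infsumI[OF has_sum_cmult_right[OF hT]])
    finally show ?thesis .
  qed
  have pp: "xi_pp B s = K * (LINT u:{0<..<pi}|lborel. f u)"
  proof -
    have "xi_pp B s = (\<Sum>b\<in>B. K * (LINT u:{0<..<pi}|lborel. S b u)) + K * (LINT u:{0<..<pi}|lborel. T u)"
      unfolding xi_pp_def pp2 by (rule arg_cong2[where f = "(+)", OF sum.cong[OF refl pp1] refl])
    also have "\<dots> = K * ((LINT u:{0<..<pi}|lborel. T u) + (\<Sum>b\<in>B. LINT u:{0<..<pi}|lborel. S b u))"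
      by (simp only: distrib_left sum_distrib_left add.commute)
    finally show ?thesis unfolding lower .
  qed
  have nn: "s / 2 \<notin> \<int>\<^sub>\<le>\<^sub>0" by (rule not_nonpos_Ints_Re) (use s in simp)
  have nz: "1 - of_nat c powr (- s) \<noteq> (0::complex)" if "c \<in> B" for c
    by (rule euler_factor_nonzero[OF base_ok_pos[OF ok that] s])
  have xce: "xi_colon B s = s ^ card B * (1 - s) ^ card B * (s * (s - 1) / 2 * of_real pi powr (- s / 2) * Gamma (s / 2) * zeta_B B s)"
    by (rule xi_colon_eq[OF ok nn nz])
  have "xi_colon B s = (- 1) ^ m / 2 * of_real pi powr (- s / 2) * NN P (s / 2) * zeta_B B s"
    unfolding xce m_def[symmetric] P_def by (rule gamma_factor_eq_NN[OF nn])
  also have "\<dots> = K * (LINT u:{0<..}|lborel. f u)"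
    unfolding mel K_def w_def by simp
  finally have "xi_colon B s = K * (LINT u:{0<..}|lborel. f u)" .
  then have "xi_colon B s - xi_pp B s = K * (LINT u:{pi..}|lborel. f u)"
    unfolding pp split by (simp add: algebra_simps)
  then show ?thesis unfolding f_def K_def w_def P_def .
qed

lemma tail_integral_tendsto:
  assumes a: "adm \<sigma> a"
  shows "(\<lambda>s. LINT u:{pi..}|lborel. of_real (Psi a p u) * complex_of_real u powr (s / 2 - 1)) \<midarrow>1 / 2\<rightarrow>
    (LINT u:{pi..}|lborel. of_real (Psi a p u) * complex_of_real u powr (1 / 2 / 2 - 1))"
proof -
  define F where "F s u = indicator {pi..} u *\<^sub>R (complex_of_real (Psi a p u) * complex_of_real u powr (s / 2 - 1))" for s u
  define G where "G u = indicator {pi..} u *\<^sub>R \<bar>Psi a p u\<bar>" for u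
  have iF: "integrable lborel (F s)" for s
    using Psi_tail_integrable[OF a, of p "s / 2 - 1"] unfolding set_integrable_def F_def .
  have iG: "integrable lborel G"
  proof -
    have "integrable lborel (\<lambda>u. norm (indicator {pi..} u *\<^sub>R (complex_of_real (Psi a p u) * complex_of_real u powr 0)))"
      using Psi_tail_integrable[OF a, of p 0] unfolding set_integrable_def by (rule integrable_norm)
    moreover have "(\<lambda>u. norm (indicator {pi..} u *\<^sub>R (complex_of_real (Psi a p u) * complex_of_real u powr 0))) = G"
    proof
      fix u :: real
      show "norm (indicator {pi..} u *\<^sub>R (complex_of_real (Psi a p u) * complex_of_real u powr 0)) = G u"
        using pi_le_pos[of u] by (cases "u \<ge> pi") (auto simp: G_def indicator_def)
    qed
    ultimately show ?thesis by simp
  qed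
  define U where "U = ball (1 / 2 :: complex) (1 / 4)"
  have "((\<lambda>s. \<integral>u. F s u \<partial>lborel) \<longlongrightarrow> (\<integral>u. F (1 / 2) u \<partial>lborel)) (at (1 / 2) within U)"
    unfolding tendsto_at_iff_sequentially
  proof (intro allI impI)
    fix X :: "nat \<Rightarrow> complex"
    assume X: "\<forall>i. X i \<in> U - {1 / 2}" and lim: "X \<longlonglongrightarrow> 1 / 2"
    have "(\<lambda>i. \<integral>u. F (X i) u \<partial>lborel) \<longlonglongrightarrow> (\<integral>u. F (1 / 2) u \<partial>lborel)"
    proof (rule integral_dominated_convergence[where w = G])
      show "F (1 / 2) \<in> borel_measurable lborel" "F (X i) \<in> borel_measurable lborel" for i
        using iF by (auto intro: borel_measurable_integrable)
      show "integrable lborel G" by (rule iG)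
      show "AE u in lborel. (\<lambda>i. F (X i) u) \<longlonglongrightarrow> F (1 / 2) u"
      proof (rule AE_I2)
        fix u :: real
        show "(\<lambda>i. F (X i) u) \<longlonglongrightarrow> F (1 / 2) u"
        proof (cases "u \<ge> pi")
          case True
          then have u: "u > 0" by (rule pi_le_pos)
          show ?thesis unfolding F_def powr_of_pos[OF u] by (intro tendsto_intros lim) auto
        qed (simp add: F_def)
      qed
      fix i
      show "AE u in lborel. norm (F (X i) u) \<le> G u"
      proof (rule AE_I2)
        fix u :: real
        show "norm (F (X i) u) \<le> G u"
        proof (cases "u \<ge> pi")
          case True
          then have u: "u \<ge> 1" using pi_ge_3 by linarith
          have "norm (X i - 1 / 2) < 1 / 4" using X by (auto simp: U_def dist_norm norm_minus_commute)
          then have "\<bar>Re (X i - 1 / 2)\<bar> < 1 / 4" using abs_Re_le_cmod[of "X i - 1 / 2"] by linarith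
          then have "Re (X i - 1 / 2) < 1 / 4" by linarith
          then have "Re (X i) \<le> 2" by simp
          then have "u powr (Re (X i) / 2 - 1) \<le> u powr 0" by (intro powr_mono u) simp
          then have "norm (complex_of_real u powr (X i / 2 - 1)) \<le> 1" using u by (simp add: norm_powr_real_powr)
          then have "\<bar>Psi a p u\<bar> * norm (complex_of_real u powr (X i / 2 - 1)) \<le> \<bar>Psi a p u\<bar> * 1" by (intro mult_left_mono) auto
          then show ?thesis using True by (simp add: F_def G_def norm_mult)
        qed (simp add: F_def G_def)
      qed
    qed
    then show "((\<lambda>s. \<integral>u. F s u \<partial>lborel) \<circ> X) \<longlonglongrightarrow> (\<integral>u. F (1 / 2) u \<partial>lborel)" by (simp add: o_def)
  qed
  moreover have "at (1 / 2) within U = at (1 / 2)" by (rule at_within_open) (auto simp: U_def)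
  ultimately show ?thesis unfolding F_def set_lebesgue_integral_def by simp
qed

theorem xi_approx_half:
  assumes ok: "base_ok B" and ind: "indep B"
  shows "xi_approx B (1 / 2) = of_real ((- 4) ^ card B * pi powr (- 1 / 4) * Jint (aB B) (card B))"
proof -
  define m where "m = card B"
  define J where "J = complex_of_real (Jint (aB B) m)"
  define I where "I s = (LINT u:{pi..}|lborel. of_real (Psi (aB B) ((LL ^^ (m + 1)) 1) u) * complex_of_real u powr (s / 2 - 1))" for s
  have I: "I \<midarrow>1 / 2\<rightarrow> J"
  proof -
    have e: "1 / 2 / 2 - 1 = (- 3 / 4 :: complex)" by simp
    show ?thesis using tail_integral_tendsto[OF adm_aB[OF ok], of "(LL ^^ (m + 1)) 1"] unfolding I_def J_def of_real_Jint e .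
  qed
  have "(\<lambda>s. (- 1) ^ m / 2 * complex_of_real pi powr (- (s / 2)) * I s) \<midarrow>1 / 2\<rightarrow> (- 1) ^ m / 2 * complex_of_real pi powr (- (1 / 2 / 2)) * J"
    unfolding powr_of_pos[OF pi_gt_zero] by (intro tendsto_intros I) auto
  moreover have "\<forall>\<^sub>F s in at (1 / 2). (- 1) ^ m / 2 * complex_of_real pi powr (- (s / 2)) * I s = xi_colon B s - xi_pp B s"
  proof -
    have "\<forall>\<^sub>F s in at (1 / 2 :: complex). s \<in> {s. Re s > 0}"
      by (rule eventually_at_in_open') (auto simp: open_halfspace_Re_gt)
    then show ?thesis
    proof (rule eventually_mono)
      fix s :: complex assume "s \<in> {s. Re s > 0}"
      then have "Re s > 0" by simp
      from xi_colon_minus_pp[OF ok ind this] show "(- 1) ^ m / 2 * complex_of_real pi powr (- (s / 2)) * I s = xi_colon B s - xi_pp B s"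
        unfolding I_def m_def by (rule sym)
    qed
  qed
  ultimately have "(\<lambda>s. xi_colon B s - xi_pp B s) \<midarrow>1 / 2\<rightarrow> (- 1) ^ m / 2 * complex_of_real pi powr (- (1 / 2 / 2)) * J"
    by (rule Lim_transform_eventually)
  then have reg: "xi_reg B (1 / 2) = (- 1) ^ m / 2 * complex_of_real pi powr (- (1 / 2 / 2)) * J"
    unfolding xi_reg_def by (rule remove_sings_eqI)
  have pw: "complex_of_real pi powr (- (1 / 2 / 2)) = of_real (pi powr (- 1 / 4))" using powr_of_real[of pi "- 1 / 4"] by simp
  have h: "1 - 1 / 2 = (1 / 2 :: complex)" by simp
  have q: "(1 / 2) ^ m * (1 / 2) ^ m = (1 / 4 :: complex) ^ m" unfolding power_mult_distrib[symmetric] by simp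
  have q4: "x / (1 / 4 :: complex) ^ m = x * 4 ^ m" for x by (simp add: power_divide)
  have q5: "(- 1) ^ m * 4 ^ m = ((- 4) ^ m :: complex)" unfolding power_mult_distrib[symmetric] by simp
  have "xi_approx B (1 / 2) = ((- 1) ^ m * 4 ^ m) * of_real (pi powr (- 1 / 4)) * J"
    unfolding xi_approx_def h reg m_def[symmetric] q q4 pw by (simp add: mult_ac)
  then show ?thesis unfolding q5 J_def m_def[symmetric] by simp
qed

section \<open>The sieve\<close>

lemma Jint_integrable:
  assumes "adm \<sigma> a"
  shows "set_integrable lborel {pi..} (\<lambda>u. Psi a p u * u powr (- 3 / 4))"
proof -
  have "set_integrable lborel {pi..} (\<lambda>v. complex_of_real (Psi a p v) * of_real v powr (of_real (- 3 / 4)))"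
    by (rule Psi_tail_integrable[OF assms])
  then have "integrable lborel (\<lambda>v. Re (indicator {pi..} v *\<^sub>R (complex_of_real (Psi a p v) * of_real v powr (of_real (- 3 / 4)))))"
    unfolding set_integrable_def by (rule integrable_Re)
  moreover have "(\<lambda>v. Re (indicator {pi..} v *\<^sub>R (complex_of_real (Psi a p v) * of_real v powr (of_real (- 3 / 4)))))
      = (\<lambda>v. indicator {pi..} v *\<^sub>R (Psi a p v * v powr (- 3 / 4)))"
  proof
    fix v :: real
    show "Re (indicator {pi..} v *\<^sub>R (complex_of_real (Psi a p v) * of_real v powr (of_real (- 3 / 4)))) = indicator {pi..} v *\<^sub>R (Psi a p v * v powr (- 3 / 4))"
    proof (cases "v \<in> {pi..}")
      case True
      then have "v \<ge> 0" using pi_le_pos[of v] by simp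
      then have "complex_of_real v powr (of_real (- 3 / 4)) = of_real (v powr (- 3 / 4))" by (rule powr_of_real)
      then show ?thesis using True by (simp only: indicator_simps scaleR_one of_real_mult[symmetric] Re_complex_of_real)
    qed simp
  qed
  ultimately show ?thesis by (simp only: set_integrable_def)
qed

lemma set_integral_pos:
  fixes f :: "real \<Rightarrow> real"
  assumes int: "set_integrable lborel {pi..} f" and pos: "\<And>u. u \<ge> pi \<Longrightarrow> f u > 0"
  shows "(LINT u:{pi..}|lborel. f u) > 0"
proof -
  define g where "g u = indicator {pi..} u *\<^sub>R f u" for u
  have ig: "integrable lborel g" using int by (simp add: set_integrable_def g_def[abs_def])
  have g0: "g u \<ge> 0" for u using pos[of u] by (auto simp: g_def indicator_def less_imp_le)
  have "(\<integral>u. g u \<partial>lborel) \<noteq> 0"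
  proof
    assume "(\<integral>u. g u \<partial>lborel) = 0"
    then have "AE u in lborel. g u = 0" using integral_nonneg_eq_0_iff_AE[OF ig] g0 by simp
    then have "AE u in lborel. u \<notin> {pi..pi + 1}"
      by (rule eventually_mono) (use pos in \<open>force simp: g_def indicator_def\<close>)
    moreover have e: "{u \<in> space lborel. \<not> (u \<notin> {pi..pi + 1})} = {pi..pi + 1}" by auto
    ultimately have "emeasure lborel {pi..pi + 1} = 0" using AE_iff_measurable[OF _ e] by simp
    then show False by (simp only: emeasure_lborel_Icc) simp
  qed
  moreover have "(\<integral>u. g u \<partial>lborel) \<ge> 0" by (rule Bochner_Integration.integral_nonneg) (rule g0)
  ultimately show ?thesis by (simp add: set_lebesgue_integral_def g_def)
qed

lemma Jint_diff:
  assumes "adm \<sigma> a" "adm \<tau> b"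
  shows "Jint a m - Jint b m = (LINT u:{pi..}|lborel. (Psi a ((LL ^^ (m + 1)) 1) u - Psi b ((LL ^^ (m + 1)) 1) u) * u powr (- 3 / 4))"
  unfolding Jint_def left_diff_distrib
  by (rule set_integral_diff(2)[OF Jint_integrable[OF assms(1)] Jint_integrable[OF assms(2)], symmetric])

lemma Jint_diff_integrable:
  assumes "adm \<sigma> a" "adm \<tau> b"
  shows "set_integrable lborel {pi..} (\<lambda>u. (Psi a p u - Psi b p u) * u powr (- 3 / 4))"
  unfolding left_diff_distrib by (intro set_integral_diff(1) Jint_integrable[OF assms(1)] Jint_integrable[OF assms(2)])

lemma set_integral_abs_less:
  fixes f g :: "real \<Rightarrow> real"
  assumes "set_integrable lborel {pi..} f" "set_integrable lborel {pi..} g" "\<And>u. u \<ge> pi \<Longrightarrow> \<bar>f u\<bar> < g u"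
  shows "\<bar>LINT u:{pi..}|lborel. f u\<bar> < (LINT u:{pi..}|lborel. g u)"
proof -
  have "(LINT u:{pi..}|lborel. g u - f u) > 0"
    by (rule set_integral_pos) (use assms in \<open>auto simp: abs_less_iff intro: set_integral_diff(1)\<close>)
  moreover have "(LINT u:{pi..}|lborel. g u + f u) > 0"
  proof (rule set_integral_pos)
    show "set_integrable lborel {pi..} (\<lambda>u. g u + f u)" by (rule set_integral_add(1)[OF assms(2,1)])
    show "g u + f u > 0" if "u \<ge> pi" for u using assms(3)[OF that] by linarith
  qed
  ultimately show ?thesis using set_integral_diff(2)[OF assms(2,1)] set_integral_add(2)[OF assms(2,1)] by linarith
qed

lemma set_integral_abs_le:
  fixes f g :: "real \<Rightarrow> real"
  assumes "set_integrable lborel {pi..} f" "set_integrable lborel {pi..} g" "\<And>u. u \<ge> pi \<Longrightarrow> \<bar>f u\<bar> \<le> g u"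
  shows "\<bar>LINT u:{pi..}|lborel. f u\<bar> \<le> (LINT u:{pi..}|lborel. g u)"
proof -
  have "(LINT u:{pi..}|lborel. f u) \<le> (LINT u:{pi..}|lborel. g u)"
    by (rule set_integral_mono[OF assms(1,2)]) (use assms(3) in \<open>auto simp: abs_le_iff\<close>)
  moreover have "(LINT u:{pi..}|lborel. - f u) \<le> (LINT u:{pi..}|lborel. g u)"
  proof (rule set_integral_mono[OF _ assms(2)])
    show "set_integrable lborel {pi..} (\<lambda>u. - f u)" using set_integrable_mult_right[of "- 1" lborel "{pi..}" f] assms(1) by simp
    show "- f u \<le> g u" if "u \<in> {pi..}" for u using assms(3)[of u] that by (auto simp: abs_le_iff)
  qed
  moreover have "(LINT u:{pi..}|lborel. - f u) = - (LINT u:{pi..}|lborel. f u)"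
    using set_integral_mult_right[of lborel "{pi..}" "- 1" f] by simp
  ultimately show ?thesis by linarith
qed

lemma approx_error:
  assumes "base_ok B" "indep B"
  shows "cmod (xi_approx B (1 / 2) - xi (1 / 2)) = 4 ^ card B * pi powr (- 1 / 4) * \<bar>Jint (aB B) (card B) - Jint one_w (card B)\<bar>"
proof -
  have "xi_approx B (1 / 2) - xi (1 / 2) = of_real ((- 4) ^ card B * pi powr (- 1 / 4) * (Jint (aB B) (card B) - Jint one_w (card B)))"
    unfolding xi_approx_half[OF assms] xi_half[of "card B"] by (simp add: algebra_simps)
  then show ?thesis by (simp only: norm_of_real) (simp add: abs_mult power_abs)
qed

lemma indep_primes: "(\<And>b. b \<in> B \<Longrightarrow> prime b) \<Longrightarrow> indep B"
  unfolding indep_def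
proof (intro ballI impI allI notI)
  fix b c r t :: nat
  assume p: "\<And>b. b \<in> B \<Longrightarrow> prime b" and h: "b \<in> B" "c \<in> B" "b \<noteq> c" "r > 0" "t > 0" "b ^ r = c ^ t"
  have "b dvd c ^ t" using h(4,6) by (metis dvd_power)
  then have "b dvd c" using p[OF h(1)] prime_dvd_power by blast
  then show False using primes_dvd_imp_eq[OF p[OF h(1)] p[OF h(2)]] h(3) by simp
qed

lemma indep_insert_primes:
  assumes p: "\<And>b. b \<in> B \<Longrightarrow> prime b" and q: "\<And>b r. b \<in> B \<Longrightarrow> q \<noteq> b ^ r"
  shows "indep (insert q B)"
proof -
  have key: False if k: "b \<in> B" "r > 0" "q ^ r = b ^ t" for b r t :: nat
  proof -
    have "q dvd q ^ r" using k(2) by simp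
    then have "q dvd b ^ t" unfolding k(3) .
    then have "\<exists>i\<le>t. q = b ^ i" unfolding divides_primepow_nat[OF p[OF k(1)]] .
    then show False using q[OF k(1)] by blast
  qed
  have "indep B" by (rule indep_primes) (rule p)
  show ?thesis unfolding indep_def
  proof (intro ballI impI allI notI)
    fix b c r t assume h: "b \<in> insert q B" "c \<in> insert q B" "b \<noteq> c" "(r::nat) > 0" "(t::nat) > 0" "b ^ r = c ^ t"
    show False
    proof (cases "b = q")
      case True
      then have "c \<in> B" using h by auto
      then show False using key[of c r t] h True by simp
    next
      case False
      then have b: "b \<in> B" using h by simp
      show False
      proof (cases "c = q")
        case True
        then have "q ^ t = b ^ r" using h(6) by simp
        then show False by (rule key[OF b h(5)])
      next
        case False
        then have "c \<in> B" using h by simp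
        then show False using \<open>indep B\<close> b h unfolding indep_def by blast
      qed
    qed
  qed
qed

lemma error_prime:
  fixes N :: nat
  defines "B \<equiv> {r. prime r \<and> r < N}"
  assumes N: "prime N" "N \<ge> 3"
  shows "cmod (xi_approx (insert N B) (1 / 2) - xi (1 / 2)) < cmod (xi_approx B (1 / 2) - xi (1 / 2))"
proof -
  have okB: "base_ok B" unfolding B_def by (rule base_ok_primes)
  have ok': "base_ok (insert N B)" using okB N by simp
  have iB: "indep B" by (rule indep_primes) (simp add: B_def)
  have i': "indep (insert N B)" by (rule indep_primes) (use N in \<open>auto simp: B_def\<close>)
  have card: "card (insert N B) = card B + 1" using okB by (simp add: base_ok_def B_def)
  have e2: "card B + 1 + 1 = card B + 2" by simp
  define f where "f u = 4 * ((Psi (aB (insert N B)) ((LL ^^ (card B + 2)) 1) u - Psi one_w ((LL ^^ (card B + 2)) 1) u) * u powr (- 3 / 4))" for u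
  define g where "g u = (Psi one_w ((LL ^^ (card B + 1)) 1) u - Psi (aB B) ((LL ^^ (card B + 1)) 1) u) * u powr (- 3 / 4)" for u
  have fint: "set_integrable lborel {pi..} f" unfolding f_def
    by (intro set_integrable_mult_right impI Jint_diff_integrable[OF adm_aB[OF ok'] adm_one_w])
  have gint: "set_integrable lborel {pi..} g" unfolding g_def by (rule Jint_diff_integrable[OF adm_one_w adm_aB[OF okB]])
  have "\<bar>LINT u:{pi..}|lborel. f u\<bar> < (LINT u:{pi..}|lborel. g u)"
  proof (rule set_integral_abs_less[OF fint gint])
    fix u assume u: "u \<ge> pi"
    then have u3: "u \<ge> 3" using pi_ge_3 by linarith
    have w: "u powr (- 3 / 4) > 0" using u3 by simp
    have "4 * \<bar>Psi (aB (insert N B)) ((LL ^^ (card B + 2)) 1) u - Psi one_w ((LL ^^ (card B + 2)) 1) u\<bar> * u powr (- 3 / 4)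
      < (Psi one_w ((LL ^^ (card B + 1)) 1) u - Psi (aB B) ((LL ^^ (card B + 1)) 1) u) * u powr (- 3 / 4)"
      by (rule mult_strict_right_mono[OF compare_prime[OF N u3, folded B_def] w])
    then show "\<bar>f u\<bar> < g u" using w by (simp add: f_def g_def abs_mult)
  qed
  moreover have "(LINT u:{pi..}|lborel. f u) = 4 * (Jint (aB (insert N B)) (card B + 1) - Jint one_w (card B + 1))"
    unfolding f_def Jint_diff[OF adm_aB[OF ok'] adm_one_w] e2 by (rule set_integral_mult_right)
  moreover have "(LINT u:{pi..}|lborel. g u) = Jint one_w (card B) - Jint (aB B) (card B)"
    unfolding g_def Jint_diff[OF adm_one_w adm_aB[OF okB]] ..
  ultimately have "4 * \<bar>Jint (aB (insert N B)) (card B + 1) - Jint one_w (card B + 1)\<bar> < \<bar>Jint (aB B) (card B) - Jint one_w (card B)\<bar>"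
    by linarith
  then have "4 ^ card B * pi powr (- 1 / 4) * (4 * \<bar>Jint (aB (insert N B)) (card B + 1) - Jint one_w (card B + 1)\<bar>)
     < 4 ^ card B * pi powr (- 1 / 4) * \<bar>Jint (aB B) (card B) - Jint one_w (card B)\<bar>"
    by (intro mult_strict_left_mono) auto
  then show ?thesis unfolding approx_error[OF okB iB] approx_error[OF ok' i'] card by (simp add: mult_ac)
qed

lemma error_composite:
  fixes q N :: nat
  defines "B \<equiv> {r. prime r \<and> r < N}"
  assumes q: "q < N" "\<not> prime q" "q \<ge> 6" "B = {r. prime r \<and> r < q}" and ind: "indep (insert q B)"
  shows "cmod (xi_approx B (1 / 2) - xi (1 / 2)) \<le> cmod (xi_approx (insert q B) (1 / 2) - xi (1 / 2))"
proof -
  have okB: "base_ok B" unfolding B_def by (rule base_ok_primes)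
  have ok': "base_ok (insert q B)" using okB q by simp
  have iB: "indep B" by (rule indep_primes) (simp add: B_def)
  have card: "card (insert q B) = card B + 1" using okB q by (simp add: base_ok_def B_def)
  have e2: "card B + 1 + 1 = card B + 2" by simp
  define f where "f u = (Psi (aB B) ((LL ^^ (card B + 1)) 1) u - Psi one_w ((LL ^^ (card B + 1)) 1) u) * u powr (- 3 / 4)" for u
  define g where "g u = 4 * ((Psi (aB (insert q B)) ((LL ^^ (card B + 2)) 1) u - Psi one_w ((LL ^^ (card B + 2)) 1) u) * u powr (- 3 / 4))" for u
  have gint: "set_integrable lborel {pi..} g" unfolding g_def
    by (intro set_integrable_mult_right impI Jint_diff_integrable[OF adm_aB[OF ok'] adm_one_w])
  have fint: "set_integrable lborel {pi..} f" unfolding f_def by (rule Jint_diff_integrable[OF adm_aB[OF okB] adm_one_w])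
  have "\<bar>LINT u:{pi..}|lborel. f u\<bar> \<le> (LINT u:{pi..}|lborel. g u)"
  proof (rule set_integral_abs_le[OF fint gint])
    fix u assume u: "u \<ge> pi"
    then have u3: "u \<ge> 3" using pi_ge_3 by linarith
    have w: "u powr (- 3 / 4) \<ge> 0" by simp
    have "\<bar>Psi (aB B) ((LL ^^ (card B + 1)) 1) u - Psi one_w ((LL ^^ (card B + 1)) 1) u\<bar> * u powr (- 3 / 4)
      \<le> 4 * (Psi (aB (insert q B)) ((LL ^^ (card B + 2)) 1) u - Psi one_w ((LL ^^ (card B + 2)) 1) u) * u powr (- 3 / 4)"
      by (rule mult_right_mono[OF compare_composite[OF q(1-3) q(4)[unfolded B_def] u3, folded B_def] w])
    moreover have "\<bar>f u\<bar> = \<bar>Psi (aB B) ((LL ^^ (card B + 1)) 1) u - Psi one_w ((LL ^^ (card B + 1)) 1) u\<bar> * u powr (- 3 / 4)"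
      unfolding f_def abs_mult abs_of_nonneg[OF w] ..
    ultimately show "\<bar>f u\<bar> \<le> g u" unfolding g_def by (simp only: mult.assoc)
  qed
  moreover have "(LINT u:{pi..}|lborel. g u) = 4 * (Jint (aB (insert q B)) (card B + 1) - Jint one_w (card B + 1))"
    unfolding g_def Jint_diff[OF adm_aB[OF ok'] adm_one_w] e2 by (rule set_integral_mult_right)
  moreover have "(LINT u:{pi..}|lborel. f u) = Jint (aB B) (card B) - Jint one_w (card B)"
    unfolding f_def Jint_diff[OF adm_aB[OF okB] adm_one_w] ..
  ultimately have "\<bar>Jint (aB B) (card B) - Jint one_w (card B)\<bar> \<le> 4 * (Jint (aB (insert q B)) (card B + 1) - Jint one_w (card B + 1))"
    by (simp only:)
  also have "\<dots> \<le> 4 * \<bar>Jint (aB (insert q B)) (card B + 1) - Jint one_w (card B + 1)\<bar>" by (intro mult_left_mono abs_ge_self) simp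
  finally have "\<bar>Jint (aB B) (card B) - Jint one_w (card B)\<bar> \<le> 4 * \<bar>Jint (aB (insert q B)) (card B + 1) - Jint one_w (card B + 1)\<bar>" .
  then have "4 ^ card B * pi powr (- 1 / 4) * \<bar>Jint (aB B) (card B) - Jint one_w (card B)\<bar>
     \<le> 4 ^ card B * pi powr (- 1 / 4) * (4 * \<bar>Jint (aB (insert q B)) (card B + 1) - Jint one_w (card B + 1)\<bar>)"
    by (intro mult_left_mono) auto
  then show ?thesis unfolding approx_error[OF okB iB] approx_error[OF ok' ind] card by (simp add: mult_ac)
qed

lemma sieve_picks_next_prime:
  fixes p :: "nat \<Rightarrow> nat"
  assumes mono: "strict_mono_on {1..} p" and primes: "p ` {1..} = {q. prime q}" and k: "k \<ge> 1"
  shows "sieve_picks (1 / 2) p k (p (k + 1))"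
proof -
  define N where "N = p (k + 1)"
  have pr: "prime (p i)" if "i \<ge> 1" for i using primes that by blast
  have less: "p i < p j \<longleftrightarrow> i < j" if "i \<ge> 1" "j \<ge> 1" for i j
    by (rule strict_mono_on_less[OF mono]) (use that in auto)
  have B: "p ` {1..k} = {r. prime r \<and> r < N}"
  proof (intro equalityI subsetI)
    fix r assume "r \<in> p ` {1..k}"
    then show "r \<in> {r. prime r \<and> r < N}" using pr less k by (auto simp: N_def)
  next
    fix r assume r: "r \<in> {r. prime r \<and> r < N}"
    then have "r \<in> p ` {1..}" using primes by simp
    then obtain i where i: "i \<ge> 1" "r = p i" by auto
    then have "i < k + 1" using r less[of i "k + 1"] by (simp add: N_def)
    then show "r \<in> p ` {1..k}" using i by auto
  qed
  have prN: "prime N" unfolding N_def by (rule pr) simp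
  have pkN: "p k < N" unfolding N_def using less[of k "k + 1"] k by simp
  have pk2: "p k \<ge> 2" by (rule prime_ge_2_nat[OF pr[OF k]])
  have N3: "N \<ge> 3" using pkN pk2 by linarith
  have adm: "sieve_admissible (1 / 2) p k N"
    unfolding sieve_admissible_def B
  proof (intro conjI ballI allI)
    fix i r assume i: "i \<in> {1..k}"
    show "N \<noteq> p i ^ r"
    proof
      assume e: "N = p i ^ r"
      have "p i < N" unfolding N_def using i less[of i "k + 1"] by simp
      moreover have "N = p i"
      proof -
        have "r \<noteq> 0" using e N3 by (cases r) auto
        then have "p i dvd N" unfolding e by simp
        then show ?thesis using primes_dvd_imp_eq[OF pr prN, of i] i by simp
      qed
      ultimately show False by simp
    qed
  qed (use pkN error_prime[OF prN N3] in auto)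
  have min: "N \<le> q" if adm': "sieve_admissible (1 / 2) p k q" for q
  proof (rule ccontr)
    assume "\<not> N \<le> q"
    then have qN: "q < N" by simp
    have qk: "p k < q" and npow: "\<And>i r. i \<in> {1..k} \<Longrightarrow> q \<noteq> p i ^ r"
      and err: "cmod (xi_approx (insert q {r. prime r \<and> r < N}) (1 / 2) - xi (1 / 2)) < cmod (xi_approx {r. prime r \<and> r < N} (1 / 2) - xi (1 / 2))"
      using adm' unfolding sieve_admissible_def B by auto
    have le: "r \<le> p k" if "prime r" "r < N" for r
    proof -
      have "r \<in> p ` {1..k}" unfolding B using that by simp
      then obtain i where "i \<in> {1..k}" "r = p i" by auto
      then show ?thesis using less[of k i] k by (auto simp: not_less[symmetric])
    qed
    have nq: "\<not> prime q" using le[of q] qN qk by auto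
    have Bq: "{r. prime r \<and> r < N} = {r. prime r \<and> r < q}"
    proof (intro equalityI subsetI)
      fix r assume r: "r \<in> {r. prime r \<and> r < N}"
      then have "r \<le> p k" using le[of r] by simp
      then show "r \<in> {r. prime r \<and> r < q}" using r qk by simp
    next
      fix r assume "r \<in> {r. prime r \<and> r < q}"
      then show "r \<in> {r. prime r \<and> r < N}" using qN by simp
    qed
    have ind: "indep (insert q {r. prime r \<and> r < N})"
    proof (rule indep_insert_primes)
      show "q \<noteq> b ^ r" if b: "b \<in> {r. prime r \<and> r < N}" for b r
      proof -
        obtain i where i: "i \<in> {1..k}" "b = p i" using b unfolding B[symmetric] by auto
        show ?thesis unfolding i(2) by (rule npow[OF i(1)])
      qed
    qed simp
    have "q \<ge> 6"
    proof (rule ccontr)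
      assume "\<not> q \<ge> 6"
      then have "q = 3 \<or> q = 4 \<or> q = 5" using qk pk2 by linarith
      moreover have "prime (3::nat)" "prime (5::nat)" by simp_all
      moreover have "q \<noteq> 4"
      proof
        assume q4: "q = 4"
        have "2 \<in> {r. prime r \<and> r < N}" using N3 by simp
        then obtain i where "i \<in> {1..k}" "2 = p i" unfolding B[symmetric] by auto
        then show False using npow[of i 2] q4 by simp
      qed
      ultimately show False using nq by auto
    qed
    from error_composite[OF qN nq this Bq ind] err show False by linarith
  qed
  show ?thesis unfolding sieve_picks_def using adm min unfolding N_def by blast
qed

lemma sieve_picks_cong:
  assumes "\<And>i. i \<in> {1..k} \<Longrightarrow> p i = p' i" "k \<ge> 1"
  shows "sieve_picks s p k q \<longleftrightarrow> sieve_picks s p' k q"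
proof -
  have "p ` {1..k} = p' ` {1..k}" by (rule image_cong[OF refl assms(1)])
  moreover have "p k = p' k" using assms by simp
  moreover have "(\<forall>i\<in>{1..k}. \<forall>r. q \<noteq> p i ^ r) \<longleftrightarrow> (\<forall>i\<in>{1..k}. \<forall>r. q \<noteq> p' i ^ r)" for q
    using assms(1) by (intro ball_cong) auto
  ultimately have "sieve_admissible s p k = sieve_admissible s p' k" unfolding sieve_admissible_def by presburger
  then show ?thesis unfolding sieve_picks_def by simp
qed

lemma sieve_picks_unique: "sieve_picks s p k q \<Longrightarrow> sieve_picks s p k q' \<Longrightarrow> q = q'"
  unfolding sieve_picks_def by (metis order_antisym)

theorem theorem1p2:
  fixes p :: "nat \<Rightarrow> nat"
  assumes "strict_mono_on {1..} p"
    and "p ` {1..} = {q. prime q}"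
  shows "(\<forall>k\<ge>1. sieve_picks (1 / 2) p k (p (k + 1))) \<and>
         (\<forall>p'. p' 1 = 2 \<and> sieve_run (1 / 2) 1 p' \<longleftrightarrow> (\<forall>k\<ge>1. p' k = p k))"
proof (intro conjI allI)
  have picks: "sieve_picks (1 / 2) p k (p (k + 1))" if "k \<ge> 1" for k
    by (rule sieve_picks_next_prime[OF assms that])
  show "k \<ge> 1 \<longrightarrow> sieve_picks (1 / 2) p k (p (k + 1))" for k using picks by blast
  have pr: "prime (p i)" if "i \<ge> 1" for i using assms(2) that by blast
  have p1: "p 1 = 2"
  proof -
    have "2 \<in> p ` {1..}" unfolding assms(2) by simp
    then obtain i where i: "i \<ge> 1" "2 = p i" by auto
    show ?thesis
    proof (cases "i = 1")
      case False
      then have "p 1 < p i" using strict_mono_onD[OF assms(1), of 1 i] i by simp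
      then show ?thesis using prime_ge_2_nat[OF pr[of 1]] i by simp
    qed (use i in simp)
  qed
  fix p' :: "nat \<Rightarrow> nat"
  show "p' 1 = 2 \<and> sieve_run (1 / 2) 1 p' \<longleftrightarrow> (\<forall>k\<ge>1. p' k = p k)"
  proof
    assume h: "p' 1 = 2 \<and> sieve_run (1 / 2) 1 p'"
    have "p' k = p k" if "k \<ge> 1" for k
      using that
    proof (induction k rule: less_induct)
      case (less k)
      show ?case
      proof (cases "k = 1")
        case False
        define m where "m = k - 1"
        have m: "m \<ge> 1" "k = m + 1" using False less.prems by (auto simp: m_def)
        have "sieve_picks (1 / 2) p' m (p' (m + 1))" using h m(1) unfolding sieve_run_def by blast
        moreover have c: "p' i = p i" if "i \<in> {1..m}" for i using less.IH[of i] m that by simp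
        ultimately have "sieve_picks (1 / 2) p m (p' (m + 1))"
          using sieve_picks_cong[OF c m(1)] by simp
        then show ?thesis unfolding m(2) by (rule sieve_picks_unique[OF _ picks[OF m(1)]])
      qed (use h p1 in simp)
    qed
    then show "\<forall>k\<ge>1. p' k = p k" by blast
  next
    assume e: "\<forall>k\<ge>1. p' k = p k"
    have "sieve_picks (1 / 2) p' k (p' (k + 1))" if k: "k \<ge> 1" for k
    proof -
      have c: "\<And>i. i \<in> {1..k} \<Longrightarrow> p' i = p i" using e by simp
      have "p' (k + 1) = p (k + 1)" using e by simp
      then show ?thesis using picks[OF k] sieve_picks_cong[OF c k] by simp
    qed
    moreover have p1': "p' 1 = 2" using e p1 by simp
    moreover have "\<forall>k\<in>{1..1}. prime (p' k)" using p1' by simp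
    ultimately show "p' 1 = 2 \<and> sieve_run (1 / 2) 1 p'" unfolding sieve_run_def by blast
  qed
qed

end
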